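(* Let $b\in B_4$ be an interchanging unital braid. Then the functor $F_b$ from the category of braided categories to the category $\mathbf{2\text{-}MonCat}$ of 2-fold monoidal categories is naturally equivalent either to $F_{\sigma_2}$ or to $F_{\sigma_2^{-1}}$, but not to both.
   Context: Braids. $B_n$ is the braid group on $n$ strands with standard generators $\sigma_i$; words read left to right are drawn top to bottom. Strands are named by their initial (top) positions. To double a strand is to replace it by two parallel untwisted copies (a flat ribbon). For $x\in B_4$ define in $B_6$: $Lx$ = $x$ on positions 1--4 followed by $x$ with its strands 1 and 2 doubled; $Rx$ = $x$ on positions 3--6 followed by $x$ with its strands 3 and 4 doubled; $L'x$ = $x$ with its strands 2 and 4 doubled followed by $x$ on positions 3--6; $R'x$ = $x$ with its strands 1 and 3 doubled followed by $x$ on positions 1--4. A braid $b\in B_4$ is an interchanging unital braid if its associated permutation is $(2~3)$, $Lb=Rb$ and $L'b=R'b$ in $B_6$, and deleting any one of the pairs of strands $(1,2),(3,4),(1,3),(2,4)$ gives the two-strand identity braid. (Both $\sigma_2$ and $\sigma_2^{-1}$ are interchanging unital braids.) Braided categories. A braided category $({\mathcal V},\otimes,\alpha,c,I)$ is a monoidal category with invertible associator $\alpha$ and strict two-sided unit $I$, with a braiding $c$ (natural isomorphisms satisfying the two hexagon axioms, so $c_{IA}=c_{AI}=1_A$). The underlying braid of a composite of instances of $c^{\pm1}$ and $\alpha^{\pm 1}$ between two products of the same $n$ objects is the $n$-strand braid with a crossing for each instance of $c$ and an inverse crossing for each instance of $c^{-1}$; by coherence the composite depends only on its source, target and underlying braid.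 For $b\in B_4$ with permutation $(2~3)$, $\eta_{(b)}$ denotes the natural transformation $(A\otimes B)\otimes(C\otimes D)\to(A\otimes C)\otimes(B\otimes D)$ built from $\alpha$ and $c$ with underlying braid $b$. A braided tensor functor $f$ has $f(I)=I$ and natural coherence maps $\phi:f(A)\otimes f(B)\to f(A\otimes B)$ compatible with associators, units and braidings. 2-fold monoidal categories. A 2-fold monoidal category consists of a category with two tensor products $\otimes_1,\otimes_2$, coherent associators $\alpha^1,\alpha^2$ (natural isomorphisms satisfying the pentagon), a common strict unit $I$, and a natural transformation $\eta_{ABCD}:(A\otimes_2B)\otimes_1(C\otimes_2D)\to(A\otimes_1C)\otimes_2(B\otimes_1D)$ such that $\eta_{ABII}=\eta_{IIAB}=1_{A\otimes_2B}$, $\eta_{AIBI}=\eta_{IAIB}=1_{A\otimes_1B}$, $$\eta_{U,V,W\otimes_1Y,X\otimes_1Z}\circ(1_{U\otimes_2V}\otimes_1\eta_{WXYZ})\circ\alpha^1=(\alpha^1\otimes_2\alpha^1)\circ\eta_{U\otimes_1W,V\otimes_1X,Y,Z}\circ(\eta_{UVWX}\otimes_1 1_{Y\otimes_2Z}),$$ $$(1_{U\otimes_1X}\otimes_2\eta_{VWYZ})\circ\eta_{U,V\otimes_2W,X,Y\otimes_2Z}\circ(\alpha^2\otimes_1\alpha^2)=\alpha^2\circ(\eta_{UVXY}\otimes_2 1_{W\otimes_1Z})\circ\eta_{U\otimes_2V,W,X\otimes_2Y,Z}.$$ A 2-fold monoidal functor $(F,\lambda^1,\lambda^2)$ is a functor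 $F$ with $F(I)=I$ and natural transformations $\lambda^i_{AB}:F(A)\otimes_iF(B)\to F(A\otimes_iB)$ ($i=1,2$), each satisfying the usual associativity and unit conditions of a lax monoidal functor (in particular $\lambda^i_{AI}=\lambda^i_{IA}=1_{F(A)}$), and such that $$\lambda^2_{A\otimes_1C,B\otimes_1D}\circ(\lambda^1_{AC}\otimes_2\lambda^1_{BD})\circ\eta_{F(A)F(B)F(C)F(D)}=F(\eta_{ABCD})\circ\lambda^1_{A\otimes_2B,C\otimes_2D}\circ(\lambda^2_{AB}\otimes_1\lambda^2_{CD}).$$ $\mathbf{2\text{-}MonCat}$ is the category of 2-fold monoidal categories and 2-fold monoidal functors. The functor $F_b$. For an interchanging unital braid $b$, $F_b$ sends a braided category ${\mathcal V}$ to the 2-fold monoidal category with the same underlying category, $\otimes_1=\otimes_2=\otimes$, $\alpha^1=\alpha^2=\alpha$, unit $I$, and interchange $\eta_{(b)}$; it sends a braided tensor functor $(f,\phi)$ to the 2-fold monoidal functor with the same underlying functor and $\lambda^1=\lambda^2=\phi$. "Naturally equivalent" means there is a natural isomorphism between the two functors. *)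

theory Defs
  imports "HOL-Algebra.Group" "HOL-Library.FuncSet" "HOL-Combinatorics.Transposition"
begin

section \<open>Braids\<close>

text \<open>The letter \<open>(i, True)\<close> stands for the generator \<open>\<sigma>\<^sub>i\<close> and \<open>(i, False)\<close> for its inverse.
  Words are read from left to right, that is from top to bottom in a diagram; strands and
  positions are numbered from 1.\<close>

type_synonym braid_word = "(nat \<times> bool) list"

definition braid_words :: "nat \<Rightarrow> braid_word set" where
  "braid_words n = {w. \<forall>(i, e) \<in> set w. 1 \<le> i \<and> i < n}"

inductive_set braid_rel :: "nat \<Rightarrow> (braid_word \<times> braid_word) set" for n :: nat where
  refl: "w \<in> braid_words n \<Longrightarrow> (w, w) \<in> braid_rel n"
| sym: "(u, v) \<in> braid_rel n \<Longrightarrow> (v, u) \<in> braid_rel n"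
| trans: "(u, v) \<in> braid_rel n \<Longrightarrow> (v, w) \<in> braid_rel n \<Longrightarrow> (u, w) \<in> braid_rel n"
| cancel: "u @ [(i, e), (i, \<not> e)] @ v \<in> braid_words n \<Longrightarrow>
    (u @ [(i, e), (i, \<not> e)] @ v, u @ v) \<in> braid_rel n"
| commute: "u @ [(i, True), (j, True)] @ v \<in> braid_words n \<Longrightarrow> i + 2 \<le> j \<Longrightarrow>
    (u @ [(i, True), (j, True)] @ v, u @ [(j, True), (i, True)] @ v) \<in> braid_rel n"
| braid: "u @ [(i, True), (i + 1, True), (i, True)] @ v \<in> braid_words n \<Longrightarrow>
    (u @ [(i, True), (i + 1, True), (i, True)] @ v,
     u @ [(i + 1, True), (i, True), (i + 1, True)] @ v) \<in> braid_rel n"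

type_synonym braid = "braid_word set"

definition braid_class :: "nat \<Rightarrow> braid_word \<Rightarrow> braid" where
  "braid_class n w = braid_rel n `` {w}"

definition braid_group :: "nat \<Rightarrow> braid monoid" where
  "braid_group n = \<lparr>carrier = braid_words n // braid_rel n,
     mult = (\<lambda>x y. braid_rel n `` {u @ v | u v. u \<in> x \<and> v \<in> y}),
     one = braid_class n []\<rparr>"

definition sigma :: "nat \<Rightarrow> nat \<Rightarrow> braid" where
  "sigma n i = braid_class n [(i, True)]"

text \<open>\<open>word_perm w p\<close> is the bottom position of the strand of \<open>w\<close> whose top position is \<open>p\<close>.\<close>

fun word_perm :: "braid_word \<Rightarrow> nat \<Rightarrow> nat" where
  "word_perm [] = id"
| "word_perm ((i, e) # w) = word_perm w \<circ> transpose i (i + 1)"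

definition braid_perm :: "braid \<Rightarrow> nat \<Rightarrow> nat" where
  "braid_perm x = the_elem (word_perm ` x)"

text \<open>A map \<open>f\<close> on words that respects the braid relations, as a map from braids
  to braids on \<open>m\<close> strands.\<close>

definition lift_braid :: "nat \<Rightarrow> (braid_word \<Rightarrow> braid_word) \<Rightarrow> braid \<Rightarrow> braid" where
  "lift_braid m f x = braid_rel m `` (f ` x)"

definition shift_word :: "nat \<Rightarrow> braid_word \<Rightarrow> braid_word" where
  "shift_word k w = map (\<lambda>(i, e). (i + k, e)) w"

text \<open>\<open>block_crossing k p q e\<close> is the crossing of a flat ribbon of \<open>p\<close> strands, at positions
  \<open>k+1, \<dots>, k+p\<close>, with a flat ribbon of \<open>q\<close> strands directly to its right: for \<open>r = 1, \<dots>, q\<close>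
  the \<open>r\<close>-th strand of the right ribbon is moved across the \<open>p\<close> strands of the left one, giving
  the letters with indices \<open>k+p+r-1, \<dots>, k+r\<close> in this order.  The negative crossing has the
  same projection with all crossings changed.  The word is empty if \<open>p = 0\<close> or \<open>q = 0\<close>.\<close>

definition block_crossing :: "nat \<Rightarrow> nat \<Rightarrow> nat \<Rightarrow> bool \<Rightarrow> braid_word" where
  "block_crossing k p q e =
     concat (map (\<lambda>r. map (\<lambda>j. (j, e)) (rev [k + r ..< k + p + r])) [1 ..< q + 1])"

text \<open>\<open>cable_word ns w\<close> replaces the strand of \<open>w\<close> with top position \<open>j\<close> by \<open>ns ! (j - 1)\<close>
  parallel copies; multiplicity 2 doubles the strand, multiplicity 0 deletes it.\<close>

fun cable_word :: "nat list \<Rightarrow> braid_word \<Rightarrow> braid_word" where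
  "cable_word ns [] = []"
| "cable_word ns ((i, e) # w) =
     block_crossing (sum_list (take (i - 1) ns)) (ns ! (i - 1)) (ns ! i) e
     @ cable_word (ns[i - 1 := ns ! i, i := ns ! (i - 1)]) w"

definition double_strands :: "nat \<Rightarrow> nat set \<Rightarrow> braid \<Rightarrow> braid" where
  "double_strands n S =
     (let ns = map (\<lambda>j. if j \<in> S then 2 else 1) [1 ..< n + 1]
      in lift_braid (sum_list ns) (cable_word ns))"

definition delete_strands :: "nat \<Rightarrow> nat set \<Rightarrow> braid \<Rightarrow> braid" where
  "delete_strands n S =
     (let ns = map (\<lambda>j. if j \<in> S then 0 else 1) [1 ..< n + 1]
      in lift_braid (sum_list ns) (cable_word ns))"

text \<open>\<open>place m k x\<close> is the braid on \<open>m\<close> strands that is \<open>x\<close> on the positions after the first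
  \<open>k\<close> and trivial elsewhere.\<close>

definition place :: "nat \<Rightarrow> nat \<Rightarrow> braid \<Rightarrow> braid" where
  "place m k = lift_braid m (shift_word k)"

definition braid_L :: "braid \<Rightarrow> braid" where
  "braid_L x = place 6 0 x \<otimes>\<^bsub>braid_group 6\<^esub> double_strands 4 {1, 2} x"

definition braid_R :: "braid \<Rightarrow> braid" where
  "braid_R x = place 6 2 x \<otimes>\<^bsub>braid_group 6\<^esub> double_strands 4 {3, 4} x"

definition braid_L' :: "braid \<Rightarrow> braid" where
  "braid_L' x = double_strands 4 {2, 4} x \<otimes>\<^bsub>braid_group 6\<^esub> place 6 2 x"

definition braid_R' :: "braid \<Rightarrow> braid" where
  "braid_R' x = double_strands 4 {1, 3} x \<otimes>\<^bsub>braid_group 6\<^esub> place 6 0 x"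

definition interchanging_unital_braid :: "braid \<Rightarrow> bool" where
  "interchanging_unital_braid b \<longleftrightarrow>
     b \<in> carrier (braid_group 4) \<and>
     braid_perm b = transpose 2 3 \<and>
     braid_L b = braid_R b \<and>
     braid_L' b = braid_R' b \<and>
     (\<forall>S \<in> {{1, 2}, {3, 4}, {1, 3}, {2, 4}}. delete_strands 4 S b = \<one>\<^bsub>braid_group 2\<^esub>)"


section \<open>Categories, functors and natural isomorphisms\<close>

text \<open>All structures have carrier sets and take the value \<open>undefined\<close> outside their domain, so
  that equality of categories, functors and so on is equality in the logic.
  Composition is written in the usual order: \<open>g \<cdot> f\<close> is \<open>f\<close> followed by \<open>g\<close>.\<close>

record ('o, 'a) cat =
  Obj :: "'o set"
  Arr :: "'a set"
  Dom :: "'a \<Rightarrow> 'o"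
  Cod :: "'a \<Rightarrow> 'o"
  Ident :: "'o \<Rightarrow> 'a"
  Comp :: "'a \<Rightarrow> 'a \<Rightarrow> 'a" (infixr "\<cdot>\<index>" 60)

definition homset :: "('o, 'a, 'x) cat_scheme \<Rightarrow> 'o \<Rightarrow> 'o \<Rightarrow> 'a set" where
  "homset C A B = {f \<in> Arr C. Dom C f = A \<and> Cod C f = B}"

locale category =
  fixes C :: "('o, 'a, 'x) cat_scheme" (structure)
  assumes Dom_in: "Dom C \<in> Arr C \<rightarrow>\<^sub>E Obj C"
    and Cod_in: "Cod C \<in> Arr C \<rightarrow>\<^sub>E Obj C"
    and Ident_ext: "Ident C \<in> extensional (Obj C)"
    and Ident_in: "A \<in> Obj C \<Longrightarrow> Ident C A \<in> homset C A A"
    and Comp_ext: "\<not> (f \<in> Arr C \<and> g \<in> Arr C \<and> Cod C f = Dom C g) \<Longrightarrow> g \<cdot> f = undefined"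
    and Comp_in: "f \<in> homset C A B \<Longrightarrow> g \<in> homset C B D \<Longrightarrow> g \<cdot> f \<in> homset C A D"
    and Comp_Ident: "f \<in> homset C A B \<Longrightarrow> f \<cdot> Ident C A = f"
    and Ident_Comp: "f \<in> homset C A B \<Longrightarrow> Ident C B \<cdot> f = f"
    and Comp_assoc: "f \<in> homset C A B \<Longrightarrow> g \<in> homset C B D \<Longrightarrow> h \<in> homset C D E \<Longrightarrow>
      (h \<cdot> g) \<cdot> f = h \<cdot> (g \<cdot> f)"

definition inverse_arrows :: "('o, 'a, 'x) cat_scheme \<Rightarrow> 'a \<Rightarrow> 'a \<Rightarrow> bool" where
  "inverse_arrows C f g \<longleftrightarrow>
     f \<in> Arr C \<and> g \<in> homset C (Cod C f) (Dom C f) \<and>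
     g \<cdot>\<^bsub>C\<^esub> f = Ident C (Dom C f) \<and> f \<cdot>\<^bsub>C\<^esub> g = Ident C (Cod C f)"

definition iso_arrow :: "('o, 'a, 'x) cat_scheme \<Rightarrow> 'a \<Rightarrow> bool" where
  "iso_arrow C f \<longleftrightarrow> (\<exists>g. inverse_arrows C f g)"

definition arrow_inv :: "('o, 'a, 'x) cat_scheme \<Rightarrow> 'a \<Rightarrow> 'a" where
  "arrow_inv C f = (THE g. inverse_arrows C f g)"

record ('o, 'a, 'p, 'b) functor_data =
  FObj :: "'o \<Rightarrow> 'p"
  FArr :: "'a \<Rightarrow> 'b"

definition is_functor ::
  "('o, 'a, 'x) cat_scheme \<Rightarrow> ('p, 'b, 'y) cat_scheme \<Rightarrow> ('o, 'a, 'p, 'b) functor_data \<Rightarrow> bool" where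
  "is_functor C D F \<longleftrightarrow>
     category C \<and> category D \<and>
     FObj F \<in> Obj C \<rightarrow>\<^sub>E Obj D \<and>
     FArr F \<in> extensional (Arr C) \<and>
     (\<forall>A B. \<forall>f \<in> homset C A B. FArr F f \<in> homset D (FObj F A) (FObj F B)) \<and>
     (\<forall>A \<in> Obj C. FArr F (Ident C A) = Ident D (FObj F A)) \<and>
     (\<forall>f \<in> Arr C. \<forall>g \<in> Arr C. Cod C f = Dom C g \<longrightarrow>
        FArr F (g \<cdot>\<^bsub>C\<^esub> f) = FArr F g \<cdot>\<^bsub>D\<^esub> FArr F f)"

definition id_functor :: "('o, 'a, 'x) cat_scheme \<Rightarrow> ('o, 'a, 'o, 'a) functor_data" where
  "id_functor C = \<lparr>FObj = restrict id (Obj C), FArr = restrict id (Arr C)\<rparr>"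

definition comp_functor ::
  "('o, 'a, 'x) cat_scheme \<Rightarrow> ('p, 'b, 'q, 'c) functor_data \<Rightarrow> ('o, 'a, 'p, 'b) functor_data
    \<Rightarrow> ('o, 'a, 'q, 'c) functor_data" where
  "comp_functor C G F =
     \<lparr>FObj = compose (Obj C) (FObj G) (FObj F), FArr = compose (Arr C) (FArr G) (FArr F)\<rparr>"

definition natural_isomorphism ::
  "('o, 'a, 'x) cat_scheme \<Rightarrow> ('p, 'b, 'y) cat_scheme \<Rightarrow>
    ('o, 'a, 'p, 'b) functor_data \<Rightarrow> ('o, 'a, 'p, 'b) functor_data \<Rightarrow> ('o \<Rightarrow> 'b) \<Rightarrow> bool" where
  "natural_isomorphism C D F G \<tau> \<longleftrightarrow>
     is_functor C D F \<and> is_functor C D G \<and>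
     (\<forall>A \<in> Obj C. \<tau> A \<in> homset D (FObj F A) (FObj G A) \<and> iso_arrow D (\<tau> A)) \<and>
     (\<forall>A B. \<forall>f \<in> homset C A B. \<tau> B \<cdot>\<^bsub>D\<^esub> FArr F f = FArr G f \<cdot>\<^bsub>D\<^esub> \<tau> A)"

definition naturally_equivalent ::
  "('o, 'a, 'x) cat_scheme \<Rightarrow> ('p, 'b, 'y) cat_scheme \<Rightarrow>
    ('o, 'a, 'p, 'b) functor_data \<Rightarrow> ('o, 'a, 'p, 'b) functor_data \<Rightarrow> bool" where
  "naturally_equivalent C D F G \<longleftrightarrow> (\<exists>\<tau>. natural_isomorphism C D F G \<tau>)"


section \<open>Monoidal categories and lax monoidal functors\<close>

record ('o, 'a) tensor =
  TObj :: "'o \<Rightarrow> 'o \<Rightarrow> 'o" (infixr "\<odot>\<index>" 70)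
  TArr :: "'a \<Rightarrow> 'a \<Rightarrow> 'a" (infixr "\<star>\<index>" 70)
  Assoc :: "'o \<Rightarrow> 'o \<Rightarrow> 'o \<Rightarrow> 'a"

text \<open>The unit is strict, so the unit constraints are identities, and the triangle axiom says
  that \<open>Assoc T A I B\<close> is an identity.\<close>

locale monoidal = category C
  for C :: "('o, 'a, 'x) cat_scheme" (structure) +
  fixes T :: "('o, 'a) tensor" (structure) and I :: 'o
  assumes TObj_ext: "case_prod (TObj T) \<in> extensional (Obj C \<times> Obj C)"
    and TArr_ext: "case_prod (TArr T) \<in> extensional (Arr C \<times> Arr C)"
    and Assoc_ext: "(\<lambda>(A, B, D). Assoc T A B D) \<in> extensional (Obj C \<times> Obj C \<times> Obj C)"
    and TObj_in: "A \<in> Obj C \<Longrightarrow> B \<in> Obj C \<Longrightarrow> A \<odot>\<^bsub>T\<^esub> B \<in> Obj C"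
    and TArr_in: "f \<in> homset C A A' \<Longrightarrow> g \<in> homset C B B' \<Longrightarrow>
      f \<star>\<^bsub>T\<^esub> g \<in> homset C (A \<odot>\<^bsub>T\<^esub> B) (A' \<odot>\<^bsub>T\<^esub> B')"
    and TArr_Ident: "A \<in> Obj C \<Longrightarrow> B \<in> Obj C \<Longrightarrow>
      Ident C A \<star>\<^bsub>T\<^esub> Ident C B = Ident C (A \<odot>\<^bsub>T\<^esub> B)"
    and TArr_Comp: "f \<in> homset C A A' \<Longrightarrow> f' \<in> homset C A' A'' \<Longrightarrow>
      g \<in> homset C B B' \<Longrightarrow> g' \<in> homset C B' B'' \<Longrightarrow>
      (f' \<cdot>\<^bsub>C\<^esub> f) \<star>\<^bsub>T\<^esub> (g' \<cdot>\<^bsub>C\<^esub> g) = (f' \<star>\<^bsub>T\<^esub> g') \<cdot>\<^bsub>C\<^esub> (f \<star>\<^bsub>T\<^esub> g)"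
    and Assoc_in: "A \<in> Obj C \<Longrightarrow> B \<in> Obj C \<Longrightarrow> D \<in> Obj C \<Longrightarrow>
      Assoc T A B D \<in> homset C ((A \<odot>\<^bsub>T\<^esub> B) \<odot>\<^bsub>T\<^esub> D) (A \<odot>\<^bsub>T\<^esub> (B \<odot>\<^bsub>T\<^esub> D))"
    and Assoc_iso: "A \<in> Obj C \<Longrightarrow> B \<in> Obj C \<Longrightarrow> D \<in> Obj C \<Longrightarrow> iso_arrow C (Assoc T A B D)"
    and Assoc_natural: "f \<in> homset C A A' \<Longrightarrow> g \<in> homset C B B' \<Longrightarrow> h \<in> homset C D D' \<Longrightarrow>
      Assoc T A' B' D' \<cdot>\<^bsub>C\<^esub> ((f \<star>\<^bsub>T\<^esub> g) \<star>\<^bsub>T\<^esub> h) = (f \<star>\<^bsub>T\<^esub> (g \<star>\<^bsub>T\<^esub> h)) \<cdot>\<^bsub>C\<^esub> Assoc T A B D"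
    and pentagon: "A \<in> Obj C \<Longrightarrow> B \<in> Obj C \<Longrightarrow> D \<in> Obj C \<Longrightarrow> E \<in> Obj C \<Longrightarrow>
      Assoc T A B (D \<odot>\<^bsub>T\<^esub> E) \<cdot>\<^bsub>C\<^esub> Assoc T (A \<odot>\<^bsub>T\<^esub> B) D E =
      (Ident C A \<star>\<^bsub>T\<^esub> Assoc T B D E) \<cdot>\<^bsub>C\<^esub> Assoc T A (B \<odot>\<^bsub>T\<^esub> D) E \<cdot>\<^bsub>C\<^esub> (Assoc T A B D \<star>\<^bsub>T\<^esub> Ident C E)"
    and unit_in: "I \<in> Obj C"
    and unit_Obj: "A \<in> Obj C \<Longrightarrow> A \<odot>\<^bsub>T\<^esub> I = A" "A \<in> Obj C \<Longrightarrow> I \<odot>\<^bsub>T\<^esub> A = A"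
    and unit_Arr: "f \<in> Arr C \<Longrightarrow> f \<star>\<^bsub>T\<^esub> Ident C I = f" "f \<in> Arr C \<Longrightarrow> Ident C I \<star>\<^bsub>T\<^esub> f = f"
    and triangle: "A \<in> Obj C \<Longrightarrow> B \<in> Obj C \<Longrightarrow> Assoc T A I B = Ident C (A \<odot>\<^bsub>T\<^esub> B)"

text \<open>Strictly unital lax monoidal functors \<open>F\<close> from \<open>(C, T, I)\<close> to \<open>(D, S, J)\<close> with coherence
  maps \<open>\<phi> A B : F A \<odot> F B \<rightarrow> F (A \<odot> B)\<close>, which need not be invertible.\<close>

definition lax_monoidal_functor ::
  "('o, 'a, 'x) cat_scheme \<Rightarrow> ('o, 'a) tensor \<Rightarrow> 'o \<Rightarrow>
   ('p, 'b, 'y) cat_scheme \<Rightarrow> ('p, 'b) tensor \<Rightarrow> 'p \<Rightarrow>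
   ('o, 'a, 'p, 'b) functor_data \<Rightarrow> ('o \<Rightarrow> 'o \<Rightarrow> 'b) \<Rightarrow> bool" where
  "lax_monoidal_functor C T I D S J F \<phi> \<longleftrightarrow>
     is_functor C D F \<and> FObj F I = J \<and>
     case_prod \<phi> \<in> extensional (Obj C \<times> Obj C) \<and>
     (\<forall>A \<in> Obj C. \<forall>B \<in> Obj C.
        \<phi> A B \<in> homset D (FObj F A \<odot>\<^bsub>S\<^esub> FObj F B) (FObj F (A \<odot>\<^bsub>T\<^esub> B))) \<and>
     (\<forall>A A' B B'. \<forall>f \<in> homset C A A'. \<forall>g \<in> homset C B B'.
        \<phi> A' B' \<cdot>\<^bsub>D\<^esub> (FArr F f \<star>\<^bsub>S\<^esub> FArr F g) = FArr F (f \<star>\<^bsub>T\<^esub> g) \<cdot>\<^bsub>D\<^esub> \<phi> A B) \<and>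
     (\<forall>A \<in> Obj C. \<forall>B \<in> Obj C. \<forall>E \<in> Obj C.
        \<phi> A (B \<odot>\<^bsub>T\<^esub> E) \<cdot>\<^bsub>D\<^esub> (Ident D (FObj F A) \<star>\<^bsub>S\<^esub> \<phi> B E)
          \<cdot>\<^bsub>D\<^esub> Assoc S (FObj F A) (FObj F B) (FObj F E) =
        FArr F (Assoc T A B E) \<cdot>\<^bsub>D\<^esub> \<phi> (A \<odot>\<^bsub>T\<^esub> B) E \<cdot>\<^bsub>D\<^esub> (\<phi> A B \<star>\<^bsub>S\<^esub> Ident D (FObj F E))) \<and>
     (\<forall>A \<in> Obj C. \<phi> A I = Ident D (FObj F A) \<and> \<phi> I A = Ident D (FObj F A))"

definition id_coherence ::
  "('o, 'a, 'x) cat_scheme \<Rightarrow> ('o, 'a) tensor \<Rightarrow> 'o \<Rightarrow> 'o \<Rightarrow> 'a" where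
  "id_coherence C T = (\<lambda>A B. if A \<in> Obj C \<and> B \<in> Obj C then Ident C (A \<odot>\<^bsub>T\<^esub> B) else undefined)"

text \<open>The coherence maps of the composite of \<open>(F, \<phi>)\<close>, defined on \<open>C\<close>, with \<open>(G, \<psi>)\<close>, whose
  target is \<open>E\<close>.\<close>

definition comp_coherence ::
  "('o, 'a, 'x) cat_scheme \<Rightarrow> ('q, 'c, 'z) cat_scheme \<Rightarrow>
   ('p, 'b, 'q, 'c) functor_data \<Rightarrow> ('p \<Rightarrow> 'p \<Rightarrow> 'c) \<Rightarrow>
   ('o, 'a, 'p, 'b) functor_data \<Rightarrow> ('o \<Rightarrow> 'o \<Rightarrow> 'b) \<Rightarrow> 'o \<Rightarrow> 'o \<Rightarrow> 'c" where
  "comp_coherence C E G \<psi> F \<phi> =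
     (\<lambda>A B. if A \<in> Obj C \<and> B \<in> Obj C
       then FArr G (\<phi> A B) \<cdot>\<^bsub>E\<^esub> \<psi> (FObj F A) (FObj F B) else undefined)"


section \<open>Braided categories\<close>

record ('o, 'a) braided = "('o, 'a) cat" +
  Ten :: "('o, 'a) tensor"
  BUnit :: 'o
  Braiding :: "'o \<Rightarrow> 'o \<Rightarrow> 'a"

locale braided_category = monoidal V "Ten V" "BUnit V"
  for V :: "('o, 'a) braided" (structure) +
  assumes Braiding_ext: "case_prod (Braiding V) \<in> extensional (Obj V \<times> Obj V)"
    and Braiding_in: "A \<in> Obj V \<Longrightarrow> B \<in> Obj V \<Longrightarrow>
      Braiding V A B \<in> homset V (A \<odot>\<^bsub>Ten V\<^esub> B) (B \<odot>\<^bsub>Ten V\<^esub> A)"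
    and Braiding_iso: "A \<in> Obj V \<Longrightarrow> B \<in> Obj V \<Longrightarrow> iso_arrow V (Braiding V A B)"
    and Braiding_natural: "f \<in> homset V A A' \<Longrightarrow> g \<in> homset V B B' \<Longrightarrow>
      Braiding V A' B' \<cdot> (f \<star>\<^bsub>Ten V\<^esub> g) = (g \<star>\<^bsub>Ten V\<^esub> f) \<cdot> Braiding V A B"
    and hexagon1: "A \<in> Obj V \<Longrightarrow> B \<in> Obj V \<Longrightarrow> D \<in> Obj V \<Longrightarrow>
      Assoc (Ten V) B D A \<cdot> Braiding V A (B \<odot>\<^bsub>Ten V\<^esub> D) \<cdot> Assoc (Ten V) A B D =
      (Ident V B \<star>\<^bsub>Ten V\<^esub> Braiding V A D) \<cdot> Assoc (Ten V) B A D \<cdot> (Braiding V A B \<star>\<^bsub>Ten V\<^esub> Ident V D)"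
    and hexagon2: "A \<in> Obj V \<Longrightarrow> B \<in> Obj V \<Longrightarrow> D \<in> Obj V \<Longrightarrow>
      arrow_inv V (Assoc (Ten V) D A B) \<cdot> Braiding V (A \<odot>\<^bsub>Ten V\<^esub> B) D \<cdot> arrow_inv V (Assoc (Ten V) A B D) =
      (Braiding V A D \<star>\<^bsub>Ten V\<^esub> Ident V B) \<cdot> arrow_inv V (Assoc (Ten V) A D B) \<cdot> (Ident V A \<star>\<^bsub>Ten V\<^esub> Braiding V B D)"

record ('o, 'a) braided_functor =
  BSource :: "('o, 'a) braided"
  BTarget :: "('o, 'a) braided"
  BFun :: "('o, 'a, 'o, 'a) functor_data"
  Phi :: "'o \<Rightarrow> 'o \<Rightarrow> 'a"

definition is_braided_functor :: "('o, 'a) braided_functor \<Rightarrow> bool" where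
  "is_braided_functor f \<longleftrightarrow>
     (let V = BSource f; W = BTarget f; F = BFun f in
      braided_category V \<and> braided_category W \<and>
      lax_monoidal_functor V (Ten V) (BUnit V) W (Ten W) (BUnit W) F (Phi f) \<and>
      (\<forall>A \<in> Obj V. \<forall>B \<in> Obj V.
         FArr F (Braiding V A B) \<cdot>\<^bsub>W\<^esub> Phi f A B =
         Phi f B A \<cdot>\<^bsub>W\<^esub> Braiding W (FObj F A) (FObj F B)))"

definition id_braided_functor :: "('o, 'a) braided \<Rightarrow> ('o, 'a) braided_functor" where
  "id_braided_functor V =
     \<lparr>BSource = V, BTarget = V, BFun = id_functor V, Phi = id_coherence V (Ten V)\<rparr>"

definition comp_braided_functor ::
  "('o, 'a) braided_functor \<Rightarrow> ('o, 'a) braided_functor \<Rightarrow> ('o, 'a) braided_functor" where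
  "comp_braided_functor g f =
     \<lparr>BSource = BSource f, BTarget = BTarget g, BFun = comp_functor (BSource f) (BFun g) (BFun f),
      Phi = comp_coherence (BSource f) (BTarget g) (BFun g) (Phi g) (BFun f) (Phi f)\<rparr>"

text \<open>The category of small braided categories.  The types \<open>'o\<close> and \<open>'a\<close> play the role of the
  universe: every object of the category has its objects in \<open>'o\<close> and its arrows in \<open>'a\<close>.  They should be
  infinite; over one-element types, for example, all braided categories are trivial.\<close>

definition BraidedCat :: "(('o, 'a) braided, ('o, 'a) braided_functor) cat" where
  "BraidedCat =
     \<lparr>Obj = {V. braided_category V},
      Arr = {f. is_braided_functor f},
      Dom = restrict BSource {f. is_braided_functor f},
      Cod = restrict BTarget {f. is_braided_functor f},
      Ident = restrict id_braided_functor {V. braided_category V},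
      Comp = (\<lambda>g f. if is_braided_functor f \<and> is_braided_functor g \<and> BTarget f = BSource g
                then comp_braided_functor g f else undefined)\<rparr>"


section \<open>2-fold monoidal categories\<close>

record ('o, 'a) two_fold = "('o, 'a) cat" +
  Ten1 :: "('o, 'a) tensor"
  Ten2 :: "('o, 'a) tensor"
  TUnit :: 'o
  Eta :: "'o \<Rightarrow> 'o \<Rightarrow> 'o \<Rightarrow> 'o \<Rightarrow> 'a"

locale two_fold_monoidal =
  m1: monoidal M "Ten1 M" "TUnit M" + m2: monoidal M "Ten2 M" "TUnit M"
  for M :: "('o, 'a) two_fold" (structure) +
  assumes Eta_ext: "(\<lambda>(A, B, C, D). Eta M A B C D) \<in> extensional (Obj M \<times> Obj M \<times> Obj M \<times> Obj M)"
    and Eta_in: "A \<in> Obj M \<Longrightarrow> B \<in> Obj M \<Longrightarrow> C \<in> Obj M \<Longrightarrow> D \<in> Obj M \<Longrightarrow>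
      Eta M A B C D \<in> homset M ((A \<odot>\<^bsub>Ten2 M\<^esub> B) \<odot>\<^bsub>Ten1 M\<^esub> (C \<odot>\<^bsub>Ten2 M\<^esub> D))
                                ((A \<odot>\<^bsub>Ten1 M\<^esub> C) \<odot>\<^bsub>Ten2 M\<^esub> (B \<odot>\<^bsub>Ten1 M\<^esub> D))"
    and Eta_natural: "f \<in> homset M A A' \<Longrightarrow> g \<in> homset M B B' \<Longrightarrow>
      h \<in> homset M C C' \<Longrightarrow> k \<in> homset M D D' \<Longrightarrow>
      Eta M A' B' C' D' \<cdot> ((f \<star>\<^bsub>Ten2 M\<^esub> g) \<star>\<^bsub>Ten1 M\<^esub> (h \<star>\<^bsub>Ten2 M\<^esub> k)) =
      ((f \<star>\<^bsub>Ten1 M\<^esub> h) \<star>\<^bsub>Ten2 M\<^esub> (g \<star>\<^bsub>Ten1 M\<^esub> k)) \<cdot> Eta M A B C D"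
    and Eta_internal_unit: "A \<in> Obj M \<Longrightarrow> B \<in> Obj M \<Longrightarrow>
      Eta M A B (TUnit M) (TUnit M) = Ident M (A \<odot>\<^bsub>Ten2 M\<^esub> B) \<and>
      Eta M (TUnit M) (TUnit M) A B = Ident M (A \<odot>\<^bsub>Ten2 M\<^esub> B)"
    and Eta_external_unit: "A \<in> Obj M \<Longrightarrow> B \<in> Obj M \<Longrightarrow>
      Eta M A (TUnit M) B (TUnit M) = Ident M (A \<odot>\<^bsub>Ten1 M\<^esub> B) \<and>
      Eta M (TUnit M) A (TUnit M) B = Ident M (A \<odot>\<^bsub>Ten1 M\<^esub> B)"
    and Eta_internal_assoc: "U \<in> Obj M \<Longrightarrow> V \<in> Obj M \<Longrightarrow> W \<in> Obj M \<Longrightarrow>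
      X \<in> Obj M \<Longrightarrow> Y \<in> Obj M \<Longrightarrow> Z \<in> Obj M \<Longrightarrow>
      Eta M U V (W \<odot>\<^bsub>Ten1 M\<^esub> Y) (X \<odot>\<^bsub>Ten1 M\<^esub> Z)
        \<cdot> (Ident M (U \<odot>\<^bsub>Ten2 M\<^esub> V) \<star>\<^bsub>Ten1 M\<^esub> Eta M W X Y Z)
        \<cdot> Assoc (Ten1 M) (U \<odot>\<^bsub>Ten2 M\<^esub> V) (W \<odot>\<^bsub>Ten2 M\<^esub> X) (Y \<odot>\<^bsub>Ten2 M\<^esub> Z) =
      (Assoc (Ten1 M) U W Y \<star>\<^bsub>Ten2 M\<^esub> Assoc (Ten1 M) V X Z)
        \<cdot> Eta M (U \<odot>\<^bsub>Ten1 M\<^esub> W) (V \<odot>\<^bsub>Ten1 M\<^esub> X) Y Z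
        \<cdot> (Eta M U V W X \<star>\<^bsub>Ten1 M\<^esub> Ident M (Y \<odot>\<^bsub>Ten2 M\<^esub> Z))"
    and Eta_external_assoc: "U \<in> Obj M \<Longrightarrow> V \<in> Obj M \<Longrightarrow> W \<in> Obj M \<Longrightarrow>
      X \<in> Obj M \<Longrightarrow> Y \<in> Obj M \<Longrightarrow> Z \<in> Obj M \<Longrightarrow>
      (Ident M (U \<odot>\<^bsub>Ten1 M\<^esub> X) \<star>\<^bsub>Ten2 M\<^esub> Eta M V W Y Z)
        \<cdot> Eta M U (V \<odot>\<^bsub>Ten2 M\<^esub> W) X (Y \<odot>\<^bsub>Ten2 M\<^esub> Z)
        \<cdot> (Assoc (Ten2 M) U V W \<star>\<^bsub>Ten1 M\<^esub> Assoc (Ten2 M) X Y Z) =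
      Assoc (Ten2 M) (U \<odot>\<^bsub>Ten1 M\<^esub> X) (V \<odot>\<^bsub>Ten1 M\<^esub> Y) (W \<odot>\<^bsub>Ten1 M\<^esub> Z)
        \<cdot> (Eta M U V X Y \<star>\<^bsub>Ten2 M\<^esub> Ident M (W \<odot>\<^bsub>Ten1 M\<^esub> Z))
        \<cdot> Eta M (U \<odot>\<^bsub>Ten2 M\<^esub> V) W (X \<odot>\<^bsub>Ten2 M\<^esub> Y) Z"

record ('o, 'a) two_fold_functor =
  TSource :: "('o, 'a) two_fold"
  TTarget :: "('o, 'a) two_fold"
  TFun :: "('o, 'a, 'o, 'a) functor_data"
  Lambda1 :: "'o \<Rightarrow> 'o \<Rightarrow> 'a"
  Lambda2 :: "'o \<Rightarrow> 'o \<Rightarrow> 'a"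

definition is_two_fold_functor :: "('o, 'a) two_fold_functor \<Rightarrow> bool" where
  "is_two_fold_functor f \<longleftrightarrow>
     (let M = TSource f; N = TTarget f; F = FObj (TFun f); l1 = Lambda1 f; l2 = Lambda2 f in
      two_fold_monoidal M \<and> two_fold_monoidal N \<and>
      lax_monoidal_functor M (Ten1 M) (TUnit M) N (Ten1 N) (TUnit N) (TFun f) l1 \<and>
      lax_monoidal_functor M (Ten2 M) (TUnit M) N (Ten2 N) (TUnit N) (TFun f) l2 \<and>
      (\<forall>A \<in> Obj M. \<forall>B \<in> Obj M. \<forall>C \<in> Obj M. \<forall>D \<in> Obj M.
         l2 (A \<odot>\<^bsub>Ten1 M\<^esub> C) (B \<odot>\<^bsub>Ten1 M\<^esub> D)
           \<cdot>\<^bsub>N\<^esub> (l1 A C \<star>\<^bsub>Ten2 N\<^esub> l1 B D)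
           \<cdot>\<^bsub>N\<^esub> Eta N (F A) (F B) (F C) (F D) =
         FArr (TFun f) (Eta M A B C D)
           \<cdot>\<^bsub>N\<^esub> l1 (A \<odot>\<^bsub>Ten2 M\<^esub> B) (C \<odot>\<^bsub>Ten2 M\<^esub> D)
           \<cdot>\<^bsub>N\<^esub> (l2 A B \<star>\<^bsub>Ten1 N\<^esub> l2 C D)))"

definition id_two_fold_functor :: "('o, 'a) two_fold \<Rightarrow> ('o, 'a) two_fold_functor" where
  "id_two_fold_functor M =
     \<lparr>TSource = M, TTarget = M, TFun = id_functor M,
      Lambda1 = id_coherence M (Ten1 M), Lambda2 = id_coherence M (Ten2 M)\<rparr>"

definition comp_two_fold_functor ::
  "('o, 'a) two_fold_functor \<Rightarrow> ('o, 'a) two_fold_functor \<Rightarrow> ('o, 'a) two_fold_functor" where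
  "comp_two_fold_functor g f =
     \<lparr>TSource = TSource f, TTarget = TTarget g, TFun = comp_functor (TSource f) (TFun g) (TFun f),
      Lambda1 = comp_coherence (TSource f) (TTarget g) (TFun g) (Lambda1 g) (TFun f) (Lambda1 f),
      Lambda2 = comp_coherence (TSource f) (TTarget g) (TFun g) (Lambda2 g) (TFun f) (Lambda2 f)\<rparr>"

definition TwoMonCat :: "(('o, 'a) two_fold, ('o, 'a) two_fold_functor) cat" where
  "TwoMonCat =
     \<lparr>Obj = {M. two_fold_monoidal M},
      Arr = {f. is_two_fold_functor f},
      Dom = restrict TSource {f. is_two_fold_functor f},
      Cod = restrict TTarget {f. is_two_fold_functor f},
      Ident = restrict id_two_fold_functor {M. two_fold_monoidal M},
      Comp = (\<lambda>g f. if is_two_fold_functor f \<and> is_two_fold_functor g \<and> TTarget f = TSource g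
                then comp_two_fold_functor g f else undefined)\<rparr>"


section \<open>The functors induced by braids\<close>

text \<open>Formal bracketed products of objects.\<close>

datatype 'o bracketed = Atom 'o | Prod "'o bracketed" "'o bracketed"

fun num_factors :: "'o bracketed \<Rightarrow> nat" where
  "num_factors (Atom A) = 1"
| "num_factors (Prod s t) = num_factors s + num_factors t"

fun product_in :: "('o, 'a) braided \<Rightarrow> 'o bracketed \<Rightarrow> 'o" where
  "product_in V (Atom A) = A"
| "product_in V (Prod s t) = product_in V s \<odot>\<^bsub>Ten V\<^esub> product_in V t"

text \<open>\<open>braid_composite V s w t h\<close>: the arrow \<open>h\<close> from the product \<open>s\<close> to the product \<open>t\<close> is a
  composite of instances of the associativity and of the braiding, tensored with identities, and
  of their inverses, whose underlying braid is given by the word \<open>w\<close>.  The instances of the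
  braiding interchange two adjacent factors of the product, so that each is a single crossing.\<close>

inductive braid_composite ::
  "('o, 'a) braided \<Rightarrow> 'o bracketed \<Rightarrow> braid_word \<Rightarrow> 'o bracketed \<Rightarrow> 'a \<Rightarrow> bool"
  for V :: "('o, 'a) braided" where
  ident: "set_bracketed s \<subseteq> Obj V \<Longrightarrow> braid_composite V s [] s (Ident V (product_in V s))"
| assoc: "set_bracketed s \<union> set_bracketed t \<union> set_bracketed u \<subseteq> Obj V \<Longrightarrow>
    braid_composite V (Prod (Prod s t) u) [] (Prod s (Prod t u))
      (Assoc (Ten V) (product_in V s) (product_in V t) (product_in V u))"
| assoc_inv: "set_bracketed s \<union> set_bracketed t \<union> set_bracketed u \<subseteq> Obj V \<Longrightarrow>
    braid_composite V (Prod s (Prod t u)) [] (Prod (Prod s t) u)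
      (arrow_inv V (Assoc (Ten V) (product_in V s) (product_in V t) (product_in V u)))"
| braiding: "A \<in> Obj V \<Longrightarrow> B \<in> Obj V \<Longrightarrow>
    braid_composite V (Prod (Atom A) (Atom B)) [(1, True)] (Prod (Atom B) (Atom A))
      (Braiding V A B)"
| braiding_inv: "A \<in> Obj V \<Longrightarrow> B \<in> Obj V \<Longrightarrow>
    braid_composite V (Prod (Atom A) (Atom B)) [(1, False)] (Prod (Atom B) (Atom A))
      (arrow_inv V (Braiding V B A))"
| tensor_right: "braid_composite V s w t h \<Longrightarrow> set_bracketed u \<subseteq> Obj V \<Longrightarrow>
    braid_composite V (Prod s u) w (Prod t u) (h \<star>\<^bsub>Ten V\<^esub> Ident V (product_in V u))"
| tensor_left: "braid_composite V s w t h \<Longrightarrow> set_bracketed u \<subseteq> Obj V \<Longrightarrow>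
    braid_composite V (Prod u s) (shift_word (num_factors u) w) (Prod u t)
      (Ident V (product_in V u) \<star>\<^bsub>Ten V\<^esub> h)"
| comp: "braid_composite V s w t h \<Longrightarrow> braid_composite V t w' u h' \<Longrightarrow>
    braid_composite V s (w @ w') u (h' \<cdot>\<^bsub>V\<^esub> h)"

text \<open>The arrow in the following definition is unique by coherence if \<open>b\<close> is a braid on four
  strands with permutation \<open>(2 3)\<close>.\<close>

definition braid_interchange :: "braid \<Rightarrow> ('o, 'a) braided \<Rightarrow> 'o \<Rightarrow> 'o \<Rightarrow> 'o \<Rightarrow> 'o \<Rightarrow> 'a" where
  "braid_interchange b V A B C D =
     (if A \<in> Obj V \<and> B \<in> Obj V \<and> C \<in> Obj V \<and> D \<in> Obj V
      then THE h. \<exists>w \<in> b. braid_composite V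
             (Prod (Prod (Atom A) (Atom B)) (Prod (Atom C) (Atom D))) w
             (Prod (Prod (Atom A) (Atom C)) (Prod (Atom B) (Atom D))) h
      else undefined)"

definition two_fold_of_braided :: "braid \<Rightarrow> ('o, 'a) braided \<Rightarrow> ('o, 'a) two_fold" where
  "two_fold_of_braided b V =
     \<lparr>Obj = Obj V, Arr = Arr V, Dom = Dom V, Cod = Cod V, Ident = Ident V, Comp = Comp V,
      Ten1 = Ten V, Ten2 = Ten V, TUnit = BUnit V, Eta = braid_interchange b V\<rparr>"

definition two_fold_functor_of_braided ::
  "braid \<Rightarrow> ('o, 'a) braided_functor \<Rightarrow> ('o, 'a) two_fold_functor" where
  "two_fold_functor_of_braided b f =
     \<lparr>TSource = two_fold_of_braided b (BSource f), TTarget = two_fold_of_braided b (BTarget f),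
      TFun = BFun f, Lambda1 = Phi f, Lambda2 = Phi f\<rparr>"

definition F_braid ::
  "braid \<Rightarrow> (('o, 'a) braided, ('o, 'a) braided_functor,
             ('o, 'a) two_fold, ('o, 'a) two_fold_functor) functor_data" where
  "F_braid b =
     \<lparr>FObj = restrict (two_fold_of_braided b) (Obj BraidedCat),
      FArr = restrict (two_fold_functor_of_braided b) (Arr BraidedCat)\<rparr>"

end

theory Submission
  imports Defs "HOL-Library.Nat_Bijection"
begin

text \<open>Words in the braid generators act on lists in the strictification of a braided category, where
  a strand may carry a whole list; cabling then corresponds to concatenation, and the equations
  \<open>L b = R b\<close>, \<open>L' b = R' b\<close> become the two associativity axioms of an interchange \<open>E\<close>. By the
  Eckmann--Hilton argument of Joyal and Street, \<open>E\<close> is determined by its restrictions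
  \<open>E A [] [] B = \<sigma>\<^sup>2\<^sup>n\<close> and \<open>E [] A B [] = \<sigma>\<^sup>2\<^sup>m\<^sup>+\<^sup>1\<close>, and the quotient \<open>\<sigma>\<^sup>p\<close> of the latter by the former
  satisfies the hexagon. In the braided category of the dihedral quandle this forces \<open>p\<close> to be \<open>1\<close> or
  \<open>-1\<close>. The identity functor with \<open>\<lambda>\<^sup>1 = 1\<close> and \<open>\<lambda>\<^sup>2 = \<sigma>\<^sup>2\<^sup>n\<close> is then the required natural equivalence.

  An equivalence of the two functors given by \<open>\<sigma>\<^sub>2\<close> and its inverse would, for each braided category,
  give an isomorphism that reverses the braiding. For the category graded by the integers modulo 3
  with the bicharacter \<open>x y\<close>, naturality makes it fix the scalar \<open>1\<close>, so that \<open>-1\<close> would be a square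
  modulo 3.\<close>

section \<open>Braid words\<close>

text \<open>The restriction on \<open>p\<close> concerns words alone, so it can be read off in one
  concrete category whatever the types \<open>'o\<close> and \<open>'a\<close> are. Over the
  integers \<open>\<sigma>^p\<close> takes \<open>[x, y]\<close> to
  \<open>[x + p (y - x), y + p (y - x)]\<close>, which keeps \<open>p\<close> visible, while an
  entry that passes two equal entries is reflected twice and comes back. The second counterexample
  has to live in the given types, of which only infinity is known; hence a countable category
  carried along injections. There the bicharacter alone would not do: \<open>z \<mapsto> - z\<close>
  is an automorphism of the integers modulo 3 that turns \<open>x y\<close> into its inverse. The
  scalars therefore also contain the additive monoid of naturals, whose only automorphism is the
  identity, and an endofunctor sends its generator to the scalar \<open>1\<close>; commuting with
  this endofunctor fixes that scalar. On the positive side, lists as labels absorb all associators,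
  and the empty list plays the unit: deleting strands is cabling with multiplicity 0, and
  restricting an interchange to units is inserting empty lists.\<close>

lemma braid_words_simps [simp]:
  "[] \<in> braid_words n"
  "a # w \<in> braid_words n \<longleftrightarrow> 1 \<le> fst a \<and> fst a < n \<and> w \<in> braid_words n"
  "u @ v \<in> braid_words n \<longleftrightarrow> u \<in> braid_words n \<and> v \<in> braid_words n"
  by (auto simp: braid_words_def split: prod.splits)

lemma braid_rel_words:
  assumes "(u, v) \<in> braid_rel n"
  shows "u \<in> braid_words n" "v \<in> braid_words n"
  using assms by (induction rule: braid_rel.induct) auto

lemma equiv_braid_rel: "equiv (braid_words n) (braid_rel n)"
proof (rule equivI)
  show "braid_rel n \<subseteq> braid_words n \<times> braid_words n" by (auto dest: braid_rel_words)
  show "refl_on (braid_words n) (braid_rel n)"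
    by (auto simp: refl_on_def intro: braid_rel.refl)
  show "sym (braid_rel n)" by (auto intro: symI braid_rel.sym)
  show "trans (braid_rel n)" by (auto intro: transI braid_rel.trans)
qed

lemma braid_rel_append:
  assumes "(u, v) \<in> braid_rel n" "x \<in> braid_words n" "y \<in> braid_words n"
  shows "(x @ u @ y, x @ v @ y) \<in> braid_rel n"
  using assms
proof (induction rule: braid_rel.induct)
  case (cancel u i e v)
  then show ?case using braid_rel.cancel[of "x @ u" i e "v @ y" n] by simp
next
  case (commute u i j v)
  then show ?case using braid_rel.commute[of "x @ u" i j "v @ y" n] by simp
next
  case (braid u i v)
  then show ?case using braid_rel.braid[of "x @ u" i "v @ y" n] by simp
qed (auto intro: braid_rel.intros)

lemma block_crossing_words:
  "k + p + q \<le> n \<Longrightarrow> block_crossing k p q e \<in> braid_words n"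
  by (auto simp: block_crossing_def braid_words_def)

text \<open>The update that \<open>cable_word\<close> makes on multiplicities, stated for lists of
  any type, so that one permutation moves labels, arrows and groups of strands. Letters count
  positions from 1, lists from 0.\<close>

definition swap_at :: "nat \<Rightarrow> 'c list \<Rightarrow> 'c list" where
  "swap_at i xs = xs[i - 1 := xs ! i, i := xs ! (i - 1)]"

fun permute :: "braid_word \<Rightarrow> 'c list \<Rightarrow> 'c list" where
  "permute [] xs = xs"
| "permute (a # w) xs = permute w (swap_at (fst a) xs)"

lemma length_swap_at [simp]: "length (swap_at i xs) = length xs"
  by (simp add: swap_at_def)

lemma length_permute [simp]: "length (permute w xs) = length xs"
  by (induction w arbitrary: xs) auto

lemma permute_append [simp]: "permute (u @ v) xs = permute v (permute u xs)"
  by (induction u arbitrary: xs) auto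

lemma swap_at_split:
  "i = Suc (length pre) \<Longrightarrow> swap_at i (pre @ x # y # post) = pre @ y # x # post"
  by (simp add: swap_at_def nth_append list_update_append)

text \<open>Around a valid letter a list has this shape, in which \<open>swap_at\<close>, crossings
  and block crossings become explicit; most arguments about a single letter start here.\<close>

lemma split_at_letter:
  assumes "1 \<le> i" "i < length xs"
  obtains pre x y post where "xs = pre @ x # y # post" "i = Suc (length pre)"
proof
  show "xs = take (i - 1) xs @ xs ! (i - 1) # xs ! i # drop (Suc i) xs"
    using assms by (metis Cons_nth_drop_Suc One_nat_def Suc_le_D Suc_lessD append_take_drop_id diff_Suc_1)
  show "i = Suc (length (take (i - 1) xs))" using assms by simp
qed

lemma map_swap_at:
  assumes "1 \<le> i" "i < length xs"
  shows "map f (swap_at i xs) = swap_at i (map f xs)"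
  using assms by (elim split_at_letter) (auto simp: swap_at_split)

lemma map_permute:
  assumes "w \<in> braid_words (length xs)"
  shows "map f (permute w xs) = permute w (map f xs)"
  using assms by (induction w arbitrary: xs) (auto simp: map_swap_at)

lemma set_swap_at:
  assumes "1 \<le> i" "i < length xs"
  shows "set (swap_at i xs) = set xs"
  using assms by (elim split_at_letter) (auto simp: swap_at_split)

lemma set_permute:
  assumes "w \<in> braid_words (length xs)"
  shows "set (permute w xs) = set xs"
  using assms by (induction w arbitrary: xs) (auto simp: set_swap_at)

lemma sum_list_swap_at:
  fixes ns :: "nat list"
  assumes "1 \<le> i" "i < length ns"
  shows "sum_list (swap_at i ns) = sum_list ns"
  using assms by (elim split_at_letter) (auto simp: swap_at_split)

lemma cable_word_Cons:
  "cable_word ns (a # w) =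
     block_crossing (sum_list (take (fst a - 1) ns)) (ns ! (fst a - 1)) (ns ! fst a) (snd a)
     @ cable_word (swap_at (fst a) ns) w"
  by (cases a) (simp add: swap_at_def)

lemma cable_word_words:
  assumes "w \<in> braid_words (length ns)" "m = sum_list ns"
  shows "cable_word ns w \<in> braid_words m"
  using assms
proof (induction w arbitrary: ns)
  case (Cons a w)
  then have a: "1 \<le> fst a" "fst a < length ns" by auto
  then obtain pre x y post where xs: "ns = pre @ x # y # post" "fst a = Suc (length pre)"
    by (elim split_at_letter)
  have 1: "block_crossing (sum_list (take (fst a - 1) ns)) (ns ! (fst a - 1)) (ns ! fst a) (snd a)
     \<in> braid_words m"
    by (rule block_crossing_words) (use Cons.prems in \<open>simp add: xs nth_append\<close>)
  have "cable_word (swap_at (fst a) ns) w \<in> braid_words m"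
    by (rule Cons.IH) (use Cons.prems sum_list_swap_at[OF a] in auto)
  then show ?case unfolding cable_word_Cons using 1 by simp
qed simp

section \<open>Strict braided categories whose objects are lists\<close>

text \<open>Objects are lists over \<open>Ob\<close> and the tensor is concatenation, so a strand
  may carry any list. Composition \<open>\<triangleright>\<close> is in diagram order, as words are
  read. \<open>br True\<close> is the braiding and \<open>br False xs ys\<close> is the inverse of
  \<open>br True ys xs\<close>; naturality and the hexagons are postulated for the positive crossing
  and derived below for the negative one.\<close>

locale strict_braided =
  fixes Ob :: "'x set" and arr :: "'m \<Rightarrow> bool" and dom cod :: "'m \<Rightarrow> 'x list"
    and ide :: "'x list \<Rightarrow> 'm"
    and seq :: "'m \<Rightarrow> 'm \<Rightarrow> 'm" (infixr "\<triangleright>" 55)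
    and tens :: "'m \<Rightarrow> 'm \<Rightarrow> 'm" (infixr "\<parallel>" 60)
    and br :: "bool \<Rightarrow> 'x list \<Rightarrow> 'x list \<Rightarrow> 'm"
  assumes dom_Ob: "arr f \<Longrightarrow> dom f \<in> lists Ob" and cod_Ob: "arr f \<Longrightarrow> cod f \<in> lists Ob"
    and arr_ide [simp]: "xs \<in> lists Ob \<Longrightarrow> arr (ide xs)"
    and dom_ide [simp]: "dom (ide xs) = xs" and cod_ide [simp]: "cod (ide xs) = xs"
    and arr_seq [simp]: "arr f \<Longrightarrow> arr g \<Longrightarrow> cod f = dom g \<Longrightarrow> arr (f \<triangleright> g)"
    and dom_seq [simp]: "dom (f \<triangleright> g) = dom f" and cod_seq [simp]: "cod (f \<triangleright> g) = cod g"
    and seq_assoc: "arr f \<Longrightarrow> arr g \<Longrightarrow> arr h \<Longrightarrow> cod f = dom g \<Longrightarrow> cod g = dom h \<Longrightarrow>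
      (f \<triangleright> g) \<triangleright> h = f \<triangleright> g \<triangleright> h"
    and ide_seq: "arr f \<Longrightarrow> dom f = xs \<Longrightarrow> ide xs \<triangleright> f = f"
    and seq_ide: "arr f \<Longrightarrow> cod f = xs \<Longrightarrow> f \<triangleright> ide xs = f"
    and arr_tens [simp]: "arr f \<Longrightarrow> arr g \<Longrightarrow> arr (f \<parallel> g)"
    and dom_tens [simp]: "dom (f \<parallel> g) = dom f @ dom g"
    and cod_tens [simp]: "cod (f \<parallel> g) = cod f @ cod g"
    and tens_assoc: "arr f \<Longrightarrow> arr g \<Longrightarrow> arr h \<Longrightarrow> (f \<parallel> g) \<parallel> h = f \<parallel> g \<parallel> h"
    and ide_tens: "xs \<in> lists Ob \<Longrightarrow> ys \<in> lists Ob \<Longrightarrow> ide xs \<parallel> ide ys = ide (xs @ ys)"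
    and Nil_tens [simp]: "arr f \<Longrightarrow> ide [] \<parallel> f = f"
    and tens_Nil [simp]: "arr f \<Longrightarrow> f \<parallel> ide [] = f"
    and interchange: "arr f \<Longrightarrow> arr g \<Longrightarrow> arr h \<Longrightarrow> arr k \<Longrightarrow> cod f = dom g \<Longrightarrow> cod h = dom k \<Longrightarrow>
      (f \<parallel> h) \<triangleright> (g \<parallel> k) = (f \<triangleright> g) \<parallel> (h \<triangleright> k)"
    and arr_br [simp]: "xs \<in> lists Ob \<Longrightarrow> ys \<in> lists Ob \<Longrightarrow> arr (br e xs ys)"
    and dom_br [simp]: "dom (br e xs ys) = xs @ ys"
    and cod_br [simp]: "cod (br e xs ys) = ys @ xs"
    and br_natural_True: "arr f \<Longrightarrow> arr g \<Longrightarrow>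
      br True (dom f) (dom g) \<triangleright> (g \<parallel> f) = (f \<parallel> g) \<triangleright> br True (cod f) (cod g)"
    and br_inverse: "xs \<in> lists Ob \<Longrightarrow> ys \<in> lists Ob \<Longrightarrow>
      br e xs ys \<triangleright> br (\<not> e) ys xs = ide (xs @ ys)"
    and hexagon_left_True: "xs \<in> lists Ob \<Longrightarrow> ys \<in> lists Ob \<Longrightarrow> zs \<in> lists Ob \<Longrightarrow>
      br True (xs @ ys) zs = (ide xs \<parallel> br True ys zs) \<triangleright> (br True xs zs \<parallel> ide ys)"
    and hexagon_right_True: "xs \<in> lists Ob \<Longrightarrow> ys \<in> lists Ob \<Longrightarrow> zs \<in> lists Ob \<Longrightarrow>
      br True xs (ys @ zs) = (br True xs ys \<parallel> ide zs) \<triangleright> (ide ys \<parallel> br True xs zs)"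
begin

declare dom_Ob [simp] cod_Ob [simp] seq_assoc [simp] ide_seq [simp] seq_ide [simp]
  tens_assoc [simp] ide_tens [simp]

definition inverse_pair :: "'m \<Rightarrow> 'm \<Rightarrow> bool" where
  "inverse_pair f g \<longleftrightarrow> arr f \<and> arr g \<and> dom f = cod g \<and> cod f = dom g
     \<and> f \<triangleright> g = ide (dom f) \<and> g \<triangleright> f = ide (cod f)"

lemma inverse_pair_sym: "inverse_pair f g \<Longrightarrow> inverse_pair g f"
  by (auto simp: inverse_pair_def)

lemma inverse_pair_unique:
  assumes "inverse_pair f g" "inverse_pair f h" shows "g = h"
proof -
  have "g = (h \<triangleright> f) \<triangleright> g" using assms by (auto simp: inverse_pair_def)
  also have "\<dots> = h \<triangleright> f \<triangleright> g" using assms by (subst seq_assoc) (auto simp: inverse_pair_def)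
  also have "\<dots> = h" using assms by (auto simp: inverse_pair_def)
  finally show ?thesis .
qed

lemma ide_tens_left [simp]:
  "xs \<in> lists Ob \<Longrightarrow> ys \<in> lists Ob \<Longrightarrow> arr f \<Longrightarrow> ide xs \<parallel> ide ys \<parallel> f = ide (xs @ ys) \<parallel> f"
  by (simp flip: tens_assoc)

lemma inverse_pair_seq_cancel:
  assumes "inverse_pair u v" "arr h" "dom h = dom u"
  shows "u \<triangleright> v \<triangleright> h = h"
proof -
  have "u \<triangleright> v \<triangleright> h = (u \<triangleright> v) \<triangleright> h"
    using assms by (subst seq_assoc) (auto simp: inverse_pair_def)
  then show ?thesis using assms by (simp add: inverse_pair_def)
qed

lemma inverse_pair_seq:
  assumes "inverse_pair f f'" "inverse_pair g g'" "cod f = dom g"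
  shows "inverse_pair (f \<triangleright> g) (g' \<triangleright> f')"
  using assms inverse_pair_seq_cancel[OF assms(2), of f']
    inverse_pair_seq_cancel[OF inverse_pair_sym[OF assms(1)], of g]
  by (auto simp: inverse_pair_def)

lemma inverse_pair_tens:
  assumes "inverse_pair f f'" "inverse_pair g g'"
  shows "inverse_pair (f \<parallel> g) (f' \<parallel> g')"
  using assms by (auto simp: inverse_pair_def interchange)

lemma inverse_pair_ide: "xs \<in> lists Ob \<Longrightarrow> inverse_pair (ide xs) (ide xs)"
  by (auto simp: inverse_pair_def)

lemma inverse_pair_br: "xs \<in> lists Ob \<Longrightarrow> ys \<in> lists Ob \<Longrightarrow> inverse_pair (br e xs ys) (br (\<not> e) ys xs)"
  using br_inverse[of xs ys e] br_inverse[of ys xs "\<not> e"] by (auto simp: inverse_pair_def)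

lemma inverse_pair_cancel_left:
  assumes "inverse_pair u v" "arr f" "arr g" "dom f = cod u" "dom g = cod u" "u \<triangleright> f = u \<triangleright> g"
  shows "f = g"
proof -
  have v: "inverse_pair v u" "dom v = cod u" using assms(1) by (auto simp: inverse_pair_def)
  have "f = v \<triangleright> u \<triangleright> f" using v assms by (metis inverse_pair_seq_cancel)
  also have "\<dots> = v \<triangleright> u \<triangleright> g" using assms(6) by simp
  also have "\<dots> = g" using v assms by (metis inverse_pair_seq_cancel)
  finally show ?thesis .
qed

lemma inverse_pair_cancel_right:
  assumes "inverse_pair u v" "arr f" "arr g" "cod f = dom u" "cod g = dom u" "f \<triangleright> u = g \<triangleright> u"
  shows "f = g"
proof -
  have u: "u \<triangleright> v = ide (dom u)" "arr u" "arr v" "cod u = dom v"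
    using assms(1) by (auto simp: inverse_pair_def)
  have "f = f \<triangleright> u \<triangleright> v" using u assms(2,4) by simp
  also have "\<dots> = (f \<triangleright> u) \<triangleright> v" using u assms(2,4) by simp
  also have "\<dots> = (g \<triangleright> u) \<triangleright> v" using assms(6) by simp
  also have "\<dots> = g \<triangleright> u \<triangleright> v" using u assms(3,5) by simp
  also have "\<dots> = g" using u assms(3,5) by simp
  finally show ?thesis .
qed

text \<open>The negative case is the positive naturality square for \<open>g\<close> and
  \<open>f\<close>, with both crossings carried to the opposite sides by their inverses.\<close>

lemma br_natural:
  assumes "arr f" "arr g"
  shows "br e (dom f) (dom g) \<triangleright> (g \<parallel> f) = (f \<parallel> g) \<triangleright> br e (cod f) (cod g)"
proof (cases e)
  case True
  then show ?thesis using br_natural_True assms by simp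
next
  case False
  let ?i = "br True (dom g) (dom f)" and ?j = "br True (cod g) (cod f)"
  show ?thesis
  proof (rule inverse_pair_cancel_right[OF inverse_pair_br[of "cod f" "cod g" False, THEN inverse_pair_sym]])
    have a: "?i \<triangleright> br False (dom f) (dom g) = ide (dom g @ dom f)"
      "br False (cod f) (cod g) \<triangleright> ?j = ide (cod f @ cod g)"
      "br False (dom f) (dom g) \<triangleright> ?i = ide (dom f @ dom g)"
      using br_inverse[of "dom g" "dom f" True] br_inverse[of "cod f" "cod g" False]
        br_inverse[of "dom f" "dom g" False] assms by auto
    have "br False (dom f) (dom g) \<triangleright> (g \<parallel> f) \<triangleright> ?j = br False (dom f) (dom g) \<triangleright> ?i \<triangleright> (f \<parallel> g)"
      using br_natural_True[of g f] assms by simp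
    also have "\<dots> = (br False (dom f) (dom g) \<triangleright> ?i) \<triangleright> (f \<parallel> g)"
      using assms by simp
    also have "\<dots> = (f \<parallel> g) \<triangleright> br False (cod f) (cod g) \<triangleright> ?j"
      using a assms by simp
    finally show "(br e (dom f) (dom g) \<triangleright> g \<parallel> f) \<triangleright> br (\<not> False) (cod g) (cod f) =
      (f \<parallel> g \<triangleright> br e (cod f) (cod g)) \<triangleright> br (\<not> False) (cod g) (cod f)"
      using False assms by simp
  qed (use assms in auto)
qed

text \<open>Inverting a hexagon exchanges the two kinds: the left one for \<open>br False\<close> is
  the inverse of the right one for \<open>br True\<close> with the blocks on opposite sides.\<close>

lemma hexagon_left:
  assumes "xs \<in> lists Ob" "ys \<in> lists Ob" "zs \<in> lists Ob"
  shows "br e (xs @ ys) zs = (ide xs \<parallel> br e ys zs) \<triangleright> (br e xs zs \<parallel> ide ys)"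
proof (cases e)
  case False
  have "inverse_pair ((br True zs xs \<parallel> ide ys) \<triangleright> (ide xs \<parallel> br True zs ys))
      ((ide xs \<parallel> br (\<not> True) ys zs) \<triangleright> (br (\<not> True) xs zs \<parallel> ide ys))"
    using assms by (intro inverse_pair_seq inverse_pair_tens inverse_pair_ide inverse_pair_br) auto
  moreover have "inverse_pair (br True zs (xs @ ys)) (br (\<not> True) (xs @ ys) zs)"
    using assms by (intro inverse_pair_br) auto
  ultimately show ?thesis
    using inverse_pair_unique False hexagon_right_True[of zs xs ys] assms by auto
qed (use hexagon_left_True assms in auto)

lemma hexagon_right:
  assumes "xs \<in> lists Ob" "ys \<in> lists Ob" "zs \<in> lists Ob"
  shows "br e xs (ys @ zs) = (br e xs ys \<parallel> ide zs) \<triangleright> (ide ys \<parallel> br e xs zs)"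
proof (cases e)
  case False
  have "inverse_pair ((ide ys \<parallel> br True zs xs) \<triangleright> (br True ys xs \<parallel> ide zs))
      ((br (\<not> True) xs ys \<parallel> ide zs) \<triangleright> (ide ys \<parallel> br (\<not> True) xs zs))"
    using assms by (intro inverse_pair_seq inverse_pair_tens inverse_pair_ide inverse_pair_br) auto
  moreover have "inverse_pair (br True (ys @ zs) xs) (br (\<not> True) xs (ys @ zs))"
    using assms by (intro inverse_pair_br) auto
  ultimately show ?thesis
    using inverse_pair_unique False hexagon_left_True[of ys zs xs] assms by auto
qed (use hexagon_right_True assms in auto)

text \<open>A hexagon with empty blocks says that the crossing equals its own square, and an
  invertible idempotent is an identity.\<close>

lemma br_Nil:
  assumes "xs \<in> lists Ob"
  shows "br e xs [] = ide xs" "br e [] xs = ide xs"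
proof -
  have idem: "f = ide xs" if "inverse_pair f g" "f = f \<triangleright> f" "dom f = xs" "cod f = xs" for f g
  proof (rule inverse_pair_cancel_left[OF that(1)])
    show "f \<triangleright> f = f \<triangleright> ide xs" using that by (auto simp: inverse_pair_def)
  qed (use that assms in \<open>auto simp: inverse_pair_def\<close>)
  show "br e xs [] = ide xs"
    by (rule idem[OF inverse_pair_br]) (use assms hexagon_right[of xs "[]" "[]" e] in auto)
  show "br e [] xs = ide xs"
    by (rule idem[OF inverse_pair_br]) (use assms hexagon_left[of "[]" "[]" xs e] in auto)
qed

lemma whisker_left:
  "xs \<in> lists Ob \<Longrightarrow> arr f \<Longrightarrow> arr g \<Longrightarrow> cod f = dom g \<Longrightarrow>
    ide xs \<parallel> (f \<triangleright> g) = (ide xs \<parallel> f) \<triangleright> (ide xs \<parallel> g)"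
  by (simp add: interchange)

lemma whisker_right:
  "xs \<in> lists Ob \<Longrightarrow> arr f \<Longrightarrow> arr g \<Longrightarrow> cod f = dom g \<Longrightarrow>
    (f \<triangleright> g) \<parallel> ide xs = (f \<parallel> ide xs) \<triangleright> (g \<parallel> ide xs)"
  by (simp add: interchange)

lemma tens_exchange:
  "arr f \<Longrightarrow> arr g \<Longrightarrow> (f \<parallel> ide (dom g)) \<triangleright> (ide (cod f) \<parallel> g) = f \<parallel> g"
  "arr f \<Longrightarrow> arr g \<Longrightarrow> (ide (dom f) \<parallel> g) \<triangleright> (f \<parallel> ide (cod g)) = f \<parallel> g"
  by (simp_all add: interchange)

text \<open>Naturality of the crossing with \<open>zs\<close> is applied to the crossing of
  \<open>xs\<close> and \<open>ys\<close>; \<open>hexagon_left\<close> splits the two crossings with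
  a concatenation.\<close>

lemma yang_baxter:
  assumes "xs \<in> lists Ob" "ys \<in> lists Ob" "zs \<in> lists Ob"
  shows "(br e xs ys \<parallel> ide zs) \<triangleright> (ide ys \<parallel> br e xs zs) \<triangleright> (br e ys zs \<parallel> ide xs) =
    (ide xs \<parallel> br e ys zs) \<triangleright> (br e xs zs \<parallel> ide ys) \<triangleright> (ide zs \<parallel> br e xs ys)"
  using br_natural[of "br e xs ys" "ide zs" e] hexagon_left[of xs ys zs e]
    hexagon_left[of ys xs zs e] assms by simp

text \<open>There is one label for each strand, and a label is itself a list: a longer list makes
  the strand a ribbon, the empty list deletes it.\<close>

definition cross :: "nat \<times> bool \<Rightarrow> 'x list list \<Rightarrow> 'm" where
  "cross a xss = ide (concat (take (fst a - 1) xss))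
     \<parallel> br (snd a) (xss ! (fst a - 1)) (xss ! fst a) \<parallel> ide (concat (drop (Suc (fst a)) xss))"

fun act :: "braid_word \<Rightarrow> 'x list list \<Rightarrow> 'm" where
  "act [] xss = ide (concat xss)"
| "act (a # w) xss = cross a xss \<triangleright> act w (swap_at (fst a) xss)"

lemma concat_Ob [simp]: "xss \<in> lists (lists Ob) \<Longrightarrow> concat xss \<in> lists Ob"
  by (induction xss) auto

lemma cross_split:
  "i = Suc (length pre) \<Longrightarrow> cross (i, e) (pre @ xs # ys # post) =
    ide (concat pre) \<parallel> br e xs ys \<parallel> ide (concat post)"
  by (simp add: cross_def nth_append)

lemma cross_typed:
  assumes "1 \<le> fst a" "fst a < length xss" "xss \<in> lists (lists Ob)"
  shows "arr (cross a xss)" "dom (cross a xss) = concat xss"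
    "cod (cross a xss) = concat (swap_at (fst a) xss)"
    "swap_at (fst a) xss \<in> lists (lists Ob)"
    "\<exists>g. inverse_pair (cross a xss) g"
proof -
  obtain pre x y post where *: "xss = pre @ x # y # post" "fst a = Suc (length pre)"
    using assms split_at_letter by metis
  obtain e where a: "a = (Suc (length pre), e)" using * by (cases a) auto
  show "arr (cross a xss)" "dom (cross a xss) = concat xss"
    "cod (cross a xss) = concat (swap_at (fst a) xss)"
    "swap_at (fst a) xss \<in> lists (lists Ob)"
    using assms unfolding * a by (auto simp: cross_split swap_at_split)
  show "\<exists>g. inverse_pair (cross a xss) g"
    unfolding * a cross_split[OF HOL.refl]
    by (rule exI[of _ "ide (concat pre) \<parallel> br (\<not> e) y x \<parallel> ide (concat post)"],
        intro inverse_pair_tens inverse_pair_ide inverse_pair_br) (use assms * in auto)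
qed

lemma permute_Ob [simp]:
  "w \<in> braid_words (length xss) \<Longrightarrow> permute w xss \<in> lists A \<longleftrightarrow> xss \<in> lists A"
  by (metis set_permute in_lists_conv_set)

lemma act_typed [simp]:
  assumes "w \<in> braid_words (length xss)" "xss \<in> lists (lists Ob)"
  shows "arr (act w xss)" "dom (act w xss) = concat xss" "cod (act w xss) = concat (permute w xss)"
  using assms by (induction w arbitrary: xss) (auto simp: cross_typed)

lemma act_invertible:
  assumes "w \<in> braid_words (length xss)" "xss \<in> lists (lists Ob)"
  shows "\<exists>g. inverse_pair (act w xss) g"
  using assms
proof (induction w arbitrary: xss)
  case Nil
  then show ?case using inverse_pair_ide[of "concat xss"] by auto
next
  case (Cons a w)
  then have a: "1 \<le> fst a" "fst a < length xss" by auto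
  note c = cross_typed[OF a Cons.prems(2)]
  obtain g where g: "inverse_pair (cross a xss) g" using c by blast
  obtain h where h: "inverse_pair (act w (swap_at (fst a) xss)) h"
    using Cons.IH[of "swap_at (fst a) xss"] Cons.prems c by auto
  have "inverse_pair (cross a xss \<triangleright> act w (swap_at (fst a) xss)) (h \<triangleright> g)"
    by (rule inverse_pair_seq[OF g h]) (use Cons.prems c in simp)
  then show ?case by auto
qed

lemma act_append:
  assumes "u @ v \<in> braid_words (length xss)" "xss \<in> lists (lists Ob)"
  shows "act (u @ v) xss = act u xss \<triangleright> act v (permute u xss)"
  using assms by (induction u arbitrary: xss) (auto simp: cross_typed)

lemma act_braid_rel_context:
  assumes "u @ x @ v \<in> braid_words n" "u @ y @ v \<in> braid_words n" "length xss = n" "xss \<in> lists (lists Ob)"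
    and "permute x (permute u xss) = permute y (permute u xss)"
    and "act x (permute u xss) = act y (permute u xss)"
  shows "act (u @ x @ v) xss = act (u @ y @ v) xss"
  using assms by (simp add: act_append)

text \<open>The three relations have three sources: \<open>br_inverse\<close> for cancellation, the
  interchange law for crossings on disjoint blocks, and \<open>yang_baxter\<close>.\<close>

lemma act_braid_rel:
  assumes "(u, v) \<in> braid_rel n" "length xss = n" "xss \<in> lists (lists Ob)"
  shows "act u xss = act v xss"
  using assms
proof (induction arbitrary: xss rule: braid_rel.induct)
  case (cancel u i e v)
  let ?y = "permute u xss"
  have y: "?y \<in> lists (lists Ob)" using cancel by simp
  have "1 \<le> i" "i < length ?y" using cancel by auto
  then obtain pre a b post where *: "?y = pre @ a # b # post" "i = Suc (length pre)"
    by (elim split_at_letter)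
  have "act (u @ [(i, e), (i, \<not> e)] @ v) xss = act (u @ [] @ v) xss"
  proof (rule act_braid_rel_context)
    show "permute [(i, e), (i, \<not> e)] ?y = permute [] ?y" by (simp add: * swap_at_split)
    show "act [(i, e), (i, \<not> e)] ?y = act [] ?y"
      using y unfolding * by (simp add: cross_split swap_at_split interchange br_inverse)
  qed (use cancel in auto)
  then show ?case by simp
next
  case (commute u i j v)
  let ?y = "permute u xss"
  have y: "?y \<in> lists (lists Ob)" using commute by simp
  have "1 \<le> i" "i < length ?y" using commute by auto
  then obtain pre a b post where *: "?y = pre @ a # b # post" "i = Suc (length pre)"
    by (elim split_at_letter)
  have l: "length (pre @ a # b # post) = n" using * commute by (metis length_permute)
  \<comment> \<open>The part \<open>pre @ [a, b]\<close> has length \<open>i + 1\<close>, so the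
    letter \<open>j\<close> of the whole list is the letter \<open>j - i - 1\<close> of
    \<open>post\<close>.\<close>
  have "1 \<le> j - i - 1" "j - i - 1 < length post" using commute * l by auto
  then obtain mid c d post' where **: "post = mid @ c # d # post'" "j - i - 1 = Suc (length mid)"
    by (elim split_at_letter)
  \<comment> \<open>Both forms occur, since \<open>a\<close> and \<open>b\<close> may or may not
    have been exchanged when the letter \<open>j\<close> is reached.\<close>
  have j: "j = Suc (length (pre @ a # b # mid))" "j = Suc (length (pre @ b # a # mid))"
    using * ** commute by auto
  show ?case
  proof (rule act_braid_rel_context)
    show "permute [(i, True), (j, True)] ?y = permute [(j, True), (i, True)] ?y"
      using swap_at_split[OF j(2), of c d post'] swap_at_split[OF j(1), of c d post']
      by (simp add: * swap_at_split **)
    have O: "a \<in> lists Ob" "b \<in> lists Ob" "c \<in> lists Ob" "d \<in> lists Ob"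
      "concat pre \<in> lists Ob" "concat mid \<in> lists Ob" "concat post' \<in> lists Ob"
      using y unfolding * ** by auto
    let ?G = "ide (concat mid) \<parallel> br True c d \<parallel> ide (concat post')"
    have "ide (concat pre) \<parallel> ((br True a b \<parallel> ide (dom ?G)) \<triangleright> (ide (b @ a) \<parallel> ?G))
      = ide (concat pre) \<parallel> ((ide (a @ b) \<parallel> ?G) \<triangleright> (br True a b \<parallel> ide (cod ?G)))"
      using tens_exchange[of "br True a b" ?G] O by simp
    then show "act [(i, True), (j, True)] ?y = act [(j, True), (i, True)] ?y"
      using O swap_at_split[OF j(2), of c d post'] swap_at_split[OF j(1), of c d post']
        cross_split[OF j(2), of True c d post'] cross_split[OF j(1), of True c d post'] *(2)
      unfolding * **
      by (simp add: swap_at_split cross_split whisker_left)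
  qed (use commute in auto)
next
  case (braid u i v)
  let ?y = "permute u xss"
  have y: "?y \<in> lists (lists Ob)" using braid by simp
  have "1 \<le> i" "i < length ?y" using braid by auto
  then obtain pre a b post where *: "?y = pre @ a # b # post" "i = Suc (length pre)"
    by (elim split_at_letter)
  have l: "length (pre @ a # b # post) = n" using * braid by (metis length_permute)
  \<comment> \<open>The letter \<open>i + 1\<close> is also valid, so a third strand follows
    \<open>a\<close> and \<open>b\<close>.\<close>
  then obtain c post' where **: "post = c # post'" using braid * by (cases post) auto
  have s: "swap_at (Suc i) (pre @ a # b # c # ys) = pre @ a # c # b # ys"
    "cross (Suc i, True) (pre @ a # b # c # ys) = ide (concat pre @ a) \<parallel> br True b c \<parallel> ide (concat ys)"
    for a b c ys
    using swap_at_split[of "Suc i" "pre @ [a]"] cross_split[of "Suc i" "pre @ [a]"] * by simp_all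
  note s = s[unfolded *(2)]
  show ?case
  proof (rule act_braid_rel_context)
    show "permute [(i, True), (i + 1, True), (i, True)] ?y =
      permute [(i + 1, True), (i, True), (i + 1, True)] ?y" by (simp add: s * swap_at_split **)
    have O: "a \<in> lists Ob" "b \<in> lists Ob" "c \<in> lists Ob" "concat pre \<in> lists Ob" "concat post' \<in> lists Ob"
      using y[unfolded *(1)] unfolding ** by auto
    have "ide (concat pre) \<parallel> ((br True a b \<parallel> ide c) \<triangleright> (ide b \<parallel> br True a c) \<triangleright> (br True b c \<parallel> ide a)) \<parallel> ide (concat post')
      = ide (concat pre) \<parallel> ((ide a \<parallel> br True b c) \<triangleright> (br True a c \<parallel> ide b) \<triangleright> (ide c \<parallel> br True a b)) \<parallel> ide (concat post')"
      using yang_baxter[of a b c True] O by simp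
    then show "act [(i, True), (i + 1, True), (i, True)] ?y =
      act [(i + 1, True), (i, True), (i + 1, True)] ?y"
      unfolding * ** using O *(2)
      by (simp add: s swap_at_split cross_split whisker_left whisker_right)
  qed (use braid in auto)
qed (use braid_rel_words in auto)

end

section \<open>Permutations, shifted words and representatives of braids\<close>

lemma concat_in_lists: "xss \<in> lists (lists A) \<Longrightarrow> concat xss \<in> lists A"
  by (induction xss) auto

lemma concat_concat_map: "concat (concat xsss) = concat (map concat xsss)"
  by (induction xsss) auto

lemma swap_at_append:
  "1 \<le> i \<Longrightarrow> i < length xs \<Longrightarrow> swap_at i (xs @ ys) = swap_at i xs @ ys"
  by (elim split_at_letter) (auto simp: swap_at_split)

lemma swap_at_shift:
  assumes "1 \<le> i" "i < length xs"
  shows "swap_at (i + length pre) (pre @ xs) = pre @ swap_at i xs"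
proof -
  obtain p x y q where *: "xs = p @ x # y # q" "i = Suc (length p)"
    using assms split_at_letter by metis
  show ?thesis using swap_at_split[of "i + length pre" "pre @ p" x y q] * by (simp add: swap_at_split)
qed

lemma permute_extend:
  "w \<in> braid_words (length xs) \<Longrightarrow> permute w (xs @ ys) = permute w xs @ ys"
  by (induction w arbitrary: xs) (auto simp: swap_at_append)

lemma shift_word_simps [simp]:
  "shift_word k [] = []" "shift_word k (a # w) = (fst a + k, snd a) # shift_word k w"
  by (auto simp: shift_word_def split: prod.splits)

lemma shift_word_0 [simp]: "shift_word 0 w = w"
  by (induction w) auto

lemma shift_word_words:
  "w \<in> braid_words n \<Longrightarrow> n + k \<le> m \<Longrightarrow> shift_word k w \<in> braid_words m"
  by (induction w) auto

lemma permute_shift: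
  "w \<in> braid_words (length xs) \<Longrightarrow> length pre = k \<Longrightarrow>
    permute (shift_word k w) (pre @ xs) = pre @ permute w xs"
  by (induction w arbitrary: xs) (auto simp: swap_at_shift)

lemma block_crossing_Suc:
  "block_crossing k p (Suc q) e =
    block_crossing k p q e @ map (\<lambda>j. (j, e)) (rev [Suc (k + q) ..< Suc (k + q + p)])"
  by (simp add: block_crossing_def add_ac)

lemma word_perm_append: "word_perm (u @ v) = word_perm v \<circ> word_perm u"
  by (induction u rule: word_perm.induct) auto

lemma word_perm_braid_rel: "(u, v) \<in> braid_rel n \<Longrightarrow> word_perm u = word_perm v"
proof (induction rule: braid_rel.induct)
  case (cancel u i e v)
  then show ?case by (simp add: word_perm_append fun_eq_iff)
next
  case (commute u i j v)
  have "transpose j (j + 1) (transpose i (i + 1) x) = transpose i (i + 1) (transpose j (j + 1) x)" for x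
    using commute by (auto simp: transpose_def)
  then show ?case by (simp add: word_perm_append fun_eq_iff)
next
  case (braid u i v)
  have "transpose i (i+1) (transpose (i+1) (i+1+1) (transpose i (i + 1) x)) =
     transpose (i+1) (i+1+1) (transpose i (i+1) (transpose (i+1) (i+1+1) x))" for x
    by (auto simp: transpose_def)
  then show ?case by (simp add: word_perm_append fun_eq_iff)
qed auto

text \<open>Connects the two descriptions of the underlying permutation: \<open>permute\<close>
  rearranges a whole list, \<open>word_perm\<close> traces one strand. The subtractions pass from
  positions, counted from 1, to list indices.\<close>

lemma permute_word_perm:
  assumes "w \<in> braid_words (length xs)" "1 \<le> p" "p \<le> length xs"
  shows "permute w xs ! (word_perm w p - 1) = xs ! (p - 1)"
  using assms
proof (induction w arbitrary: xs p)
  case (Cons a w)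
  then have a: "1 \<le> fst a" "fst a < length xs" by auto
  let ?p = "transpose (fst a) (fst a + 1) p"
  have "permute w (swap_at (fst a) xs) ! (word_perm w ?p - 1) = swap_at (fst a) xs ! (?p - 1)"
    by (rule Cons.IH) (use Cons.prems a in \<open>auto simp: transpose_def\<close>)
  also have "\<dots> = xs ! (p - 1)"
    using a Cons.prems(2,3) by (auto simp: transpose_def swap_at_def nth_list_update)
  finally show ?case by (cases a) simp
qed simp

lemma permute_transpose_2_3:
  assumes "w \<in> braid_words 4" "word_perm w = transpose 2 3"
  shows "permute w [x, y, z, t] = [x, z, y, t]"
proof -
  have w: "w \<in> braid_words (length [x, y, z, t])" using assms by (simp add: eval_nat_numeral)
  have *: "permute w [x, y, z, t] ! (transpose 2 3 p - 1) = [x, y, z, t] ! (p - 1)"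
    if "1 \<le> p" "p \<le> 4" for p
    using permute_word_perm[OF w, of p] assms that by (simp add: eval_nat_numeral)
  have "length (permute w [x, y, z, t]) = 4" by simp
  moreover have "permute w [x, y, z, t] ! 0 = x" "permute w [x, y, z, t] ! 2 = y"
    "permute w [x, y, z, t] ! 1 = z" "permute w [x, y, z, t] ! 3 = t"
    using *[of 1] *[of 2] *[of 3] *[of 4] by (auto simp: transpose_def)
  ultimately show ?thesis
    by (auto simp: list_eq_iff_nth_eq less_Suc_eq numeral_eq_Suc)
qed

lemma braid_class_carrier:
  assumes "b \<in> carrier (braid_group n)" "w \<in> b"
  shows "w \<in> braid_words n" "b = braid_class n w"
proof -
  obtain v where v: "v \<in> braid_words n" "b = braid_rel n `` {v}"
    using assms(1) by (auto simp: braid_group_def elim: quotientE)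
  then have vw: "(v, w) \<in> braid_rel n" using assms(2) by auto
  then show "w \<in> braid_words n" by (rule braid_rel_words)
  show "b = braid_class n w"
    unfolding braid_class_def v(2) by (rule equiv_class_eq[OF equiv_braid_rel vw])
qed

lemma braid_class_rel: "b \<in> carrier (braid_group n) \<Longrightarrow> u \<in> b \<Longrightarrow> v \<in> b \<Longrightarrow> (u, v) \<in> braid_rel n"
  using braid_class_carrier(2)[of b n u] by (auto simp: braid_class_def)

lemma braid_class_nonempty:
  assumes "b \<in> carrier (braid_group n)"
  shows "\<exists>w. w \<in> b"
proof -
  obtain v where v: "v \<in> braid_words n" "b = braid_rel n `` {v}"
    using assms by (auto simp: braid_group_def elim: quotientE)
  then show ?thesis by (auto intro: braid_rel.refl)
qed

text \<open>The permutation is constant on a class, so its image is a singleton and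
  \<open>the_elem\<close> is meaningful.\<close>

lemma braid_perm_class:
  assumes "b \<in> carrier (braid_group n)" "w \<in> b"
  shows "braid_perm b = word_perm w"
proof -
  have "word_perm ` b = {word_perm w}"
    using assms by (auto intro!: word_perm_braid_rel dest: braid_class_rel)
  then show ?thesis by (simp add: braid_perm_def)
qed

lemma lift_braid_memI:
  "w \<in> x \<Longrightarrow> f w \<in> braid_words m \<Longrightarrow> f w \<in> lift_braid m f x"
  by (auto simp: lift_braid_def intro: braid_rel.refl)

lemma lift_braid_mult_mem:
  assumes "w \<in> x" "f w \<in> braid_words m" "g w \<in> braid_words m"
  shows "f w @ g w \<in> lift_braid m f x \<otimes>\<^bsub>braid_group m\<^esub> lift_braid m g x"
proof -
  have "(f w @ g w, f w @ g w) \<in> braid_rel m" using assms by (intro braid_rel.refl) auto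
  then show ?thesis using lift_braid_memI[of w x f m] lift_braid_memI[of w x g m] assms
    by (auto simp: braid_group_def)
qed

text \<open>\<open>lift_braid\<close> closes up the images of all words of the class, so the two
  factors of a product may come from different words \<open>v\<close> and \<open>w\<close>.\<close>

lemma lift_braid_mult_memD:
  assumes "z \<in> lift_braid m f x \<otimes>\<^bsub>braid_group m\<^esub> lift_braid m g x"
  obtains v w where "v \<in> x" "w \<in> x" "(f v @ g w, z) \<in> braid_rel m"
proof -
  obtain p q v w where *: "(p @ q, z) \<in> braid_rel m" "v \<in> x" "w \<in> x"
    "(f v, p) \<in> braid_rel m" "(g w, q) \<in> braid_rel m"
    using assms by (auto simp: braid_group_def lift_braid_def)
  have "(f v @ g w, p @ g w) \<in> braid_rel m"
    using braid_rel_append[OF *(4), of "[]" "g w"] braid_rel_words[OF *(5)] by simp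
  moreover have "(p @ g w, p @ q) \<in> braid_rel m"
    using braid_rel_append[OF *(5), of p "[]"] braid_rel_words[OF *(4)] by simp
  ultimately have "(f v @ g w, z) \<in> braid_rel m"
    using *(1) by (blast intro: braid_rel.trans)
  then show ?thesis using that * by blast
qed

text \<open>Turns the conditions on \<open>b\<close> into relations between words. One side of each
  equation can be written with the given \<open>w\<close> in both factors; the words on the other
  side are only known to lie in \<open>b\<close>, and \<open>act_b\<close> will identify their
  actions.\<close>

lemma interchanging_braid_rels:
  assumes "interchanging_unital_braid b" "w \<in> b"
  shows "w \<in> braid_words 4" "word_perm w = transpose 2 3"
    "\<exists>u\<in>b. \<exists>v\<in>b. (w @ cable_word [2,2,1,1] w, shift_word 2 u @ cable_word [1,1,2,2] v) \<in> braid_rel 6"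
    "\<exists>u\<in>b. \<exists>v\<in>b. (cable_word [1,2,1,2] w @ shift_word 2 w, cable_word [2,1,2,1] u @ v) \<in> braid_rel 6"
    "\<And>ns. ns \<in> {[0,0,1,1],[1,1,0,0],[0,1,0,1],[1,0,1,0]} \<Longrightarrow> (cable_word ns w, []) \<in> braid_rel 2"
proof -
  have b: "b \<in> carrier (braid_group 4)" using assms by (simp add: interchanging_unital_braid_def)
  show w: "w \<in> braid_words 4" using braid_class_carrier[OF b assms(2)] by simp
  show "word_perm w = transpose 2 3"
    using braid_perm_class[OF b assms(2)] assms(1) by (simp add: interchanging_unital_braid_def)
  have w6: "w \<in> braid_words 6" "w \<in> braid_words (Suc (Suc (Suc (Suc 0))))"
    using shift_word_words[OF w, of 0 6] w by (simp_all add: eval_nat_numeral)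
  have upt: "[1..<4 + 1] = [1,2,3,4::nat]" by (simp add: upt_rec)
  have d: "double_strands 4 {1,2} b = lift_braid 6 (cable_word [2,2,1,1]) b"
    "double_strands 4 {3,4} b = lift_braid 6 (cable_word [1,1,2,2]) b"
    "double_strands 4 {2,4} b = lift_braid 6 (cable_word [1,2,1,2]) b"
    "double_strands 4 {1,3} b = lift_braid 6 (cable_word [2,1,2,1]) b"
    unfolding double_strands_def upt by simp_all
  \<comment> \<open>Written with a shift by 0, both factors of \<open>braid_L\<close> are lifts of
    maps applied to the same word.\<close>
  have "w @ cable_word [2,2,1,1] w = shift_word 0 w @ cable_word [2,2,1,1] w" by simp
  also have "\<dots> \<in> braid_L b"
    unfolding braid_L_def d place_def
    by (rule lift_braid_mult_mem) (use w w6 assms in \<open>auto intro!: cable_word_words\<close>)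
  also have "braid_L b = braid_R b" using assms by (simp add: interchanging_unital_braid_def)
  finally show "\<exists>u\<in>b. \<exists>v\<in>b. (w @ cable_word [2,2,1,1] w, shift_word 2 u @ cable_word [1,1,2,2] v) \<in> braid_rel 6"
    unfolding braid_R_def d place_def by (elim lift_braid_mult_memD) (auto intro: braid_rel.sym)
  have "cable_word [1,2,1,2] w @ shift_word 2 w \<in> braid_L' b"
    unfolding braid_L'_def d place_def
    by (rule lift_braid_mult_mem) (use w w6 assms in \<open>auto intro!: cable_word_words shift_word_words[of _ 4]\<close>)
  also have "braid_L' b = braid_R' b" using assms by (simp add: interchanging_unital_braid_def)
  finally show "\<exists>u\<in>b. \<exists>v\<in>b. (cable_word [1,2,1,2] w @ shift_word 2 w, cable_word [2,1,2,1] u @ v) \<in> braid_rel 6"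
    unfolding braid_R'_def d place_def by (elim lift_braid_mult_memD) (auto intro: braid_rel.sym)
  have del: "delete_strands 4 {1,2} b = lift_braid 2 (cable_word [0,0,1,1]) b"
    "delete_strands 4 {3,4} b = lift_braid 2 (cable_word [1,1,0,0]) b"
    "delete_strands 4 {2,4} b = lift_braid 2 (cable_word [1,0,1,0]) b"
    "delete_strands 4 {1,3} b = lift_braid 2 (cable_word [0,1,0,1]) b"
    unfolding delete_strands_def upt by (simp_all add: numeral_2_eq_2)
  fix ns :: "nat list" assume ns: "ns \<in> {[0,0,1,1],[1,1,0,0],[0,1,0,1],[1,0,1,0]}"
  have "\<forall>S\<in>{{1, 2}, {3, 4}, {1, 3}, {2, 4}}. delete_strands 4 S b = \<one>\<^bsub>braid_group 2\<^esub>"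
    using assms(1) unfolding interchanging_unital_braid_def by blast
  then have "\<forall>ns\<in>{[0,0,1,1],[1,1,0,0],[0,1,0,1],[1,0,1,0]}. lift_braid 2 (cable_word ns) b = \<one>\<^bsub>braid_group 2\<^esub>"
    by (simp only: ball_simps del)
  then have "lift_braid 2 (cable_word ns) b = \<one>\<^bsub>braid_group 2\<^esub>"
    using ns by blast
  moreover have "cable_word ns w \<in> lift_braid 2 (cable_word ns) b"
    by (rule lift_braid_memI) (use ns w w6 assms in \<open>auto intro!: cable_word_words\<close>)
  ultimately show "(cable_word ns w, []) \<in> braid_rel 2"
    by (auto simp: braid_group_def braid_class_def intro: braid_rel.sym)
qed

section \<open>Naturality, juxtaposition and cabling of the action\<close>

context strict_braided
begin

definition tens_list :: "'m list \<Rightarrow> 'm" where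
  "tens_list fs = foldr tens fs (ide [])"

lemma tens_list_simps [simp]:
  "tens_list [] = ide []" "tens_list (f # fs) = f \<parallel> tens_list fs"
  by (simp_all add: tens_list_def)

lemma tens_list_typed [simp]:
  "\<forall>f\<in>set fs. arr f \<Longrightarrow> arr (tens_list fs)"
  "dom (tens_list fs) = concat (map dom fs)" "cod (tens_list fs) = concat (map cod fs)"
  by (induction fs) auto

lemma tens_list_append [simp]:
  "\<forall>f\<in>set fs. arr f \<Longrightarrow> \<forall>f\<in>set gs. arr f \<Longrightarrow> tens_list (fs @ gs) = tens_list fs \<parallel> tens_list gs"
  by (induction fs) auto

lemma map_dom_cod_Ob:
  "\<forall>f\<in>set fs. arr f \<Longrightarrow> map dom fs \<in> lists (lists Ob)"
  "\<forall>f\<in>set fs. arr f \<Longrightarrow> map cod fs \<in> lists (lists Ob)"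
  by (induction fs) auto

lemma cross_natural:
  assumes "1 \<le> fst a" "fst a < length fs" "\<forall>f\<in>set fs. arr f"
  shows "cross a (map dom fs) \<triangleright> tens_list (swap_at (fst a) fs) = tens_list fs \<triangleright> cross a (map cod fs)"
proof -
  obtain pre f g post where *: "fs = pre @ f # g # post" "fst a = Suc (length pre)"
    using assms split_at_letter by metis
  obtain e where a: "a = (Suc (length pre), e)" using * by (cases a) auto
  have [simp]: "arr f" "arr g" "\<forall>f\<in>set pre. arr f" "\<forall>f\<in>set post. arr f" using assms * by auto
  let ?l = "tens_list pre" and ?r = "tens_list post"
  have "cross a (map dom fs) \<triangleright> tens_list (swap_at (fst a) fs) =
     (ide (dom ?l) \<parallel> br e (dom f) (dom g) \<parallel> ide (dom ?r)) \<triangleright> (?l \<parallel> (g \<parallel> f) \<parallel> ?r)"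
    unfolding * a by (simp add: cross_split swap_at_split)
  also have "\<dots> = ?l \<parallel> (br e (dom f) (dom g) \<triangleright> (g \<parallel> f)) \<parallel> ?r"
    by (simp add: interchange del: tens_assoc tens_list_typed(2,3))
  also have "\<dots> = ?l \<parallel> ((f \<parallel> g) \<triangleright> br e (cod f) (cod g)) \<parallel> ?r"
    by (simp add: br_natural)
  also have "\<dots> = (?l \<parallel> (f \<parallel> g) \<parallel> ?r) \<triangleright> (ide (cod ?l) \<parallel> br e (cod f) (cod g) \<parallel> ide (cod ?r))"
    by (simp add: interchange del: tens_assoc tens_list_typed(2,3))
  also have "\<dots> = tens_list fs \<triangleright> cross a (map cod fs)"
    unfolding * a by (simp add: cross_split swap_at_split)
  finally show ?thesis .
qed

text \<open>Arrows placed below a braid slide up through it one crossing at a time, by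
  \<open>cross_natural\<close>.\<close>

lemma act_natural:
  assumes "w \<in> braid_words (length fs)" "\<forall>f\<in>set fs. arr f"
  shows "act w (map dom fs) \<triangleright> tens_list (permute w fs) = tens_list fs \<triangleright> act w (map cod fs)"
  using assms
proof (induction w arbitrary: fs)
  case Nil
  then show ?case using map_dom_cod_Ob[of fs] by simp
next
  case (Cons a w)
  then have a: "1 \<le> fst a" "fst a < length fs" by auto
  let ?s = "swap_at (fst a) fs"
  note m = map_dom_cod_Ob[OF Cons.prems(2)]
  have s: "\<forall>f\<in>set ?s. arr f" using Cons.prems set_swap_at[OF a] by auto
  note ms = map_dom_cod_Ob[OF s]
  have w: "w \<in> braid_words (length ?s)" using Cons.prems by simp
  have p: "\<forall>f\<in>set (permute w ?s). arr f" using s set_permute[OF w] by auto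
  note c1 = cross_typed[of a "map dom fs"] and c2 = cross_typed[of a "map cod fs"]
  have "act (a # w) (map dom fs) \<triangleright> tens_list (permute (a # w) fs) =
      cross a (map dom fs) \<triangleright> act w (map dom ?s) \<triangleright> tens_list (permute w ?s)"
    using a m w s ms p c1 by (simp add: map_swap_at map_permute)
  also have "\<dots> = cross a (map dom fs) \<triangleright> tens_list ?s \<triangleright> act w (map cod ?s)"
    using Cons.IH[OF w s] by simp
  also have "\<dots> = (cross a (map dom fs) \<triangleright> tens_list ?s) \<triangleright> act w (map cod ?s)"
    using a m w s ms p c1 by (simp add: map_swap_at map_permute)
  also have "\<dots> = (tens_list fs \<triangleright> cross a (map cod fs)) \<triangleright> act w (map cod ?s)"
    using cross_natural[OF a Cons.prems(2)] by simp
  also have "\<dots> = tens_list fs \<triangleright> act (a # w) (map cod fs)"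
    using a m w s ms p c2 Cons.prems by (simp add: map_swap_at map_permute)
  finally show ?case .
qed

lemma cross_extend:
  assumes "1 \<le> fst a" "fst a < length xss" "xss \<in> lists (lists Ob)" "yss \<in> lists (lists Ob)"
  shows "cross a (xss @ yss) = cross a xss \<parallel> ide (concat yss)"
proof -
  obtain pre x y post where *: "xss = pre @ x # y # post" "fst a = Suc (length pre)"
    using assms split_at_letter by metis
  obtain e where a: "a = (Suc (length pre), e)" using * by (cases a) auto
  show ?thesis using assms(3,4) unfolding * a by (simp add: cross_split)
qed

lemma cross_shift:
  assumes "1 \<le> fst a" "fst a < length xss" "xss \<in> lists (lists Ob)" "pre \<in> lists (lists Ob)"
  shows "cross (fst a + length pre, snd a) (pre @ xss) = ide (concat pre) \<parallel> cross a xss"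
proof -
  obtain p x y q where *: "xss = p @ x # y # q" "fst a = Suc (length p)"
    using assms split_at_letter by metis
  obtain e where a: "a = (Suc (length p), e)" using * by (cases a) auto
  have "cross (fst a + length pre, e) ((pre @ p) @ x # y # q) =
    ide (concat (pre @ p)) \<parallel> br e x y \<parallel> ide (concat q)"
    by (rule cross_split) (use * in simp)
  then show ?thesis using assms(3,4) unfolding * a by (simp add: cross_split)
qed

lemma act_extend:
  assumes "w \<in> braid_words (length xss)" "xss \<in> lists (lists Ob)" "yss \<in> lists (lists Ob)"
  shows "act w (xss @ yss) = act w xss \<parallel> ide (concat yss)"
  using assms
proof (induction w arbitrary: xss)
  case (Cons a w)
  then have a: "1 \<le> fst a" "fst a < length xss" by auto
  note c = cross_typed[OF a Cons.prems(2)] cross_extend[OF a Cons.prems(2,3)] swap_at_append[OF a, of yss]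
  show ?case using Cons c by (simp add: whisker_right)
qed simp

lemma act_shift:
  assumes "w \<in> braid_words (length xss)" "xss \<in> lists (lists Ob)" "pre \<in> lists (lists Ob)" "length pre = k"
  shows "act (shift_word k w) (pre @ xss) = ide (concat pre) \<parallel> act w xss"
  using assms
proof (induction w arbitrary: xss)
  case (Cons a w)
  then have a: "1 \<le> fst a" "fst a < length xss" by auto
  note c = cross_typed[OF a Cons.prems(2)] cross_shift[OF a Cons.prems(2,3)] swap_at_shift[OF a, of pre]
  show ?case using Cons c by (simp add: whisker_left)
qed simp

text \<open>One strand passes a ribbon, beginning with the rightmost strand of the ribbon; this is
  one row of \<open>block_crossing\<close>. The hexagon joins the crossing with the strand just
  passed to the crossing with the rest. A strand already passed is counted in \<open>post\<close>,
  which must therefore be arbitrary in the induction.\<close>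

lemma act_strand:
  assumes "xss \<in> lists (lists Ob)" "ys \<in> lists Ob" "pre \<in> lists (lists Ob)" "post \<in> lists (lists Ob)"
    and "k = length pre" "p = length xss"
  shows "act (map (\<lambda>j. (j, e)) (rev [Suc k ..< Suc (k + p)])) (pre @ xss @ ys # post) =
      ide (concat pre) \<parallel> br e (concat xss) ys \<parallel> ide (concat post)
    \<and> permute (map (\<lambda>j. (j, e)) (rev [Suc k ..< Suc (k + p)])) (pre @ xss @ ys # post) = pre @ ys # xss @ post"
  using assms
proof (induction xss arbitrary: post p rule: rev_induct)
  case Nil
  then show ?case by (simp add: br_Nil)
next
  case (snoc x xss)
  let ?w = "map (\<lambda>j. (j, e)) (rev [Suc k ..< Suc (k + length xss)])"
  have w: "map (\<lambda>j. (j, e)) (rev [Suc k ..< Suc (k + p)]) = (Suc (k + length xss), e) # ?w"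
    using snoc.prems by simp
  have IH: "act ?w (pre @ xss @ ys # x # post) =
      ide (concat pre) \<parallel> br e (concat xss) ys \<parallel> ide (concat (x # post))
    \<and> permute ?w (pre @ xss @ ys # x # post) = pre @ ys # xss @ x # post"
    by (rule snoc.IH) (use snoc.prems in auto)
  have i: "Suc (k + length xss) = Suc (length (pre @ xss))" using snoc.prems by simp
  have s: "swap_at (Suc (k + length xss)) (pre @ xss @ x # ys # post) = pre @ xss @ ys # x # post"
    "cross (Suc (k + length xss), e) (pre @ xss @ x # ys # post) =
       ide (concat (pre @ xss)) \<parallel> br e x ys \<parallel> ide (concat post)"
    using swap_at_split[OF i] cross_split[OF i] by simp_all
  have "act (map (\<lambda>j. (j, e)) (rev [Suc k ..< Suc (k + p)])) (pre @ (xss @ [x]) @ ys # post) =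
    (ide (concat (pre @ xss)) \<parallel> br e x ys \<parallel> ide (concat post)) \<triangleright>
    (ide (concat pre) \<parallel> br e (concat xss) ys \<parallel> ide (concat (x # post)))"
    unfolding w using IH s by simp
  also have "\<dots> = ide (concat pre) \<parallel> br e (concat xss @ x) ys \<parallel> ide (concat post)"
    using snoc.prems by (simp add: hexagon_left whisker_left whisker_right)
  finally show ?case unfolding w using IH s by simp
qed

text \<open>Rows are added one at a time, each moving the next strand of the right ribbon, and
  \<open>hexagon_right\<close> joins them.\<close>

lemma act_block:
  assumes "xss \<in> lists (lists Ob)" "yss \<in> lists (lists Ob)" "pre \<in> lists (lists Ob)" "post \<in> lists (lists Ob)"
    and "k = length pre" "p = length xss" "q = length yss"
  shows "act (block_crossing k p q e) (pre @ xss @ yss @ post) =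
      ide (concat pre) \<parallel> br e (concat xss) (concat yss) \<parallel> ide (concat post)
    \<and> permute (block_crossing k p q e) (pre @ xss @ yss @ post) = pre @ yss @ xss @ post"
  using assms
proof (induction yss arbitrary: post q rule: rev_induct)
  case Nil
  then show ?case by (simp add: br_Nil block_crossing_def)
next
  case (snoc y yss)
  let ?u = "block_crossing k p (length yss) e"
  let ?v = "map (\<lambda>j. (j, e)) (rev [Suc (k + length yss) ..< Suc (k + length yss + p)])"
  have w: "block_crossing k p q e = ?u @ ?v" using snoc.prems block_crossing_Suc by simp
  have IH: "act ?u (pre @ xss @ yss @ [y] @ post) =
      ide (concat pre) \<parallel> br e (concat xss) (concat yss) \<parallel> ide (concat ([y] @ post))
    \<and> permute ?u (pre @ xss @ yss @ [y] @ post) = pre @ yss @ xss @ [y] @ post"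
    by (rule snoc.IH) (use snoc.prems in auto)
  have v: "act ?v ((pre @ yss) @ xss @ y # post) =
      ide (concat (pre @ yss)) \<parallel> br e (concat xss) y \<parallel> ide (concat post)
    \<and> permute ?v ((pre @ yss) @ xss @ y # post) = (pre @ yss) @ y # xss @ post"
    by (rule act_strand) (use snoc.prems in auto)
  have "block_crossing k p q e \<in> braid_words (length (pre @ xss @ (yss @ [y]) @ post))"
    by (rule block_crossing_words) (use snoc.prems in simp)
  then have "act (block_crossing k p q e) (pre @ xss @ (yss @ [y]) @ post) =
      act ?u (pre @ xss @ yss @ [y] @ post) \<triangleright> act ?v (permute ?u (pre @ xss @ yss @ [y] @ post))"
    unfolding w using act_append snoc.prems by simp
  also have "\<dots> = ide (concat pre) \<parallel> br e (concat xss) (concat yss @ y) \<parallel> ide (concat post)"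
    using IH v snoc.prems by (simp add: hexagon_right whisker_left whisker_right)
  finally show ?case using IH v by (simp add: w)
qed

text \<open>A ribbon with labels \<open>x\<close> behaves like one strand with label
  \<open>concat x\<close>, so cabling a word amounts to regrouping labels; an empty group is a
  deleted strand. This is what turns equations between cabled braids into equations between
  interchanges.\<close>

lemma act_cable:
  assumes "w \<in> braid_words (length xsss)" "xsss \<in> lists (lists (lists Ob))" "ns = map length xsss"
  shows "act (cable_word ns w) (concat xsss) = act w (map concat xsss)
    \<and> permute (cable_word ns w) (concat xsss) = concat (permute w xsss)"
  using assms
proof (induction w arbitrary: xsss ns)
  case Nil
  then show ?case by (simp add: concat_concat_map)
next
  case (Cons a w)
  then have "1 \<le> fst a" "fst a < length xsss" by auto
  then obtain pre x y post where *: "xsss = pre @ x # y # post" "fst a = Suc (length pre)"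
    by (elim split_at_letter)
  obtain e where a: "a = (Suc (length pre), e)" using * by (cases a) auto
  let ?u = "block_crossing (length (concat pre)) (length x) (length y) e"
  have s: "swap_at (fst a) ns = map length (swap_at (fst a) xsss)"
    using Cons.prems(3) * by (simp add: map_swap_at)
  have w: "cable_word ns (a # w) = ?u @ cable_word (swap_at (fst a) ns) w"
    unfolding cable_word_Cons using * a Cons.prems(3) by (simp add: nth_append length_concat)
  have cw: "cable_word ns (a # w) \<in> braid_words (length (concat xsss))"
    by (rule cable_word_words) (use Cons.prems in \<open>auto simp: length_concat\<close>)
  have O: "concat pre \<in> lists (lists Ob)" "x \<in> lists (lists Ob)" "y \<in> lists (lists Ob)"
    "concat post \<in> lists (lists Ob)" "concat xsss \<in> lists (lists Ob)"
    using Cons.prems(2) * by (simp_all add: concat_in_lists)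
  have O': "swap_at (fst a) xsss \<in> lists (lists (lists Ob))"
    using Cons.prems(2) * by (auto simp: swap_at_split)
  note u = act_block[OF O(2,3,1,4) HOL.refl HOL.refl HOL.refl, of e]
  have IH: "act (cable_word (swap_at (fst a) ns) w) (concat (swap_at (fst a) xsss)) =
     act w (map concat (swap_at (fst a) xsss)) \<and>
     permute (cable_word (swap_at (fst a) ns) w) (concat (swap_at (fst a) xsss)) =
     concat (permute w (swap_at (fst a) xsss))"
    by (rule Cons.IH[OF _ O' s]) (use Cons.prems in auto)
  have pu: "permute ?u (concat xsss) = concat (swap_at (fst a) xsss)"
    using u * by (simp add: swap_at_split)
  have au: "act ?u (concat xsss) = cross a (map concat xsss)"
    using u * a by (simp add: cross_split concat_concat_map)
  have "act (cable_word ns (a # w)) (concat xsss) =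
      act ?u (concat xsss) \<triangleright> act (cable_word (swap_at (fst a) ns) w) (permute ?u (concat xsss))"
    unfolding w using act_append cw O(5) by (simp add: w)
  also have "\<dots> = act (a # w) (map concat xsss)"
    using IH pu au * by (simp add: map_swap_at)
  finally show ?case using IH pu by (simp add: w)
qed

end

text \<open>The strict form of a 2-fold monoidal structure whose two tensor products agree:
  associators disappear and the four unit laws have empty lists as arguments. Invertibility is added
  to permit the cancellations of the Eckmann--Hilton argument.\<close>

locale strict_interchange = strict_braided +
  fixes E :: "'a list \<Rightarrow> 'a list \<Rightarrow> 'a list \<Rightarrow> 'a list \<Rightarrow> 'b"
  assumes E_typed [simp]: "U \<in> lists Ob \<Longrightarrow> V \<in> lists Ob \<Longrightarrow> W \<in> lists Ob \<Longrightarrow> X \<in> lists Ob \<Longrightarrow>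
      arr (E U V W X) \<and> dom (E U V W X) = U @ V @ W @ X \<and> cod (E U V W X) = U @ W @ V @ X"
    and E_invertible: "U \<in> lists Ob \<Longrightarrow> V \<in> lists Ob \<Longrightarrow> W \<in> lists Ob \<Longrightarrow> X \<in> lists Ob \<Longrightarrow>
      \<exists>g. inverse_pair (E U V W X) g"
    and E_natural: "arr f \<Longrightarrow> arr g \<Longrightarrow> arr h \<Longrightarrow> arr k \<Longrightarrow>
      E (dom f) (dom g) (dom h) (dom k) \<triangleright> (f \<parallel> h \<parallel> g \<parallel> k) =
      (f \<parallel> g \<parallel> h \<parallel> k) \<triangleright> E (cod f) (cod g) (cod h) (cod k)"
    and E_unit: "U \<in> lists Ob \<Longrightarrow> V \<in> lists Ob \<Longrightarrow> E U V [] [] = ide (U @ V)"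
      "U \<in> lists Ob \<Longrightarrow> V \<in> lists Ob \<Longrightarrow> E [] [] U V = ide (U @ V)"
      "U \<in> lists Ob \<Longrightarrow> V \<in> lists Ob \<Longrightarrow> E U [] V [] = ide (U @ V)"
      "U \<in> lists Ob \<Longrightarrow> V \<in> lists Ob \<Longrightarrow> E [] U [] V = ide (U @ V)"
    and E_internal: "U \<in> lists Ob \<Longrightarrow> V \<in> lists Ob \<Longrightarrow> W \<in> lists Ob \<Longrightarrow> X \<in> lists Ob \<Longrightarrow>
      Y \<in> lists Ob \<Longrightarrow> Z \<in> lists Ob \<Longrightarrow>
      (ide (U @ V) \<parallel> E W X Y Z) \<triangleright> E U V (W @ Y) (X @ Z) =
      (E U V W X \<parallel> ide (Y @ Z)) \<triangleright> E (U @ W) (V @ X) Y Z"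
    and E_external: "U \<in> lists Ob \<Longrightarrow> V \<in> lists Ob \<Longrightarrow> W \<in> lists Ob \<Longrightarrow> X \<in> lists Ob \<Longrightarrow>
      Y \<in> lists Ob \<Longrightarrow> Z \<in> lists Ob \<Longrightarrow>
      E U (V @ W) X (Y @ Z) \<triangleright> (ide (U @ X) \<parallel> E V W Y Z) =
      E (U @ V) W (X @ Y) Z \<triangleright> (E U V X Y \<parallel> ide (W @ Z))"
begin

section \<open>The Eckmann--Hilton argument for a strict interchange\<close>

abbreviation "outer U V \<equiv> E U [] [] V"
abbreviation "inner U V \<equiv> E [] U V []"

lemma outer_assoc_aux:
  assumes "B \<in> lists Ob" "C \<in> lists Ob" "D \<in> lists Ob"
  shows "(outer C B \<parallel> ide D) \<triangleright> E C B [] D = outer C (B @ D)"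
  using E_internal[of C "[]" "[]" B "[]" D] assms by (simp add: E_unit)

text \<open>Both sides pass through \<open>E A B [] C\<close>. External associativity writes
  \<open>outer (A @ B) C\<close> as this arrow followed by \<open>outer B C\<close>; internal
  associativity makes \<open>outer A B\<close> followed by it equal to
  \<open>outer A (B @ C)\<close>; naturality then moves \<open>outer B C\<close> to the front. The
  result is the associativity law that \<open>\<lambda>\<^sup>2\<close> must satisfy.\<close>

lemma outer_assoc:
  assumes [simp]: "A \<in> lists Ob" "B \<in> lists Ob" "C \<in> lists Ob"
  shows "(ide A \<parallel> outer B C) \<triangleright> outer A (B @ C) = (outer A B \<parallel> ide C) \<triangleright> outer (A @ B) C"
proof -
  have "(outer A B \<parallel> ide C) \<triangleright> outer (A @ B) C =
      (outer A B \<parallel> ide C) \<triangleright> E A B [] C \<triangleright> (ide A \<parallel> outer B C)"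
    using E_external[of A B "[]" "[]" "[]" C] by (simp add: E_unit)
  also have "\<dots> = ((outer A B \<parallel> ide C) \<triangleright> E A B [] C) \<triangleright> (ide A \<parallel> outer B C)"
    by simp
  also have "\<dots> = outer A (B @ C) \<triangleright> (ide A \<parallel> outer B C)"
    by (simp only: outer_assoc_aux assms)
  also have "\<dots> = (ide A \<parallel> outer B C) \<triangleright> outer A (B @ C)"
    using E_natural[of "ide A" "ide []" "ide []" "outer B C"] by simp
  finally show ?thesis by simp
qed

text \<open>The Eckmann--Hilton argument of Joyal and Street: the interchange is determined by its
  two restrictions \<open>outer\<close> and \<open>inner\<close>, and comparing them gives a braiding \<open>\<beta>\<close>.\<close>

lemma interchange_decomposition:
  assumes [simp]: "A \<in> lists Ob" "B \<in> lists Ob" "C \<in> lists Ob" "D \<in> lists Ob"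
    and [simp]: "arr \<beta>" "dom \<beta> = B @ C" "cod \<beta> = C @ B" and \<beta>: "\<beta> \<triangleright> outer C B = inner B C"
  shows "(outer A B \<parallel> outer C D) \<triangleright> E A B C D = (ide A \<parallel> \<beta> \<parallel> ide D) \<triangleright> outer (A @ C) (B @ D)"
proof -
  \<comment> \<open>Internal associativity is used three times with unit arguments: here to split
    off \<open>A\<close>, in \<open>2\<close> to replace the remaining interchange by
    \<open>inner B C\<close>, and in \<open>3\<close> to reassemble the outer parts.\<close>
  have 1: "(outer A B \<parallel> ide (C @ D)) \<triangleright> E A B C D = (ide A \<parallel> E [] B C D) \<triangleright> E A [] C (B @ D)"
    using E_internal[of A "[]" "[]" B C D] by simp
  have "(ide B \<parallel> outer C D) \<triangleright> E [] B C D = (inner B C \<parallel> ide D) \<triangleright> E C B [] D"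
    using E_internal[of "[]" B C "[]" "[]" D] by simp
  also have "\<dots> = (\<beta> \<parallel> ide D) \<triangleright> (outer C B \<parallel> ide D) \<triangleright> E C B [] D"
    by (simp add: whisker_right flip: \<beta>)
  also have "\<dots> = (\<beta> \<parallel> ide D) \<triangleright> outer C (B @ D)"
    by (simp add: outer_assoc_aux)
  finally have 2: "(ide B \<parallel> outer C D) \<triangleright> E [] B C D = (\<beta> \<parallel> ide D) \<triangleright> outer C (B @ D)" .
  have 3: "(ide A \<parallel> outer C (B @ D)) \<triangleright> E A [] C (B @ D) = outer (A @ C) (B @ D)"
    using E_internal[of A "[]" C "[]" "[]" "B @ D"] by (simp add: E_unit)
  have "(outer A B \<parallel> outer C D) \<triangleright> E A B C D =
      ((ide (A @ B) \<parallel> outer C D) \<triangleright> (outer A B \<parallel> ide (C @ D))) \<triangleright> E A B C D"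
    using tens_exchange(2)[of "outer A B" "outer C D"] by simp
  also have "\<dots> = (ide (A @ B) \<parallel> outer C D) \<triangleright> (ide A \<parallel> E [] B C D) \<triangleright> E A [] C (B @ D)"
    using 1 by simp
  also have "\<dots> = (ide A \<parallel> ((ide B \<parallel> outer C D) \<triangleright> E [] B C D)) \<triangleright> E A [] C (B @ D)"
    by (simp add: whisker_left)
  also have "\<dots> = (ide A \<parallel> \<beta> \<parallel> ide D) \<triangleright> (ide A \<parallel> outer C (B @ D)) \<triangleright> E A [] C (B @ D)"
    unfolding 2 by (simp add: whisker_left)
  finally show ?thesis unfolding 3 .
qed

text \<open>Since \<open>E B [] C []\<close> is trivial, internal associativity writes
  \<open>inner A (B @ C)\<close> through \<open>E B A C []\<close>. The decomposition evaluates that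
  arrow, and the invertible \<open>outer (B @ C) A\<close> is cancelled.\<close>

lemma comparison_hexagon:
  assumes [simp]: "A \<in> lists Ob" "B \<in> lists Ob" "C \<in> lists Ob"
    and \<beta>: "\<And>X Y. X \<in> lists Ob \<Longrightarrow> Y \<in> lists Ob \<Longrightarrow>
      arr (\<beta> X Y) \<and> dom (\<beta> X Y) = X @ Y \<and> cod (\<beta> X Y) = Y @ X \<and> \<beta> X Y \<triangleright> outer Y X = inner X Y"
  shows "\<beta> A (B @ C) = (\<beta> A B \<parallel> ide C) \<triangleright> (ide B \<parallel> \<beta> A C)"
proof -
  obtain g where g: "inverse_pair (outer (B @ C) A) g" using E_invertible by fastforce
  have [simp]: "arr (\<beta> X Y)" "dom (\<beta> X Y) = X @ Y" "cod (\<beta> X Y) = Y @ X"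
    if "X \<in> lists Ob" "Y \<in> lists Ob" for X Y using \<beta>[OF that] by auto
  have "\<beta> A (B @ C) \<triangleright> outer (B @ C) A = inner A (B @ C)" using \<beta> by simp
  also have "\<dots> = (inner A B \<parallel> ide C) \<triangleright> E B A C []"
    using E_internal[of "[]" A B "[]" C "[]"] by (simp add: E_unit)
  also have "\<dots> = ((\<beta> A B \<triangleright> outer B A) \<parallel> ide C) \<triangleright> E B A C []"
    using \<beta>[of A B] by simp
  also have "\<dots> = (\<beta> A B \<parallel> ide C) \<triangleright> (outer B A \<parallel> ide C) \<triangleright> E B A C []"
    by (simp add: whisker_right)
  also have "\<dots> = (\<beta> A B \<parallel> ide C) \<triangleright> (ide B \<parallel> \<beta> A C) \<triangleright> outer (B @ C) A"
    using interchange_decomposition[of B A C "[]" "\<beta> A C"] \<beta>[of A C] by (simp add: E_unit)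
  finally show ?thesis
    using inverse_pair_cancel_right[OF g, of "\<beta> A (B @ C)" "(\<beta> A B \<parallel> ide C) \<triangleright> (ide B \<parallel> \<beta> A C)"] by simp
qed

end

context strict_braided
begin

text \<open>Both associativity laws reduce to the hexagons once crossings of disjoint blocks are
  commuted, which is the fact \<open>*\<close>. Thus the elementary crossings of both signs fit the
  same scheme as \<open>b\<close>.\<close>

lemma strict_interchange_crossing:
  "strict_interchange Ob arr dom cod ide seq tens br (\<lambda>U V W X. ide U \<parallel> br e V W \<parallel> ide X)"
proof unfold_locales
  fix f g h k assume [simp]: "arr f" "arr g" "arr h" "arr k"
  have "(ide (dom f) \<parallel> br e (dom g) (dom h) \<parallel> ide (dom k)) \<triangleright> (f \<parallel> (h \<parallel> g) \<parallel> k) =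
      (f \<parallel> (g \<parallel> h) \<parallel> k) \<triangleright> (ide (cod f) \<parallel> br e (cod g) (cod h) \<parallel> ide (cod k))"
    by (simp add: interchange br_natural del: tens_assoc)
  then show "(ide (dom f) \<parallel> br e (dom g) (dom h) \<parallel> ide (dom k)) \<triangleright> (f \<parallel> h \<parallel> g \<parallel> k) =
      (f \<parallel> g \<parallel> h \<parallel> k) \<triangleright> (ide (cod f) \<parallel> br e (cod g) (cod h) \<parallel> ide (cod k))"
    by simp
next
  fix U V W X assume "U \<in> lists Ob" "V \<in> lists Ob" "W \<in> lists Ob" "X \<in> lists Ob"
  then have "inverse_pair (ide U \<parallel> br e V W \<parallel> ide X) (ide U \<parallel> br (\<not> e) W V \<parallel> ide X)"
    by (intro inverse_pair_tens inverse_pair_ide inverse_pair_br) auto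
  then show "\<exists>g. inverse_pair (ide U \<parallel> br e V W \<parallel> ide X) g" by blast
next
  fix U V W X Y Z assume [simp]: "U \<in> lists Ob" "V \<in> lists Ob" "W \<in> lists Ob" "X \<in> lists Ob" "Y \<in> lists Ob" "Z \<in> lists Ob"
  have *: "(ide (U @ V @ W) \<parallel> br e X Y \<parallel> ide Z) \<triangleright> (ide U \<parallel> br e V W \<parallel> ide (Y @ X @ Z)) =
     (ide U \<parallel> br e V W \<parallel> ide (X @ Y @ Z)) \<triangleright> (ide (U @ W @ V) \<parallel> br e X Y \<parallel> ide Z)"
    if [simp]: "V \<in> lists Ob" "W \<in> lists Ob" "X \<in> lists Ob" "Y \<in> lists Ob" for V W X Y
  proof -
    have "ide U \<parallel> ((ide (V @ W) \<parallel> br e X Y) \<triangleright> (br e V W \<parallel> ide (Y @ X))) \<parallel> ide Z =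
        ide U \<parallel> ((br e V W \<parallel> ide (X @ Y)) \<triangleright> (ide (W @ V) \<parallel> br e X Y)) \<parallel> ide Z"
      using tens_exchange[of "br e V W" "br e X Y"] by simp
    then show ?thesis by (simp add: whisker_left whisker_right)
  qed
  have "(ide (U @ V) \<parallel> ide W \<parallel> br e X Y \<parallel> ide Z) \<triangleright> (ide U \<parallel> br e V (W @ Y) \<parallel> ide (X @ Z)) =
      ((ide (U @ V @ W) \<parallel> br e X Y \<parallel> ide Z) \<triangleright> (ide U \<parallel> br e V W \<parallel> ide (Y @ X @ Z)))
        \<triangleright> (ide (U @ W) \<parallel> br e V Y \<parallel> ide (X @ Z))"
    by (simp add: hexagon_right whisker_left whisker_right)
  also have "\<dots> = (ide U \<parallel> br e V W \<parallel> ide X) \<parallel> ide (Y @ Z) \<triangleright> ide (U @ W) \<parallel> br e (V @ X) Y \<parallel> ide Z"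
    unfolding *[OF \<open>V \<in> lists Ob\<close> \<open>W \<in> lists Ob\<close> \<open>X \<in> lists Ob\<close> \<open>Y \<in> lists Ob\<close>]
    by (simp add: hexagon_left whisker_left whisker_right)
  finally show "(ide (U @ V) \<parallel> ide W \<parallel> br e X Y \<parallel> ide Z) \<triangleright> (ide U \<parallel> br e V (W @ Y) \<parallel> ide (X @ Z)) =
       (ide U \<parallel> br e V W \<parallel> ide X) \<parallel> ide (Y @ Z) \<triangleright> ide (U @ W) \<parallel> br e (V @ X) Y \<parallel> ide Z" .
  have "(ide U \<parallel> br e (V @ W) X \<parallel> ide (Y @ Z)) \<triangleright> (ide (U @ X) \<parallel> ide V \<parallel> br e W Y \<parallel> ide Z) =
      (ide (U @ V) \<parallel> br e W X \<parallel> ide (Y @ Z)) \<triangleright>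
      ((ide U \<parallel> br e V X \<parallel> ide (W @ Y @ Z)) \<triangleright> (ide (U @ X @ V) \<parallel> br e W Y \<parallel> ide Z))"
    by (simp add: hexagon_left whisker_left whisker_right)
  also have "\<dots> = ide (U @ V) \<parallel> br e W (X @ Y) \<parallel> ide Z \<triangleright> (ide U \<parallel> br e V X \<parallel> ide Y) \<parallel> ide (W @ Z)"
    unfolding *[OF \<open>V \<in> lists Ob\<close> \<open>X \<in> lists Ob\<close> \<open>W \<in> lists Ob\<close> \<open>Y \<in> lists Ob\<close>, symmetric]
    by (simp add: hexagon_right whisker_left whisker_right)
  finally show "(ide U \<parallel> br e (V @ W) X \<parallel> ide (Y @ Z)) \<triangleright> (ide (U @ X) \<parallel> ide V \<parallel> br e W Y \<parallel> ide Z) =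
     ide (U @ V) \<parallel> br e W (X @ Y) \<parallel> ide Z \<triangleright> (ide U \<parallel> br e V X \<parallel> ide Y) \<parallel> ide (W @ Z)" .
qed (auto simp: br_Nil)

end

section \<open>Braids on two strands\<close>

definition exponent_sum :: "braid_word \<Rightarrow> int" where
  "exponent_sum w = (\<Sum>a\<leftarrow>w. if snd a then 1 else - 1)"

lemma exponent_sum_simps [simp]:
  "exponent_sum [] = 0"
  "exponent_sum (a # w) = (if snd a then 1 else - 1) + exponent_sum w"
  "exponent_sum (u @ v) = exponent_sum u + exponent_sum v"
  by (simp_all add: exponent_sum_def)

text \<open>The normal form \<open>\<sigma>_1^s\<close>. Zero counts as positive, which is why the
  exponents 0 and -1 need extra care when a letter is added.\<close>

definition power_word :: "int \<Rightarrow> braid_word" where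
  "power_word s = replicate (nat \<bar>s\<bar>) (1, 0 \<le> s)"

lemma power_word_words [simp]: "power_word s \<in> braid_words 2"
  by (simp add: power_word_def braid_words_def)

lemma exponent_sum_power_word [simp]: "exponent_sum (power_word s) = s"
proof -
  have "exponent_sum (replicate n (1, e)) = (if e then int n else - int n)" for n e
    by (induction n) auto
  then show ?thesis by (simp add: power_word_def)
qed

lemma power_word_eq:
  "power_word 0 = []" "power_word 1 = [(1, True)]" "power_word (- 1) = [(1, False)]"
  by (simp_all add: power_word_def)

lemma power_word_step:
  "((1, e) # power_word s, power_word ((if e then 1 else - 1) + s)) \<in> braid_rel 2"
proof -
  consider "e \<longleftrightarrow> 0 \<le> s" | "e" "s < 0" | "\<not> e" "s > 0" | "\<not> e" "s = 0" by linarith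
  then show ?thesis
  proof cases
    case 1
    then have *: "(1, e) # power_word s = power_word ((if e then 1 else - 1) + s)"
    proof (cases e)
      case True
      then have "nat \<bar>1 + s\<bar> = Suc (nat \<bar>s\<bar>)" using 1 by auto
      then show ?thesis using 1 True by (simp add: power_word_def)
    next
      case False
      then have "nat \<bar>- 1 + s\<bar> = Suc (nat \<bar>s\<bar>)" using 1 by auto
      then show ?thesis using 1 False by (simp add: power_word_def)
    qed
    have "(1, e) # power_word s \<in> braid_words 2" by simp
    then show ?thesis unfolding * by (intro braid_rel.refl)
  next
    case 2
    then have "nat \<bar>s\<bar> = Suc (nat \<bar>1 + s\<bar>)" by auto
    then have *: "power_word s = (1, \<not> e) # power_word (1 + s)"
      using 2 by (cases "s = - 1") (auto simp: power_word_def)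
    have "([] @ [(1, e), (1, \<not> e)] @ power_word (1 + s), [] @ power_word (1 + s)) \<in> braid_rel 2"
      by (rule braid_rel.cancel) simp
    then show ?thesis unfolding * using 2 by simp
  next
    case 3
    then have "nat \<bar>s\<bar> = Suc (nat \<bar>- 1 + s\<bar>)" by auto
    then have *: "power_word s = (1, \<not> e) # power_word (- 1 + s)"
      using 3 by (auto simp: power_word_def)
    have "([] @ [(1, e), (1, \<not> e)] @ power_word (- 1 + s), [] @ power_word (- 1 + s)) \<in> braid_rel 2"
      by (rule braid_rel.cancel) simp
    then show ?thesis unfolding * using 3 by simp
  next
    case 4
    have "[(1, False)] \<in> braid_words 2" by simp
    then show ?thesis using 4 by (auto simp: power_word_eq intro: braid_rel.refl)
  qed
qed

text \<open>On two strands the exponent sum decides the braid: a letter put in front changes the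
  exponent of the normal form by one.\<close>

lemma power_word_rel:
  "v \<in> braid_words 2 \<Longrightarrow> (v, power_word (exponent_sum v)) \<in> braid_rel 2"
proof (induction v)
  case Nil
  then show ?case by (auto simp: power_word_eq intro: braid_rel.refl)
next
  case (Cons a v)
  then obtain e where a: "a = (1, e)" by (cases a) auto
  have "([a] @ v @ [], [a] @ power_word (exponent_sum v) @ []) \<in> braid_rel 2"
    by (rule braid_rel_append) (use Cons in auto)
  then show ?case using power_word_step[of e "exponent_sum v"] a
    by (auto intro: braid_rel.trans)
qed

lemma permute_two:
  "v \<in> braid_words 2 \<Longrightarrow> permute v [x, y] = (if even (exponent_sum v) then [x, y] else [y, x])"
proof (induction v arbitrary: x y)
  case (Cons a v)
  then have "fst a = Suc (length [])" by auto
  then have "swap_at (fst a) [x, y] = [y, x]" using swap_at_split[of "fst a" "[]" x y "[]"] by simp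
  then show ?case using Cons by auto
qed simp

context strict_braided
begin

lemma act_two_rel:
  assumes "u \<in> braid_words 2" "v \<in> braid_words 2" "exponent_sum u = exponent_sum v"
    "xs \<in> lists Ob" "ys \<in> lists Ob"
  shows "act u [xs, ys] = act v [xs, ys]"
proof -
  have "(u, v) \<in> braid_rel 2"
    using power_word_rel[OF assms(1)] power_word_rel[OF assms(2)] assms(3)
    by (metis braid_rel.sym braid_rel.trans)
  then show ?thesis using act_braid_rel[of u v 2 "[xs, ys]"] assms by simp
qed

lemma act_single [simp]: "xs \<in> lists Ob \<Longrightarrow> ys \<in> lists Ob \<Longrightarrow> act [(Suc 0, e)] [xs, ys] = br e xs ys"
  using cross_split[of "Suc 0" "[]" e xs ys "[]"] swap_at_split[of "Suc 0" "[]" xs ys "[]"] by simp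

lemma act_middle:
  assumes [simp]: "U \<in> lists Ob" "V \<in> lists Ob" "W \<in> lists Ob" "X \<in> lists Ob"
  shows "act [(2, e)] [U, V, W, X] = ide U \<parallel> br e V W \<parallel> ide X"
  using cross_split[of 2 "[U]" e V W "[X]"] swap_at_split[of 2 "[U]" V W "[X]"] by simp

end

text \<open>The multiplicities \<open>[0,1,1,0]\<close> keep the inner strands and
  \<open>[1,0,0,1]\<close> the outer ones. This is the exponent \<open>p\<close> for which
  \<open>\<sigma>^p\<close> followed by the outer restriction gives the inner one.\<close>

definition comparison_exponent :: "braid_word \<Rightarrow> int" where
  "comparison_exponent w = exponent_sum (cable_word [0,1,1,0] w) - exponent_sum (cable_word [1,0,0,1] w)"

section \<open>The action of an interchanging unital braid\<close>

locale braid_action = strict_braided +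
  fixes b :: braid and w :: braid_word
  assumes b: "interchanging_unital_braid b" and w: "w \<in> b"
begin

lemma w4: "w \<in> braid_words 4" "w \<in> braid_words (length [x, y, z, t])"
  using interchanging_braid_rels[OF b w] by (simp_all add: eval_nat_numeral)

lemma permute_w: "permute w [x, y, z, t] = [x, z, y, t]"
  by (rule permute_transpose_2_3) (use interchanging_braid_rels[OF b w] in auto)

text \<open>Words of one class act equally, so the unknown words in the relations for
  \<open>b\<close> can be traded for the fixed \<open>w\<close>.\<close>

lemma act_b: "u \<in> b \<Longrightarrow> U \<in> lists Ob \<Longrightarrow> V \<in> lists Ob \<Longrightarrow> W \<in> lists Ob \<Longrightarrow> X \<in> lists Ob \<Longrightarrow>
   act u [U, V, W, X] = act w [U, V, W, X]"
  using b w by (intro act_braid_rel[of _ _ 4] braid_class_rel[of b])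
    (auto simp: interchanging_unital_braid_def)

text \<open>The cabled word is any \<open>w'\<close> of the class, but the result is expressed by
  the fixed \<open>w\<close>, so that both sides of a braid equation become interchanges of the same
  family.\<close>

lemma act_w_cable:
  assumes "w' \<in> b" and "xs1 \<in> lists (lists Ob)" "xs2 \<in> lists (lists Ob)" "xs3 \<in> lists (lists Ob)" "xs4 \<in> lists (lists Ob)"
    and "ns = [length xs1, length xs2, length xs3, length xs4]" "m = length (xs1 @ xs2 @ xs3 @ xs4)"
  shows "cable_word ns w' \<in> braid_words m"
    "act (cable_word ns w') (xs1 @ xs2 @ xs3 @ xs4) = act w [concat xs1, concat xs2, concat xs3, concat xs4]"
    "permute (cable_word ns w') (xs1 @ xs2 @ xs3 @ xs4) = xs1 @ xs3 @ xs2 @ xs4"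
proof -
  interpret w': braid_action Ob arr dom cod ide seq tens br b w'
    by unfold_locales (use assms b in auto)
  show "cable_word ns w' \<in> braid_words m"
    by (rule cable_word_words) (use w'.w4(2)[of "length xs1" "length xs2" "length xs3" "length xs4"] assms in auto)
  show "act (cable_word ns w') (xs1 @ xs2 @ xs3 @ xs4) = act w [concat xs1, concat xs2, concat xs3, concat xs4]"
    "permute (cable_word ns w') (xs1 @ xs2 @ xs3 @ xs4) = xs1 @ xs3 @ xs2 @ xs4"
    using act_cable[of w' "[xs1, xs2, xs3, xs4]" ns] w'.w4(2)[of xs1 xs2 xs3 xs4] w'.permute_w[of xs1 xs2 xs3 xs4]
      assms act_b[OF assms(1), of "concat xs1" "concat xs2" "concat xs3" "concat xs4"] by auto
qed

text \<open>Strands that carry an empty group are deleted, so the four unit laws are the four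
  deletion conditions on \<open>b\<close>.\<close>

lemma act_w_unit:
  assumes "xs1 \<in> lists (lists Ob)" "xs2 \<in> lists (lists Ob)" "xs3 \<in> lists (lists Ob)" "xs4 \<in> lists (lists Ob)"
    and "[length xs1, length xs2, length xs3, length xs4] \<in> {[0,0,1,1],[1,1,0,0],[0,1,0,1],[1,0,1,0]}"
  shows "act w [concat xs1, concat xs2, concat xs3, concat xs4] = ide (concat (xs1 @ xs2 @ xs3 @ xs4))"
proof -
  let ?ns = "[length xs1, length xs2, length xs3, length xs4]"
  have "act (cable_word ?ns w) (xs1 @ xs2 @ xs3 @ xs4) = act [] (xs1 @ xs2 @ xs3 @ xs4)"
  proof (rule act_braid_rel)
    show "(cable_word ?ns w, []) \<in> braid_rel 2" using interchanging_braid_rels(5)[OF b w assms(5)] .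
    show "length (xs1 @ xs2 @ xs3 @ xs4) = 2" using assms(5) by auto
  qed (use assms in simp)
  then show ?thesis using act_w_cable(2)[OF w assms(1-4) HOL.refl HOL.refl] by simp
qed

text \<open>Evaluated on six labels \<open>U, V, W, X, Y, Z\<close>, the equation for
  \<open>braid_L\<close> and \<open>braid_R\<close> is internal associativity and the one for
  \<open>braid_L'\<close> and \<open>braid_R'\<close> is external associativity; a doubled strand
  carries two of the labels.\<close>

sublocale strict_interchange Ob arr dom cod ide seq tens br "\<lambda>U V W X. act w [U, V, W, X]"
proof unfold_locales
  fix U V W X assume [simp]: "U \<in> lists Ob" "V \<in> lists Ob" "W \<in> lists Ob" "X \<in> lists Ob"
  show "arr (act w [U, V, W, X]) \<and> dom (act w [U, V, W, X]) = U @ V @ W @ X \<and> cod (act w [U, V, W, X]) = U @ W @ V @ X"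
    using w4(2)[of U V W X] by (simp add: permute_w)
  show "\<exists>g. inverse_pair (act w [U, V, W, X]) g"
    by (rule act_invertible[OF w4(2)]) simp
next
  fix f g h k assume [simp]: "arr f" "arr g" "arr h" "arr k"
  show "act w [dom f, dom g, dom h, dom k] \<triangleright> (f \<parallel> h \<parallel> g \<parallel> k) =
     (f \<parallel> g \<parallel> h \<parallel> k) \<triangleright> act w [cod f, cod g, cod h, cod k]"
    using act_natural[OF w4(2), of f g h k] by (simp add: permute_w)
next
  fix U V assume [simp]: "U \<in> lists Ob" "V \<in> lists Ob"
  show "act w [U, V, [], []] = ide (U @ V)" using act_w_unit[of "[U]" "[V]" "[]" "[]"] by simp
  show "act w [[], [], U, V] = ide (U @ V)" using act_w_unit[of "[]" "[]" "[U]" "[V]"] by simp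
  show "act w [U, [], V, []] = ide (U @ V)" using act_w_unit[of "[U]" "[]" "[V]" "[]"] by simp
  show "act w [[], U, [], V] = ide (U @ V)" using act_w_unit[of "[]" "[U]" "[]" "[V]"] by simp
next
  fix U V W X Y Z assume [simp]: "U \<in> lists Ob" "V \<in> lists Ob" "W \<in> lists Ob" "X \<in> lists Ob" "Y \<in> lists Ob" "Z \<in> lists Ob"
  let ?l = "[U, V, W, X, Y, Z]"
  have O: "?l \<in> lists (lists Ob)" by simp
  obtain u v where uv: "u \<in> b" "v \<in> b"
    and rel: "(w @ cable_word [2,2,1,1] w, shift_word 2 u @ cable_word [1,1,2,2] v) \<in> braid_rel 6"
    using interchanging_braid_rels(3)[OF b w] by blast
  interpret u: braid_action Ob arr dom cod ide seq tens br b u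
    by unfold_locales (use b uv in auto)
  have "act w (?l) = act w [U, V, W, X] \<parallel> ide (Y @ Z)"
    using act_extend[OF w4(2), of U V W X "[Y, Z]"] by simp
  moreover have "permute w ?l = [U, W, V, X, Y, Z]"
    using permute_extend[OF w4(2), of U V W X "[Y, Z]"] permute_w[of U V W X] by simp
  moreover have "act (cable_word [2,2,1,1] w) [U, W, V, X, Y, Z] = act w [U @ W, V @ X, Y, Z]"
    using act_w_cable(2)[OF w, of "[U, W]" "[V, X]" "[Y]" "[Z]"] by (simp add: eval_nat_numeral)
  moreover have "w @ cable_word [2,2,1,1] w \<in> braid_words (length ?l)"
    using braid_rel_words[OF rel] by (simp add: eval_nat_numeral)
  ultimately have 1: "act (w @ cable_word [2,2,1,1] w) ?l =
     (act w [U, V, W, X] \<parallel> ide (Y @ Z)) \<triangleright> act w [U @ W, V @ X, Y, Z]"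
    using act_append[of w "cable_word [2,2,1,1] w" ?l] O by simp
  have "act (shift_word 2 u) ?l = ide (U @ V) \<parallel> act w [W, X, Y, Z]"
    using act_shift[OF u.w4(2), of W X Y Z "[U, V]" 2] act_b[OF uv(1)] by simp
  moreover have "permute (shift_word 2 u) ?l = [U, V, W, Y, X, Z]"
    using permute_shift[OF u.w4(2), of "[U, V]" 2 W X Y Z] u.permute_w[of W X Y Z] by simp
  moreover have "act (cable_word [1,1,2,2] v) [U, V, W, Y, X, Z] = act w [U, V, W @ Y, X @ Z]"
    using act_w_cable(2)[OF uv(2), of "[U]" "[V]" "[W, Y]" "[X, Z]"] by (simp add: eval_nat_numeral)
  moreover have "shift_word 2 u @ cable_word [1,1,2,2] v \<in> braid_words (length ?l)"
    using braid_rel_words[OF rel] by (simp add: eval_nat_numeral)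
  ultimately have 2: "act (shift_word 2 u @ cable_word [1,1,2,2] v) ?l =
     (ide (U @ V) \<parallel> act w [W, X, Y, Z]) \<triangleright> act w [U, V, W @ Y, X @ Z]"
    using act_append[of "shift_word 2 u" "cable_word [1,1,2,2] v" ?l] O by simp
  show "(ide (U @ V) \<parallel> act w [W, X, Y, Z]) \<triangleright> act w [U, V, W @ Y, X @ Z] =
      (act w [U, V, W, X] \<parallel> ide (Y @ Z)) \<triangleright> act w [U @ W, V @ X, Y, Z]"
    using act_braid_rel[OF rel _ O] 1 2 by simp
next
  fix U V W X Y Z assume [simp]: "U \<in> lists Ob" "V \<in> lists Ob" "W \<in> lists Ob" "X \<in> lists Ob" "Y \<in> lists Ob" "Z \<in> lists Ob"
  let ?l = "[U, V, W, X, Y, Z]"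
  have O: "?l \<in> lists (lists Ob)" by simp
  obtain u v where uv: "u \<in> b" "v \<in> b"
    and rel: "(cable_word [1,2,1,2] w @ shift_word 2 w, cable_word [2,1,2,1] u @ v) \<in> braid_rel 6"
    using interchanging_braid_rels(4)[OF b w] by blast
  interpret v: braid_action Ob arr dom cod ide seq tens br b v
    by unfold_locales (use b uv in auto)
  have "act (cable_word [1,2,1,2] w) ?l = act w [U, V @ W, X, Y @ Z]"
    "permute (cable_word [1,2,1,2] w) ?l = [U, X, V, W, Y, Z]"
    using act_w_cable(2,3)[OF w, of "[U]" "[V, W]" "[X]" "[Y, Z]"] by (simp_all add: eval_nat_numeral)
  moreover have "act (shift_word 2 w) [U, X, V, W, Y, Z] = ide (U @ X) \<parallel> act w [V, W, Y, Z]"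
    using act_shift[OF w4(2), of V W Y Z "[U, X]" 2] by simp
  moreover have "cable_word [1,2,1,2] w @ shift_word 2 w \<in> braid_words (length ?l)"
    using braid_rel_words[OF rel] by (simp add: eval_nat_numeral)
  ultimately have 1: "act (cable_word [1,2,1,2] w @ shift_word 2 w) ?l =
     act w [U, V @ W, X, Y @ Z] \<triangleright> (ide (U @ X) \<parallel> act w [V, W, Y, Z])"
    using act_append[of "cable_word [1,2,1,2] w" "shift_word 2 w" ?l] O by simp
  have "act (cable_word [2,1,2,1] u) ?l = act w [U @ V, W, X @ Y, Z]"
    "permute (cable_word [2,1,2,1] u) ?l = [U, V, X, Y, W, Z]"
    using act_w_cable(2,3)[OF uv(1), of "[U, V]" "[W]" "[X, Y]" "[Z]"] by (simp_all add: eval_nat_numeral)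
  moreover have "act v [U, V, X, Y, W, Z] = act w [U, V, X, Y] \<parallel> ide (W @ Z)"
    using act_extend[OF v.w4(2), of U V X Y "[W, Z]"] act_b[OF uv(2)] by simp
  moreover have "cable_word [2,1,2,1] u @ v \<in> braid_words (length ?l)"
    using braid_rel_words[OF rel] by (simp add: eval_nat_numeral)
  ultimately have 2: "act (cable_word [2,1,2,1] u @ v) ?l =
     act w [U @ V, W, X @ Y, Z] \<triangleright> (act w [U, V, X, Y] \<parallel> ide (W @ Z))"
    using act_append[of "cable_word [2,1,2,1] u" v ?l] O by simp
  show "act w [U, V @ W, X, Y @ Z] \<triangleright> (ide (U @ X) \<parallel> act w [V, W, Y, Z]) =
      act w [U @ V, W, X @ Y, Z] \<triangleright> (act w [U, V, X, Y] \<parallel> ide (W @ Z))"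
    using act_braid_rel[OF rel _ O] 1 2 by simp
qed

lemma outer_inner_two:
  assumes "U \<in> lists Ob" "V \<in> lists Ob"
  shows "cable_word [1,0,0,1] w \<in> braid_words 2" "cable_word [0,1,1,0] w \<in> braid_words 2"
    "act w [U, [], [], V] = act (cable_word [1,0,0,1] w) [U, V]"
    "act w [[], U, V, []] = act (cable_word [0,1,1,0] w) [U, V]"
    "permute (cable_word [1,0,0,1] w) [U, V] = [U, V]"
    "permute (cable_word [0,1,1,0] w) [U, V] = [V, U]"
  using act_w_cable[OF w, of "[U]" "[]" "[]" "[V]"] act_w_cable[OF w, of "[]" "[U]" "[V]" "[]"] assms
  by (auto simp: numeral_2_eq_2)

text \<open>Both sides come from words on two strands, and \<open>comparison_exponent\<close> is
  chosen so that their exponent sums agree.\<close>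

lemma comparison:
  assumes "odd (comparison_exponent w)" and [simp]: "U \<in> lists Ob" "V \<in> lists Ob"
  shows "act (power_word (comparison_exponent w)) [U, V] \<triangleright> outer V U = inner U V"
proof -
  let ?p = "power_word (comparison_exponent w)"
  note uv = outer_inner_two[OF assms(2,3)] outer_inner_two[OF assms(3,2)]
  have "permute ?p [U, V] = [V, U]" using permute_two[of ?p U V] assms(1) by simp
  then have "act ?p [U, V] \<triangleright> outer V U = act (?p @ cable_word [1,0,0,1] w) [U, V]"
    using act_append[of ?p "cable_word [1,0,0,1] w" "[U, V]"] uv power_word_words by (simp add: numeral_2_eq_2)
  also have "\<dots> = act (cable_word [0,1,1,0] w) [U, V]"
    by (rule act_two_rel) (use uv in \<open>auto simp: comparison_exponent_def\<close>)
  finally show ?thesis using uv by simp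
qed

text \<open>Distinct labels make the permutation visible: the outer strands keep their order, so
  their exponent is even; the inner strands are exchanged, so theirs is odd.\<close>

lemma comparison_odd:
  assumes "x \<in> Ob" "y \<in> Ob" "x \<noteq> y"
  shows "odd (comparison_exponent w)"
  using outer_inner_two[of "[x]" "[y]"] assms permute_two[of "cable_word [1,0,0,1] w" "[x]" "[y]"]
    permute_two[of "cable_word [0,1,1,0] w" "[x]" "[y]"]
  by (auto simp: comparison_exponent_def split: if_splits)

lemma comparison_hexagon_power:
  assumes "odd (comparison_exponent w)" and [simp]: "A \<in> lists Ob" "B \<in> lists Ob" "C \<in> lists Ob"
  defines "\<beta> \<equiv> \<lambda>X Y. act (power_word (comparison_exponent w)) [X, Y]"
  shows "\<beta> A (B @ C) = (\<beta> A B \<parallel> ide C) \<triangleright> (ide B \<parallel> \<beta> A C)"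
proof (rule comparison_hexagon)
  fix X Y assume [simp]: "X \<in> lists Ob" "Y \<in> lists Ob"
  show "arr (\<beta> X Y) \<and> dom (\<beta> X Y) = X @ Y \<and> cod (\<beta> X Y) = Y @ X \<and> \<beta> X Y \<triangleright> outer Y X = inner X Y"
    using comparison[OF assms(1), of X Y] permute_two[of "power_word (comparison_exponent w)" X Y] assms(1) power_word_words
    unfolding \<beta>_def by (simp add: numeral_2_eq_2)
qed simp_all

text \<open>For these two exponents the comparison arrow is a single crossing of the matching sign,
  so the decomposition compares \<open>w\<close> with an elementary crossing.\<close>

lemma interchange_comparison:
  assumes "(comparison_exponent w) = 1 \<or> (comparison_exponent w) = - 1"
    and "A \<in> lists Ob" "B \<in> lists Ob" "C \<in> lists Ob" "D \<in> lists Ob"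
  shows "(outer A B \<parallel> outer C D) \<triangleright> act w [A, B, C, D] =
    (ide A \<parallel> br ((comparison_exponent w) = 1) B C \<parallel> ide D) \<triangleright> outer (A @ C) (B @ D)"
proof (rule interchange_decomposition)
  show "br ((comparison_exponent w) = 1) B C \<triangleright> outer C B = inner B C"
    using assms(1) comparison[of B C] assms(3,4)
    by (elim disjE) (simp_all add: power_word_eq del: act.simps)
qed (use assms in auto)

end

text \<open>Typing side conditions are stated with membership in \<open>lists\<close>, which must not be unfolded.\<close>

declare in_listsI [rule del] in_listsD [rule del]

section \<open>The strictification of a braided category\<close>

context category
begin

lemma in_homset: "f \<in> Arr C \<Longrightarrow> f \<in> homset C (Dom C f) (Cod C f)"
  by (auto simp: homset_def)

lemma Dom_Obj [simp]: "f \<in> Arr C \<Longrightarrow> Dom C f \<in> Obj C"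
  and Cod_Obj [simp]: "f \<in> Arr C \<Longrightarrow> Cod C f \<in> Obj C"
  using Dom_in Cod_in by auto

lemma Ident_typed [simp]:
  assumes "A \<in> Obj C"
  shows "Ident C A \<in> Arr C" "Dom C (Ident C A) = A" "Cod C (Ident C A) = A"
  using Ident_in[OF assms] by (auto simp: homset_def)

lemma Comp_typed [simp]:
  assumes "f \<in> Arr C" "g \<in> Arr C" "Cod C f = Dom C g"
  shows "g \<cdot> f \<in> Arr C" "Dom C (g \<cdot> f) = Dom C f" "Cod C (g \<cdot> f) = Cod C g"
  using Comp_in[of f "Dom C f" "Cod C f" g "Cod C g"] assms by (auto simp: homset_def)

lemma Comp_Ident' [simp]: "f \<in> Arr C \<Longrightarrow> Dom C f = A \<Longrightarrow> f \<cdot> Ident C A = f"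
  and Ident_Comp' [simp]: "f \<in> Arr C \<Longrightarrow> Cod C f = A \<Longrightarrow> Ident C A \<cdot> f = f"
  using Comp_Ident Ident_Comp by (auto simp: homset_def)

lemma Comp_assoc' [simp]:
  "f \<in> Arr C \<Longrightarrow> g \<in> Arr C \<Longrightarrow> h \<in> Arr C \<Longrightarrow> Cod C f = Dom C g \<Longrightarrow> Cod C g = Dom C h \<Longrightarrow>
    (h \<cdot> g) \<cdot> f = h \<cdot> (g \<cdot> f)"
  using Comp_assoc by (auto simp: homset_def)

lemma Comp_tail:
  "g \<cdot> f = k \<Longrightarrow> f \<in> Arr C \<Longrightarrow> g \<in> Arr C \<Longrightarrow> r \<in> Arr C \<Longrightarrow> Cod C f = Dom C g \<Longrightarrow> Cod C r = Dom C f \<Longrightarrow>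
    g \<cdot> f \<cdot> r = k \<cdot> r"
  by (simp flip: Comp_assoc')

lemma inverse_arrows_unique:
  assumes "inverse_arrows C f g" "inverse_arrows C f h"
  shows "g = h"
proof -
  have *: "f \<in> Arr C" "g \<in> Arr C" "h \<in> Arr C" "Dom C g = Cod C f" "Cod C g = Dom C f"
    "Dom C h = Cod C f" "Cod C h = Dom C f" "f \<cdot> g = Ident C (Cod C f)" "h \<cdot> f = Ident C (Dom C f)"
    using assms by (auto simp: inverse_arrows_def homset_def)
  have "h \<cdot> f \<cdot> g = (h \<cdot> f) \<cdot> g" using * by (subst Comp_assoc') auto
  then show ?thesis using * by simp
qed

lemma inverse_arrows_sym: "inverse_arrows C f g \<Longrightarrow> inverse_arrows C g f"
  by (auto simp: inverse_arrows_def homset_def)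

lemma arrow_inv_eq: "inverse_arrows C f g \<Longrightarrow> arrow_inv C f = g"
  unfolding arrow_inv_def using inverse_arrows_unique by blast

lemma inverse_arrow_inv: "iso_arrow C f \<Longrightarrow> inverse_arrows C f (arrow_inv C f)"
  unfolding iso_arrow_def using arrow_inv_eq by fastforce

lemma iso_arrowD:
  assumes "iso_arrow C f"
  shows "f \<in> Arr C" "arrow_inv C f \<in> Arr C" "Dom C (arrow_inv C f) = Cod C f"
    "Cod C (arrow_inv C f) = Dom C f" "arrow_inv C f \<cdot> f = Ident C (Dom C f)"
    "f \<cdot> arrow_inv C f = Ident C (Cod C f)" "iso_arrow C (arrow_inv C f)"
  using inverse_arrow_inv[OF assms] inverse_arrows_sym[OF inverse_arrow_inv[OF assms]]
  by (auto simp: inverse_arrows_def homset_def iso_arrow_def)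

lemma iso_arrowI:
  assumes "f \<in> Arr C" "g \<in> Arr C" "Dom C g = Cod C f" "Cod C g = Dom C f"
    "g \<cdot> f = Ident C (Dom C f)" "f \<cdot> g = Ident C (Cod C f)"
  shows "iso_arrow C f"
  using assms by (auto simp: inverse_arrows_def homset_def iso_arrow_def)

lemma inv_Comp_tail:
  assumes "iso_arrow C f"
  shows "r \<in> Arr C \<Longrightarrow> Cod C r = Dom C f \<Longrightarrow> arrow_inv C f \<cdot> f \<cdot> r = r"
    and "r \<in> Arr C \<Longrightarrow> Cod C r = Cod C f \<Longrightarrow> f \<cdot> arrow_inv C f \<cdot> r = r"
  using iso_arrowD[OF assms] by (simp_all flip: Comp_assoc')

lemma iso_Ident [simp]: "A \<in> Obj C \<Longrightarrow> iso_arrow C (Ident C A)"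
  by (rule iso_arrowI[of _ "Ident C A"]) auto

lemma iso_Comp:
  assumes "iso_arrow C f" "iso_arrow C g" "Cod C f = Dom C g"
  shows "iso_arrow C (g \<cdot> f)"
  by (rule iso_arrowI[of _ "arrow_inv C f \<cdot> arrow_inv C g"])
    (use assms iso_arrowD[OF assms(1)] iso_arrowD[OF assms(2)] in
      \<open>simp_all add: inv_Comp_tail[OF assms(1)] inv_Comp_tail[OF assms(2)]\<close>)

lemma iso_epi:
  assumes "iso_arrow C f" "g \<in> Arr C" "h \<in> Arr C" "Dom C g = Cod C f" "Dom C h = Cod C f" "g \<cdot> f = h \<cdot> f"
  shows "g = h"
proof -
  note f = iso_arrowD[OF assms(1)]
  have "g = (g \<cdot> f) \<cdot> arrow_inv C f" using f assms(2,4) by simp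
  also have "\<dots> = h" unfolding assms(6) using f assms(3,5) by simp
  finally show ?thesis .
qed

lemma iso_mono:
  assumes "iso_arrow C f" "g \<in> Arr C" "h \<in> Arr C" "Cod C g = Dom C f" "Cod C h = Dom C f" "f \<cdot> g = f \<cdot> h"
  shows "g = h"
proof -
  have "g = arrow_inv C f \<cdot> f \<cdot> h" using inv_Comp_tail(1)[OF assms(1,2,4)] assms(6) by simp
  also have "\<dots> = h" using inv_Comp_tail(1)[OF assms(1,3,5)] .
  finally show ?thesis .
qed

lemma iso_idempotent:
  assumes "iso_arrow C f" "f \<cdot> f = f" "Cod C f = Dom C f"
  shows "f = Ident C (Dom C f)"
  by (rule iso_mono[OF assms(1)]) (use assms iso_arrowD[OF assms(1)] in auto)

end

section \<open>Coherence for products of lists\<close>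

context monoidal
begin

abbreviation tensor_Obj (infixr "\<diamondop>" 70) where "A \<diamondop> B \<equiv> TObj T A B"
abbreviation tensor_Arr (infixr "\<boxtimes>" 70) where "f \<boxtimes> g \<equiv> TArr T f g"
abbreviation \<alpha> where "\<alpha> \<equiv> Assoc T"

declare TObj_in [simp] unit_in [simp] unit_Obj [simp] unit_Arr [simp] triangle [simp]

lemma TArr_typed [simp]:
  assumes "f \<in> Arr C" "g \<in> Arr C"
  shows "f \<boxtimes> g \<in> Arr C" "Dom C (f \<boxtimes> g) = Dom C f \<diamondop> Dom C g" "Cod C (f \<boxtimes> g) = Cod C f \<diamondop> Cod C g"
  using TArr_in[OF in_homset[OF assms(1)] in_homset[OF assms(2)]] by (auto simp: homset_def)

lemma TArr_Ident' [simp]: "A \<in> Obj C \<Longrightarrow> B \<in> Obj C \<Longrightarrow> Ident C A \<boxtimes> Ident C B = Ident C (A \<diamondop> B)"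
  by (rule TArr_Ident)

lemma TArr_Comp':
  "f \<in> Arr C \<Longrightarrow> f' \<in> Arr C \<Longrightarrow> g \<in> Arr C \<Longrightarrow> g' \<in> Arr C \<Longrightarrow> Cod C f = Dom C f' \<Longrightarrow> Cod C g = Dom C g' \<Longrightarrow>
    (f' \<boxtimes> g') \<cdot> (f \<boxtimes> g) = (f' \<cdot> f) \<boxtimes> (g' \<cdot> g)"
  using TArr_Comp[of f "Dom C f" "Cod C f" f' "Cod C f'" g "Dom C g" "Cod C g" g' "Cod C g'"]
  by (auto simp: homset_def)

lemma TArr_Comp_tail:
  "f \<in> Arr C \<Longrightarrow> f' \<in> Arr C \<Longrightarrow> g \<in> Arr C \<Longrightarrow> g' \<in> Arr C \<Longrightarrow> Cod C f = Dom C f' \<Longrightarrow> Cod C g = Dom C g' \<Longrightarrow>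
    r \<in> Arr C \<Longrightarrow> Cod C r = Dom C f \<diamondop> Dom C g \<Longrightarrow>
    (f' \<boxtimes> g') \<cdot> (f \<boxtimes> g) \<cdot> r = ((f' \<cdot> f) \<boxtimes> (g' \<cdot> g)) \<cdot> r"
  by (rule Comp_tail) (simp_all add: TArr_Comp')

lemma Assoc_typed [simp]:
  assumes "A \<in> Obj C" "B \<in> Obj C" "D \<in> Obj C"
  shows "\<alpha> A B D \<in> Arr C" "Dom C (\<alpha> A B D) = (A \<diamondop> B) \<diamondop> D" "Cod C (\<alpha> A B D) = A \<diamondop> B \<diamondop> D"
  using Assoc_in[OF assms] by (auto simp: homset_def)

lemma Assoc_natural':
  "f \<in> Arr C \<Longrightarrow> g \<in> Arr C \<Longrightarrow> h \<in> Arr C \<Longrightarrow>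
    \<alpha> (Cod C f) (Cod C g) (Cod C h) \<cdot> ((f \<boxtimes> g) \<boxtimes> h) =
    (f \<boxtimes> g \<boxtimes> h) \<cdot> \<alpha> (Dom C f) (Dom C g) (Dom C h)"
  by (rule Assoc_natural) (auto simp: homset_def)

lemma Assoc_natural_eq:
  assumes "f \<in> homset C A A'" "g \<in> homset C B B'" "h \<in> homset C D D'" "r \<in> Arr C" "Cod C r = (A \<diamondop> B) \<diamondop> D"
  shows "\<alpha> A' B' D' \<cdot> ((f \<boxtimes> g) \<boxtimes> h) \<cdot> r = (f \<boxtimes> g \<boxtimes> h) \<cdot> \<alpha> A B D \<cdot> r"
proof -
  have *: "f \<in> Arr C" "Dom C f = A" "Cod C f = A'" "g \<in> Arr C" "Dom C g = B" "Cod C g = B'"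
    "h \<in> Arr C" "Dom C h = D" "Cod C h = D'" using assms by (auto simp: homset_def)
  have [simp]: "A \<in> Obj C" "A' \<in> Obj C" "B \<in> Obj C" "B' \<in> Obj C" "D \<in> Obj C" "D' \<in> Obj C"
    using * by auto
  show ?thesis
    using Comp_tail[OF Assoc_natural[OF assms(1-3)], of r] assms(4,5) * by simp
qed

lemma iso_TArr:
  assumes "iso_arrow C f" "iso_arrow C g"
  shows "iso_arrow C (f \<boxtimes> g)"
  by (rule iso_arrowI[of _ "arrow_inv C f \<boxtimes> arrow_inv C g"])
    (use iso_arrowD[OF assms(1)] iso_arrowD[OF assms(2)] in \<open>simp_all add: TArr_Comp'\<close>)

text \<open>With the triangle axiom, the pentagon at \<open>I, I, A, B\<close> says that this
  associator is its own square, and an idempotent isomorphism is an identity.\<close>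

lemma Assoc_unit_left [simp]:
  assumes "A \<in> Obj C" "B \<in> Obj C"
  shows "\<alpha> I A B = Ident C (A \<diamondop> B)"
  using pentagon[of I I A B] iso_idempotent[OF Assoc_iso[of I A B]] assms by simp

lemma Assoc_unit_right [simp]:
  assumes "A \<in> Obj C" "B \<in> Obj C"
  shows "\<alpha> A B I = Ident C (A \<diamondop> B)"
  using pentagon[of A B I I] iso_idempotent[OF Assoc_iso[of A B I]] assms by simp

fun tensor_list :: "'o list \<Rightarrow> 'o" where
  "tensor_list [] = I"
| "tensor_list (x # xs) = x \<diamondop> tensor_list xs"

fun merge :: "'o list \<Rightarrow> 'o list \<Rightarrow> 'a" where
  "merge [] ys = Ident C (tensor_list ys)"
| "merge (x # xs) ys = (Ident C x \<boxtimes> merge xs ys) \<cdot> \<alpha> x (tensor_list xs) (tensor_list ys)"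

lemma tensor_list_Obj [simp]: "xs \<in> lists (Obj C) \<Longrightarrow> tensor_list xs \<in> Obj C"
  by (induction xs) auto

lemma merge_typed [simp]:
  assumes "xs \<in> lists (Obj C)" "ys \<in> lists (Obj C)"
  shows "merge xs ys \<in> Arr C" "Dom C (merge xs ys) = tensor_list xs \<diamondop> tensor_list ys"
    "Cod C (merge xs ys) = tensor_list (xs @ ys)"
  using assms by (induction xs) auto

lemma iso_merge [simp]:
  "xs \<in> lists (Obj C) \<Longrightarrow> ys \<in> lists (Obj C) \<Longrightarrow> iso_arrow C (merge xs ys)"
  by (induction xs) (auto intro!: iso_Comp iso_TArr Assoc_iso)

lemma merge_Nil [simp]: "xs \<in> lists (Obj C) \<Longrightarrow> merge xs [] = Ident C (tensor_list xs)"
  by (induction xs) auto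

text \<open>An instance of coherence, by induction from the pentagon and the naturality of the
  associator. It is the reason why the tensor of strict arrows is strictly associative.\<close>

lemma merge_assoc:
  assumes "xs \<in> lists (Obj C)" "ys \<in> lists (Obj C)" "zs \<in> lists (Obj C)"
  shows "merge xs (ys @ zs) \<cdot> (Ident C (tensor_list xs) \<boxtimes> merge ys zs) \<cdot> \<alpha> (tensor_list xs) (tensor_list ys) (tensor_list zs) =
    merge (xs @ ys) zs \<cdot> (merge xs ys \<boxtimes> Ident C (tensor_list zs))"
  using assms
proof (induction xs)
  case (Cons x xs)
  let ?X = "tensor_list xs" and ?Y = "tensor_list ys" and ?Z = "tensor_list zs" and ?i = "Ident C"
  have [simp]: "x \<in> Obj C" "xs \<in> lists (Obj C)" "ys \<in> lists (Obj C)" "zs \<in> lists (Obj C)"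
    using Cons by simp_all
  have "merge (x # xs) (ys @ zs) \<cdot> (?i (tensor_list (x # xs)) \<boxtimes> merge ys zs) \<cdot> \<alpha> (tensor_list (x # xs)) ?Y ?Z =
     (?i x \<boxtimes> merge xs (ys @ zs)) \<cdot> \<alpha> x ?X (tensor_list (ys @ zs)) \<cdot> ((?i x \<boxtimes> ?i ?X) \<boxtimes> merge ys zs) \<cdot> \<alpha> (x \<diamondop> ?X) ?Y ?Z"
    by simp
  also have "\<dots> = (?i x \<boxtimes> merge xs (ys @ zs)) \<cdot> (?i x \<boxtimes> ?i ?X \<boxtimes> merge ys zs) \<cdot> \<alpha> x ?X (?Y \<diamondop> ?Z) \<cdot> \<alpha> (x \<diamondop> ?X) ?Y ?Z"
    by (subst Assoc_natural_eq) (auto simp: homset_def)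
  also have "\<alpha> x ?X (?Y \<diamondop> ?Z) \<cdot> \<alpha> (x \<diamondop> ?X) ?Y ?Z = (?i x \<boxtimes> \<alpha> ?X ?Y ?Z) \<cdot> \<alpha> x (?X \<diamondop> ?Y) ?Z \<cdot> (\<alpha> x ?X ?Y \<boxtimes> ?i ?Z)"
    by (rule pentagon) auto
  also have "(?i x \<boxtimes> merge xs (ys @ zs)) \<cdot> (?i x \<boxtimes> ?i ?X \<boxtimes> merge ys zs) \<cdot> (?i x \<boxtimes> \<alpha> ?X ?Y ?Z) \<cdot> \<alpha> x (?X \<diamondop> ?Y) ?Z \<cdot> (\<alpha> x ?X ?Y \<boxtimes> ?i ?Z) =
     (?i x \<boxtimes> (merge xs (ys @ zs) \<cdot> (?i ?X \<boxtimes> merge ys zs) \<cdot> \<alpha> ?X ?Y ?Z)) \<cdot> \<alpha> x (?X \<diamondop> ?Y) ?Z \<cdot> (\<alpha> x ?X ?Y \<boxtimes> ?i ?Z)"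
    by (simp add: TArr_Comp_tail)
  also have "\<dots> = (?i x \<boxtimes> (merge (xs @ ys) zs \<cdot> (merge xs ys \<boxtimes> ?i ?Z))) \<cdot> \<alpha> x (?X \<diamondop> ?Y) ?Z \<cdot> (\<alpha> x ?X ?Y \<boxtimes> ?i ?Z)"
    using Cons.IH by simp
  also have "\<dots> = (?i x \<boxtimes> merge (xs @ ys) zs) \<cdot> (?i x \<boxtimes> merge xs ys \<boxtimes> ?i ?Z) \<cdot> \<alpha> x (?X \<diamondop> ?Y) ?Z \<cdot> (\<alpha> x ?X ?Y \<boxtimes> ?i ?Z)"
    by (simp add: TArr_Comp_tail)
  also have "\<dots> = (?i x \<boxtimes> merge (xs @ ys) zs) \<cdot> \<alpha> x (tensor_list (xs @ ys)) ?Z \<cdot> ((?i x \<boxtimes> merge xs ys) \<boxtimes> ?i ?Z) \<cdot> (\<alpha> x ?X ?Y \<boxtimes> ?i ?Z)"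
    by (subst Assoc_natural_eq) (auto simp: homset_def)
  also have "\<dots> = merge ((x # xs) @ ys) zs \<cdot> (merge (x # xs) ys \<boxtimes> ?i ?Z)"
    by (simp add: TArr_Comp')
  finally show ?case .
qed simp

end

text \<open>The two lists belong to the arrow because different lists may have the same product;
  composability in the strictification refers to the lists.\<close>

datatype ('o, 'a) strict_arrow = SArr (sdom: "'o list") (sval: 'a) (scod: "'o list")

context monoidal
begin

definition sarr :: "('o, 'a) strict_arrow \<Rightarrow> bool" where
  "sarr f \<longleftrightarrow> sdom f \<in> lists (Obj C) \<and> scod f \<in> lists (Obj C) \<and>
    sval f \<in> Arr C \<and> Dom C (sval f) = tensor_list (sdom f) \<and> Cod C (sval f) = tensor_list (scod f)"

definition sid :: "'o list \<Rightarrow> ('o, 'a) strict_arrow" where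
  "sid xs = SArr xs (Ident C (tensor_list xs)) xs"

definition sseq :: "('o, 'a) strict_arrow \<Rightarrow> ('o, 'a) strict_arrow \<Rightarrow> ('o, 'a) strict_arrow" (infixr "\<triangleright>" 55) where
  "f \<triangleright> g = SArr (sdom f) (sval g \<cdot> sval f) (scod g)"

definition stens :: "('o, 'a) strict_arrow \<Rightarrow> ('o, 'a) strict_arrow \<Rightarrow> ('o, 'a) strict_arrow" (infixr "\<parallel>" 60) where
  "f \<parallel> g = SArr (sdom f @ sdom g)
     (merge (scod f) (scod g) \<cdot> (sval f \<boxtimes> sval g) \<cdot> arrow_inv C (merge (sdom f) (sdom g))) (scod f @ scod g)"

lemma sarrD [simp]:
  assumes "sarr f"
  shows "sdom f \<in> lists (Obj C)" "scod f \<in> lists (Obj C)"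
    "sval f \<in> Arr C" "Dom C (sval f) = tensor_list (sdom f)" "Cod C (sval f) = tensor_list (scod f)"
  using assms by (auto simp: sarr_def)

lemma s_sel [simp]:
  "sdom (sid xs) = xs" "scod (sid xs) = xs" "sval (sid xs) = Ident C (tensor_list xs)"
  "sdom (f \<triangleright> g) = sdom f" "scod (f \<triangleright> g) = scod g" "sval (f \<triangleright> g) = sval g \<cdot> sval f"
  "sdom (f \<parallel> g) = sdom f @ sdom g" "scod (f \<parallel> g) = scod f @ scod g"
  by (simp_all add: sid_def sseq_def stens_def)

lemmas merge_inv_typed [simp] = iso_arrowD[OF iso_merge]

lemma sarr_sid [simp]: "xs \<in> lists (Obj C) \<Longrightarrow> sarr (sid xs)"
  unfolding sarr_def[of "sid xs"] by simp

lemma sarr_sseq [simp]: "sarr f \<Longrightarrow> sarr g \<Longrightarrow> scod f = sdom g \<Longrightarrow> sarr (f \<triangleright> g)"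
  unfolding sarr_def[of "f \<triangleright> g"] by simp

lemma sarr_stens [simp]: "sarr f \<Longrightarrow> sarr g \<Longrightarrow> sarr (f \<parallel> g)"
  unfolding sarr_def[of "f \<parallel> g"] by (simp add: stens_def)

lemma stens_merge:
  "sarr f \<Longrightarrow> sarr g \<Longrightarrow> xs = sdom f \<Longrightarrow> ys = sdom g \<Longrightarrow>
    sval (f \<parallel> g) \<cdot> merge xs ys = merge (scod f) (scod g) \<cdot> (sval f \<boxtimes> sval g)"
  by (simp add: stens_def)

lemma stens_merge_tail:
  "sarr f \<Longrightarrow> sarr g \<Longrightarrow> xs = sdom f \<Longrightarrow> ys = sdom g \<Longrightarrow> r \<in> Arr C \<Longrightarrow> Cod C r = tensor_list xs \<diamondop> tensor_list ys \<Longrightarrow>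
    sval (f \<parallel> g) \<cdot> merge xs ys \<cdot> r = merge (scod f) (scod g) \<cdot> (sval f \<boxtimes> sval g) \<cdot> r"
  using Comp_tail[OF stens_merge[of f g xs ys], of r] by simp

lemma strict_arrow_eqI:
  "sdom f = sdom g \<Longrightarrow> scod f = scod g \<Longrightarrow> sval f = sval g \<Longrightarrow> f = g"
  by (cases f; cases g) auto

text \<open>Strict tensors and crossings are defined with inverse merges. Precomposing both sides
  with a merge \<open>m\<close> absorbs these, and invertibility of \<open>m\<close> allows it to be
  removed again.\<close>

lemma strict_eqI:
  assumes "sarr f" "sarr g" "sdom f = sdom g" "scod f = scod g"
    and "iso_arrow C m" "Cod C m = tensor_list (sdom f)" "sval f \<cdot> m = sval g \<cdot> m"
  shows "f = g"
  by (rule strict_arrow_eqI) (use assms iso_epi[OF assms(5), of "sval f" "sval g"] in auto)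

text \<open>After precomposition with a triple merge, \<open>merge_assoc\<close> on the target
  passes from one bracketing to the other, naturality of the associator moves it through the three
  arrows, and \<open>merge_assoc\<close> on the source returns to the triple merge.\<close>

lemma stens_assoc:
  assumes [simp]: "sarr f" "sarr g" "sarr h"
  shows "(f \<parallel> g) \<parallel> h = f \<parallel> g \<parallel> h"
proof (rule strict_eqI)
  let ?m = "\<lambda>x y z. merge (x @ y) z \<cdot> (merge x y \<boxtimes> Ident C (tensor_list z))"
  let ?P = tensor_list
  show "iso_arrow C (?m (sdom f) (sdom g) (sdom h))"
    by (intro iso_Comp iso_TArr) auto
  have "sval ((f \<parallel> g) \<parallel> h) \<cdot> ?m (sdom f) (sdom g) (sdom h) =
      merge (scod f @ scod g) (scod h) \<cdot> (sval (f \<parallel> g) \<boxtimes> sval h) \<cdot> (merge (sdom f) (sdom g) \<boxtimes> Ident C (?P (sdom h)))"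
    by (simp add: stens_merge_tail)
  also have "\<dots> = merge (scod f @ scod g) (scod h) \<cdot> ((merge (scod f) (scod g) \<cdot> (sval f \<boxtimes> sval g)) \<boxtimes> sval h)"
    by (simp add: TArr_Comp' stens_merge)
  also have "\<dots> = ?m (scod f) (scod g) (scod h) \<cdot> ((sval f \<boxtimes> sval g) \<boxtimes> sval h)"
    by (simp add: TArr_Comp')
  also have "\<dots> = (merge (scod f) (scod g @ scod h) \<cdot> (Ident C (?P (scod f)) \<boxtimes> merge (scod g) (scod h)) \<cdot>
      \<alpha> (?P (scod f)) (?P (scod g)) (?P (scod h))) \<cdot> ((sval f \<boxtimes> sval g) \<boxtimes> sval h)"
    by (subst merge_assoc) auto
  also have "\<dots> = merge (scod f) (scod g @ scod h) \<cdot> (Ident C (?P (scod f)) \<boxtimes> merge (scod g) (scod h)) \<cdot>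
      (sval f \<boxtimes> sval g \<boxtimes> sval h) \<cdot> \<alpha> (?P (sdom f)) (?P (sdom g)) (?P (sdom h))"
    using Assoc_natural'[of "sval f" "sval g" "sval h"] by simp
  also have "\<dots> = merge (scod f) (scod g @ scod h) \<cdot> (sval f \<boxtimes> (merge (scod g) (scod h) \<cdot> (sval g \<boxtimes> sval h)))
      \<cdot> \<alpha> (?P (sdom f)) (?P (sdom g)) (?P (sdom h))"
    by (simp add: TArr_Comp_tail)
  also have "\<dots> = sval (f \<parallel> g \<parallel> h) \<cdot> merge (sdom f) (sdom g @ sdom h) \<cdot> (Ident C (?P (sdom f)) \<boxtimes> merge (sdom g) (sdom h)) \<cdot>
      \<alpha> (?P (sdom f)) (?P (sdom g)) (?P (sdom h))"
    by (simp add: stens_merge_tail TArr_Comp_tail stens_merge)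
  also have "\<dots> = sval (f \<parallel> g \<parallel> h) \<cdot> ?m (sdom f) (sdom g) (sdom h)"
    by (subst merge_assoc) auto
  finally show "sval ((f \<parallel> g) \<parallel> h) \<cdot> ?m (sdom f) (sdom g) (sdom h) = sval (f \<parallel> g \<parallel> h) \<cdot> ?m (sdom f) (sdom g) (sdom h)" .
qed simp_all

lemma sid_stens [simp]:
  assumes "xs \<in> lists (Obj C)" "ys \<in> lists (Obj C)"
  shows "sid xs \<parallel> sid ys = sid (xs @ ys)"
  using assms by (intro strict_arrow_eqI) (simp_all add: stens_def)

lemma arrow_inv_Ident [simp]: "A \<in> Obj C \<Longrightarrow> arrow_inv C (Ident C A) = Ident C A"
  by (rule arrow_inv_eq) (auto simp: inverse_arrows_def homset_def)

lemma stens_Nil [simp]: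
  assumes "sarr f"
  shows "sid [] \<parallel> f = f" "f \<parallel> sid [] = f"
  using assms by (auto intro!: strict_arrow_eqI simp: stens_def)

lemma s_interchange:
  assumes [simp]: "sarr f" "sarr g" "sarr h" "sarr k" "scod f = sdom g" "scod h = sdom k"
  shows "(f \<parallel> h) \<triangleright> (g \<parallel> k) = (f \<triangleright> g) \<parallel> (h \<triangleright> k)"
proof (rule strict_eqI)
  show "iso_arrow C (merge (sdom f) (sdom h))" by simp
  show "sval ((f \<parallel> h) \<triangleright> (g \<parallel> k)) \<cdot> merge (sdom f) (sdom h) = sval ((f \<triangleright> g) \<parallel> (h \<triangleright> k)) \<cdot> merge (sdom f) (sdom h)"
    by (simp add: stens_merge stens_merge_tail TArr_Comp')
qed simp_all

end

context braided_category
begin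

abbreviation tensor_Obj' (infixr "\<diamondop>" 70) where "A \<diamondop> B \<equiv> TObj (Ten V) A B"
abbreviation tensor_Arr' (infixr "\<boxtimes>" 70) where "f \<boxtimes> g \<equiv> TArr (Ten V) f g"
abbreviation \<alpha>' where "\<alpha>' \<equiv> Assoc (Ten V)"

notation sseq (infixr "\<triangleright>" 55) and stens (infixr "\<parallel>" 60)

lemma Braiding_typed [simp]:
  assumes "A \<in> Obj V" "B \<in> Obj V"
  shows "Braiding V A B \<in> Arr V" "Dom V (Braiding V A B) = A \<diamondop> B" "Cod V (Braiding V A B) = B \<diamondop> A"
  using Braiding_in[OF assms] by (auto simp: homset_def)

lemmas Braiding_inv_typed [simp] = iso_arrowD[OF Braiding_iso]
lemmas Assoc_inv_typed [simp] = iso_arrowD[OF Assoc_iso]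

fun sbraiding :: "bool \<Rightarrow> 'o list \<Rightarrow> 'o list \<Rightarrow> ('o, 'a) strict_arrow" where
  "sbraiding True xs ys = SArr (xs @ ys)
     (merge ys xs \<cdot> Braiding V (tensor_list xs) (tensor_list ys) \<cdot> arrow_inv V (merge xs ys)) (ys @ xs)"
| "sbraiding False xs ys = SArr (xs @ ys)
     (merge ys xs \<cdot> arrow_inv V (Braiding V (tensor_list ys) (tensor_list xs)) \<cdot> arrow_inv V (merge xs ys)) (ys @ xs)"

lemma sbraiding_typed [simp]:
  "xs \<in> lists (Obj V) \<Longrightarrow> ys \<in> lists (Obj V) \<Longrightarrow> sarr (sbraiding e xs ys)"
  "sdom (sbraiding e xs ys) = xs @ ys" "scod (sbraiding e xs ys) = ys @ xs"
  by (cases e; simp add: sarr_def[of "SArr xs f ys" for xs f ys])+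

lemma sbraiding_merge:
  assumes "xs \<in> lists (Obj V)" "ys \<in> lists (Obj V)"
  shows "sval (sbraiding True xs ys) \<cdot> merge xs ys = merge ys xs \<cdot> Braiding V (tensor_list xs) (tensor_list ys)"
  using assms by simp

lemma Braiding_natural':
  "f \<in> Arr V \<Longrightarrow> g \<in> Arr V \<Longrightarrow>
    Braiding V (Cod V f) (Cod V g) \<cdot> (f \<boxtimes> g) = (g \<boxtimes> f) \<cdot> Braiding V (Dom V f) (Dom V g)"
  by (rule Braiding_natural) (auto simp: homset_def)

lemma sbraiding_natural:
  assumes [simp]: "sarr f" "sarr g"
  shows "sbraiding True (sdom f) (sdom g) \<triangleright> (g \<parallel> f) = (f \<parallel> g) \<triangleright> sbraiding True (scod f) (scod g)"
proof (rule strict_eqI)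
  show "iso_arrow V (merge (sdom f) (sdom g))" by simp
  have "sval (sbraiding True (sdom f) (sdom g) \<triangleright> (g \<parallel> f)) \<cdot> merge (sdom f) (sdom g) =
     merge (scod g) (scod f) \<cdot> (sval g \<boxtimes> sval f) \<cdot> Braiding V (tensor_list (sdom f)) (tensor_list (sdom g))"
    by (simp add: stens_merge_tail)
  also have "\<dots> = merge (scod g) (scod f) \<cdot> Braiding V (tensor_list (scod f)) (tensor_list (scod g)) \<cdot> (sval f \<boxtimes> sval g)"
    using Braiding_natural'[of "sval f" "sval g"] by simp
  also have "\<dots> = sval ((f \<parallel> g) \<triangleright> sbraiding True (scod f) (scod g)) \<cdot> merge (sdom f) (sdom g)"
    by (simp add: stens_merge inv_Comp_tail)
  finally show "sval (sbraiding True (sdom f) (sdom g) \<triangleright> (g \<parallel> f)) \<cdot> merge (sdom f) (sdom g) =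
     sval ((f \<parallel> g) \<triangleright> sbraiding True (scod f) (scod g)) \<cdot> merge (sdom f) (sdom g)" .
qed (simp_all del: sbraiding.simps)

lemma sbraiding_inverse:
  assumes [simp]: "xs \<in> lists (Obj V)" "ys \<in> lists (Obj V)"
  shows "sbraiding e xs ys \<triangleright> sbraiding (\<not> e) ys xs = sid (xs @ ys)"
  by (cases e; rule strict_arrow_eqI)
    (simp_all add: inv_Comp_tail Braiding_iso)

lemma Braiding_tensor_left:
  assumes [simp]: "A \<in> Obj V" "B \<in> Obj V" "D \<in> Obj V"
  shows "Braiding V (A \<diamondop> B) D =
    \<alpha>' D A B \<cdot> (Braiding V A D \<boxtimes> Ident V B) \<cdot> arrow_inv V (\<alpha>' A D B) \<cdot> (Ident V A \<boxtimes> Braiding V B D) \<cdot> \<alpha>' A B D"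
proof -
  note i = Assoc_iso[of D A B] Assoc_iso[of A B D] Assoc_iso[of A D B]
  have "Braiding V (A \<diamondop> B) D = \<alpha>' D A B \<cdot>
      (arrow_inv V (\<alpha>' D A B) \<cdot> Braiding V (A \<diamondop> B) D \<cdot> arrow_inv V (\<alpha>' A B D)) \<cdot> \<alpha>' A B D"
    using i by (simp add: inv_Comp_tail)
  also have "\<dots> = \<alpha>' D A B \<cdot> ((Braiding V A D \<boxtimes> Ident V B) \<cdot> arrow_inv V (\<alpha>' A D B) \<cdot> (Ident V A \<boxtimes> Braiding V B D)) \<cdot> \<alpha>' A B D"
    by (simp only: hexagon2 assms)
  finally show ?thesis by simp
qed

lemma Braiding_tensor_right:
  assumes [simp]: "A \<in> Obj V" "B \<in> Obj V" "D \<in> Obj V"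
  shows "\<alpha>' B D A \<cdot> Braiding V A (B \<diamondop> D) =
    (Ident V B \<boxtimes> Braiding V A D) \<cdot> \<alpha>' B A D \<cdot> (Braiding V A B \<boxtimes> Ident V D) \<cdot> arrow_inv V (\<alpha>' A B D)"
proof -
  note i = Assoc_iso[of A B D]
  have "\<alpha>' B D A \<cdot> Braiding V A (B \<diamondop> D) = (\<alpha>' B D A \<cdot> Braiding V A (B \<diamondop> D) \<cdot> \<alpha>' A B D) \<cdot> arrow_inv V (\<alpha>' A B D)"
    using i by simp
  also have "\<dots> = ((Ident V B \<boxtimes> Braiding V A D) \<cdot> \<alpha>' B A D \<cdot> (Braiding V A B \<boxtimes> Ident V D)) \<cdot> arrow_inv V (\<alpha>' A B D)"
    by (simp only: hexagon1 assms)
  finally show ?thesis using i by simp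
qed

text \<open>Precomposed with a triple merge, the crossing is moved past the merges by naturality and
  split by the hexagon. Then \<open>merge_assoc\<close> is applied for each of the three orders in
  which the blocks occur, so that the two strict crossings can be recognized.\<close>

lemma sbraiding_hexagon_left:
  assumes [simp]: "xs \<in> lists (Obj V)" "ys \<in> lists (Obj V)" "zs \<in> lists (Obj V)"
  shows "sbraiding True (xs @ ys) zs = (sid xs \<parallel> sbraiding True ys zs) \<triangleright> (sbraiding True xs zs \<parallel> sid ys)"
proof (rule strict_eqI)
  let ?i = "Ident V" and ?X = "tensor_list xs" and ?Y = "tensor_list ys" and ?Z = "tensor_list zs"
    and ?c = "Braiding V"
  let ?m = "merge (xs @ ys) zs \<cdot> (merge xs ys \<boxtimes> ?i ?Z)"
  show "iso_arrow V ?m" by (intro iso_Comp iso_TArr) auto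
  note [simp del] = sbraiding.simps
  have 1: "sval (sbraiding True (xs @ ys) zs) \<cdot> ?m =
      merge zs (xs @ ys) \<cdot> ?c (tensor_list (xs @ ys)) ?Z \<cdot> (merge xs ys \<boxtimes> ?i ?Z)"
    using Comp_tail[OF sbraiding_merge[of "xs @ ys" zs], of "merge xs ys \<boxtimes> ?i ?Z"] by simp
  also have "?c (tensor_list (xs @ ys)) ?Z \<cdot> (merge xs ys \<boxtimes> ?i ?Z) = (?i ?Z \<boxtimes> merge xs ys) \<cdot> ?c (?X \<diamondop> ?Y) ?Z"
    using Braiding_natural'[of "merge xs ys" "?i ?Z"] by simp
  also have "merge zs (xs @ ys) \<cdot> (?i ?Z \<boxtimes> merge xs ys) \<cdot> ?c (?X \<diamondop> ?Y) ?Z =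
     (merge zs (xs @ ys) \<cdot> (?i ?Z \<boxtimes> merge xs ys) \<cdot> \<alpha>' ?Z ?X ?Y) \<cdot> (?c ?X ?Z \<boxtimes> ?i ?Y) \<cdot> arrow_inv V (\<alpha>' ?X ?Z ?Y)
       \<cdot> (?i ?X \<boxtimes> ?c ?Y ?Z) \<cdot> \<alpha>' ?X ?Y ?Z"
    by (simp add: Braiding_tensor_left Assoc_iso)
  also have "\<dots> = (merge (zs @ xs) ys \<cdot> (merge zs xs \<boxtimes> ?i ?Y)) \<cdot> (?c ?X ?Z \<boxtimes> ?i ?Y) \<cdot> arrow_inv V (\<alpha>' ?X ?Z ?Y)
       \<cdot> (?i ?X \<boxtimes> ?c ?Y ?Z) \<cdot> \<alpha>' ?X ?Y ?Z"
    by (subst merge_assoc) auto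
  also have "\<dots> = (merge (zs @ xs) ys \<cdot> (sval (sbraiding True xs zs) \<boxtimes> ?i ?Y)) \<cdot> (merge xs zs \<boxtimes> ?i ?Y) \<cdot> arrow_inv V (\<alpha>' ?X ?Z ?Y)
       \<cdot> (?i ?X \<boxtimes> ?c ?Y ?Z) \<cdot> \<alpha>' ?X ?Y ?Z"
    by (simp add: TArr_Comp_tail sbraiding_merge Assoc_iso)
  also have "merge (zs @ xs) ys \<cdot> (sval (sbraiding True xs zs) \<boxtimes> ?i ?Y) = sval (sbraiding True xs zs \<parallel> sid ys) \<cdot> merge (xs @ zs) ys"
    by (simp add: stens_merge)
  also have "(sval (sbraiding True xs zs \<parallel> sid ys) \<cdot> merge (xs @ zs) ys) \<cdot> (merge xs zs \<boxtimes> ?i ?Y) \<cdot> arrow_inv V (\<alpha>' ?X ?Z ?Y)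
       \<cdot> (?i ?X \<boxtimes> ?c ?Y ?Z) \<cdot> \<alpha>' ?X ?Y ?Z =
     sval (sbraiding True xs zs \<parallel> sid ys) \<cdot> (merge (xs @ zs) ys \<cdot> (merge xs zs \<boxtimes> ?i ?Y)) \<cdot> arrow_inv V (\<alpha>' ?X ?Z ?Y)
       \<cdot> (?i ?X \<boxtimes> ?c ?Y ?Z) \<cdot> \<alpha>' ?X ?Y ?Z"
    by (simp add: Assoc_iso)
  also have "merge (xs @ zs) ys \<cdot> (merge xs zs \<boxtimes> ?i ?Y) = merge xs (zs @ ys) \<cdot> (?i ?X \<boxtimes> merge zs ys) \<cdot> \<alpha>' ?X ?Z ?Y"
    by (rule merge_assoc[symmetric]) auto
  also have "sval (sbraiding True xs zs \<parallel> sid ys) \<cdot> (merge xs (zs @ ys) \<cdot> (?i ?X \<boxtimes> merge zs ys) \<cdot> \<alpha>' ?X ?Z ?Y) \<cdot> arrow_inv V (\<alpha>' ?X ?Z ?Y)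
       \<cdot> (?i ?X \<boxtimes> ?c ?Y ?Z) \<cdot> \<alpha>' ?X ?Y ?Z =
      sval (sbraiding True xs zs \<parallel> sid ys) \<cdot> merge xs (zs @ ys) \<cdot> (?i ?X \<boxtimes> (merge zs ys \<cdot> ?c ?Y ?Z)) \<cdot> \<alpha>' ?X ?Y ?Z"
    by (simp add: inv_Comp_tail Assoc_iso TArr_Comp_tail)
  also have "\<dots> = sval (sbraiding True xs zs \<parallel> sid ys) \<cdot> merge xs (zs @ ys) \<cdot> (?i ?X \<boxtimes> sval (sbraiding True ys zs)) \<cdot> (?i ?X \<boxtimes> merge ys zs) \<cdot> \<alpha>' ?X ?Y ?Z"
    by (simp add: TArr_Comp_tail sbraiding_merge)
  also have "\<dots> = sval (sbraiding True xs zs \<parallel> sid ys) \<cdot> sval (sid xs \<parallel> sbraiding True ys zs) \<cdot> merge xs (ys @ zs) \<cdot> (?i ?X \<boxtimes> merge ys zs) \<cdot> \<alpha>' ?X ?Y ?Z"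
    by (simp add: stens_merge_tail)
  also have "merge xs (ys @ zs) \<cdot> (?i ?X \<boxtimes> merge ys zs) \<cdot> \<alpha>' ?X ?Y ?Z = ?m"
    by (rule merge_assoc) auto
  also have "sval (sbraiding True xs zs \<parallel> sid ys) \<cdot> sval (sid xs \<parallel> sbraiding True ys zs) \<cdot> ?m =
     sval ((sid xs \<parallel> sbraiding True ys zs) \<triangleright> (sbraiding True xs zs \<parallel> sid ys)) \<cdot> ?m"
    by simp
  finally show "sval (sbraiding True (xs @ ys) zs) \<cdot> ?m = sval ((sid xs \<parallel> sbraiding True ys zs) \<triangleright> (sbraiding True xs zs \<parallel> sid ys)) \<cdot> ?m" .
qed (simp_all del: sbraiding.simps)

lemma sbraiding_hexagon_right:
  assumes [simp]: "xs \<in> lists (Obj V)" "ys \<in> lists (Obj V)" "zs \<in> lists (Obj V)"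
  shows "sbraiding True xs (ys @ zs) = (sbraiding True xs ys \<parallel> sid zs) \<triangleright> (sid ys \<parallel> sbraiding True xs zs)"
proof (rule strict_eqI)
  let ?i = "Ident V" and ?X = "tensor_list xs" and ?Y = "tensor_list ys" and ?Z = "tensor_list zs"
    and ?c = "Braiding V"
  let ?m = "merge xs (ys @ zs) \<cdot> (?i ?X \<boxtimes> merge ys zs)"
  show "iso_arrow V ?m" by (intro iso_Comp iso_TArr) auto
  note [simp del] = sbraiding.simps
  let ?r = "arrow_inv V (\<alpha>' ?X ?Y ?Z)"
  have 1: "sval (sbraiding True xs (ys @ zs)) \<cdot> ?m =
      merge (ys @ zs) xs \<cdot> ?c ?X (tensor_list (ys @ zs)) \<cdot> (?i ?X \<boxtimes> merge ys zs)"
    using Comp_tail[OF sbraiding_merge[of xs "ys @ zs"], of "?i ?X \<boxtimes> merge ys zs"] by simp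
  also have "?c ?X (tensor_list (ys @ zs)) \<cdot> (?i ?X \<boxtimes> merge ys zs) = (merge ys zs \<boxtimes> ?i ?X) \<cdot> ?c ?X (?Y \<diamondop> ?Z)"
    using Braiding_natural'[of "?i ?X" "merge ys zs"] by simp
  also have "merge (ys @ zs) xs \<cdot> (merge ys zs \<boxtimes> ?i ?X) \<cdot> ?c ?X (?Y \<diamondop> ?Z) =
      (merge (ys @ zs) xs \<cdot> (merge ys zs \<boxtimes> ?i ?X)) \<cdot> ?c ?X (?Y \<diamondop> ?Z)"
    by simp
  also have "\<dots> = (merge ys (zs @ xs) \<cdot> (?i ?Y \<boxtimes> merge zs xs) \<cdot> \<alpha>' ?Y ?Z ?X) \<cdot> ?c ?X (?Y \<diamondop> ?Z)"
    by (subst merge_assoc) auto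
  also have "\<dots> = merge ys (zs @ xs) \<cdot> (?i ?Y \<boxtimes> (merge zs xs \<cdot> ?c ?X ?Z)) \<cdot> \<alpha>' ?Y ?X ?Z \<cdot> (?c ?X ?Y \<boxtimes> ?i ?Z) \<cdot> ?r"
    by (simp add: Braiding_tensor_right Assoc_iso TArr_Comp_tail)
  also have "\<dots> = merge ys (zs @ xs) \<cdot> (?i ?Y \<boxtimes> sval (sbraiding True xs zs)) \<cdot> (?i ?Y \<boxtimes> merge xs zs) \<cdot> \<alpha>' ?Y ?X ?Z \<cdot> (?c ?X ?Y \<boxtimes> ?i ?Z) \<cdot> ?r"
    by (simp add: Assoc_iso TArr_Comp_tail sbraiding_merge)
  also have "\<dots> = sval (sid ys \<parallel> sbraiding True xs zs) \<cdot> (merge ys (xs @ zs) \<cdot> (?i ?Y \<boxtimes> merge xs zs) \<cdot> \<alpha>' ?Y ?X ?Z) \<cdot> (?c ?X ?Y \<boxtimes> ?i ?Z) \<cdot> ?r"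
    by (simp add: stens_merge_tail Assoc_iso)
  also have "merge ys (xs @ zs) \<cdot> (?i ?Y \<boxtimes> merge xs zs) \<cdot> \<alpha>' ?Y ?X ?Z = merge (ys @ xs) zs \<cdot> (merge ys xs \<boxtimes> ?i ?Z)"
    by (rule merge_assoc) auto
  also have "sval (sid ys \<parallel> sbraiding True xs zs) \<cdot> (merge (ys @ xs) zs \<cdot> (merge ys xs \<boxtimes> ?i ?Z)) \<cdot> (?c ?X ?Y \<boxtimes> ?i ?Z) \<cdot> ?r =
     sval (sid ys \<parallel> sbraiding True xs zs) \<cdot> merge (ys @ xs) zs \<cdot> (sval (sbraiding True xs ys) \<boxtimes> ?i ?Z) \<cdot> (merge xs ys \<boxtimes> ?i ?Z) \<cdot> ?r"
    by (simp add: TArr_Comp_tail sbraiding_merge Assoc_iso)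
  also have "\<dots> = sval (sid ys \<parallel> sbraiding True xs zs) \<cdot> sval (sbraiding True xs ys \<parallel> sid zs) \<cdot> (merge (xs @ ys) zs \<cdot> (merge xs ys \<boxtimes> ?i ?Z)) \<cdot> ?r"
    by (simp add: stens_merge_tail Assoc_iso)
  also have "merge (xs @ ys) zs \<cdot> (merge xs ys \<boxtimes> ?i ?Z) = merge xs (ys @ zs) \<cdot> (?i ?X \<boxtimes> merge ys zs) \<cdot> \<alpha>' ?X ?Y ?Z"
    by (rule merge_assoc[symmetric]) auto
  also have "sval (sid ys \<parallel> sbraiding True xs zs) \<cdot> sval (sbraiding True xs ys \<parallel> sid zs) \<cdot> (merge xs (ys @ zs) \<cdot> (?i ?X \<boxtimes> merge ys zs) \<cdot> \<alpha>' ?X ?Y ?Z) \<cdot> ?r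
     = sval ((sbraiding True xs ys \<parallel> sid zs) \<triangleright> (sid ys \<parallel> sbraiding True xs zs)) \<cdot> ?m"
    by (simp add: Assoc_iso)
  finally show "sval (sbraiding True xs (ys @ zs)) \<cdot> ?m = sval ((sbraiding True xs ys \<parallel> sid zs) \<triangleright> (sid ys \<parallel> sbraiding True xs zs)) \<cdot> ?m" .
qed (simp_all del: sbraiding.simps)

sublocale strict: strict_braided "Obj V" sarr sdom scod sid sseq stens sbraiding
proof unfold_locales
  fix f g h assume "sarr f" "sarr g" "sarr h" "scod f = sdom g" "scod g = sdom h"
  then show "(f \<triangleright> g) \<triangleright> h = f \<triangleright> g \<triangleright> h" by (intro strict_arrow_eqI) simp_all
next
  fix f xs assume "sarr f" "sdom f = xs" then show "sid xs \<triangleright> f = f" by (intro strict_arrow_eqI) auto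
next
  fix f xs assume "sarr f" "scod f = xs" then show "f \<triangleright> sid xs = f" by (intro strict_arrow_eqI) auto
qed (simp_all add: stens_assoc s_interchange sbraiding_natural sbraiding_inverse
    sbraiding_hexagon_left sbraiding_hexagon_right del: sbraiding.simps)

end

text \<open>Bracketings with unit leaves. \<open>bracketed\<close> has no empty product, but the
  interchange must also be evaluated at units, and these correspond to empty lists of
  leaves.\<close>

datatype 'o product_tree = Empty | Leaf 'o | Node "'o product_tree" "'o product_tree"

fun leaves :: "'o product_tree \<Rightarrow> 'o list" where
  "leaves Empty = []"
| "leaves (Leaf A) = [A]"
| "leaves (Node s t) = leaves s @ leaves t"

fun tree_of :: "'o bracketed \<Rightarrow> 'o product_tree" where
  "tree_of (Atom A) = Leaf A"
| "tree_of (Prod s t) = Node (tree_of s) (tree_of t)"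

lemma length_leaves_tree_of [simp]: "length (leaves (tree_of s)) = num_factors s"
  by (induction s) auto

lemma leaves_tree_of_lists [simp]: "leaves (tree_of s) \<in> lists A \<longleftrightarrow> set_bracketed s \<subseteq> A"
  by (induction s) auto

lemma num_factors_pos [simp]: "0 < num_factors s"
  by (induction s) auto

section \<open>Coherence for bracketed products\<close>

context braided_category
begin

abbreviation (input) tree_Ob where "tree_Ob t \<equiv> leaves t \<in> lists (Obj V)"

fun tree_val :: "'o product_tree \<Rightarrow> 'o" where
  "tree_val Empty = BUnit V"
| "tree_val (Leaf A) = A"
| "tree_val (Node s t) = tree_val s \<diamondop> tree_val t"

lemma tree_val_Obj [simp]: "tree_Ob t \<Longrightarrow> tree_val t \<in> Obj V"
  by (induction t) auto

lemma tree_val_tree_of [simp]: "tree_val (tree_of s) = product_in V s"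
  by (induction s) auto

definition emb :: "'a \<Rightarrow> ('o, 'a) strict_arrow" where
  "emb f = SArr [Dom V f] f [Cod V f]"

definition mu :: "'o \<Rightarrow> 'o \<Rightarrow> ('o, 'a) strict_arrow" where
  "mu A B = SArr [A, B] (Ident V (A \<diamondop> B)) [A \<diamondop> B]"

lemma emb_typed [simp]:
  "f \<in> Arr V \<Longrightarrow> sarr (emb f)" "sdom (emb f) = [Dom V f]" "scod (emb f) = [Cod V f]" "sval (emb f) = f"
  by (simp_all add: emb_def sarr_def[of "SArr xs g ys" for xs g ys])

lemma mu_typed [simp]:
  "A \<in> Obj V \<Longrightarrow> B \<in> Obj V \<Longrightarrow> sarr (mu A B)" "sdom (mu A B) = [A, B]" "scod (mu A B) = [A \<diamondop> B]"
  "sval (mu A B) = Ident V (A \<diamondop> B)"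
  by (simp_all add: mu_def sarr_def[of "SArr xs g ys" for xs g ys])

lemma merge_one [simp]:
  assumes "A \<in> Obj V" "ys \<in> lists (Obj V)"
  shows "merge [A] ys = Ident V (A \<diamondop> tensor_list ys)"
  using assms by simp

lemma emb_Ident [simp]: "A \<in> Obj V \<Longrightarrow> emb (Ident V A) = sid [A]"
  by (intro strict_arrow_eqI) auto

lemma emb_Comp: "f \<in> Arr V \<Longrightarrow> g \<in> Arr V \<Longrightarrow> Cod V f = Dom V g \<Longrightarrow> emb f \<triangleright> emb g = emb (g \<cdot> f)"
  by (intro strict_arrow_eqI) auto

lemma mu_natural:
  "f \<in> Arr V \<Longrightarrow> g \<in> Arr V \<Longrightarrow>
    (emb f \<parallel> emb g) \<triangleright> mu (Cod V f) (Cod V g) = mu (Dom V f) (Dom V g) \<triangleright> emb (f \<boxtimes> g)"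
  by (intro strict_arrow_eqI) (simp_all add: stens_def del: merge.simps)

lemma mu_assoc:
  "A \<in> Obj V \<Longrightarrow> B \<in> Obj V \<Longrightarrow> D \<in> Obj V \<Longrightarrow>
    (mu A B \<parallel> sid [D]) \<triangleright> mu (A \<diamondop> B) D \<triangleright> emb (\<alpha>' A B D) = (sid [A] \<parallel> mu B D) \<triangleright> mu A (B \<diamondop> D)"
  by (intro strict_arrow_eqI) (simp_all add: stens_def Assoc_iso)

fun signed_braiding :: "bool \<Rightarrow> 'o \<Rightarrow> 'o \<Rightarrow> 'a" where
  "signed_braiding True A B = Braiding V A B"
| "signed_braiding False A B = arrow_inv V (Braiding V B A)"

lemma signed_braiding_typed [simp]:
  assumes "A \<in> Obj V" "B \<in> Obj V"
  shows "signed_braiding e A B \<in> Arr V" "Dom V (signed_braiding e A B) = A \<diamondop> B"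
    "Cod V (signed_braiding e A B) = B \<diamondop> A"
  using assms by (cases e; simp add: Braiding_iso)+

lemma mu_braiding:
  assumes "A \<in> Obj V" "B \<in> Obj V"
  shows "sbraiding e [A] [B] \<triangleright> mu B A = mu A B \<triangleright> emb (signed_braiding e A B)"
  using assms by (cases e) (auto intro!: strict_arrow_eqI simp: Braiding_iso)

text \<open>The canonical isomorphism from the list of leaves to the one-element list formed by
  their bracketed product. It translates arrows between products into strict arrows between
  lists.\<close>

fun theta :: "'o product_tree \<Rightarrow> ('o, 'a) strict_arrow" where
  "theta Empty = SArr [] (Ident V (BUnit V)) [BUnit V]"
| "theta (Leaf A) = sid [A]"
| "theta (Node s t) = (theta s \<parallel> theta t) \<triangleright> mu (tree_val s) (tree_val t)"

lemma theta_typed [simp]: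
  "sdom (theta t) = leaves t" "scod (theta t) = [tree_val t]" "tree_Ob t \<Longrightarrow> sarr (theta t)"
proof -
  show "sdom (theta t) = leaves t" by (induction t) auto
  show *: "scod (theta t) = [tree_val t]" for t by (induction t) auto
  show "tree_Ob t \<Longrightarrow> sarr (theta t)"
    by (induction t) (simp_all add: * sarr_def[of "SArr xs g ys" for xs g ys])
qed

lemma theta_invertible: "tree_Ob t \<Longrightarrow> \<exists>g. strict.inverse_pair (theta t) g"
proof (induction t)
  case Empty
  have "strict.inverse_pair (theta Empty) (SArr [BUnit V] (Ident V (BUnit V)) [])"
    unfolding strict.inverse_pair_def
    by (auto intro!: strict_arrow_eqI simp: sarr_def[of "SArr xs g ys" for xs g ys])
  then show ?case by blast
next
  case (Leaf A)
  then have "strict.inverse_pair (theta (Leaf A)) (sid [A])"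
    by (simp add: strict.inverse_pair_ide)
  then show ?case by blast
next
  case (Node s t)
  then obtain g h where "strict.inverse_pair (theta s) g" "strict.inverse_pair (theta t) h" by auto
  then have gh: "strict.inverse_pair (theta s \<parallel> theta t) (g \<parallel> h)" by (rule strict.inverse_pair_tens)
  have m: "strict.inverse_pair (mu (tree_val s) (tree_val t))
      (SArr [tree_val s \<diamondop> tree_val t] (Ident V (tree_val s \<diamondop> tree_val t)) [tree_val s, tree_val t])"
    unfolding strict.inverse_pair_def using Node.prems
    by (auto intro!: strict_arrow_eqI simp: sarr_def[of "SArr xs g ys" for xs g ys])
  show ?case using strict.inverse_pair_seq[OF gh m] by auto
qed

lemma theta_Node_Empty [simp]:
  assumes "tree_Ob s"
  shows "theta (Node s Empty) = theta s" "theta (Node Empty s) = theta s"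
  using assms by (auto intro!: strict_arrow_eqI simp: stens_def)

text \<open>As \<open>theta\<close> is invertible, \<open>h\<close> is determined by the strict arrow that it realizes: this is coherence.\<close>

definition realizes ::
  "'o product_tree \<Rightarrow> ('o, 'a) strict_arrow \<Rightarrow> 'o product_tree \<Rightarrow> 'a \<Rightarrow> bool" where
  "realizes s f t h \<longleftrightarrow> tree_Ob s \<and> tree_Ob t \<and> sarr f \<and> sdom f = leaves s \<and> scod f = leaves t \<and>
     h \<in> Arr V \<and> Dom V h = tree_val s \<and> Cod V h = tree_val t \<and> theta s \<triangleright> emb h = f \<triangleright> theta t"

lemma realizes_unique:
  assumes "realizes s f t h" "realizes s f t k"
  shows "h = k"
proof -
  obtain g where g: "strict.inverse_pair (theta s) g"
    using assms theta_invertible by (auto simp: realizes_def)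
  have "emb h = emb k"
    by (rule strict.inverse_pair_cancel_left[OF g]) (use assms in \<open>auto simp: realizes_def\<close>)
  then show ?thesis by (simp add: emb_def)
qed

text \<open>The realization is obtained by conjugating the strict arrow with
  \<open>theta\<close>.\<close>

lemma realizes_exists:
  assumes "tree_Ob s" "tree_Ob t" "sarr f" "sdom f = leaves s" "scod f = leaves t"
  shows "\<exists>h. realizes s f t h"
proof -
  obtain g where g: "strict.inverse_pair (theta s) g"
    using assms theta_invertible by auto
  then have g': "sarr g" "sdom g = [tree_val s]" "scod g = leaves s"
    by (auto simp: strict.inverse_pair_def)
  let ?h = "sval (g \<triangleright> f \<triangleright> theta t)"
  have h: "?h \<in> Arr V" "Dom V ?h = tree_val s" "Cod V ?h = tree_val t"
    using g' assms by (simp_all del: s_sel(6))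
  have "emb ?h = g \<triangleright> f \<triangleright> theta t"
    by (rule strict_arrow_eqI) (use h g' assms in simp_all)
  then have "theta s \<triangleright> emb ?h = f \<triangleright> theta t"
    using strict.inverse_pair_seq_cancel[OF g, of "f \<triangleright> theta t"] assms by simp
  then show ?thesis using h assms unfolding realizes_def by blast
qed

lemma realizes_Comp:
  assumes "realizes s f t h" "realizes t g u k"
  shows "realizes s (f \<triangleright> g) u (k \<cdot> h)"
proof -
  have [simp]: "tree_Ob s" "tree_Ob t" "tree_Ob u" "sarr f" "sarr g" "sdom f = leaves s" "scod f = leaves t"
    "sdom g = leaves t" "scod g = leaves u" "h \<in> Arr V" "k \<in> Arr V"
    "Dom V h = tree_val s" "Cod V h = tree_val t" "Dom V k = tree_val t" "Cod V k = tree_val u"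
    and eq: "theta s \<triangleright> emb h = f \<triangleright> theta t" "theta t \<triangleright> emb k = g \<triangleright> theta u"
    using assms by (auto simp: realizes_def)
  have "theta s \<triangleright> emb (k \<cdot> h) = theta s \<triangleright> emb h \<triangleright> emb k" by (simp add: emb_Comp)
  also have "\<dots> = (theta s \<triangleright> emb h) \<triangleright> emb k" by (subst strict.seq_assoc) simp_all
  also have "\<dots> = f \<triangleright> theta t \<triangleright> emb k" unfolding eq(1) by (subst strict.seq_assoc) simp_all
  also have "\<dots> = (f \<triangleright> g) \<triangleright> theta u" unfolding eq by (subst strict.seq_assoc) simp_all
  finally show ?thesis by (simp add: realizes_def)
qed

lemma realizes_TArr:
  assumes "realizes s f t h" "realizes s' f' t' h'"
  shows "realizes (Node s s') (f \<parallel> f') (Node t t') (h \<boxtimes> h')"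
proof -
  have [simp]: "tree_Ob s" "tree_Ob t" "sarr f" "sdom f = leaves s" "scod f = leaves t" "h \<in> Arr V"
    "Dom V h = tree_val s" "Cod V h = tree_val t"
    and eq: "theta s \<triangleright> emb h = f \<triangleright> theta t" using assms(1) by (auto simp: realizes_def)
  have [simp]: "tree_Ob s'" "tree_Ob t'" "sarr f'" "sdom f' = leaves s'" "scod f' = leaves t'" "h' \<in> Arr V"
    "Dom V h' = tree_val s'" "Cod V h' = tree_val t'"
    and eq': "theta s' \<triangleright> emb h' = f' \<triangleright> theta t'" using assms(2) by (auto simp: realizes_def)
  have "theta (Node s s') \<triangleright> emb (h \<boxtimes> h') = (theta s \<parallel> theta s') \<triangleright> mu (tree_val s) (tree_val s') \<triangleright> emb (h \<boxtimes> h')"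
    by simp
  also have "\<dots> = (theta s \<parallel> theta s') \<triangleright> (emb h \<parallel> emb h') \<triangleright> mu (tree_val t) (tree_val t')"
    using mu_natural[of h h'] by simp
  also have "\<dots> = ((theta s \<triangleright> emb h) \<parallel> (theta s' \<triangleright> emb h')) \<triangleright> mu (tree_val t) (tree_val t')"
    by (simp flip: strict.seq_assoc strict.interchange)
  also have "\<dots> = (f \<parallel> f') \<triangleright> theta (Node t t')"
    unfolding eq eq' by (simp flip: strict.interchange)
  finally show ?thesis by (simp add: realizes_def)
qed

lemma realizes_Ident: "tree_Ob t \<Longrightarrow> realizes t (sid (leaves t)) t (Ident V (tree_val t))"
  by (simp add: realizes_def)

lemma realizes_Leaf: "h \<in> Arr V \<Longrightarrow> realizes (Leaf (Dom V h)) (emb h) (Leaf (Cod V h)) h"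
  by (simp add: realizes_def)

text \<open>Rebracketing is invisible on lists, so an associator realizes an identity.\<close>

lemma realizes_Assoc:
  assumes [simp]: "tree_Ob s" "tree_Ob t" "tree_Ob u"
  shows "realizes (Node (Node s t) u) (sid (leaves s @ leaves t @ leaves u)) (Node s (Node t u))
    (\<alpha>' (tree_val s) (tree_val t) (tree_val u))"
proof -
  let ?s = "tree_val s" and ?t = "tree_val t" and ?u = "tree_val u"
  have "theta (Node (Node s t) u) = ((theta s \<parallel> theta t) \<parallel> theta u) \<triangleright> (mu ?s ?t \<parallel> sid [?u]) \<triangleright> mu (?s \<diamondop> ?t) ?u"
    by (simp add: strict.interchange flip: strict.seq_assoc del: strict.tens_assoc)
  then have "theta (Node (Node s t) u) \<triangleright> emb (\<alpha>' ?s ?t ?u) =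
     ((theta s \<parallel> theta t) \<parallel> theta u) \<triangleright> (mu ?s ?t \<parallel> sid [?u]) \<triangleright> mu (?s \<diamondop> ?t) ?u \<triangleright> emb (\<alpha>' ?s ?t ?u)"
    by simp
  also have "\<dots> = (theta s \<parallel> theta t \<parallel> theta u) \<triangleright> (sid [?s] \<parallel> mu ?t ?u) \<triangleright> mu ?s (?t \<diamondop> ?u)"
    by (simp add: mu_assoc)
  also have "\<dots> = theta (Node s (Node t u))"
    by (simp add: strict.interchange flip: strict.seq_assoc)
  finally have "theta (Node (Node s t) u) \<triangleright> emb (\<alpha>' ?s ?t ?u) = theta (Node s (Node t u))" .
  then show ?thesis unfolding realizes_def by simp
qed

text \<open>The inverse strict arrow has some realization \<open>k\<close>; by uniqueness both
  composites of \<open>k\<close> with \<open>h\<close> are identities.\<close>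

lemma realizes_inverse:
  assumes "realizes s f t h" "strict.inverse_pair f g"
  shows "iso_arrow V h" "realizes t g s (arrow_inv V h)"
proof -
  have [simp]: "tree_Ob s" "tree_Ob t" "sdom f = leaves s" "scod f = leaves t"
    and h: "h \<in> Arr V" "Dom V h = tree_val s" "Cod V h = tree_val t"
    using assms by (auto simp: realizes_def)
  have g: "sarr g" "sdom g = leaves t" "scod g = leaves s" "f \<triangleright> g = sid (leaves s)" "g \<triangleright> f = sid (leaves t)"
    using assms(2) by (auto simp: strict.inverse_pair_def)
  then obtain k where k: "realizes t g s k" using realizes_exists[of t s g] by auto
  then have k': "k \<in> Arr V" "Dom V k = tree_val t" "Cod V k = tree_val s" by (auto simp: realizes_def)
  have "k \<cdot> h = Ident V (tree_val s)"
    using realizes_unique[OF realizes_Comp[OF assms(1) k]] realizes_Ident[of s] g by simp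
  moreover have "h \<cdot> k = Ident V (tree_val t)"
    using realizes_unique[OF realizes_Comp[OF k assms(1)]] realizes_Ident[of t] g by simp
  ultimately have "inverse_arrows V h k" using h k' by (auto simp: inverse_arrows_def homset_def)
  then show "iso_arrow V h" "realizes t g s (arrow_inv V h)"
    using k arrow_inv_eq by (auto simp: iso_arrow_def)
qed

lemma realizes_braiding:
  assumes "A \<in> Obj V" "B \<in> Obj V"
  shows "realizes (Node (Leaf A) (Leaf B)) (sbraiding e [A] [B]) (Node (Leaf B) (Leaf A)) (signed_braiding e A B)"
  unfolding realizes_def using assms mu_braiding[OF assms, of e] by (simp del: sbraiding.simps)

abbreviation singletons :: "'o list \<Rightarrow> 'o list list" where "singletons \<equiv> map (\<lambda>x. [x])"

lemma singletons_Ob [simp]: "singletons xs \<in> lists (lists (Obj V)) \<longleftrightarrow> xs \<in> lists (Obj V)"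
  by (induction xs) auto

text \<open>The underlying braid acts on the singletons of the factors. Associators contribute
  nothing, tensoring with an identity is \<open>act_extend\<close> or \<open>act_shift\<close>, and
  a crossing of two atoms is a strict crossing.\<close>

lemma braid_composite_realizes:
  assumes "braid_composite V s w t h"
  shows "w \<in> braid_words (num_factors s) \<and> num_factors t = num_factors s \<and>
    leaves (tree_of t) = permute w (leaves (tree_of s)) \<and>
    realizes (tree_of s) (strict.act w (singletons (leaves (tree_of s)))) (tree_of t) h"
  using assms
proof (induction rule: braid_composite.induct)
  case (ident s)
  then show ?case using realizes_Ident[of "tree_of s"] by simp
next
  case (assoc s t u)
  then show ?case using realizes_Assoc[of "tree_of s" "tree_of t" "tree_of u"] by simp
next
  case (assoc_inv s t u)
  then show ?case
    using realizes_inverse(2)[OF realizes_Assoc[of "tree_of s" "tree_of t" "tree_of u"] strict.inverse_pair_ide] by simp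
next
  case (braiding A B)
  then show ?case using realizes_braiding[of A B True] swap_at_split[of "Suc 0" "[]" A B "[]"]
    strict.act_single[of "[A]" "[B]" True] by (simp del: strict.act.simps sbraiding.simps)
next
  case (braiding_inv A B)
  then show ?case using realizes_braiding[of A B False] swap_at_split[of "Suc 0" "[]" A B "[]"]
    strict.act_single[of "[A]" "[B]" False] by (simp del: strict.act.simps sbraiding.simps)
next
  case (tensor_right s w t h u)
  let ?s = "leaves (tree_of s)" and ?u = "leaves (tree_of u)"
  have s: "?s \<in> lists (Obj V)" and u: "?u \<in> lists (Obj V)" and w: "w \<in> braid_words (length (singletons ?s))"
    using tensor_right by (auto simp: realizes_def)
  have "realizes (Node (tree_of s) (tree_of u)) (strict.act w (singletons ?s) \<parallel> sid ?u)
     (Node (tree_of t) (tree_of u)) (h \<boxtimes> Ident V (product_in V u))"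
    using realizes_TArr[of _ _ _ h, OF _ realizes_Ident[OF u]] tensor_right by auto
  then show ?case using strict.act_extend[OF w, of "singletons ?u"] s u w permute_extend[of w ?s ?u] tensor_right.IH
    by (auto simp: braid_words_def)
next
  case (tensor_left s w t h u)
  let ?s = "leaves (tree_of s)" and ?u = "leaves (tree_of u)"
  have s: "?s \<in> lists (Obj V)" and u: "?u \<in> lists (Obj V)" and w: "w \<in> braid_words (length (singletons ?s))"
    using tensor_left by (auto simp: realizes_def)
  have "realizes (Node (tree_of u) (tree_of s)) (sid ?u \<parallel> strict.act w (singletons ?s))
     (Node (tree_of u) (tree_of t)) (Ident V (product_in V u) \<boxtimes> h)"
    using realizes_TArr[OF realizes_Ident[OF u], of _ _ _ h] tensor_left by auto
  then show ?case
    using strict.act_shift[OF w, of "singletons ?u" "num_factors u"] s u w permute_shift[of w ?s ?u "num_factors u"]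
      tensor_left.IH shift_word_words[of w "num_factors s" "num_factors u"]
    by (auto simp: add_ac)
next
  case (comp s w t h w' u h')
  let ?s = "leaves (tree_of s)"
  have s: "?s \<in> lists (Obj V)" using comp by (auto simp: realizes_def)
  have "map (\<lambda>x. [x]) (permute w ?s) = permute w (singletons ?s)"
    by (rule map_permute) (use comp in simp)
  then show ?case using comp realizes_Comp strict.act_append[of w w' "singletons ?s"] s by auto
qed

text \<open>Coherence for braided categories: related words act by the same strict arrow, and a
  strict arrow has only one realization between given products.\<close>

lemma braid_composite_unique:
  assumes "braid_composite V s w t h" "braid_composite V s w' t h'" "(w, w') \<in> braid_rel n" "num_factors s = n"
  shows "h = h'"
proof -
  have "set_bracketed s \<subseteq> Obj V"
    using braid_composite_realizes[OF assms(1)] by (auto simp: realizes_def)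
  then have "strict.act w (singletons (leaves (tree_of s))) = strict.act w' (singletons (leaves (tree_of s)))"
    by (intro strict.act_braid_rel[OF assms(3)]) (simp_all add: assms(4))
  then show ?thesis
    using braid_composite_realizes[OF assms(1)] braid_composite_realizes[OF assms(2)] realizes_unique by metis
qed

section \<open>Existence of composites with a given underlying braid\<close>

fun right_nested :: "'o list \<Rightarrow> 'o bracketed" where
  "right_nested [] = undefined"
| "right_nested [x] = Atom x"
| "right_nested (x # y # xs) = Prod (Atom x) (right_nested (y # xs))"

lemma right_nested_simps:
  "xs \<noteq> [] \<Longrightarrow> right_nested (x # xs) = Prod (Atom x) (right_nested xs)"
  by (cases xs) auto

lemma right_nested_leaves [simp]:
  "xs \<noteq> [] \<Longrightarrow> leaves (tree_of (right_nested xs)) = xs"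
  by (induction xs rule: right_nested.induct) auto

lemma right_nested_set [simp]: "xs \<noteq> [] \<Longrightarrow> set_bracketed (right_nested xs) = set xs"
  by (induction xs rule: right_nested.induct) auto

lemma right_nested_append:
  assumes "xs \<noteq> []" "ys \<noteq> []" "set xs \<subseteq> Obj V" "set ys \<subseteq> Obj V"
  shows "\<exists>h. braid_composite V (Prod (right_nested xs) (right_nested ys)) [] (right_nested (xs @ ys)) h"
  using assms
proof (induction xs)
  case (Cons x xs)
  show ?case
  proof (cases "xs = []")
    case True
    then show ?thesis using Cons.prems braid_composite.ident[of "right_nested (x # ys)" V]
      by (auto simp: right_nested_simps)
  next
    case False
    then obtain h where h: "braid_composite V (Prod (right_nested xs) (right_nested ys)) [] (right_nested (xs @ ys)) h"
      using Cons by auto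
    have a: "braid_composite V (Prod (Prod (Atom x) (right_nested xs)) (right_nested ys)) []
      (Prod (Atom x) (Prod (right_nested xs) (right_nested ys)))
      (\<alpha>' x (product_in V (right_nested xs)) (product_in V (right_nested ys)))"
      using braid_composite.assoc[of "Atom x" "right_nested xs" "right_nested ys" V] Cons.prems False by auto
    have "braid_composite V (Prod (Atom x) (Prod (right_nested xs) (right_nested ys)))
      (shift_word (num_factors (Atom x)) []) (Prod (Atom x) (right_nested (xs @ ys))) (Ident V (product_in V (Atom x)) \<boxtimes> h)"
      by (rule braid_composite.tensor_left[OF h]) (use Cons.prems in auto)
    from braid_composite.comp[OF a this] show ?thesis using False by (auto simp: right_nested_simps)
  qed
qed simp

lemma to_right_nested:
  "set_bracketed s \<subseteq> Obj V \<Longrightarrow> \<exists>h. braid_composite V s [] (right_nested (leaves (tree_of s))) h"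
proof (induction s)
  case (Atom A)
  then show ?case using braid_composite.ident[of "Atom A" V] by auto
next
  case (Prod s t)
  let ?s = "leaves (tree_of s)" and ?t = "leaves (tree_of t)"
  have ne: "?s \<noteq> []" "?t \<noteq> []"
    using num_factors_pos length_leaves_tree_of by (metis less_irrefl list.size(3))+
  have O: "set ?s \<subseteq> Obj V" "set ?t \<subseteq> Obj V"
    using Prod.prems leaves_tree_of_lists[of s "Obj V"] leaves_tree_of_lists[of t "Obj V"] by (auto simp: in_lists_conv_set)
  obtain h where h: "braid_composite V s [] (right_nested ?s) h" using Prod by auto
  obtain k where k: "braid_composite V t [] (right_nested ?t) k" using Prod by auto
  have 1: "braid_composite V (Prod s t) [] (Prod (right_nested ?s) t) (h \<boxtimes> Ident V (product_in V t))"
    by (rule braid_composite.tensor_right[OF h]) (use Prod.prems in auto)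
  have 2: "braid_composite V (Prod (right_nested ?s) t) (shift_word (num_factors (right_nested ?s)) [])
      (Prod (right_nested ?s) (right_nested ?t)) (Ident V (product_in V (right_nested ?s)) \<boxtimes> k)"
    by (rule braid_composite.tensor_left[OF k]) (use O ne in auto)
  obtain l where 3: "braid_composite V (Prod (right_nested ?s) (right_nested ?t)) [] (right_nested (?s @ ?t)) l"
    using right_nested_append[OF ne O] by auto
  show ?case using braid_composite.comp[OF braid_composite.comp[OF 1 2] 3] by auto
qed

text \<open>A composite with empty word contains only associators and their inverses, and the
  generators provide both directions of these.\<close>

lemma braid_composite_Nil_sym:
  assumes "braid_composite V s w t h" "w = []"
  shows "\<exists>k. braid_composite V t [] s k"
  using assms
proof (induction rule: braid_composite.induct)
  case (tensor_right s w t h u)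
  then obtain k where "braid_composite V t [] s k" by auto
  from braid_composite.tensor_right[OF this tensor_right.hyps(2)] show ?case by auto
next
  case (tensor_left s w t h u)
  then have "w = []" by (simp add: shift_word_def)
  then obtain k where "braid_composite V t [] s k" using tensor_left by auto
  from braid_composite.tensor_left[OF this tensor_left.hyps(2)] show ?case by auto
next
  case (comp s w t h w' u h')
  then obtain k k' where "braid_composite V t [] s k" "braid_composite V u [] t k'" by auto
  from braid_composite.comp[OF this(2,1)] show ?case by auto
next
  case (assoc s t u)
  then show ?case using braid_composite.assoc_inv[of s t u V] by auto
next
  case (assoc_inv s t u)
  then show ?case using braid_composite.assoc[of s t u V] by auto
qed (auto intro: braid_composite.intros)

text \<open>Any two bracketings of a list are joined through the right-nested one.\<close>

lemma rebracket:
  assumes "set_bracketed s \<subseteq> Obj V" "leaves (tree_of s) = leaves (tree_of t)"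
  shows "\<exists>h. braid_composite V s [] t h"
proof -
  have t: "set_bracketed t \<subseteq> Obj V"
    using assms leaves_tree_of_lists[of s "Obj V"] leaves_tree_of_lists[of t "Obj V"] by simp
  obtain h where h: "braid_composite V s [] (right_nested (leaves (tree_of s))) h"
    using to_right_nested[OF assms(1)] by auto
  obtain k where "braid_composite V t [] (right_nested (leaves (tree_of t))) k"
    using to_right_nested[OF t] by auto
  then obtain k where "braid_composite V (right_nested (leaves (tree_of t))) [] t k"
    using braid_composite_Nil_sym by blast
  then show ?thesis using braid_composite.comp[OF h] assms(2) by auto
qed

text \<open>The generating crossings exchange two atoms that form a factor, so the bracketings are
  chosen to contain such a factor; \<open>rebracket\<close> later adapts them to any other
  bracketing.\<close>

lemma single_crossing:
  assumes "set pre \<union> set post \<union> {x, y} \<subseteq> Obj V" "i = Suc (length pre)"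
  shows "\<exists>s t h. leaves (tree_of s) = pre @ x # y # post \<and> leaves (tree_of t) = pre @ y # x # post \<and>
    braid_composite V s [(i, e)] t h"
  using assms
proof (induction pre arbitrary: i)
  case Nil
  have "\<exists>h. braid_composite V (Prod (Atom x) (Atom y)) [(1, e)] (Prod (Atom y) (Atom x)) h"
    using braid_composite.braiding[of x V y] braid_composite.braiding_inv[of x V y] Nil by (cases e) auto
  then obtain h where h: "braid_composite V (Prod (Atom x) (Atom y)) [(1, e)] (Prod (Atom y) (Atom x)) h" ..
  show ?case
  proof (cases "post = []")
    case True
    then show ?thesis using h Nil
      by (intro exI[of _ "Prod (Atom x) (Atom y)"] exI[of _ "Prod (Atom y) (Atom x)"] exI[of _ h]) auto
  next
    case False
    have "braid_composite V (Prod (Prod (Atom x) (Atom y)) (right_nested post)) [(1, e)]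
      (Prod (Prod (Atom y) (Atom x)) (right_nested post)) (h \<boxtimes> Ident V (product_in V (right_nested post)))"
      by (rule braid_composite.tensor_right[OF h]) (use Nil False in auto)
    then show ?thesis using Nil False
      by (intro exI[of _ "Prod (Prod (Atom x) (Atom y)) (right_nested post)"]
          exI[of _ "Prod (Prod (Atom y) (Atom x)) (right_nested post)"] exI) auto
  qed
next
  case (Cons p pre)
  obtain s t h where *: "leaves (tree_of s) = pre @ x # y # post" "leaves (tree_of t) = pre @ y # x # post"
    "braid_composite V s [(Suc (length pre), e)] t h"
    using Cons.IH[of "Suc (length pre)"] Cons.prems by auto
  have "braid_composite V (Prod (Atom p) s) (shift_word (num_factors (Atom p)) [(Suc (length pre), e)])
     (Prod (Atom p) t) (Ident V (product_in V (Atom p)) \<boxtimes> h)"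
    by (rule braid_composite.tensor_left[OF *(3)]) (use Cons.prems in auto)
  then show ?case using * Cons.prems
    by (intro exI[of _ "Prod (Atom p) s"] exI[of _ "Prod (Atom p) t"] exI) (auto simp: shift_word_def)
qed

lemma braid_composite_exists:
  assumes "w \<in> braid_words (num_factors s)" "set_bracketed s \<subseteq> Obj V"
    "leaves (tree_of t) = permute w (leaves (tree_of s))"
  shows "\<exists>h. braid_composite V s w t h"
  using assms
proof (induction w arbitrary: s)
  case Nil
  then show ?case using rebracket by simp
next
  case (Cons a w)
  then have "1 \<le> fst a" "fst a < length (leaves (tree_of s))" by auto
  then obtain pre x y post where *: "leaves (tree_of s) = pre @ x # y # post" "fst a = Suc (length pre)"
    by (elim split_at_letter)
  obtain e where a: "a = (Suc (length pre), e)" using * by (cases a) auto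
  have sO: "set (leaves (tree_of s)) \<subseteq> Obj V"
    using Cons.prems(2) leaves_tree_of_lists[of s "Obj V"] by (auto simp: in_lists_conv_set)
  then obtain s' t' h where c: "leaves (tree_of s') = pre @ x # y # post" "leaves (tree_of t') = pre @ y # x # post"
    "braid_composite V s' [a] t' h"
    using single_crossing[of pre post x y "fst a" e] * a by auto
  obtain k where k: "braid_composite V s [] s' k" using rebracket[of s s'] Cons.prems * c by auto
  have t': "num_factors t' = num_factors s" "set_bracketed t' \<subseteq> Obj V"
    using c * sO leaves_tree_of_lists[of t' "Obj V"] length_leaves_tree_of[of s] length_leaves_tree_of[of t']
    by (auto simp: in_lists_conv_set)
  obtain l where l: "braid_composite V t' w t l"
    using Cons.IH[of t'] Cons.prems t' c * by (auto simp: swap_at_split)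
  show ?case using braid_composite.comp[OF braid_composite.comp[OF k c(3)] l] by auto
qed

abbreviation source4 :: "'o \<Rightarrow> 'o \<Rightarrow> 'o \<Rightarrow> 'o \<Rightarrow> 'o bracketed" where
  "source4 A B C D \<equiv> Prod (Prod (Atom A) (Atom B)) (Prod (Atom C) (Atom D))"

text \<open>The definite description denotes an arrow: a composite exists for the word
  \<open>w\<close>, and coherence makes it the same for all words of the class.\<close>

lemma braid_interchange_composite:
  assumes "b \<in> carrier (braid_group 4)" "w \<in> b" "word_perm w = transpose 2 3"
    and "A \<in> Obj V" "B \<in> Obj V" "C \<in> Obj V" "D \<in> Obj V"
  shows "braid_composite V (source4 A B C D) w (source4 A C B D) (braid_interchange b V A B C D)"
proof -
  let ?P = "\<lambda>h. \<exists>w\<in>b. braid_composite V (source4 A B C D) w (source4 A C B D) h"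
  have w4: "w \<in> braid_words 4" using braid_class_carrier[OF assms(1,2)] by simp
  have "\<exists>h. braid_composite V (source4 A B C D) w (source4 A C B D) h"
    using assms w4 permute_transpose_2_3[OF w4 assms(3), of A B C D]
    by (intro braid_composite_exists) (simp_all add: eval_nat_numeral)
  then obtain h where h: "braid_composite V (source4 A B C D) w (source4 A C B D) h" ..
  have "(THE h. ?P h) = h"
  proof (rule the_equality)
    show "?P h" using h assms(2) by blast
    fix k assume "?P k"
    then obtain v where v: "v \<in> b" "braid_composite V (source4 A B C D) v (source4 A C B D) k" by blast
    show "k = h"
      by (rule braid_composite_unique[OF v(2) h braid_class_rel[OF assms(1) v(1) assms(2)]])
        (simp add: eval_nat_numeral)
  qed
  then show ?thesis using h assms by (simp add: braid_interchange_def)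
qed

lemma braid_interchange_realizes:
  assumes "b \<in> carrier (braid_group 4)" "w \<in> b" "word_perm w = transpose 2 3"
    and "A \<in> Obj V" "B \<in> Obj V" "C \<in> Obj V" "D \<in> Obj V"
  shows "realizes (Node (Node (Leaf A) (Leaf B)) (Node (Leaf C) (Leaf D))) (strict.act w [[A], [B], [C], [D]])
    (Node (Node (Leaf A) (Leaf C)) (Node (Leaf B) (Leaf D))) (braid_interchange b V A B C D)"
  using braid_composite_realizes[OF braid_interchange_composite[OF assms]] by simp

end

section \<open>Categories of structured categories\<close>

lemma is_functorD:
  assumes "is_functor C D F"
  shows "category C" "category D" "A \<in> Obj C \<Longrightarrow> FObj F A \<in> Obj D"
    "f \<in> Arr C \<Longrightarrow> FArr F f \<in> Arr D"
    "f \<in> Arr C \<Longrightarrow> Dom D (FArr F f) = FObj F (Dom C f)"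
    "f \<in> Arr C \<Longrightarrow> Cod D (FArr F f) = FObj F (Cod C f)"
    "A \<in> Obj C \<Longrightarrow> FArr F (Ident C A) = Ident D (FObj F A)"
    "f \<in> Arr C \<Longrightarrow> g \<in> Arr C \<Longrightarrow> Cod C f = Dom C g \<Longrightarrow> FArr F (g \<cdot>\<^bsub>C\<^esub> f) = FArr F g \<cdot>\<^bsub>D\<^esub> FArr F f"
    "FObj F \<in> extensional (Obj C)" "FArr F \<in> extensional (Arr C)"
  using assms unfolding is_functor_def homset_def PiE_def by auto

lemma is_functorI:
  assumes "category C" "category D" "\<And>A. A \<in> Obj C \<Longrightarrow> FObj F A \<in> Obj D"
    "\<And>f. f \<in> Arr C \<Longrightarrow> FArr F f \<in> Arr D \<and> Dom D (FArr F f) = FObj F (Dom C f) \<and> Cod D (FArr F f) = FObj F (Cod C f)"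
    "\<And>A. A \<in> Obj C \<Longrightarrow> FArr F (Ident C A) = Ident D (FObj F A)"
    "\<And>f g. f \<in> Arr C \<Longrightarrow> g \<in> Arr C \<Longrightarrow> Cod C f = Dom C g \<Longrightarrow> FArr F (g \<cdot>\<^bsub>C\<^esub> f) = FArr F g \<cdot>\<^bsub>D\<^esub> FArr F f"
    "FObj F \<in> extensional (Obj C)" "FArr F \<in> extensional (Arr C)"
  shows "is_functor C D F"
  using assms unfolding is_functor_def homset_def by (auto simp: PiE_def)

lemma functor_data_eqI:
  assumes "FObj F \<in> extensional O'" "FObj G \<in> extensional O'" "FArr F \<in> extensional A'" "FArr G \<in> extensional A'"
    "\<And>A. A \<in> O' \<Longrightarrow> FObj F A = FObj G A" "\<And>f. f \<in> A' \<Longrightarrow> FArr F f = FArr G f"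
  shows "F = (G :: ('o, 'a, 'p, 'b) functor_data)"
  using assms by (intro functor_data.equality) (auto intro: extensionalityI)

lemma comp_functor_sel [simp]:
  "A \<in> Obj C \<Longrightarrow> FObj (comp_functor C G F) A = FObj G (FObj F A)"
  "f \<in> Arr C \<Longrightarrow> FArr (comp_functor C G F) f = FArr G (FArr F f)"
  "FObj (comp_functor C G F) \<in> extensional (Obj C)" "FArr (comp_functor C G F) \<in> extensional (Arr C)"
  by (simp_all add: comp_functor_def compose_def)

lemma id_functor_sel [simp]:
  "A \<in> Obj C \<Longrightarrow> FObj (id_functor C) A = A" "f \<in> Arr C \<Longrightarrow> FArr (id_functor C) f = f"
  "FObj (id_functor C) \<in> extensional (Obj C)" "FArr (id_functor C) \<in> extensional (Arr C)"
  by (simp_all add: id_functor_def)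

lemma is_functor_id: "category C \<Longrightarrow> is_functor C C (id_functor C)"
proof -
  assume "category C"
  then interpret category C .
  show ?thesis by (rule is_functorI) (auto simp: \<open>category C\<close>)
qed

lemma is_functor_comp:
  assumes F: "is_functor C D F" and G: "is_functor D E G"
  shows "is_functor C E (comp_functor C G F)"
proof -
  interpret C: category C using is_functorD(1)[OF F] .
  show ?thesis
    by (rule is_functorI) (simp_all add: is_functorD[OF F] is_functorD[OF G])
qed

lemma laxD:
  assumes "lax_monoidal_functor C T I D S J F \<phi>"
  shows "is_functor C D F" "FObj F I = J"
    "A \<in> Obj C \<Longrightarrow> B \<in> Obj C \<Longrightarrow> \<phi> A B \<in> Arr D"
    "A \<in> Obj C \<Longrightarrow> B \<in> Obj C \<Longrightarrow> Dom D (\<phi> A B) = FObj F A \<odot>\<^bsub>S\<^esub> FObj F B"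
    "A \<in> Obj C \<Longrightarrow> B \<in> Obj C \<Longrightarrow> Cod D (\<phi> A B) = FObj F (A \<odot>\<^bsub>T\<^esub> B)"
    "f \<in> Arr C \<Longrightarrow> g \<in> Arr C \<Longrightarrow> \<phi> (Cod C f) (Cod C g) \<cdot>\<^bsub>D\<^esub> (FArr F f \<star>\<^bsub>S\<^esub> FArr F g) =
      FArr F (f \<star>\<^bsub>T\<^esub> g) \<cdot>\<^bsub>D\<^esub> \<phi> (Dom C f) (Dom C g)"
    "A \<in> Obj C \<Longrightarrow> B \<in> Obj C \<Longrightarrow> E \<in> Obj C \<Longrightarrow>
       \<phi> A (B \<odot>\<^bsub>T\<^esub> E) \<cdot>\<^bsub>D\<^esub> (Ident D (FObj F A) \<star>\<^bsub>S\<^esub> \<phi> B E) \<cdot>\<^bsub>D\<^esub> Assoc S (FObj F A) (FObj F B) (FObj F E) =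
       FArr F (Assoc T A B E) \<cdot>\<^bsub>D\<^esub> \<phi> (A \<odot>\<^bsub>T\<^esub> B) E \<cdot>\<^bsub>D\<^esub> (\<phi> A B \<star>\<^bsub>S\<^esub> Ident D (FObj F E))"
    "A \<in> Obj C \<Longrightarrow> \<phi> A I = Ident D (FObj F A)" "A \<in> Obj C \<Longrightarrow> \<phi> I A = Ident D (FObj F A)"
    "case_prod \<phi> \<in> extensional (Obj C \<times> Obj C)"
proof -
  show "f \<in> Arr C \<Longrightarrow> g \<in> Arr C \<Longrightarrow> \<phi> (Cod C f) (Cod C g) \<cdot>\<^bsub>D\<^esub> (FArr F f \<star>\<^bsub>S\<^esub> FArr F g) =
      FArr F (f \<star>\<^bsub>T\<^esub> g) \<cdot>\<^bsub>D\<^esub> \<phi> (Dom C f) (Dom C g)"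
    using assms unfolding lax_monoidal_functor_def homset_def by blast
qed (use assms in \<open>unfold lax_monoidal_functor_def homset_def, auto\<close>)

lemma laxI:
  assumes "is_functor C D F" "FObj F I = J" "case_prod \<phi> \<in> extensional (Obj C \<times> Obj C)"
    "\<And>A B. A \<in> Obj C \<Longrightarrow> B \<in> Obj C \<Longrightarrow>
      \<phi> A B \<in> Arr D \<and> Dom D (\<phi> A B) = FObj F A \<odot>\<^bsub>S\<^esub> FObj F B \<and> Cod D (\<phi> A B) = FObj F (A \<odot>\<^bsub>T\<^esub> B)"
    "\<And>f g. f \<in> Arr C \<Longrightarrow> g \<in> Arr C \<Longrightarrow> \<phi> (Cod C f) (Cod C g) \<cdot>\<^bsub>D\<^esub> (FArr F f \<star>\<^bsub>S\<^esub> FArr F g) =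
      FArr F (f \<star>\<^bsub>T\<^esub> g) \<cdot>\<^bsub>D\<^esub> \<phi> (Dom C f) (Dom C g)"
    "\<And>A B E. A \<in> Obj C \<Longrightarrow> B \<in> Obj C \<Longrightarrow> E \<in> Obj C \<Longrightarrow>
       \<phi> A (B \<odot>\<^bsub>T\<^esub> E) \<cdot>\<^bsub>D\<^esub> (Ident D (FObj F A) \<star>\<^bsub>S\<^esub> \<phi> B E) \<cdot>\<^bsub>D\<^esub> Assoc S (FObj F A) (FObj F B) (FObj F E) =
       FArr F (Assoc T A B E) \<cdot>\<^bsub>D\<^esub> \<phi> (A \<odot>\<^bsub>T\<^esub> B) E \<cdot>\<^bsub>D\<^esub> (\<phi> A B \<star>\<^bsub>S\<^esub> Ident D (FObj F E))"
    "\<And>A. A \<in> Obj C \<Longrightarrow> \<phi> A I = Ident D (FObj F A) \<and> \<phi> I A = Ident D (FObj F A)"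
  shows "lax_monoidal_functor C T I D S J F \<phi>"
  unfolding lax_monoidal_functor_def
proof (intro conjI ballI allI)
  fix A A' B B' f g assume "f \<in> homset C A A'" "g \<in> homset C B B'"
  then show "\<phi> A' B' \<cdot>\<^bsub>D\<^esub> (FArr F f \<star>\<^bsub>S\<^esub> FArr F g) = FArr F (f \<star>\<^bsub>T\<^esub> g) \<cdot>\<^bsub>D\<^esub> \<phi> A B"
    using assms(5)[of f g] by (auto simp: homset_def)
qed (use assms in \<open>auto simp: homset_def\<close>)

lemma id_coherence_simp [simp]:
  "A \<in> Obj C \<Longrightarrow> B \<in> Obj C \<Longrightarrow> id_coherence C T A B = Ident C (A \<odot>\<^bsub>T\<^esub> B)"
  "case_prod (id_coherence C T) \<in> extensional (Obj C \<times> Obj C)"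
  by (auto simp: id_coherence_def extensional_def)

lemma comp_coherence_simp [simp]:
  "A \<in> Obj C \<Longrightarrow> B \<in> Obj C \<Longrightarrow>
    comp_coherence C E G \<psi> F \<phi> A B = FArr G (\<phi> A B) \<cdot>\<^bsub>E\<^esub> \<psi> (FObj F A) (FObj F B)"
  "case_prod (comp_coherence C E G \<psi> F \<phi>) \<in> extensional (Obj C \<times> Obj C)"
  by (auto simp: comp_coherence_def extensional_def)

lemma coherence_eqI:
  assumes "case_prod \<phi> \<in> extensional (O' \<times> O')" "case_prod \<psi> \<in> extensional (O' \<times> O')"
    "\<And>A B. A \<in> O' \<Longrightarrow> B \<in> O' \<Longrightarrow> \<phi> A B = \<psi> A B"
  shows "\<phi> = \<psi>"
proof (intro ext)
  fix A B
  show "\<phi> A B = \<psi> A B"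
    using assms extensional_arb[OF assms(1), of "(A, B)"] extensional_arb[OF assms(2), of "(A, B)"]
    by (cases "A \<in> O' \<and> B \<in> O'") auto
qed

lemma lax_id:
  assumes "monoidal C T I"
  shows "lax_monoidal_functor C T I C T I (id_functor C) (id_coherence C T)"
proof -
  interpret monoidal C T I by fact
  show ?thesis
    by (rule laxI) (simp_all add: is_functor_id category_axioms)
qed

text \<open>For associativity, naturality of \<open>\<psi>\<close> moves the image of
  \<open>\<phi>\<close> past \<open>\<psi>\<close>, once before the axiom for \<open>G\<close> is
  applied and once after the axiom for \<open>F\<close>.\<close>

lemma lax_comp:
  assumes C: "monoidal C T I" and D: "monoidal D S J" and E: "monoidal E U K"
    and F: "lax_monoidal_functor C T I D S J F \<phi>" and G: "lax_monoidal_functor D S J E U K G \<psi>"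
  shows "lax_monoidal_functor C T I E U K (comp_functor C G F) (comp_coherence C E G \<psi> F \<phi>)"
proof -
  interpret C: monoidal C T I by fact
  interpret D: monoidal D S J by fact
  interpret E: monoidal E U K by fact
  note Fu = laxD(1)[OF F] and Gu = laxD(1)[OF G]
  note [simp] = is_functorD(3-8)[OF Fu] is_functorD(3-8)[OF Gu] laxD(2-5,8,9)[OF F] laxD(2-5,8,9)[OF G]
  show ?thesis
  proof (rule laxI)
    show "is_functor C E (comp_functor C G F)" by (rule is_functor_comp[OF Fu Gu])
  next
    fix f g assume [simp]: "f \<in> Arr C" "g \<in> Arr C"
    let ?Gf = "FArr G (FArr F f)" and ?Gg = "FArr G (FArr F g)"
    have "FArr G (\<phi> (Cod C f) (Cod C g)) \<cdot>\<^bsub>E\<^esub> \<psi> (FObj F (Cod C f)) (FObj F (Cod C g)) \<cdot>\<^bsub>E\<^esub> (?Gf \<star>\<^bsub>U\<^esub> ?Gg)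
      = FArr G (\<phi> (Cod C f) (Cod C g)) \<cdot>\<^bsub>E\<^esub> FArr G (FArr F f \<star>\<^bsub>S\<^esub> FArr F g) \<cdot>\<^bsub>E\<^esub> \<psi> (FObj F (Dom C f)) (FObj F (Dom C g))"
      using laxD(6)[OF G, of "FArr F f" "FArr F g"] by simp
    also have "\<dots> = FArr G (\<phi> (Cod C f) (Cod C g) \<cdot>\<^bsub>D\<^esub> (FArr F f \<star>\<^bsub>S\<^esub> FArr F g)) \<cdot>\<^bsub>E\<^esub> \<psi> (FObj F (Dom C f)) (FObj F (Dom C g))"
      by simp
    also have "\<phi> (Cod C f) (Cod C g) \<cdot>\<^bsub>D\<^esub> (FArr F f \<star>\<^bsub>S\<^esub> FArr F g) = FArr F (f \<star>\<^bsub>T\<^esub> g) \<cdot>\<^bsub>D\<^esub> \<phi> (Dom C f) (Dom C g)"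
      by (rule laxD(6)[OF F]) auto
    finally show "comp_coherence C E G \<psi> F \<phi> (Cod C f) (Cod C g) \<cdot>\<^bsub>E\<^esub>
        (FArr (comp_functor C G F) f \<star>\<^bsub>U\<^esub> FArr (comp_functor C G F) g) =
      FArr (comp_functor C G F) (f \<star>\<^bsub>T\<^esub> g) \<cdot>\<^bsub>E\<^esub> comp_coherence C E G \<psi> F \<phi> (Dom C f) (Dom C g)"
      by simp
  next
    fix A B X assume [simp]: "A \<in> Obj C" "B \<in> Obj C" "X \<in> Obj C"
    let ?F = "FObj F" and ?GF = "\<lambda>A. FObj G (FObj F A)"
    let ?G = "FArr G"
    note nat = E.Comp_tail[OF laxD(6)[OF G]]
    have "?G (\<phi> A (B \<odot>\<^bsub>T\<^esub> X)) \<cdot>\<^bsub>E\<^esub> \<psi> (?F A) (?F (B \<odot>\<^bsub>T\<^esub> X)) \<cdot>\<^bsub>E\<^esub>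
         (Ident E (?GF A) \<star>\<^bsub>U\<^esub> (?G (\<phi> B X) \<cdot>\<^bsub>E\<^esub> \<psi> (?F B) (?F X))) \<cdot>\<^bsub>E\<^esub> Assoc U (?GF A) (?GF B) (?GF X)
      = ?G (\<phi> A (B \<odot>\<^bsub>T\<^esub> X)) \<cdot>\<^bsub>E\<^esub> \<psi> (?F A) (?F (B \<odot>\<^bsub>T\<^esub> X)) \<cdot>\<^bsub>E\<^esub> (?G (Ident D (?F A)) \<star>\<^bsub>U\<^esub> ?G (\<phi> B X)) \<cdot>\<^bsub>E\<^esub>
         (Ident E (?GF A) \<star>\<^bsub>U\<^esub> \<psi> (?F B) (?F X)) \<cdot>\<^bsub>E\<^esub> Assoc U (?GF A) (?GF B) (?GF X)"
      by (simp add: E.TArr_Comp_tail)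
    also have "\<dots> = ?G (\<phi> A (B \<odot>\<^bsub>T\<^esub> X)) \<cdot>\<^bsub>E\<^esub> ?G (Ident D (?F A) \<star>\<^bsub>S\<^esub> \<phi> B X) \<cdot>\<^bsub>E\<^esub> \<psi> (?F A) (?F B \<odot>\<^bsub>S\<^esub> ?F X) \<cdot>\<^bsub>E\<^esub>
         (Ident E (?GF A) \<star>\<^bsub>U\<^esub> \<psi> (?F B) (?F X)) \<cdot>\<^bsub>E\<^esub> Assoc U (?GF A) (?GF B) (?GF X)"
      using nat[of "Ident D (?F A)" "\<phi> B X"
          "(Ident E (?GF A) \<star>\<^bsub>U\<^esub> \<psi> (?F B) (?F X)) \<cdot>\<^bsub>E\<^esub> Assoc U (?GF A) (?GF B) (?GF X)"] by simp
    also have "\<psi> (?F A) (?F B \<odot>\<^bsub>S\<^esub> ?F X) \<cdot>\<^bsub>E\<^esub> (Ident E (?GF A) \<star>\<^bsub>U\<^esub> \<psi> (?F B) (?F X)) \<cdot>\<^bsub>E\<^esub> Assoc U (?GF A) (?GF B) (?GF X)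
      = ?G (Assoc S (?F A) (?F B) (?F X)) \<cdot>\<^bsub>E\<^esub> \<psi> (?F A \<odot>\<^bsub>S\<^esub> ?F B) (?F X) \<cdot>\<^bsub>E\<^esub> (\<psi> (?F A) (?F B) \<star>\<^bsub>U\<^esub> Ident E (?GF X))"
      using laxD(7)[OF G, of "?F A" "?F B" "?F X"] by simp
    also have "?G (\<phi> A (B \<odot>\<^bsub>T\<^esub> X)) \<cdot>\<^bsub>E\<^esub> ?G (Ident D (?F A) \<star>\<^bsub>S\<^esub> \<phi> B X) \<cdot>\<^bsub>E\<^esub>
        ?G (Assoc S (?F A) (?F B) (?F X)) \<cdot>\<^bsub>E\<^esub> \<psi> (?F A \<odot>\<^bsub>S\<^esub> ?F B) (?F X) \<cdot>\<^bsub>E\<^esub> (\<psi> (?F A) (?F B) \<star>\<^bsub>U\<^esub> Ident E (?GF X))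
      = ?G (\<phi> A (B \<odot>\<^bsub>T\<^esub> X) \<cdot>\<^bsub>D\<^esub> (Ident D (?F A) \<star>\<^bsub>S\<^esub> \<phi> B X) \<cdot>\<^bsub>D\<^esub> Assoc S (?F A) (?F B) (?F X))
         \<cdot>\<^bsub>E\<^esub> \<psi> (?F A \<odot>\<^bsub>S\<^esub> ?F B) (?F X) \<cdot>\<^bsub>E\<^esub> (\<psi> (?F A) (?F B) \<star>\<^bsub>U\<^esub> Ident E (?GF X))"
      by simp
    also have "\<dots> = ?G (FArr F (Assoc T A B X) \<cdot>\<^bsub>D\<^esub> \<phi> (A \<odot>\<^bsub>T\<^esub> B) X \<cdot>\<^bsub>D\<^esub> (\<phi> A B \<star>\<^bsub>S\<^esub> Ident D (?F X)))
         \<cdot>\<^bsub>E\<^esub> \<psi> (?F A \<odot>\<^bsub>S\<^esub> ?F B) (?F X) \<cdot>\<^bsub>E\<^esub> (\<psi> (?F A) (?F B) \<star>\<^bsub>U\<^esub> Ident E (?GF X))"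
      by (subst laxD(7)[OF F]) auto
    also have "\<dots> = ?G (FArr F (Assoc T A B X)) \<cdot>\<^bsub>E\<^esub> ?G (\<phi> (A \<odot>\<^bsub>T\<^esub> B) X) \<cdot>\<^bsub>E\<^esub> ?G (\<phi> A B \<star>\<^bsub>S\<^esub> Ident D (?F X))
         \<cdot>\<^bsub>E\<^esub> \<psi> (?F A \<odot>\<^bsub>S\<^esub> ?F B) (?F X) \<cdot>\<^bsub>E\<^esub> (\<psi> (?F A) (?F B) \<star>\<^bsub>U\<^esub> Ident E (?GF X))"
      by simp
    also have "\<dots> = ?G (FArr F (Assoc T A B X)) \<cdot>\<^bsub>E\<^esub> ?G (\<phi> (A \<odot>\<^bsub>T\<^esub> B) X) \<cdot>\<^bsub>E\<^esub> \<psi> (?F (A \<odot>\<^bsub>T\<^esub> B)) (?F X)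
         \<cdot>\<^bsub>E\<^esub> (?G (\<phi> A B) \<star>\<^bsub>U\<^esub> ?G (Ident D (?F X))) \<cdot>\<^bsub>E\<^esub> (\<psi> (?F A) (?F B) \<star>\<^bsub>U\<^esub> Ident E (?GF X))"
      using nat[of "\<phi> A B" "Ident D (?F X)" "\<psi> (?F A) (?F B) \<star>\<^bsub>U\<^esub> Ident E (?GF X)"] by simp
    finally show "comp_coherence C E G \<psi> F \<phi> A (B \<odot>\<^bsub>T\<^esub> X) \<cdot>\<^bsub>E\<^esub>
        (Ident E (FObj (comp_functor C G F) A) \<star>\<^bsub>U\<^esub> comp_coherence C E G \<psi> F \<phi> B X) \<cdot>\<^bsub>E\<^esub>
        Assoc U (FObj (comp_functor C G F) A) (FObj (comp_functor C G F) B) (FObj (comp_functor C G F) X) =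
      FArr (comp_functor C G F) (Assoc T A B X) \<cdot>\<^bsub>E\<^esub> comp_coherence C E G \<psi> F \<phi> (A \<odot>\<^bsub>T\<^esub> B) X \<cdot>\<^bsub>E\<^esub>
        (comp_coherence C E G \<psi> F \<phi> A B \<star>\<^bsub>U\<^esub> Ident E (FObj (comp_functor C G F) X))"
      by (simp add: E.TArr_Comp')
  qed simp_all
qed

lemma comp_functor_assoc:
  assumes "is_functor C D F" "is_functor D E G"
  shows "comp_functor C (comp_functor D H G) F = comp_functor C H (comp_functor C G F)"
  by (rule functor_data_eqI[where O' = "Obj C" and A' = "Arr C"]) (use is_functorD(3,4)[OF assms(1)] in simp_all)

lemma comp_functor_id:
  assumes "is_functor C D F"
  shows "comp_functor C F (id_functor C) = F" "comp_functor C (id_functor D) F = F"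
  by (rule functor_data_eqI[where O' = "Obj C" and A' = "Arr C"]; use is_functorD[OF assms] in simp)+

lemma comp_coherence_assoc:
  assumes E: "category E'" and F: "lax_monoidal_functor C T I D S J F \<phi>"
    and G: "lax_monoidal_functor D S J E U K G \<psi>" and D: "monoidal D S J" and E': "category E"
    and H: "lax_monoidal_functor E U K E' U' K' H \<chi>"
  shows "comp_coherence C E' (comp_functor D H G) (comp_coherence D E' H \<chi> G \<psi>) F \<phi> =
    comp_coherence C E' H \<chi> (comp_functor C G F) (comp_coherence C E G \<psi> F \<phi>)"
proof (rule coherence_eqI[where O' = "Obj C"])
  interpret E': category E' by fact
  interpret E: category E by fact
  interpret D: monoidal D S J by fact
  fix A B assume [simp]: "A \<in> Obj C" "B \<in> Obj C"
  note Fu = laxD(1)[OF F] and Gu = laxD(1)[OF G] and Hu = laxD(1)[OF H]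
  note [simp] = is_functorD(3-8)[OF Fu] is_functorD(3-8)[OF Gu] is_functorD(3-8)[OF Hu]
    laxD(3-5)[OF F] laxD(3-5)[OF G] laxD(3-5)[OF H]
  show "comp_coherence C E' (comp_functor D H G) (comp_coherence D E' H \<chi> G \<psi>) F \<phi> A B =
    comp_coherence C E' H \<chi> (comp_functor C G F) (comp_coherence C E G \<psi> F \<phi>) A B"
    by simp
qed simp_all

lemma comp_coherence_id:
  assumes F: "lax_monoidal_functor C T I D S J F \<phi>" and C: "monoidal C T I" and D: "monoidal D S J"
  shows "comp_coherence C D F \<phi> (id_functor C) (id_coherence C T) = \<phi>"
    "comp_coherence C D (id_functor D) (id_coherence D S) F \<phi> = \<phi>"
proof -
  interpret C: monoidal C T I by fact
  interpret D: monoidal D S J by fact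
  note [simp] = is_functorD(3-8)[OF laxD(1)[OF F]] laxD(3-5)[OF F]
  show "comp_coherence C D F \<phi> (id_functor C) (id_coherence C T) = \<phi>"
    "comp_coherence C D (id_functor D) (id_coherence D S) F \<phi> = \<phi>"
    by (rule coherence_eqI[where O' = "Obj C"]; simp add: laxD(10)[OF F])+
qed

section \<open>The category of braided categories\<close>

lemma is_braided_functorD:
  assumes "is_braided_functor f"
  shows "braided_category (BSource f)" "braided_category (BTarget f)"
    "lax_monoidal_functor (BSource f) (Ten (BSource f)) (BUnit (BSource f))
       (BTarget f) (Ten (BTarget f)) (BUnit (BTarget f)) (BFun f) (Phi f)"
    "A \<in> Obj (BSource f) \<Longrightarrow> B \<in> Obj (BSource f) \<Longrightarrow>
       FArr (BFun f) (Braiding (BSource f) A B) \<cdot>\<^bsub>BTarget f\<^esub> Phi f A B =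
       Phi f B A \<cdot>\<^bsub>BTarget f\<^esub> Braiding (BTarget f) (FObj (BFun f) A) (FObj (BFun f) B)"
  using assms by (auto simp: is_braided_functor_def Let_def)

lemma braided_category_monoidal: "braided_category V \<Longrightarrow> monoidal V (Ten V) (BUnit V)"
  by (rule braided_category.axioms)

lemma is_braided_functor_id:
  assumes "braided_category V"
  shows "is_braided_functor (id_braided_functor V)"
proof -
  interpret braided_category V by fact
  show ?thesis unfolding is_braided_functor_def id_braided_functor_def Let_def
    using assms lax_id[OF monoidal_axioms] by auto
qed

lemma is_braided_functor_comp:
  assumes f: "is_braided_functor f" and g: "is_braided_functor g" and fg: "BTarget f = BSource g"
  shows "is_braided_functor (comp_braided_functor g f)"
proof -
  note F = is_braided_functorD[OF f, unfolded fg] and G = is_braided_functorD[OF g]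
  interpret C: braided_category "BSource f" using F(1) .
  interpret D: braided_category "BSource g" using F(2) .
  interpret E: braided_category "BTarget g" using G(2) .
  note Fu = laxD(1)[OF F(3)] and Gu = laxD(1)[OF G(3)]
  note [simp] = is_functorD(3-8)[OF Fu] is_functorD(3-8)[OF Gu] laxD(3-5)[OF F(3)] laxD(3-5)[OF G(3)]
  let ?F = "BFun f" and ?G = "BFun g" and ?\<phi> = "Phi f" and ?\<psi> = "Phi g"
  have "FArr ?G (FArr ?F (Braiding (BSource f) A B)) \<cdot>\<^bsub>BTarget g\<^esub> FArr ?G (?\<phi> A B) \<cdot>\<^bsub>BTarget g\<^esub> ?\<psi> (FObj ?F A) (FObj ?F B)
     = FArr ?G (?\<phi> B A) \<cdot>\<^bsub>BTarget g\<^esub> ?\<psi> (FObj ?F B) (FObj ?F A) \<cdot>\<^bsub>BTarget g\<^esub>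
        Braiding (BTarget g) (FObj ?G (FObj ?F A)) (FObj ?G (FObj ?F B))"
    if [simp]: "A \<in> Obj (BSource f)" "B \<in> Obj (BSource f)" for A B
  proof -
    have "FArr ?G (FArr ?F (Braiding (BSource f) A B)) \<cdot>\<^bsub>BTarget g\<^esub> FArr ?G (?\<phi> A B) \<cdot>\<^bsub>BTarget g\<^esub> ?\<psi> (FObj ?F A) (FObj ?F B)
      = FArr ?G (FArr ?F (Braiding (BSource f) A B) \<cdot>\<^bsub>BSource g\<^esub> ?\<phi> A B) \<cdot>\<^bsub>BTarget g\<^esub> ?\<psi> (FObj ?F A) (FObj ?F B)"
      by simp
    also have "\<dots> = FArr ?G (?\<phi> B A) \<cdot>\<^bsub>BTarget g\<^esub> FArr ?G (Braiding (BSource g) (FObj ?F A) (FObj ?F B)) \<cdot>\<^bsub>BTarget g\<^esub> ?\<psi> (FObj ?F A) (FObj ?F B)"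
      by (simp add: F(4))
    also have "\<dots> = FArr ?G (?\<phi> B A) \<cdot>\<^bsub>BTarget g\<^esub> ?\<psi> (FObj ?F B) (FObj ?F A) \<cdot>\<^bsub>BTarget g\<^esub>
        Braiding (BTarget g) (FObj ?G (FObj ?F A)) (FObj ?G (FObj ?F B))"
      by (simp add: G(4))
    finally show ?thesis .
  qed
  then show ?thesis unfolding is_braided_functor_def comp_braided_functor_def Let_def
    using F(1) G(2) lax_comp[OF C.monoidal_axioms D.monoidal_axioms E.monoidal_axioms F(3) G(3)] by simp
qed

lemma BraidedCat_simps [simp]:
  "Obj BraidedCat = {V. braided_category V}" "Arr BraidedCat = {f. is_braided_functor f}"
  "is_braided_functor f \<Longrightarrow> Dom BraidedCat f = BSource f"
  "is_braided_functor f \<Longrightarrow> Cod BraidedCat f = BTarget f"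
  "braided_category V \<Longrightarrow> Ident BraidedCat V = id_braided_functor V"
  "is_braided_functor f \<Longrightarrow> is_braided_functor g \<Longrightarrow> BTarget f = BSource g \<Longrightarrow>
    g \<cdot>\<^bsub>BraidedCat\<^esub> f = comp_braided_functor g f"
  by (simp_all add: BraidedCat_def)

lemma braided_functor_sel [simp]:
  "BSource (id_braided_functor V) = V" "BTarget (id_braided_functor V) = V"
  "BSource (comp_braided_functor g f) = BSource f" "BTarget (comp_braided_functor g f) = BTarget g"
  by (simp_all add: id_braided_functor_def comp_braided_functor_def)

lemma category_BraidedCat: "category (BraidedCat :: (('o, 'a) braided, ('o, 'a) braided_functor) cat)"
proof
  fix f g h :: "('o, 'a) braided_functor" and A B D E
  assume "f \<in> homset BraidedCat A B" "g \<in> homset BraidedCat B D" "h \<in> homset BraidedCat D E"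
  then have *: "is_braided_functor f" "is_braided_functor g" "is_braided_functor h"
    "BTarget f = BSource g" "BTarget g = BSource h" by (auto simp: homset_def)
  note F = is_braided_functorD[OF *(1)] and G = is_braided_functorD[OF *(2)] and H = is_braided_functorD[OF *(3)]
  interpret E: braided_category "BTarget h" using H(2) .
  interpret D: braided_category "BSource g" using G(1) .
  interpret D': braided_category "BSource h" using H(1) .
  have "comp_braided_functor (comp_braided_functor h g) f = comp_braided_functor h (comp_braided_functor g f)"
    unfolding comp_braided_functor_def
    using comp_functor_assoc[OF laxD(1)[OF F(3), unfolded *(4)] laxD(1)[OF G(3)]]
      comp_coherence_assoc[OF E.category_axioms F(3)[unfolded *(4)] G(3)[unfolded *(5)] D.monoidal_axioms D'.category_axioms H(3)] *
    by simp
  then show "(h \<cdot>\<^bsub>BraidedCat\<^esub> g) \<cdot>\<^bsub>BraidedCat\<^esub> f = h \<cdot>\<^bsub>BraidedCat\<^esub> g \<cdot>\<^bsub>BraidedCat\<^esub> f"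
    using * by (simp add: is_braided_functor_comp)
next
  fix f :: "('o, 'a) braided_functor" and A B
  assume "f \<in> homset BraidedCat A B"
  then have *: "is_braided_functor f" "BSource f = A" "BTarget f = B" by (auto simp: homset_def)
  note F = is_braided_functorD[OF *(1)]
  interpret C: braided_category "BSource f" using F(1) .
  interpret D: braided_category "BTarget f" using F(2) .
  note id = comp_functor_id[OF laxD(1)[OF F(3)]]
    comp_coherence_id[OF F(3) C.monoidal_axioms D.monoidal_axioms]
  have "comp_braided_functor f (id_braided_functor A) = f" "comp_braided_functor (id_braided_functor B) f = f"
    unfolding comp_braided_functor_def id_braided_functor_def using id by (simp_all flip: *(2,3))
  then show "f \<cdot>\<^bsub>BraidedCat\<^esub> Ident BraidedCat A = f" "Ident BraidedCat B \<cdot>\<^bsub>BraidedCat\<^esub> f = f"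
    using * F(1,2) by (auto simp: is_braided_functor_id)
qed (auto simp: BraidedCat_def homset_def is_braided_functorD is_braided_functor_id is_braided_functor_comp)

section \<open>The category of 2-fold monoidal categories\<close>

lemma is_two_fold_functorD:
  assumes "is_two_fold_functor f"
  shows "two_fold_monoidal (TSource f)" "two_fold_monoidal (TTarget f)"
    "lax_monoidal_functor (TSource f) (Ten1 (TSource f)) (TUnit (TSource f))
       (TTarget f) (Ten1 (TTarget f)) (TUnit (TTarget f)) (TFun f) (Lambda1 f)"
    "lax_monoidal_functor (TSource f) (Ten2 (TSource f)) (TUnit (TSource f))
       (TTarget f) (Ten2 (TTarget f)) (TUnit (TTarget f)) (TFun f) (Lambda2 f)"
    "A \<in> Obj (TSource f) \<Longrightarrow> B \<in> Obj (TSource f) \<Longrightarrow> C \<in> Obj (TSource f) \<Longrightarrow> D \<in> Obj (TSource f) \<Longrightarrow>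
     Lambda2 f (A \<odot>\<^bsub>Ten1 (TSource f)\<^esub> C) (B \<odot>\<^bsub>Ten1 (TSource f)\<^esub> D)
           \<cdot>\<^bsub>TTarget f\<^esub> (Lambda1 f A C \<star>\<^bsub>Ten2 (TTarget f)\<^esub> Lambda1 f B D)
           \<cdot>\<^bsub>TTarget f\<^esub> Eta (TTarget f) (FObj (TFun f) A) (FObj (TFun f) B) (FObj (TFun f) C) (FObj (TFun f) D) =
         FArr (TFun f) (Eta (TSource f) A B C D)
           \<cdot>\<^bsub>TTarget f\<^esub> Lambda1 f (A \<odot>\<^bsub>Ten2 (TSource f)\<^esub> B) (C \<odot>\<^bsub>Ten2 (TSource f)\<^esub> D)
           \<cdot>\<^bsub>TTarget f\<^esub> (Lambda2 f A B \<star>\<^bsub>Ten1 (TTarget f)\<^esub> Lambda2 f C D)"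
  using assms by (auto simp: is_two_fold_functor_def Let_def)

context two_fold_monoidal
begin

lemma Eta_typed [simp]:
  assumes "A \<in> Obj M" "B \<in> Obj M" "C \<in> Obj M" "D \<in> Obj M"
  shows "Eta M A B C D \<in> Arr M" "Dom M (Eta M A B C D) = (A \<odot>\<^bsub>Ten2 M\<^esub> B) \<odot>\<^bsub>Ten1 M\<^esub> (C \<odot>\<^bsub>Ten2 M\<^esub> D)"
    "Cod M (Eta M A B C D) = (A \<odot>\<^bsub>Ten1 M\<^esub> C) \<odot>\<^bsub>Ten2 M\<^esub> (B \<odot>\<^bsub>Ten1 M\<^esub> D)"
  using Eta_in[OF assms] by (auto simp: homset_def)

end

lemma is_two_fold_functor_id:
  assumes "two_fold_monoidal M"
  shows "is_two_fold_functor (id_two_fold_functor M)"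
proof -
  interpret two_fold_monoidal M by fact
  show ?thesis unfolding is_two_fold_functor_def id_two_fold_functor_def Let_def
    using assms lax_id[OF m1.monoidal_axioms] lax_id[OF m2.monoidal_axioms] by auto
qed

text \<open>Naturality of \<open>Lambda2 g\<close> exposes the interchange condition of
  \<open>g\<close>; after it the condition of \<open>f\<close> applies under the functor
  \<open>g\<close>, and naturality of \<open>Lambda1 g\<close> restores the order of the
  factors.\<close>

lemma is_two_fold_functor_comp:
  assumes f: "is_two_fold_functor f" and g: "is_two_fold_functor g" and fg: "TTarget f = TSource g"
  shows "is_two_fold_functor (comp_two_fold_functor g f)"
proof -
  note F = is_two_fold_functorD[OF f, unfolded fg] and G = is_two_fold_functorD[OF g]
  interpret C: two_fold_monoidal "TSource f" using F(1) .
  interpret D: two_fold_monoidal "TSource g" using F(2) .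
  interpret E: two_fold_monoidal "TTarget g" using G(2) .
  note Fu = laxD(1)[OF F(3)] and Gu = laxD(1)[OF G(3)]
  note [simp] = is_functorD(3-8)[OF Fu] is_functorD(3-8)[OF Gu] laxD(3-5)[OF F(3)] laxD(3-5)[OF G(3)]
    laxD(3-5)[OF F(4)] laxD(3-5)[OF G(4)]
  let ?C = "TSource f" and ?D = "TSource g" and ?E = "TTarget g"
  let ?F = "FObj (TFun f)" and ?G = "FArr (TFun g)" and ?GF = "\<lambda>A. FObj (TFun g) (FObj (TFun f) A)"
  let ?l1 = "Lambda1 f" and ?l2 = "Lambda2 f" and ?m1 = "Lambda1 g" and ?m2 = "Lambda2 g"
  have "(?G (?l2 (A \<odot>\<^bsub>Ten1 ?C\<^esub> X) (B \<odot>\<^bsub>Ten1 ?C\<^esub> Y)) \<cdot>\<^bsub>?E\<^esub> ?m2 (?F (A \<odot>\<^bsub>Ten1 ?C\<^esub> X)) (?F (B \<odot>\<^bsub>Ten1 ?C\<^esub> Y)))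
       \<cdot>\<^bsub>?E\<^esub> ((?G (?l1 A X) \<cdot>\<^bsub>?E\<^esub> ?m1 (?F A) (?F X)) \<star>\<^bsub>Ten2 ?E\<^esub> (?G (?l1 B Y) \<cdot>\<^bsub>?E\<^esub> ?m1 (?F B) (?F Y)))
       \<cdot>\<^bsub>?E\<^esub> Eta ?E (?GF A) (?GF B) (?GF X) (?GF Y) =
      ?G (FArr (TFun f) (Eta ?C A B X Y))
       \<cdot>\<^bsub>?E\<^esub> (?G (?l1 (A \<odot>\<^bsub>Ten2 ?C\<^esub> B) (X \<odot>\<^bsub>Ten2 ?C\<^esub> Y)) \<cdot>\<^bsub>?E\<^esub> ?m1 (?F (A \<odot>\<^bsub>Ten2 ?C\<^esub> B)) (?F (X \<odot>\<^bsub>Ten2 ?C\<^esub> Y)))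
       \<cdot>\<^bsub>?E\<^esub> ((?G (?l2 A B) \<cdot>\<^bsub>?E\<^esub> ?m2 (?F A) (?F B)) \<star>\<^bsub>Ten1 ?E\<^esub> (?G (?l2 X Y) \<cdot>\<^bsub>?E\<^esub> ?m2 (?F X) (?F Y)))"
    (is "?lhs = ?rhs")
    if [simp]: "A \<in> Obj ?C" "B \<in> Obj ?C" "X \<in> Obj ?C" "Y \<in> Obj ?C" for A B X Y
  proof -
    let ?r = "(?m1 (?F A) (?F X) \<star>\<^bsub>Ten2 ?E\<^esub> ?m1 (?F B) (?F Y)) \<cdot>\<^bsub>?E\<^esub> Eta ?E (?GF A) (?GF B) (?GF X) (?GF Y)"
    have "?lhs = ?G (?l2 (A \<odot>\<^bsub>Ten1 ?C\<^esub> X) (B \<odot>\<^bsub>Ten1 ?C\<^esub> Y)) \<cdot>\<^bsub>?E\<^esub> ?m2 (?F (A \<odot>\<^bsub>Ten1 ?C\<^esub> X)) (?F (B \<odot>\<^bsub>Ten1 ?C\<^esub> Y))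
       \<cdot>\<^bsub>?E\<^esub> (?G (?l1 A X) \<star>\<^bsub>Ten2 ?E\<^esub> ?G (?l1 B Y)) \<cdot>\<^bsub>?E\<^esub> ?r"
      by (simp add: E.m2.TArr_Comp_tail)
    also have "\<dots> = ?G (?l2 (A \<odot>\<^bsub>Ten1 ?C\<^esub> X) (B \<odot>\<^bsub>Ten1 ?C\<^esub> Y)) \<cdot>\<^bsub>?E\<^esub> ?G (?l1 A X \<star>\<^bsub>Ten2 ?D\<^esub> ?l1 B Y)
       \<cdot>\<^bsub>?E\<^esub> ?m2 (?F A \<odot>\<^bsub>Ten1 ?D\<^esub> ?F X) (?F B \<odot>\<^bsub>Ten1 ?D\<^esub> ?F Y) \<cdot>\<^bsub>?E\<^esub> ?r"
      using E.m1.Comp_tail[OF laxD(6)[OF G(4), of "?l1 A X" "?l1 B Y"], of ?r] by simp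
    also have "?m2 (?F A \<odot>\<^bsub>Ten1 ?D\<^esub> ?F X) (?F B \<odot>\<^bsub>Ten1 ?D\<^esub> ?F Y) \<cdot>\<^bsub>?E\<^esub> ?r = ?G (Eta ?D (?F A) (?F B) (?F X) (?F Y))
       \<cdot>\<^bsub>?E\<^esub> ?m1 (?F A \<odot>\<^bsub>Ten2 ?D\<^esub> ?F B) (?F X \<odot>\<^bsub>Ten2 ?D\<^esub> ?F Y) \<cdot>\<^bsub>?E\<^esub> (?m2 (?F A) (?F B) \<star>\<^bsub>Ten1 ?E\<^esub> ?m2 (?F X) (?F Y))"
      by (rule G(5)) simp_all
    also have "?G (?l2 (A \<odot>\<^bsub>Ten1 ?C\<^esub> X) (B \<odot>\<^bsub>Ten1 ?C\<^esub> Y)) \<cdot>\<^bsub>?E\<^esub> ?G (?l1 A X \<star>\<^bsub>Ten2 ?D\<^esub> ?l1 B Y) \<cdot>\<^bsub>?E\<^esub> ?G (Eta ?D (?F A) (?F B) (?F X) (?F Y))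
       \<cdot>\<^bsub>?E\<^esub> ?m1 (?F A \<odot>\<^bsub>Ten2 ?D\<^esub> ?F B) (?F X \<odot>\<^bsub>Ten2 ?D\<^esub> ?F Y) \<cdot>\<^bsub>?E\<^esub> (?m2 (?F A) (?F B) \<star>\<^bsub>Ten1 ?E\<^esub> ?m2 (?F X) (?F Y)) =
       ?G (?l2 (A \<odot>\<^bsub>Ten1 ?C\<^esub> X) (B \<odot>\<^bsub>Ten1 ?C\<^esub> Y) \<cdot>\<^bsub>?D\<^esub> (?l1 A X \<star>\<^bsub>Ten2 ?D\<^esub> ?l1 B Y) \<cdot>\<^bsub>?D\<^esub> Eta ?D (?F A) (?F B) (?F X) (?F Y))
       \<cdot>\<^bsub>?E\<^esub> ?m1 (?F A \<odot>\<^bsub>Ten2 ?D\<^esub> ?F B) (?F X \<odot>\<^bsub>Ten2 ?D\<^esub> ?F Y) \<cdot>\<^bsub>?E\<^esub> (?m2 (?F A) (?F B) \<star>\<^bsub>Ten1 ?E\<^esub> ?m2 (?F X) (?F Y))"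
      by simp
    also have "\<dots> = ?G (FArr (TFun f) (Eta ?C A B X Y) \<cdot>\<^bsub>?D\<^esub> ?l1 (A \<odot>\<^bsub>Ten2 ?C\<^esub> B) (X \<odot>\<^bsub>Ten2 ?C\<^esub> Y) \<cdot>\<^bsub>?D\<^esub> (?l2 A B \<star>\<^bsub>Ten1 ?D\<^esub> ?l2 X Y))
       \<cdot>\<^bsub>?E\<^esub> ?m1 (?F A \<odot>\<^bsub>Ten2 ?D\<^esub> ?F B) (?F X \<odot>\<^bsub>Ten2 ?D\<^esub> ?F Y) \<cdot>\<^bsub>?E\<^esub> (?m2 (?F A) (?F B) \<star>\<^bsub>Ten1 ?E\<^esub> ?m2 (?F X) (?F Y))"
      by (subst F(5)) simp_all
    also have "\<dots> = ?G (FArr (TFun f) (Eta ?C A B X Y)) \<cdot>\<^bsub>?E\<^esub> ?G (?l1 (A \<odot>\<^bsub>Ten2 ?C\<^esub> B) (X \<odot>\<^bsub>Ten2 ?C\<^esub> Y)) \<cdot>\<^bsub>?E\<^esub> ?G (?l2 A B \<star>\<^bsub>Ten1 ?D\<^esub> ?l2 X Y)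
       \<cdot>\<^bsub>?E\<^esub> ?m1 (?F A \<odot>\<^bsub>Ten2 ?D\<^esub> ?F B) (?F X \<odot>\<^bsub>Ten2 ?D\<^esub> ?F Y) \<cdot>\<^bsub>?E\<^esub> (?m2 (?F A) (?F B) \<star>\<^bsub>Ten1 ?E\<^esub> ?m2 (?F X) (?F Y))"
      by simp
    also have "\<dots> = ?rhs"
      using E.m1.Comp_tail[OF laxD(6)[OF G(3), of "?l2 A B" "?l2 X Y"], of "?m2 (?F A) (?F B) \<star>\<^bsub>Ten1 ?E\<^esub> ?m2 (?F X) (?F Y)"]
      by (simp add: E.m1.TArr_Comp_tail E.m1.TArr_Comp')
    finally show ?thesis .
  qed
  then show ?thesis unfolding is_two_fold_functor_def comp_two_fold_functor_def Let_def
    using F(1) G(2) lax_comp[OF C.m1.monoidal_axioms D.m1.monoidal_axioms E.m1.monoidal_axioms F(3) G(3)]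
      lax_comp[OF C.m2.monoidal_axioms D.m2.monoidal_axioms E.m2.monoidal_axioms F(4) G(4)] by simp
qed

lemma TwoMonCat_simps [simp]:
  "Obj TwoMonCat = {M. two_fold_monoidal M}" "Arr TwoMonCat = {f. is_two_fold_functor f}"
  "is_two_fold_functor f \<Longrightarrow> Dom TwoMonCat f = TSource f"
  "is_two_fold_functor f \<Longrightarrow> Cod TwoMonCat f = TTarget f"
  "two_fold_monoidal M \<Longrightarrow> Ident TwoMonCat M = id_two_fold_functor M"
  "is_two_fold_functor f \<Longrightarrow> is_two_fold_functor g \<Longrightarrow> TTarget f = TSource g \<Longrightarrow>
    g \<cdot>\<^bsub>TwoMonCat\<^esub> f = comp_two_fold_functor g f"
  by (simp_all add: TwoMonCat_def)

lemma two_fold_functor_sel [simp]: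
  "TSource (id_two_fold_functor M) = M" "TTarget (id_two_fold_functor M) = M"
  "TSource (comp_two_fold_functor g f) = TSource f" "TTarget (comp_two_fold_functor g f) = TTarget g"
  by (simp_all add: id_two_fold_functor_def comp_two_fold_functor_def)

lemma category_TwoMonCat: "category (TwoMonCat :: (('o, 'a) two_fold, ('o, 'a) two_fold_functor) cat)"
proof
  fix f g h :: "('o, 'a) two_fold_functor" and A B D E
  assume "f \<in> homset TwoMonCat A B" "g \<in> homset TwoMonCat B D" "h \<in> homset TwoMonCat D E"
  then have *: "is_two_fold_functor f" "is_two_fold_functor g" "is_two_fold_functor h"
    "TTarget f = TSource g" "TTarget g = TSource h" by (auto simp: homset_def)
  note F = is_two_fold_functorD[OF *(1)] and G = is_two_fold_functorD[OF *(2)] and H = is_two_fold_functorD[OF *(3)]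
  interpret E: two_fold_monoidal "TTarget h" using H(2) .
  interpret D: two_fold_monoidal "TSource g" using G(1) .
  interpret D': two_fold_monoidal "TSource h" using H(1) .
  have "comp_two_fold_functor (comp_two_fold_functor h g) f = comp_two_fold_functor h (comp_two_fold_functor g f)"
    unfolding comp_two_fold_functor_def
    using comp_functor_assoc[OF laxD(1)[OF F(3), unfolded *(4)] laxD(1)[OF G(3)]]
      comp_coherence_assoc[OF E.m1.category_axioms F(3)[unfolded *(4)] G(3)[unfolded *(5)] D.m1.monoidal_axioms D'.m1.category_axioms H(3)]
      comp_coherence_assoc[OF E.m1.category_axioms F(4)[unfolded *(4)] G(4)[unfolded *(5)] D.m2.monoidal_axioms D'.m1.category_axioms H(4)] *
    by simp
  then show "(h \<cdot>\<^bsub>TwoMonCat\<^esub> g) \<cdot>\<^bsub>TwoMonCat\<^esub> f = h \<cdot>\<^bsub>TwoMonCat\<^esub> g \<cdot>\<^bsub>TwoMonCat\<^esub> f"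
    using * by (simp add: is_two_fold_functor_comp)
next
  fix f :: "('o, 'a) two_fold_functor" and A B
  assume "f \<in> homset TwoMonCat A B"
  then have *: "is_two_fold_functor f" "TSource f = A" "TTarget f = B" by (auto simp: homset_def)
  note F = is_two_fold_functorD[OF *(1)]
  interpret C: two_fold_monoidal "TSource f" using F(1) .
  interpret D: two_fold_monoidal "TTarget f" using F(2) .
  note id = comp_functor_id[OF laxD(1)[OF F(3)]]
    comp_coherence_id[OF F(3) C.m1.monoidal_axioms D.m1.monoidal_axioms]
    comp_coherence_id[OF F(4) C.m2.monoidal_axioms D.m2.monoidal_axioms]
  have "comp_two_fold_functor f (id_two_fold_functor A) = f" "comp_two_fold_functor (id_two_fold_functor B) f = f"
    unfolding comp_two_fold_functor_def id_two_fold_functor_def using id by (simp_all flip: *(2,3))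
  then show "f \<cdot>\<^bsub>TwoMonCat\<^esub> Ident TwoMonCat A = f" "Ident TwoMonCat B \<cdot>\<^bsub>TwoMonCat\<^esub> f = f"
    using * F(1,2) by (auto simp: is_two_fold_functor_id)
qed (auto simp: TwoMonCat_def homset_def is_two_fold_functorD is_two_fold_functor_id is_two_fold_functor_comp)

section \<open>The two-fold monoidal categories induced by interchanging braids\<close>

text \<open>Covers interchanging unital braids and elementary crossings at once. \<open>E\<close> is
  tied to the word at singletons, which are the labels in \<open>braid_interchange\<close>; its
  values at longer and empty lists enter through naturality.\<close>

locale interchange_category = braided_category V for V :: "('o, 'a) braided" (structure) +
  fixes b :: braid and w :: braid_word
    and E :: "'o list \<Rightarrow> 'o list \<Rightarrow> 'o list \<Rightarrow> 'o list \<Rightarrow> ('o, 'a) strict_arrow"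
  assumes b_carrier: "b \<in> carrier (braid_group 4)" and w_b: "w \<in> b" and w_perm: "word_perm w = transpose 2 3"
    and strict_interchange: "strict_interchange (Obj V) sarr sdom scod sid sseq stens sbraiding E"
    and E_act: "A \<in> Obj V \<Longrightarrow> B \<in> Obj V \<Longrightarrow> C \<in> Obj V \<Longrightarrow> D \<in> Obj V \<Longrightarrow>
      E [A] [B] [C] [D] = strict.act w [[A], [B], [C], [D]]"
begin

sublocale strict: strict_interchange "Obj V" sarr sdom scod sid sseq stens sbraiding E
  by (rule strict_interchange)

abbreviation \<eta> where "\<eta> \<equiv> braid_interchange b V"

text \<open>Naturality of \<open>E\<close> with respect to the arrows \<open>theta\<close> passes
  from the singletons \<open>[tree_val s]\<close> to the lists \<open>leaves s\<close>. Hence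
  \<open>\<eta>\<close> at products is realized by \<open>E\<close> at concatenations, and
  \<open>\<eta>\<close> at units by \<open>E\<close> at empty lists.\<close>

lemma eta_realizes:
  assumes [simp]: "tree_Ob s1" "tree_Ob s2" "tree_Ob s3" "tree_Ob s4"
  shows "realizes (Node (Node s1 s2) (Node s3 s4)) (E (leaves s1) (leaves s2) (leaves s3) (leaves s4))
    (Node (Node s1 s3) (Node s2 s4)) (\<eta> (tree_val s1) (tree_val s2) (tree_val s3) (tree_val s4))"
proof -
  let ?A = "tree_val s1" and ?B = "tree_val s2" and ?C = "tree_val s3" and ?D = "tree_val s4"
  let ?L = "Node (Node (Leaf ?A) (Leaf ?B)) (Node (Leaf ?C) (Leaf ?D))"
  let ?R = "Node (Node (Leaf ?A) (Leaf ?C)) (Node (Leaf ?B) (Leaf ?D))"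
  have r: "realizes ?L (E [?A] [?B] [?C] [?D]) ?R (\<eta> ?A ?B ?C ?D)"
    using braid_interchange_realizes[OF b_carrier w_b w_perm, of ?A ?B ?C ?D] E_act[of ?A ?B ?C ?D] by simp
  \<comment> \<open>Each of the four subtrees is first contracted to a single leaf, which separates
    their \<open>theta\<close> from that of the outer bracketing.\<close>
  have split: "theta (Node (Node t1 t2) (Node t3 t4)) = (theta t1 \<parallel> theta t2 \<parallel> theta t3 \<parallel> theta t4) \<triangleright>
      theta (Node (Node (Leaf (tree_val t1)) (Leaf (tree_val t2))) (Node (Leaf (tree_val t3)) (Leaf (tree_val t4))))"
    if [simp]: "tree_Ob t1" "tree_Ob t2" "tree_Ob t3" "tree_Ob t4" for t1 t2 t3 t4
  proof -
    have "theta (Node (Node t1 t2) (Node t3 t4)) =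
        (((theta t1 \<parallel> theta t2) \<parallel> (theta t3 \<parallel> theta t4)) \<triangleright> (mu (tree_val t1) (tree_val t2) \<parallel> mu (tree_val t3) (tree_val t4)))
          \<triangleright> mu (tree_val t1 \<diamondop> tree_val t2) (tree_val t3 \<diamondop> tree_val t4)"
      by (simp add: strict.interchange del: strict.tens_assoc)
    also have "\<dots> = (theta t1 \<parallel> theta t2 \<parallel> theta t3 \<parallel> theta t4) \<triangleright>
      theta (Node (Node (Leaf (tree_val t1)) (Leaf (tree_val t2))) (Node (Leaf (tree_val t3)) (Leaf (tree_val t4))))"
      by simp
    finally show ?thesis .
  qed
  have t: "theta ?L \<triangleright> emb (\<eta> ?A ?B ?C ?D) = E [?A] [?B] [?C] [?D] \<triangleright> theta ?R"
    and h: "\<eta> ?A ?B ?C ?D \<in> Arr V" "Dom V (\<eta> ?A ?B ?C ?D) = tree_val ?L" "Cod V (\<eta> ?A ?B ?C ?D) = tree_val ?R"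
    using r by (simp_all add: realizes_def del: theta.simps)
  have L: "sarr (theta ?L)" "scod (theta ?L) = [tree_val ?L]" "sdom (theta ?L) = leaves ?L"
    and R: "sarr (theta ?R)" "scod (theta ?R) = [tree_val ?R]" "sdom (theta ?R) = leaves ?R"
    by (simp_all del: theta.simps)
  have "theta (Node (Node s1 s2) (Node s3 s4)) \<triangleright> emb (\<eta> ?A ?B ?C ?D) =
     (theta s1 \<parallel> theta s2 \<parallel> theta s3 \<parallel> theta s4) \<triangleright> theta ?L \<triangleright> emb (\<eta> ?A ?B ?C ?D)"
    unfolding split[OF assms] using L h by (subst strict.seq_assoc) (simp_all del: theta.simps)
  also have "\<dots> = ((theta s1 \<parallel> theta s2 \<parallel> theta s3 \<parallel> theta s4) \<triangleright> E [?A] [?B] [?C] [?D]) \<triangleright> theta ?R"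
    unfolding t using R by (subst strict.seq_assoc) (simp_all del: theta.simps)
  also have "(theta s1 \<parallel> theta s2 \<parallel> theta s3 \<parallel> theta s4) \<triangleright> E [?A] [?B] [?C] [?D] =
      E (leaves s1) (leaves s2) (leaves s3) (leaves s4) \<triangleright> (theta s1 \<parallel> theta s3 \<parallel> theta s2 \<parallel> theta s4)"
    using strict.E_natural[of "theta s1" "theta s2" "theta s3" "theta s4"] by simp
  also have "(E (leaves s1) (leaves s2) (leaves s3) (leaves s4) \<triangleright> (theta s1 \<parallel> theta s3 \<parallel> theta s2 \<parallel> theta s4)) \<triangleright> theta ?R =
     E (leaves s1) (leaves s2) (leaves s3) (leaves s4) \<triangleright> theta (Node (Node s1 s3) (Node s2 s4))"
    unfolding split[OF assms(1,3,2,4)] using R by (subst strict.seq_assoc) (simp_all del: theta.simps)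
  finally show ?thesis using h unfolding realizes_def by (simp del: theta.simps)
qed

lemma eta_typed [simp]:
  assumes "A \<in> Obj V" "B \<in> Obj V" "C \<in> Obj V" "D \<in> Obj V"
  shows "\<eta> A B C D \<in> Arr V" "Dom V (\<eta> A B C D) = (A \<diamondop> B) \<diamondop> (C \<diamondop> D)" "Cod V (\<eta> A B C D) = (A \<diamondop> C) \<diamondop> (B \<diamondop> D)"
  using eta_realizes[of "Leaf A" "Leaf B" "Leaf C" "Leaf D"] assms by (simp_all add: realizes_def)

lemma theta_Node_cong:
  assumes "theta s = theta s'" "theta t = theta t'"
  shows "theta (Node s t) = theta (Node s' t')"
proof -
  have "[tree_val s] = [tree_val s']" "[tree_val t] = [tree_val t']"
    using assms theta_typed(2) by metis+
  then show ?thesis using assms by simp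
qed

lemma realizes_trivial:
  assumes "realizes s (sid (leaves s)) t h" "theta s = theta t"
  shows "h = Ident V (tree_val s)"
proof (rule realizes_unique[OF assms(1)])
  have "leaves s = leaves t" "[tree_val s] = [tree_val t]" using assms(2) theta_typed(1,2) by metis+
  then show "realizes s (sid (leaves s)) t (Ident V (tree_val s))"
    using assms unfolding realizes_def by (simp del: theta.simps)
qed

text \<open>With the unit represented by \<open>Empty\<close>, the strict interchange is an identity
  and the trees of source and target have the same \<open>theta\<close>, so the realized arrow is an
  identity.\<close>

lemma eta_units:
  assumes [simp]: "A \<in> Obj V" "B \<in> Obj V"
  shows "\<eta> A B (BUnit V) (BUnit V) = Ident V (A \<diamondop> B)" "\<eta> (BUnit V) (BUnit V) A B = Ident V (A \<diamondop> B)"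
    "\<eta> A (BUnit V) B (BUnit V) = Ident V (A \<diamondop> B)" "\<eta> (BUnit V) A (BUnit V) B = Ident V (A \<diamondop> B)"
proof -
  let ?A = "Leaf A" and ?B = "Leaf B" and ?E = "Empty"
  have E: "theta (Node ?E ?E) = theta ?E" by (rule theta_Node_Empty) simp
  have AB: "theta (Node (Node ?A ?E) (Node ?B ?E)) = theta (Node ?A ?B)"
    "theta (Node (Node ?E ?A) (Node ?E ?B)) = theta (Node ?A ?B)"
    by (rule theta_Node_cong; rule theta_Node_Empty; simp)+
  have "theta (Node (Node ?A ?B) (Node ?E ?E)) = theta (Node (Node ?A ?B) ?E)"
    "theta (Node (Node ?E ?E) (Node ?A ?B)) = theta (Node ?E (Node ?A ?B))"
    by (rule theta_Node_cong; simp only: E)+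
  then have AB': "theta (Node (Node ?A ?B) (Node ?E ?E)) = theta (Node ?A ?B)"
    "theta (Node (Node ?E ?E) (Node ?A ?B)) = theta (Node ?A ?B)"
    using theta_Node_Empty[of "Node ?A ?B"] by simp_all
  have "realizes (Node (Node ?A ?B) (Node ?E ?E)) (sid (leaves (Node (Node ?A ?B) (Node ?E ?E)))) (Node (Node ?A ?E) (Node ?B ?E)) (\<eta> A B (BUnit V) (BUnit V))"
    using eta_realizes[of ?A ?B ?E ?E] by (simp add: strict.E_unit)
  from realizes_trivial[OF this] show "\<eta> A B (BUnit V) (BUnit V) = Ident V (A \<diamondop> B)"
    using AB AB' by (simp del: theta.simps)
  have "realizes (Node (Node ?E ?E) (Node ?A ?B)) (sid (leaves (Node (Node ?E ?E) (Node ?A ?B)))) (Node (Node ?E ?A) (Node ?E ?B)) (\<eta> (BUnit V) (BUnit V) A B)"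
    using eta_realizes[of ?E ?E ?A ?B] by (simp add: strict.E_unit)
  from realizes_trivial[OF this] show "\<eta> (BUnit V) (BUnit V) A B = Ident V (A \<diamondop> B)"
    using AB AB' by (simp del: theta.simps)
  have "realizes (Node (Node ?A ?E) (Node ?B ?E)) (sid (leaves (Node (Node ?A ?E) (Node ?B ?E)))) (Node (Node ?A ?B) (Node ?E ?E)) (\<eta> A (BUnit V) B (BUnit V))"
    using eta_realizes[of ?A ?E ?B ?E] by (simp add: strict.E_unit)
  from realizes_trivial[OF this] show "\<eta> A (BUnit V) B (BUnit V) = Ident V (A \<diamondop> B)"
    using AB AB' by (simp del: theta.simps)
  have "realizes (Node (Node ?E ?A) (Node ?E ?B)) (sid (leaves (Node (Node ?E ?A) (Node ?E ?B)))) (Node (Node ?E ?E) (Node ?A ?B)) (\<eta> (BUnit V) A (BUnit V) B)"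
    using eta_realizes[of ?E ?A ?E ?B] by (simp add: strict.E_unit)
  from realizes_trivial[OF this] show "\<eta> (BUnit V) A (BUnit V) B = Ident V (A \<diamondop> B)"
    using AB AB' by (simp del: theta.simps)
qed

lemma eta_natural:
  assumes [simp]: "f \<in> Arr V" "g \<in> Arr V" "h \<in> Arr V" "k \<in> Arr V"
  shows "\<eta> (Cod V f) (Cod V g) (Cod V h) (Cod V k) \<cdot> ((f \<boxtimes> g) \<boxtimes> (h \<boxtimes> k)) =
    ((f \<boxtimes> h) \<boxtimes> (g \<boxtimes> k)) \<cdot> \<eta> (Dom V f) (Dom V g) (Dom V h) (Dom V k)"
proof -
  note r = realizes_Leaf[of f] realizes_Leaf[of g] realizes_Leaf[of h] realizes_Leaf[of k]
  note e = eta_realizes[of "Leaf A" "Leaf B" "Leaf C" "Leaf D" for A B C D, simplified]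
  show ?thesis
    using realizes_unique[OF realizes_Comp[OF
        realizes_TArr[OF realizes_TArr[OF r(1,2)] realizes_TArr[OF r(3,4)]]
        e[of "Cod V f" "Cod V g" "Cod V h" "Cod V k"]]]
      realizes_Comp[OF e[of "Dom V f" "Dom V g" "Dom V h" "Dom V k"]
        realizes_TArr[OF realizes_TArr[OF r(1,3)] realizes_TArr[OF r(2,4)]]]
      strict.E_natural[of "emb f" "emb g" "emb h" "emb k"]
    by simp
qed

text \<open>The associators realize identities on lists, so the two composites realize the two sides
  of \<open>E_internal\<close>; uniqueness of realizations finishes the argument.\<close>

lemma eta_internal_assoc:
  assumes [simp]: "U \<in> Obj V" "X \<in> Obj V" "W \<in> Obj V" "Y \<in> Obj V" "S \<in> Obj V" "Z \<in> Obj V"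
  shows "\<eta> U S (W \<diamondop> Y) (X \<diamondop> Z) \<cdot> (Ident V (U \<diamondop> S) \<boxtimes> \<eta> W X Y Z) \<cdot> \<alpha>' (U \<diamondop> S) (W \<diamondop> X) (Y \<diamondop> Z) =
    (\<alpha>' U W Y \<boxtimes> \<alpha>' S X Z) \<cdot> \<eta> (U \<diamondop> W) (S \<diamondop> X) Y Z \<cdot> (\<eta> U S W X \<boxtimes> Ident V (Y \<diamondop> Z))"
proof -
  let ?u = "Leaf U" and ?s = "Leaf S" and ?w = "Leaf W" and ?x = "Leaf X" and ?y = "Leaf Y" and ?z = "Leaf Z"
  have 1: "realizes (Node (Node (Node ?u ?s) (Node ?w ?x)) (Node ?y ?z))
      ((sid [U, S, W, X, Y, Z] \<triangleright> (sid [U, S] \<parallel> E [W] [X] [Y] [Z])) \<triangleright> E [U] [S] [W, Y] [X, Z])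
      (Node (Node ?u (Node ?w ?y)) (Node ?s (Node ?x ?z)))
      (\<eta> U S (W \<diamondop> Y) (X \<diamondop> Z) \<cdot> (Ident V (U \<diamondop> S) \<boxtimes> \<eta> W X Y Z) \<cdot> \<alpha>' (U \<diamondop> S) (W \<diamondop> X) (Y \<diamondop> Z))"
    using realizes_Comp[OF realizes_Comp[OF realizes_Assoc[of "Node ?u ?s" "Node ?w ?x" "Node ?y ?z"]
        realizes_TArr[OF realizes_Ident[of "Node ?u ?s"] eta_realizes[of ?w ?x ?y ?z]]]
        eta_realizes[of ?u ?s "Node ?w ?y" "Node ?x ?z"]] by simp
  have 2: "realizes (Node (Node (Node ?u ?s) (Node ?w ?x)) (Node ?y ?z))
      (((E [U] [S] [W] [X] \<parallel> sid [Y, Z]) \<triangleright> E [U, W] [S, X] [Y] [Z]) \<triangleright> (sid [U, W, Y] \<parallel> sid [S, X, Z]))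
      (Node (Node ?u (Node ?w ?y)) (Node ?s (Node ?x ?z)))
      ((\<alpha>' U W Y \<boxtimes> \<alpha>' S X Z) \<cdot> \<eta> (U \<diamondop> W) (S \<diamondop> X) Y Z \<cdot> (\<eta> U S W X \<boxtimes> Ident V (Y \<diamondop> Z)))"
    using realizes_Comp[OF realizes_Comp[OF realizes_TArr[OF eta_realizes[of ?u ?s ?w ?x] realizes_Ident[of "Node ?y ?z"]]
        eta_realizes[of "Node ?u ?w" "Node ?s ?x" ?y ?z]] realizes_TArr[OF realizes_Assoc[of ?u ?w ?y] realizes_Assoc[of ?s ?x ?z]]]
    by simp
  show ?thesis
    by (rule realizes_unique[OF 1]) (use 2 strict.E_internal[of "[U]" "[S]" "[W]" "[X]" "[Y]" "[Z]"] in simp)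
qed

lemma eta_external_assoc:
  assumes [simp]: "U \<in> Obj V" "X \<in> Obj V" "W \<in> Obj V" "Y \<in> Obj V" "S \<in> Obj V" "Z \<in> Obj V"
  shows "(Ident V (U \<diamondop> X) \<boxtimes> \<eta> S W Y Z) \<cdot> \<eta> U (S \<diamondop> W) X (Y \<diamondop> Z) \<cdot> (\<alpha>' U S W \<boxtimes> \<alpha>' X Y Z) =
    \<alpha>' (U \<diamondop> X) (S \<diamondop> Y) (W \<diamondop> Z) \<cdot> (\<eta> U S X Y \<boxtimes> Ident V (W \<diamondop> Z)) \<cdot> \<eta> (U \<diamondop> S) W (X \<diamondop> Y) Z"
proof -
  let ?u = "Leaf U" and ?s = "Leaf S" and ?w = "Leaf W" and ?x = "Leaf X" and ?y = "Leaf Y" and ?z = "Leaf Z"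
  have 1: "realizes (Node (Node (Node ?u ?s) ?w) (Node (Node ?x ?y) ?z))
      (((sid [U, S, W] \<parallel> sid [X, Y, Z]) \<triangleright> E [U] [S, W] [X] [Y, Z]) \<triangleright> (sid [U, X] \<parallel> E [S] [W] [Y] [Z]))
      (Node (Node ?u ?x) (Node (Node ?s ?y) (Node ?w ?z)))
      ((Ident V (U \<diamondop> X) \<boxtimes> \<eta> S W Y Z) \<cdot> \<eta> U (S \<diamondop> W) X (Y \<diamondop> Z) \<cdot> (\<alpha>' U S W \<boxtimes> \<alpha>' X Y Z))"
    using realizes_Comp[OF realizes_Comp[OF realizes_TArr[OF realizes_Assoc[of ?u ?s ?w] realizes_Assoc[of ?x ?y ?z]]
        eta_realizes[of ?u "Node ?s ?w" ?x "Node ?y ?z"]]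
        realizes_TArr[OF realizes_Ident[of "Node ?u ?x"] eta_realizes[of ?s ?w ?y ?z]]] by simp
  have 2: "realizes (Node (Node (Node ?u ?s) ?w) (Node (Node ?x ?y) ?z))
      ((E [U, S] [W] [X, Y] [Z] \<triangleright> (E [U] [S] [X] [Y] \<parallel> sid [W, Z])) \<triangleright> sid [U, X, S, Y, W, Z])
      (Node (Node ?u ?x) (Node (Node ?s ?y) (Node ?w ?z)))
      (\<alpha>' (U \<diamondop> X) (S \<diamondop> Y) (W \<diamondop> Z) \<cdot> (\<eta> U S X Y \<boxtimes> Ident V (W \<diamondop> Z)) \<cdot> \<eta> (U \<diamondop> S) W (X \<diamondop> Y) Z)"
    using realizes_Comp[OF realizes_Comp[OF eta_realizes[of "Node ?u ?s" ?w "Node ?x ?y" ?z]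
        realizes_TArr[OF eta_realizes[of ?u ?s ?x ?y] realizes_Ident[of "Node ?w ?z"]]]
        realizes_Assoc[of "Node ?u ?x" "Node ?s ?y" "Node ?w ?z"]] by simp
  show ?thesis
    by (rule realizes_unique[OF 1]) (use 2 strict.E_external[of "[U]" "[S]" "[W]" "[X]" "[Y]" "[Z]"] in simp)
qed

end

lemma two_fold_of_braided_sel [simp]:
  "Obj (two_fold_of_braided b V) = Obj V" "Arr (two_fold_of_braided b V) = Arr V"
  "Dom (two_fold_of_braided b V) = Dom V" "Cod (two_fold_of_braided b V) = Cod V"
  "Ident (two_fold_of_braided b V) = Ident V" "Comp (two_fold_of_braided b V) = Comp V"
  "Ten1 (two_fold_of_braided b V) = Ten V" "Ten2 (two_fold_of_braided b V) = Ten V"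
  "TUnit (two_fold_of_braided b V) = BUnit V" "Eta (two_fold_of_braided b V) = braid_interchange b V"
  "homset (two_fold_of_braided b V) = homset V"
  by (simp_all add: two_fold_of_braided_def homset_def fun_eq_iff)

lemma category_two_fold_of_braided [simp]: "category (two_fold_of_braided b V) \<longleftrightarrow> category V"
  by (simp add: category_def)

lemma monoidal_two_fold_of_braided:
  assumes "braided_category V"
  shows "monoidal (two_fold_of_braided b V) (Ten V) (BUnit V)"
  using braided_category_monoidal[OF assms]
  by (simp add: monoidal_def monoidal_axioms_def iso_arrow_def inverse_arrows_def)

lemma is_functor_two_fold_of_braided [simp]:
  "is_functor (two_fold_of_braided b V) (two_fold_of_braided c W) F \<longleftrightarrow> is_functor V W F"
  by (simp add: is_functor_def)

lemma lax_two_fold_of_braided [simp]: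
  "lax_monoidal_functor (two_fold_of_braided b V) T I (two_fold_of_braided c W) S J F \<phi> \<longleftrightarrow>
    lax_monoidal_functor V T I W S J F \<phi>"
  by (simp add: lax_monoidal_functor_def)

context interchange_category
begin

lemma two_fold_monoidal_two_fold_of_braided: "two_fold_monoidal (two_fold_of_braided b V)"
proof -
  have m: "monoidal (two_fold_of_braided b V) (Ten1 (two_fold_of_braided b V)) (TUnit (two_fold_of_braided b V))"
    "monoidal (two_fold_of_braided b V) (Ten2 (two_fold_of_braided b V)) (TUnit (two_fold_of_braided b V))"
    using monoidal_two_fold_of_braided[OF braided_category_axioms] by simp_all
  show ?thesis
  proof (rule two_fold_monoidal.intro[OF m], rule two_fold_monoidal_axioms.intro, unfold two_fold_of_braided_sel)
    show "(\<lambda>(A, B, C, D). \<eta> A B C D) \<in> extensional (Obj V \<times> Obj V \<times> Obj V \<times> Obj V)"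
      by (auto simp: extensional_def braid_interchange_def)
  next
    fix A B C D assume "A \<in> Obj V" "B \<in> Obj V" "C \<in> Obj V" "D \<in> Obj V"
    then show "\<eta> A B C D \<in> homset V ((A \<diamondop> B) \<diamondop> (C \<diamondop> D)) ((A \<diamondop> C) \<diamondop> (B \<diamondop> D))"
      by (simp add: homset_def)
  next
    fix f A A' g B B' h C C' k D D'
    assume "f \<in> homset V A A'" "g \<in> homset V B B'" "h \<in> homset V C C'" "k \<in> homset V D D'"
    then show "\<eta> A' B' C' D' \<cdot> ((f \<boxtimes> g) \<boxtimes> (h \<boxtimes> k)) = ((f \<boxtimes> h) \<boxtimes> (g \<boxtimes> k)) \<cdot> \<eta> A B C D"
      using eta_natural[of f g h k] by (auto simp: homset_def)
  qed (simp_all add: eta_units eta_internal_assoc eta_external_assoc)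
qed

end

section \<open>The induced functors\<close>

text \<open>The iterated coherence map from the product of the images to the image of the
  product.\<close>

fun phi_tree :: "('o, 'a) braided_functor \<Rightarrow> 'o bracketed \<Rightarrow> 'a" where
  "phi_tree f (Atom A) = Ident (BTarget f) (FObj (BFun f) A)"
| "phi_tree f (Prod s t) = Phi f (product_in (BSource f) s) (product_in (BSource f) t) \<cdot>\<^bsub>BTarget f\<^esub>
    (phi_tree f s \<star>\<^bsub>Ten (BTarget f)\<^esub> phi_tree f t)"

lemma num_factors_map [simp]: "num_factors (map_bracketed F s) = num_factors s"
  by (induction s) auto

text \<open>A braided functor carries a composite to a composite with the same word, up to the
  coherence maps. On generators this is compatibility with associators and braidings. The coherence
  maps may fail to be invertible, so for inverse generators it is the associator or braiding itself
  that is cancelled.\<close>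

lemma braided_functor_composite:
  assumes f: "is_braided_functor f" and h: "braid_composite (BSource f) s w t h"
  shows "\<exists>g. braid_composite (BTarget f) (map_bracketed (FObj (BFun f)) s) w (map_bracketed (FObj (BFun f)) t) g \<and>
    FArr (BFun f) h \<cdot>\<^bsub>BTarget f\<^esub> phi_tree f s = phi_tree f t \<cdot>\<^bsub>BTarget f\<^esub> g"
proof -
  let ?V = "BSource f" and ?W = "BTarget f"
  let ?m = "map_bracketed (FObj (BFun f))" and ?F = "FArr (BFun f)" and ?O = "FObj (BFun f)" and ?\<Phi> = "phi_tree f"
  let ?p = "product_in ?V" and ?q = "product_in ?W"
  note D = is_braided_functorD[OF f]
  interpret V: braided_category ?V using D(1) .
  interpret W: braided_category ?W using D(2) .
  note Fu = laxD(1)[OF D(3)]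
  note [simp] = is_functorD(3-8)[OF Fu] laxD(3-5)[OF D(3)]
  have pO [simp]: "set_bracketed s \<subseteq> Obj ?V \<Longrightarrow> ?p s \<in> Obj ?V" for s
    using V.tree_val_Obj[of "tree_of s"] by simp
  have mO [simp]: "set_bracketed s \<subseteq> Obj ?V \<Longrightarrow> set_bracketed (?m s) \<subseteq> Obj ?W" for s
    by (auto simp: bracketed.set_map)
  have qO [simp]: "set_bracketed s \<subseteq> Obj ?V \<Longrightarrow> ?q (?m s) \<in> Obj ?W" for s
    using W.tree_val_Obj[of "tree_of (?m s)"] mO[of s] by simp
  have \<Phi> [simp]: "set_bracketed s \<subseteq> Obj ?V \<Longrightarrow> ?\<Phi> s \<in> Arr ?W \<and> Dom ?W (?\<Phi> s) = ?q (?m s) \<and> Cod ?W (?\<Phi> s) = ?O (?p s)" for s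
    by (induction s) auto
  have typed: "set_bracketed s \<subseteq> Obj ?V \<and> set_bracketed t \<subseteq> Obj ?V \<and> h \<in> Arr ?V \<and> Dom ?V h = ?p s \<and> Cod ?V h = ?p t"
    if "braid_composite ?V s w t h" for s w t h
    using V.braid_composite_realizes[OF that] by (simp add: V.realizes_def)
  have typed': "g \<in> Arr ?W \<and> Dom ?W g = ?q s \<and> Cod ?W g = ?q t"
    if "braid_composite ?W s w t g" for s w t g
    using W.braid_composite_realizes[OF that] by (simp add: W.realizes_def)
  have phi_assoc: "?F (V.\<alpha>' (?p s) (?p t) (?p u)) \<cdot>\<^bsub>?W\<^esub> ?\<Phi> (Prod (Prod s t) u) =
      ?\<Phi> (Prod s (Prod t u)) \<cdot>\<^bsub>?W\<^esub> W.\<alpha>' (?q (?m s)) (?q (?m t)) (?q (?m u))"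
    if [simp]: "set_bracketed s \<subseteq> Obj ?V" "set_bracketed t \<subseteq> Obj ?V" "set_bracketed u \<subseteq> Obj ?V" for s t u
  proof -
    let ?\<phi> = "Phi f" and ?i = "Ident ?W"
    let ?r = "(?\<Phi> s \<star>\<^bsub>Ten ?W\<^esub> ?\<Phi> t) \<star>\<^bsub>Ten ?W\<^esub> ?\<Phi> u"
    have "?F (V.\<alpha>' (?p s) (?p t) (?p u)) \<cdot>\<^bsub>?W\<^esub> ?\<Phi> (Prod (Prod s t) u) =
       (?F (V.\<alpha>' (?p s) (?p t) (?p u)) \<cdot>\<^bsub>?W\<^esub> ?\<phi> (?p s \<odot>\<^bsub>Ten ?V\<^esub> ?p t) (?p u) \<cdot>\<^bsub>?W\<^esub>
         (?\<phi> (?p s) (?p t) \<star>\<^bsub>Ten ?W\<^esub> ?i (?O (?p u)))) \<cdot>\<^bsub>?W\<^esub> ?r"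
      by (simp add: W.TArr_Comp')
    also have "\<dots> = (?\<phi> (?p s) (?p t \<odot>\<^bsub>Ten ?V\<^esub> ?p u) \<cdot>\<^bsub>?W\<^esub> (?i (?O (?p s)) \<star>\<^bsub>Ten ?W\<^esub> ?\<phi> (?p t) (?p u)) \<cdot>\<^bsub>?W\<^esub>
       W.\<alpha>' (?O (?p s)) (?O (?p t)) (?O (?p u))) \<cdot>\<^bsub>?W\<^esub> ?r"
      by (subst laxD(7)[OF D(3)]) simp_all
    also have "\<dots> = ?\<phi> (?p s) (?p t \<odot>\<^bsub>Ten ?V\<^esub> ?p u) \<cdot>\<^bsub>?W\<^esub> (?i (?O (?p s)) \<star>\<^bsub>Ten ?W\<^esub> ?\<phi> (?p t) (?p u)) \<cdot>\<^bsub>?W\<^esub>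
       (?\<Phi> s \<star>\<^bsub>Ten ?W\<^esub> ?\<Phi> t \<star>\<^bsub>Ten ?W\<^esub> ?\<Phi> u) \<cdot>\<^bsub>?W\<^esub> W.\<alpha>' (?q (?m s)) (?q (?m t)) (?q (?m u))"
      using W.Assoc_natural'[of "?\<Phi> s" "?\<Phi> t" "?\<Phi> u"] by simp
    also have "\<dots> = ?\<Phi> (Prod s (Prod t u)) \<cdot>\<^bsub>?W\<^esub> W.\<alpha>' (?q (?m s)) (?q (?m t)) (?q (?m u))"
      by (simp add: W.TArr_Comp_tail)
    finally show ?thesis .
  qed
  have inverse: "?F (arrow_inv ?V x) \<cdot>\<^bsub>?W\<^esub> B = A \<cdot>\<^bsub>?W\<^esub> arrow_inv ?W y"
    if x: "iso_arrow ?V x" and y: "iso_arrow ?W y" and [simp]: "A \<in> Arr ?W" "B \<in> Arr ?W" "Cod ?W A = ?O (Dom ?V x)"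
      "Cod ?W B = ?O (Cod ?V x)" "Dom ?W A = Dom ?W y" "Dom ?W B = Cod ?W y"
      and eq: "?F x \<cdot>\<^bsub>?W\<^esub> A = B \<cdot>\<^bsub>?W\<^esub> y" for x y A B
  proof -
    note [simp] = V.iso_arrowD[OF x] W.iso_arrowD[OF y]
    have "?F (arrow_inv ?V x) \<cdot>\<^bsub>?W\<^esub> B = ?F (arrow_inv ?V x) \<cdot>\<^bsub>?W\<^esub> (B \<cdot>\<^bsub>?W\<^esub> y) \<cdot>\<^bsub>?W\<^esub> arrow_inv ?W y" by simp
    also have "\<dots> = (?F (arrow_inv ?V x) \<cdot>\<^bsub>?W\<^esub> ?F x) \<cdot>\<^bsub>?W\<^esub> A \<cdot>\<^bsub>?W\<^esub> arrow_inv ?W y"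
      unfolding eq[symmetric] by simp
    also have "?F (arrow_inv ?V x) \<cdot>\<^bsub>?W\<^esub> ?F x = ?F (arrow_inv ?V x \<cdot>\<^bsub>?V\<^esub> x)"
      by (rule is_functorD(8)[OF Fu, symmetric]) simp_all
    finally show ?thesis by simp
  qed
  from h show ?thesis
  proof (induction rule: braid_composite.induct)
    case (ident s)
    then show ?case using braid_composite.ident[of "?m s" ?W] mO[of s] by fastforce
  next
    case (assoc s t u)
    then have "braid_composite ?W (?m (Prod (Prod s t) u)) [] (?m (Prod s (Prod t u)))
       (W.\<alpha>' (?q (?m s)) (?q (?m t)) (?q (?m u)))"
      using braid_composite.assoc[of "?m s" "?m t" "?m u" ?W] mO[of s] mO[of t] mO[of u] by auto
    then show ?case using phi_assoc[of s t u] assoc by auto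
  next
    case (assoc_inv s t u)
    then have O: "set_bracketed s \<subseteq> Obj ?V" "set_bracketed t \<subseteq> Obj ?V" "set_bracketed u \<subseteq> Obj ?V" by auto
    note [simp] = O
    have "braid_composite ?W (?m (Prod s (Prod t u))) [] (?m (Prod (Prod s t) u))
       (arrow_inv ?W (W.\<alpha>' (?q (?m s)) (?q (?m t)) (?q (?m u))))"
      using braid_composite.assoc_inv[of "?m s" "?m t" "?m u" ?W] mO[of s] mO[of t] mO[of u] O by auto
    moreover have "?F (arrow_inv ?V (V.\<alpha>' (?p s) (?p t) (?p u))) \<cdot>\<^bsub>?W\<^esub> ?\<Phi> (Prod s (Prod t u)) =
       ?\<Phi> (Prod (Prod s t) u) \<cdot>\<^bsub>?W\<^esub> arrow_inv ?W (W.\<alpha>' (?q (?m s)) (?q (?m t)) (?q (?m u)))"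
      by (rule inverse[OF V.Assoc_iso W.Assoc_iso _ _ _ _ _ _ phi_assoc[OF O]]) simp_all
    ultimately show ?case by blast
  next
    case (braiding A B)
    then show ?case using braid_composite.braiding[of "?O A" ?W "?O B"] D(4)[of A B] by fastforce
  next
    case (braiding_inv A B)
    then have "?F (arrow_inv ?V (Braiding ?V B A)) \<cdot>\<^bsub>?W\<^esub> Phi f A B =
       Phi f B A \<cdot>\<^bsub>?W\<^esub> arrow_inv ?W (Braiding ?W (?O B) (?O A))"
      by (intro inverse[OF V.Braiding_iso W.Braiding_iso _ _ _ _ _ _ D(4)]) simp_all
    then show ?case using braiding_inv braid_composite.braiding_inv[of "?O A" ?W "?O B"] by fastforce
  next
    case (tensor_right s w t h u)
    then obtain g where g: "braid_composite ?W (?m s) w (?m t) g" "?F h \<cdot>\<^bsub>?W\<^esub> ?\<Phi> s = ?\<Phi> t \<cdot>\<^bsub>?W\<^esub> g" by auto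
    note [simp] = tensor_right.hyps(2) typed[OF tensor_right.hyps(1)] typed'[OF g(1)]
    have "?F (h \<star>\<^bsub>Ten ?V\<^esub> Ident ?V (?p u)) \<cdot>\<^bsub>?W\<^esub> Phi f (?p s) (?p u) \<cdot>\<^bsub>?W\<^esub> (?\<Phi> s \<star>\<^bsub>Ten ?W\<^esub> ?\<Phi> u) =
       Phi f (?p t) (?p u) \<cdot>\<^bsub>?W\<^esub> (?F h \<star>\<^bsub>Ten ?W\<^esub> Ident ?W (?O (?p u))) \<cdot>\<^bsub>?W\<^esub> (?\<Phi> s \<star>\<^bsub>Ten ?W\<^esub> ?\<Phi> u)"
      using W.Comp_tail[OF laxD(6)[OF D(3), of h "Ident ?V (?p u)"], of "?\<Phi> s \<star>\<^bsub>Ten ?W\<^esub> ?\<Phi> u"] by simp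
    also have "\<dots> = Phi f (?p t) (?p u) \<cdot>\<^bsub>?W\<^esub> (?\<Phi> t \<star>\<^bsub>Ten ?W\<^esub> ?\<Phi> u) \<cdot>\<^bsub>?W\<^esub> (g \<star>\<^bsub>Ten ?W\<^esub> Ident ?W (?q (?m u)))"
      using g(2) by (simp add: W.TArr_Comp')
    finally show ?case using braid_composite.tensor_right[OF g(1) mO[OF tensor_right.hyps(2)]] by auto
  next
    case (tensor_left s w t h u)
    then obtain g where g: "braid_composite ?W (?m s) w (?m t) g" "?F h \<cdot>\<^bsub>?W\<^esub> ?\<Phi> s = ?\<Phi> t \<cdot>\<^bsub>?W\<^esub> g" by auto
    note [simp] = tensor_left.hyps(2) typed[OF tensor_left.hyps(1)] typed'[OF g(1)]
    have "?F (Ident ?V (?p u) \<star>\<^bsub>Ten ?V\<^esub> h) \<cdot>\<^bsub>?W\<^esub> Phi f (?p u) (?p s) \<cdot>\<^bsub>?W\<^esub> (?\<Phi> u \<star>\<^bsub>Ten ?W\<^esub> ?\<Phi> s) =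
       Phi f (?p u) (?p t) \<cdot>\<^bsub>?W\<^esub> (Ident ?W (?O (?p u)) \<star>\<^bsub>Ten ?W\<^esub> ?F h) \<cdot>\<^bsub>?W\<^esub> (?\<Phi> u \<star>\<^bsub>Ten ?W\<^esub> ?\<Phi> s)"
      using W.Comp_tail[OF laxD(6)[OF D(3), of "Ident ?V (?p u)" h], of "?\<Phi> u \<star>\<^bsub>Ten ?W\<^esub> ?\<Phi> s"] by simp
    also have "\<dots> = Phi f (?p u) (?p t) \<cdot>\<^bsub>?W\<^esub> (?\<Phi> u \<star>\<^bsub>Ten ?W\<^esub> ?\<Phi> t) \<cdot>\<^bsub>?W\<^esub> (Ident ?W (?q (?m u)) \<star>\<^bsub>Ten ?W\<^esub> g)"
      using g(2) by (simp add: W.TArr_Comp')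
    finally show ?case using braid_composite.tensor_left[OF g(1) mO[OF tensor_left.hyps(2)]] by auto
  next
    case (comp s w t h w' u h')
    then obtain g g' where g: "braid_composite ?W (?m s) w (?m t) g" "?F h \<cdot>\<^bsub>?W\<^esub> ?\<Phi> s = ?\<Phi> t \<cdot>\<^bsub>?W\<^esub> g"
      "braid_composite ?W (?m t) w' (?m u) g'" "?F h' \<cdot>\<^bsub>?W\<^esub> ?\<Phi> t = ?\<Phi> u \<cdot>\<^bsub>?W\<^esub> g'" by auto
    note t = typed[OF comp.hyps(1)] typed[OF comp.hyps(2)] typed'[OF g(1)] typed'[OF g(3)]
    have "?F (h' \<cdot>\<^bsub>?V\<^esub> h) \<cdot>\<^bsub>?W\<^esub> ?\<Phi> s = ?F h' \<cdot>\<^bsub>?W\<^esub> ?\<Phi> t \<cdot>\<^bsub>?W\<^esub> g"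
      using t g(2) by simp
    also have "\<dots> = ?\<Phi> u \<cdot>\<^bsub>?W\<^esub> g' \<cdot>\<^bsub>?W\<^esub> g"
      using t W.Comp_tail[OF g(4), of g] by simp
    finally show ?case using braid_composite.comp[OF g(1,3)] by auto
  qed
qed

text \<open>The word is chosen before the category, because a braided functor compares the
  interchanges of its source and target by means of one word. The first argument only fixes the
  types.\<close>

definition acts_by_interchange :: "('o, 'a) braided itself \<Rightarrow> braid \<Rightarrow> bool" where
  "acts_by_interchange _ b \<longleftrightarrow>
    (\<exists>w. \<forall>V :: ('o, 'a) braided. braided_category V \<longrightarrow> (\<exists>E. interchange_category V b w E))"

lemma two_fold_functor_of_braided_sel [simp]:
  "TSource (two_fold_functor_of_braided b f) = two_fold_of_braided b (BSource f)"
  "TTarget (two_fold_functor_of_braided b f) = two_fold_of_braided b (BTarget f)"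
  "TFun (two_fold_functor_of_braided b f) = BFun f"
  "Lambda1 (two_fold_functor_of_braided b f) = Phi f" "Lambda2 (two_fold_functor_of_braided b f) = Phi f"
  by (simp_all add: two_fold_functor_of_braided_def)

text \<open>The interchange of the source is carried to a composite with the same word in the
  target, and by uniqueness that composite is the interchange of the target.\<close>

lemma is_two_fold_functor_of_braided:
  fixes f :: "('o, 'a) braided_functor"
  assumes b: "acts_by_interchange TYPE(('o, 'a) braided) b" and f: "is_braided_functor f"
  shows "is_two_fold_functor (two_fold_functor_of_braided b f)"
proof -
  let ?V = "BSource f" and ?W = "BTarget f" and ?F = "FObj (BFun f)"
  note D = is_braided_functorD[OF f]
  obtain w E E' where "interchange_category ?V b w E" "interchange_category ?W b w E'"
    using b D(1,2) unfolding acts_by_interchange_def by blast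
  interpret V: interchange_category ?V b w E by fact
  interpret W: interchange_category ?W b w E' by fact
  note [simp] = is_functorD(3-8)[OF laxD(1)[OF D(3)]] laxD(3-5)[OF D(3)]
  have "Phi f (A \<odot>\<^bsub>Ten ?V\<^esub> C) (B \<odot>\<^bsub>Ten ?V\<^esub> X) \<cdot>\<^bsub>?W\<^esub> (Phi f A C \<star>\<^bsub>Ten ?W\<^esub> Phi f B X) \<cdot>\<^bsub>?W\<^esub> W.\<eta> (?F A) (?F B) (?F C) (?F X) =
      FArr (BFun f) (V.\<eta> A B C X) \<cdot>\<^bsub>?W\<^esub> Phi f (A \<odot>\<^bsub>Ten ?V\<^esub> B) (C \<odot>\<^bsub>Ten ?V\<^esub> X) \<cdot>\<^bsub>?W\<^esub> (Phi f A B \<star>\<^bsub>Ten ?W\<^esub> Phi f C X)"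
    if [simp]: "A \<in> Obj ?V" "B \<in> Obj ?V" "C \<in> Obj ?V" "X \<in> Obj ?V" for A B C X
  proof -
    have c: "braid_composite ?V (V.source4 A B C X) w (V.source4 A C B X) (V.\<eta> A B C X)"
      by (rule V.braid_interchange_composite[OF V.b_carrier V.w_b V.w_perm]) simp_all
    obtain g where g: "braid_composite ?W (W.source4 (?F A) (?F B) (?F C) (?F X)) w (W.source4 (?F A) (?F C) (?F B) (?F X)) g"
      "FArr (BFun f) (V.\<eta> A B C X) \<cdot>\<^bsub>?W\<^esub> phi_tree f (V.source4 A B C X) = phi_tree f (V.source4 A C B X) \<cdot>\<^bsub>?W\<^esub> g"
      using braided_functor_composite[OF f c] by auto
    have c': "braid_composite ?W (W.source4 (?F A) (?F B) (?F C) (?F X)) w (W.source4 (?F A) (?F C) (?F B) (?F X)) (W.\<eta> (?F A) (?F B) (?F C) (?F X))"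
      by (rule W.braid_interchange_composite[OF V.b_carrier V.w_b V.w_perm]) simp_all
    have "g = W.\<eta> (?F A) (?F B) (?F C) (?F X)"
      by (rule W.braid_composite_unique[OF g(1) c' braid_class_rel[OF V.b_carrier V.w_b V.w_b]]) (simp add: eval_nat_numeral)
    then show ?thesis using g(2) by simp
  qed
  then show ?thesis unfolding is_two_fold_functor_def Let_def
    using D(3) V.two_fold_monoidal_two_fold_of_braided W.two_fold_monoidal_two_fold_of_braided by simp
qed

lemma two_fold_monoidal_acts:
  fixes V :: "('o, 'a) braided"
  assumes "acts_by_interchange TYPE(('o, 'a) braided) b" "braided_category V"
  shows "two_fold_monoidal (two_fold_of_braided b V)"
  using assms unfolding acts_by_interchange_def
  using interchange_category.two_fold_monoidal_two_fold_of_braided by blast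

lemma F_braid_sel [simp]:
  "braided_category V \<Longrightarrow> FObj (F_braid b) V = two_fold_of_braided b V"
  "is_braided_functor f \<Longrightarrow> FArr (F_braid b) f = two_fold_functor_of_braided b f"
  by (simp_all add: F_braid_def)

lemma is_functor_F_braid:
  fixes b :: braid
  assumes b: "acts_by_interchange TYPE(('o, 'a) braided) b"
  shows "is_functor BraidedCat TwoMonCat
    (F_braid b :: (('o, 'a) braided, ('o, 'a) braided_functor, ('o, 'a) two_fold, ('o, 'a) two_fold_functor) functor_data)"
proof (rule is_functorI)
  fix V :: "('o, 'a) braided" assume "V \<in> Obj BraidedCat"
  then show "FObj (F_braid b) V \<in> Obj TwoMonCat"
    using two_fold_monoidal_acts[OF b] by simp
next
  fix V :: "('o, 'a) braided" assume "V \<in> Obj BraidedCat"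
  then show "FArr (F_braid b) (Ident BraidedCat V) = Ident TwoMonCat (FObj (F_braid b) V)"
    using two_fold_monoidal_acts[OF b] is_braided_functor_id[of V]
    by (simp add: two_fold_functor_of_braided_def id_braided_functor_def id_two_fold_functor_def
        id_functor_def id_coherence_def fun_eq_iff)
next
  fix f :: "('o, 'a) braided_functor" assume "f \<in> Arr BraidedCat"
  then have f: "is_braided_functor f" by simp
  show "FArr (F_braid b) f \<in> Arr TwoMonCat \<and> Dom TwoMonCat (FArr (F_braid b) f) = FObj (F_braid b) (Dom BraidedCat f) \<and>
     Cod TwoMonCat (FArr (F_braid b) f) = FObj (F_braid b) (Cod BraidedCat f)"
    using f is_two_fold_functor_of_braided[OF b f] is_braided_functorD(1,2)[OF f] by simp
next
  fix f g :: "('o, 'a) braided_functor"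
  assume "f \<in> Arr BraidedCat" "g \<in> Arr BraidedCat" "Cod BraidedCat f = Dom BraidedCat g"
  then have f: "is_braided_functor f" and g: "is_braided_functor g" and fg: "BTarget f = BSource g" by auto
  show "FArr (F_braid b) (g \<cdot>\<^bsub>BraidedCat\<^esub> f) = FArr (F_braid b) g \<cdot>\<^bsub>TwoMonCat\<^esub> FArr (F_braid b) f"
    using f g fg is_two_fold_functor_of_braided[OF b f] is_two_fold_functor_of_braided[OF b g]
      is_braided_functor_comp[OF f g fg]
    by (simp add: two_fold_functor_of_braided_def comp_two_fold_functor_def comp_braided_functor_def
        comp_functor_def comp_coherence_def cong: if_cong)
qed (simp_all add: category_BraidedCat category_TwoMonCat F_braid_def)

section \<open>Comparison with the elementary crossings\<close>

lemma two_fold_of_braided_data [simp]: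
  "id_functor (two_fold_of_braided b V) = id_functor V"
  "comp_functor (two_fold_of_braided b V) G F = comp_functor V G F"
  "id_coherence (two_fold_of_braided b V) T = id_coherence V T"
  "comp_coherence (two_fold_of_braided b V) (two_fold_of_braided c W) G \<psi> F \<phi> = comp_coherence V W G \<psi> F \<phi>"
  by (simp_all add: id_functor_def comp_functor_def id_coherence_def comp_coherence_def fun_eq_iff cong: if_cong)

text \<open>The laws for \<open>\<lambda>\<^sup>2\<close> on an identity functor with
  \<open>\<lambda>\<^sup>1 = 1\<close>, together with invertibility.\<close>

locale unit_comparison = braided_category V for V :: "('o, 'a) braided" (structure) +
  fixes l :: "'o \<Rightarrow> 'o \<Rightarrow> 'a"
  assumes l_iso: "A \<in> Obj V \<Longrightarrow> B \<in> Obj V \<Longrightarrow> iso_arrow V (l A B)"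
    and l_typed [simp]: "A \<in> Obj V \<Longrightarrow> B \<in> Obj V \<Longrightarrow> l A B \<in> Arr V"
      "A \<in> Obj V \<Longrightarrow> B \<in> Obj V \<Longrightarrow> Dom V (l A B) = A \<diamondop> B"
      "A \<in> Obj V \<Longrightarrow> B \<in> Obj V \<Longrightarrow> Cod V (l A B) = A \<diamondop> B"
    and l_natural: "f \<in> Arr V \<Longrightarrow> g \<in> Arr V \<Longrightarrow> l (Cod V f) (Cod V g) \<cdot> (f \<boxtimes> g) = (f \<boxtimes> g) \<cdot> l (Dom V f) (Dom V g)"
    and l_unit: "A \<in> Obj V \<Longrightarrow> l A (BUnit V) = Ident V A" "A \<in> Obj V \<Longrightarrow> l (BUnit V) A = Ident V A"
    and l_assoc: "A \<in> Obj V \<Longrightarrow> B \<in> Obj V \<Longrightarrow> D \<in> Obj V \<Longrightarrow>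
      l A (B \<diamondop> D) \<cdot> (Ident V A \<boxtimes> l B D) \<cdot> \<alpha>' A B D = \<alpha>' A B D \<cdot> l (A \<diamondop> B) D \<cdot> (l A B \<boxtimes> Ident V D)"
begin

lemmas l_inv [simp] = iso_arrowD[OF l_iso]

lemma l_inv_natural:
  assumes [simp]: "f \<in> Arr V" "g \<in> Arr V"
  shows "arrow_inv V (l (Cod V f) (Cod V g)) \<cdot> (f \<boxtimes> g) = (f \<boxtimes> g) \<cdot> arrow_inv V (l (Dom V f) (Dom V g))"
proof (rule iso_mono[OF l_iso[of "Cod V f" "Cod V g"]])
  show "l (Cod V f) (Cod V g) \<cdot> arrow_inv V (l (Cod V f) (Cod V g)) \<cdot> f \<boxtimes> g =
     l (Cod V f) (Cod V g) \<cdot> f \<boxtimes> g \<cdot> arrow_inv V (l (Dom V f) (Dom V g))"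
    using Comp_tail[OF l_natural[of f g], of "arrow_inv V (l (Dom V f) (Dom V g))"]
    by (simp add: inv_Comp_tail[OF l_iso])
qed simp_all

text \<open>Inverting the associativity law reverses the order of the two factors on each side;
  naturality restores it.\<close>

lemma inverse_comparison: "unit_comparison V (\<lambda>A B. arrow_inv V (l A B))"
proof unfold_locales
  fix A assume "A \<in> Obj V"
  then show "arrow_inv V (l A (BUnit V)) = Ident V A" "arrow_inv V (l (BUnit V) A) = Ident V A"
    by (simp_all add: l_unit)
next
  fix A B D assume [simp]: "A \<in> Obj V" "B \<in> Obj V" "D \<in> Obj V"
  let ?k = "\<lambda>A B. arrow_inv V (l A B)"
  let ?X = "?k A (B \<diamondop> D) \<cdot> (Ident V A \<boxtimes> ?k B D) \<cdot> \<alpha>' A B D"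
  let ?r = "l (A \<diamondop> B) D \<cdot> (l A B \<boxtimes> Ident V D)"
  have ir: "iso_arrow V ?r" by (intro iso_Comp iso_TArr l_iso) simp_all
  have "?X = (Ident V A \<boxtimes> ?k B D) \<cdot> ?k A (B \<diamondop> D) \<cdot> \<alpha>' A B D"
    using Comp_tail[OF l_inv_natural[of "Ident V A" "?k B D"], of "\<alpha>' A B D"] by simp
  moreover have "\<alpha>' A B D \<cdot> ?r = l A (B \<diamondop> D) \<cdot> (Ident V A \<boxtimes> l B D) \<cdot> \<alpha>' A B D"
    by (simp add: l_assoc)
  ultimately have "?X \<cdot> ?r = (Ident V A \<boxtimes> ?k B D) \<cdot> (?k A (B \<diamondop> D) \<cdot> l A (B \<diamondop> D) \<cdot> (Ident V A \<boxtimes> l B D) \<cdot> \<alpha>' A B D)"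
    by simp
  also have "\<dots> = \<alpha>' A B D"
    by (simp add: inv_Comp_tail[OF l_iso] TArr_Comp_tail)
  also have "\<dots> = (\<alpha>' A B D \<cdot> ?k (A \<diamondop> B) D \<cdot> (?k A B \<boxtimes> Ident V D)) \<cdot> ?r"
  proof -
    have "?k (A \<diamondop> B) D \<cdot> (?k A B \<boxtimes> Ident V D) = (?k A B \<boxtimes> Ident V D) \<cdot> ?k (A \<diamondop> B) D"
      using l_inv_natural[of "?k A B" "Ident V D"] by simp
    then show ?thesis by (simp add: inv_Comp_tail[OF l_iso] TArr_Comp')
  qed
  finally have eq: "?X \<cdot> ?r = (\<alpha>' A B D \<cdot> ?k (A \<diamondop> B) D \<cdot> (?k A B \<boxtimes> Ident V D)) \<cdot> ?r" .
  show "?X = \<alpha>' A B D \<cdot> ?k (A \<diamondop> B) D \<cdot> (?k A B \<boxtimes> Ident V D)"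
    by (rule iso_epi[OF ir _ _ _ _ eq]) simp_all
qed (simp_all add: l_inv_natural)

end

definition comparison_functor ::
  "braid \<Rightarrow> braid \<Rightarrow> ('o, 'a) braided \<Rightarrow> ('o \<Rightarrow> 'o \<Rightarrow> 'a) \<Rightarrow> ('o, 'a) two_fold_functor" where
  "comparison_functor b c V l =
    \<lparr>TSource = two_fold_of_braided b V, TTarget = two_fold_of_braided c V, TFun = id_functor V,
     Lambda1 = id_coherence V (Ten V),
     Lambda2 = (\<lambda>A B. if A \<in> Obj V \<and> B \<in> Obj V then l A B else undefined)\<rparr>"

text \<open>What remains of the interchange condition of a 2-fold monoidal functor when the functor
  is an identity and \<open>\<lambda>\<^sup>1 = 1\<close>.\<close>

definition comparison_compatible ::
  "braid \<Rightarrow> braid \<Rightarrow> ('o, 'a) braided \<Rightarrow> ('o \<Rightarrow> 'o \<Rightarrow> 'a) \<Rightarrow> bool" where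
  "comparison_compatible b c V l \<longleftrightarrow> (\<forall>A\<in>Obj V. \<forall>B\<in>Obj V. \<forall>C\<in>Obj V. \<forall>D\<in>Obj V.
    l (A \<odot>\<^bsub>Ten V\<^esub> C) (B \<odot>\<^bsub>Ten V\<^esub> D) \<cdot>\<^bsub>V\<^esub> braid_interchange c V A B C D =
    braid_interchange b V A B C D \<cdot>\<^bsub>V\<^esub> (l A B \<star>\<^bsub>Ten V\<^esub> l C D))"

lemma is_two_fold_functor_comparison:
  assumes l: "unit_comparison V l" and b: "two_fold_monoidal (two_fold_of_braided b V)"
    and c: "two_fold_monoidal (two_fold_of_braided c V)" and bc: "comparison_compatible b c V l"
  shows "is_two_fold_functor (comparison_functor b c V l)"
proof -
  interpret unit_comparison V l by fact
  interpret B: two_fold_monoidal "two_fold_of_braided b V" by fact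
  interpret C: two_fold_monoidal "two_fold_of_braided c V" by fact
  let ?l = "\<lambda>A B. if A \<in> Obj V \<and> B \<in> Obj V then l A B else undefined"
  note Bt = B.Eta_typed[unfolded two_fold_of_braided_sel] and Ct = C.Eta_typed[unfolded two_fold_of_braided_sel]
  have "lax_monoidal_functor V (Ten V) (BUnit V) V (Ten V) (BUnit V) (id_functor V) ?l"
    by (rule laxI) (auto simp: is_functor_id[OF category_axioms] l_natural l_unit l_assoc extensional_def)
  moreover have "l (A \<odot>\<^bsub>Ten V\<^esub> C) (B \<odot>\<^bsub>Ten V\<^esub> D) \<cdot>\<^bsub>V\<^esub> braid_interchange c V A B C D =
    braid_interchange b V A B C D \<cdot>\<^bsub>V\<^esub> (l A B \<star>\<^bsub>Ten V\<^esub> l C D)"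
    if "A \<in> Obj V" "B \<in> Obj V" "C \<in> Obj V" "D \<in> Obj V" for A B C D
    using bc that by (auto simp: comparison_compatible_def)
  ultimately show ?thesis
    unfolding is_two_fold_functor_def Let_def comparison_functor_def
    using b c lax_id[OF monoidal_axioms] by (simp add: Bt Ct)
qed

lemma comparison_compatible_inverse:
  assumes l: "unit_comparison V l" and b: "two_fold_monoidal (two_fold_of_braided b V)"
    and c: "two_fold_monoidal (two_fold_of_braided c V)" and bc: "comparison_compatible b c V l"
  shows "comparison_compatible c b V (\<lambda>A B. arrow_inv V (l A B))"
  unfolding comparison_compatible_def
proof (intro ballI)
  fix A B C D assume [simp]: "A \<in> Obj V" "B \<in> Obj V" "C \<in> Obj V" "D \<in> Obj V"
  interpret unit_comparison V l by fact
  interpret B: two_fold_monoidal "two_fold_of_braided b V" by fact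
  interpret C: two_fold_monoidal "two_fold_of_braided c V" by fact
  note [simp] = B.Eta_typed[unfolded two_fold_of_braided_sel] C.Eta_typed[unfolded two_fold_of_braided_sel]
  let ?k = "\<lambda>A B. arrow_inv V (l A B)"
  let ?lhs = "?k (A \<diamondop> C) (B \<diamondop> D) \<cdot>\<^bsub>V\<^esub> braid_interchange b V A B C D"
    and ?rhs = "braid_interchange c V A B C D \<cdot>\<^bsub>V\<^esub> (?k A B \<boxtimes> ?k C D)"
  have i: "iso_arrow V (l A B \<boxtimes> l C D)" by (intro iso_TArr l_iso) simp_all
  have "?lhs \<cdot>\<^bsub>V\<^esub> (l A B \<boxtimes> l C D) = ?k (A \<diamondop> C) (B \<diamondop> D) \<cdot>\<^bsub>V\<^esub> (braid_interchange b V A B C D \<cdot>\<^bsub>V\<^esub> (l A B \<boxtimes> l C D))"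
    by simp
  also have "\<dots> = ?k (A \<diamondop> C) (B \<diamondop> D) \<cdot>\<^bsub>V\<^esub> l (A \<diamondop> C) (B \<diamondop> D) \<cdot>\<^bsub>V\<^esub> braid_interchange c V A B C D"
    using bc by (simp add: comparison_compatible_def)
  also have "\<dots> = ?rhs \<cdot>\<^bsub>V\<^esub> (l A B \<boxtimes> l C D)"
    by (simp add: inv_Comp_tail[OF l_iso] TArr_Comp')
  finally have eq: "?lhs \<cdot>\<^bsub>V\<^esub> (l A B \<boxtimes> l C D) = ?rhs \<cdot>\<^bsub>V\<^esub> (l A B \<boxtimes> l C D)" .
  show "?lhs = ?rhs" by (rule iso_epi[OF i _ _ _ _ eq]) simp_all
qed

lemma comp_comparison_functor:
  assumes l: "unit_comparison V l" and k: "\<And>A B. A \<in> Obj V \<Longrightarrow> B \<in> Obj V \<Longrightarrow> l A B \<cdot>\<^bsub>V\<^esub> k A B = Ident V (A \<odot>\<^bsub>Ten V\<^esub> B)"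
    "\<And>A B. A \<in> Obj V \<Longrightarrow> B \<in> Obj V \<Longrightarrow> k A B \<in> Arr V"
  shows "comp_two_fold_functor (comparison_functor c b V k) (comparison_functor b c V l) =
    id_two_fold_functor (two_fold_of_braided b V)"
proof -
  interpret unit_comparison V l by fact
  have "comp_functor V (id_functor V) (id_functor V) = id_functor V"
    using comp_functor_id[OF is_functor_id[OF category_axioms]] by simp
  moreover have "comp_coherence V V (id_functor V) (id_coherence V (Ten V)) (id_functor V) (id_coherence V (Ten V)) = id_coherence V (Ten V)"
    using comp_coherence_id[OF lax_id[OF monoidal_axioms] monoidal_axioms monoidal_axioms] by simp
  moreover have "comp_coherence V V (id_functor V) (\<lambda>A B. if A \<in> Obj V \<and> B \<in> Obj V then k A B else undefined) (id_functor V)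
     (\<lambda>A B. if A \<in> Obj V \<and> B \<in> Obj V then l A B else undefined) = id_coherence V (Ten V)"
    by (rule coherence_eqI[where O' = "Obj V"]) (simp_all add: k)
  ultimately show ?thesis
    unfolding comp_two_fold_functor_def id_two_fold_functor_def by (simp add: comparison_functor_def)
qed

context interchange_category
begin

abbreviation outer_eta where "outer_eta A B \<equiv> \<eta> A (BUnit V) (BUnit V) B"

lemma outer_eta_realizes:
  assumes "tree_Ob s" "tree_Ob t"
  shows "realizes (Node s t) (E (leaves s) [] [] (leaves t)) (Node s t) (outer_eta (tree_val s) (tree_val t))"
proof -
  have "theta (Node (Node s Empty) (Node Empty t)) = theta (Node s t)"
    by (rule theta_Node_cong) (use assms in \<open>simp_all del: theta.simps\<close>)
  then show ?thesis
    using eta_realizes[of s Empty Empty t] assms by (simp add: realizes_def del: theta.simps)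
qed

text \<open>Naturality and the unit laws are inherited from \<open>\<eta>\<close>, invertibility
  from \<open>E\<close>, and associativity is the strict law \<open>outer_assoc\<close> read through
  realizations.\<close>

lemma unit_comparison_outer: "unit_comparison V outer_eta"
proof unfold_locales
  fix A B assume [simp]: "A \<in> Obj V" "B \<in> Obj V"
  obtain g where "strict.inverse_pair (E [A] [] [] [B]) g"
    using strict.E_invertible[of "[A]" "[]" "[]" "[B]"] by auto
  then show "iso_arrow V (outer_eta A B)"
    using realizes_inverse(1)[OF outer_eta_realizes[of "Leaf A" "Leaf B"]] by simp
next
  fix f g assume "f \<in> Arr V" "g \<in> Arr V"
  then show "outer_eta (Cod V f) (Cod V g) \<cdot> (f \<boxtimes> g) = (f \<boxtimes> g) \<cdot> outer_eta (Dom V f) (Dom V g)"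
    using eta_natural[of f "Ident V (BUnit V)" "Ident V (BUnit V)" g] by simp
next
  fix A B D assume [simp]: "A \<in> Obj V" "B \<in> Obj V" "D \<in> Obj V"
  let ?a = "Leaf A" and ?b = "Leaf B" and ?d = "Leaf D"
  have 1: "realizes (Node (Node ?a ?b) ?d) ((sid [A, B, D] \<triangleright> (sid [A] \<parallel> E [B] [] [] [D])) \<triangleright> E [A] [] [] [B, D])
     (Node ?a (Node ?b ?d)) (outer_eta A (B \<diamondop> D) \<cdot> (Ident V A \<boxtimes> outer_eta B D) \<cdot> \<alpha>' A B D)"
    using realizes_Comp[OF realizes_Comp[OF realizes_Assoc[of ?a ?b ?d] realizes_TArr[OF realizes_Ident[of ?a] outer_eta_realizes[of ?b ?d]]]
        outer_eta_realizes[of ?a "Node ?b ?d"]] by simp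
  have 2: "realizes (Node (Node ?a ?b) ?d) (((E [A] [] [] [B] \<parallel> sid [D]) \<triangleright> E [A, B] [] [] [D]) \<triangleright> sid [A, B, D])
     (Node ?a (Node ?b ?d)) (\<alpha>' A B D \<cdot> outer_eta (A \<diamondop> B) D \<cdot> (outer_eta A B \<boxtimes> Ident V D))"
    using realizes_Comp[OF realizes_Comp[OF realizes_TArr[OF outer_eta_realizes[of ?a ?b] realizes_Ident[of ?d]]
        outer_eta_realizes[of "Node ?a ?b" ?d]] realizes_Assoc[of ?a ?b ?d]] by simp
  show "outer_eta A (B \<diamondop> D) \<cdot> (Ident V A \<boxtimes> outer_eta B D) \<cdot> \<alpha>' A B D =
     \<alpha>' A B D \<cdot> outer_eta (A \<diamondop> B) D \<cdot> (outer_eta A B \<boxtimes> Ident V D)"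
    by (rule realizes_unique[OF 1]) (use 2 strict.outer_assoc[of "[A]" "[B]" "[D]"] in simp)
qed (simp_all add: eta_units)

text \<open>The Eckmann--Hilton decomposition \<open>dec\<close>, read through realizations, is the
  compatibility of the two interchanges with the outer restriction.\<close>

lemma comparison_compatible_crossing:
  assumes c: "interchange_category V c v (\<lambda>U V W X. sid U \<parallel> sbraiding e V W \<parallel> sid X)"
    and dec: "\<And>A B C D. A \<in> lists (Obj V) \<Longrightarrow> B \<in> lists (Obj V) \<Longrightarrow> C \<in> lists (Obj V) \<Longrightarrow> D \<in> lists (Obj V) \<Longrightarrow>
      (E A [] [] B \<parallel> E C [] [] D) \<triangleright> E A B C D = (sid A \<parallel> sbraiding e B C \<parallel> sid D) \<triangleright> E (A @ C) [] [] (B @ D)"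
  shows "comparison_compatible b c V outer_eta"
  unfolding comparison_compatible_def
proof (intro ballI)
  fix A B C D assume [simp]: "A \<in> Obj V" "B \<in> Obj V" "C \<in> Obj V" "D \<in> Obj V"
  interpret c: interchange_category V c v "\<lambda>U V W X. sid U \<parallel> sbraiding e V W \<parallel> sid X" by fact
  let ?a = "Leaf A" and ?b = "Leaf B" and ?c = "Leaf C" and ?d = "Leaf D"
  have 1: "realizes (Node (Node ?a ?b) (Node ?c ?d)) ((sid [A] \<parallel> sbraiding e [B] [C] \<parallel> sid [D]) \<triangleright> E [A, C] [] [] [B, D])
     (Node (Node ?a ?c) (Node ?b ?d)) (outer_eta (A \<diamondop> C) (B \<diamondop> D) \<cdot> c.\<eta> A B C D)"
    using realizes_Comp[OF c.eta_realizes[of ?a ?b ?c ?d] outer_eta_realizes[of "Node ?a ?c" "Node ?b ?d"]]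
    by (simp del: sbraiding.simps)
  have 2: "realizes (Node (Node ?a ?b) (Node ?c ?d)) ((E [A] [] [] [B] \<parallel> E [C] [] [] [D]) \<triangleright> E [A] [B] [C] [D])
     (Node (Node ?a ?c) (Node ?b ?d)) (\<eta> A B C D \<cdot> (outer_eta A B \<boxtimes> outer_eta C D))"
    using realizes_Comp[OF realizes_TArr[OF outer_eta_realizes[of ?a ?b] outer_eta_realizes[of ?c ?d]] eta_realizes[of ?a ?b ?c ?d]]
    by simp
  show "outer_eta (A \<diamondop> C) (B \<diamondop> D) \<cdot> c.\<eta> A B C D = \<eta> A B C D \<cdot> (outer_eta A B \<boxtimes> outer_eta C D)"
    by (rule realizes_unique[OF 1]) (use 2 dec[of "[A]" "[B]" "[C]" "[D]"] in \<open>simp del: sbraiding.simps\<close>)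
qed

end

lemma naturally_equivalent_F_braid:
  assumes b: "acts_by_interchange TYPE(('o, 'a) braided) b" and c: "acts_by_interchange TYPE(('o, 'a) braided) c"
    and compat: "\<And>V :: ('o, 'a) braided. braided_category V \<Longrightarrow>
      comparison_compatible b c V (\<lambda>A B. braid_interchange b V A (BUnit V) (BUnit V) B)"
  shows "naturally_equivalent (BraidedCat :: (('o, 'a) braided, ('o, 'a) braided_functor) cat) TwoMonCat (F_braid b) (F_braid c)"
proof -
  let ?l = "\<lambda>V A B. braid_interchange b V A (BUnit V) (BUnit V) B"
  let ?\<tau> = "\<lambda>V :: ('o, 'a) braided. comparison_functor b c V (?l V)"
  let ?\<sigma> = "\<lambda>V :: ('o, 'a) braided. comparison_functor c b V (\<lambda>A B. arrow_inv V (?l V A B))"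
  have l: "unit_comparison V (?l V)" if "braided_category V" for V :: "('o, 'a) braided"
    using b that interchange_category.unit_comparison_outer unfolding acts_by_interchange_def by blast
  have sel: "TSource (comparison_functor b c V l) = two_fold_of_braided b V" "TTarget (comparison_functor b c V l) = two_fold_of_braided c V"
    for b c l and V :: "('o, 'a) braided" by (simp_all add: comparison_functor_def)
  have \<tau>: "is_two_fold_functor (?\<tau> V)" "is_two_fold_functor (?\<sigma> V)"
    and inv: "comp_two_fold_functor (?\<sigma> V) (?\<tau> V) = id_two_fold_functor (two_fold_of_braided b V)"
    "comp_two_fold_functor (?\<tau> V) (?\<sigma> V) = id_two_fold_functor (two_fold_of_braided c V)"
    if V: "braided_category V" for V :: "('o, 'a) braided"
  proof -
    interpret unit_comparison V "?l V" by (rule l[OF V])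
    note m = two_fold_monoidal_acts[OF b V] two_fold_monoidal_acts[OF c V]
    show "is_two_fold_functor (?\<tau> V)"
      by (rule is_two_fold_functor_comparison[OF l[OF V] m compat[OF V]])
    show "is_two_fold_functor (?\<sigma> V)"
      by (rule is_two_fold_functor_comparison[OF inverse_comparison m(2,1)
          comparison_compatible_inverse[OF l[OF V] m compat[OF V]]])
    show "comp_two_fold_functor (?\<sigma> V) (?\<tau> V) = id_two_fold_functor (two_fold_of_braided b V)"
      by (rule comp_comparison_functor[OF l[OF V]]) (simp_all add: iso_arrowD[OF l_iso])
    show "comp_two_fold_functor (?\<tau> V) (?\<sigma> V) = id_two_fold_functor (two_fold_of_braided c V)"
      by (rule comp_comparison_functor[OF inverse_comparison]) (simp_all add: iso_arrowD[OF l_iso])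
  qed
  have "natural_isomorphism BraidedCat TwoMonCat (F_braid b) (F_braid c) ?\<tau>"
    unfolding natural_isomorphism_def
  proof (intro conjI ballI allI)
    show "is_functor BraidedCat TwoMonCat
      (F_braid b :: (('o, 'a) braided, ('o, 'a) braided_functor, ('o, 'a) two_fold, ('o, 'a) two_fold_functor) functor_data)"
      by (rule is_functor_F_braid[OF b])
    show "is_functor BraidedCat TwoMonCat
      (F_braid c :: (('o, 'a) braided, ('o, 'a) braided_functor, ('o, 'a) two_fold, ('o, 'a) two_fold_functor) functor_data)"
      by (rule is_functor_F_braid[OF c])
  next
    fix V :: "('o, 'a) braided" assume "V \<in> Obj BraidedCat"
    then have V: "braided_category V" by simp
    note m = two_fold_monoidal_acts[OF b V] two_fold_monoidal_acts[OF c V]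
    show "?\<tau> V \<in> homset TwoMonCat (FObj (F_braid b) V) (FObj (F_braid c) V)"
      using V \<tau>[OF V] by (simp add: homset_def sel)
    show "iso_arrow TwoMonCat (?\<tau> V)"
      unfolding iso_arrow_def inverse_arrows_def
      using \<tau>[OF V] inv[OF V] m by (intro exI[of _ "?\<sigma> V"]) (simp add: homset_def sel)
  next
    fix V W :: "('o, 'a) braided" and f :: "('o, 'a) braided_functor"
    assume "f \<in> homset BraidedCat V W"
    then have f: "is_braided_functor f" and VW: "BSource f = V" "BTarget f = W" by (auto simp: homset_def)
    note D = is_braided_functorD[OF f, unfolded VW]
    interpret V: unit_comparison V "?l V" by (rule l[OF D(1)])
    interpret W: unit_comparison W "?l W" by (rule l[OF D(2)])
    note F = is_two_fold_functor_of_braided[OF b f] is_two_fold_functor_of_braided[OF c f]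
    note T = is_two_fold_functorD(5)[OF F(1), simplified, unfolded VW]
    let ?r = "\<lambda>V A B. if A \<in> Obj V \<and> B \<in> Obj V then ?l V A B else undefined"
    note [simp] = is_functorD(3-8)[OF laxD(1)[OF D(3)]] laxD(2-5,8,9)[OF D(3)]
    \<comment> \<open>At \<open>A, I, I, B\<close> the coherence maps with a unit argument are
      identities, so the interchange condition says that \<open>f\<close> respects the outer
      restriction. This is the naturality of \<open>?\<tau>\<close>.\<close>
    have nat: "Phi f A B \<cdot>\<^bsub>W\<^esub> ?l W (FObj (BFun f) A) (FObj (BFun f) B) = FArr (BFun f) (?l V A B) \<cdot>\<^bsub>W\<^esub> Phi f A B"
      if [simp]: "A \<in> Obj V" "B \<in> Obj V" for A B
      using T[of A "BUnit V" "BUnit V" B] by simp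
    have 1: "comp_functor V (id_functor W) (BFun f) = BFun f" "comp_functor V (BFun f) (id_functor V) = BFun f"
      "comp_coherence V W (id_functor W) (id_coherence W (Ten W)) (BFun f) (Phi f) = Phi f"
      "comp_coherence V W (BFun f) (Phi f) (id_functor V) (id_coherence V (Ten V)) = Phi f"
      using comp_functor_id[OF laxD(1)[OF D(3)]]
        comp_coherence_id[OF D(3) V.monoidal_axioms W.monoidal_axioms] by auto
    have 2: "comp_coherence V W (id_functor W) (?r W) (BFun f) (Phi f) = comp_coherence V W (BFun f) (Phi f) (id_functor V) (?r V)"
      by (rule coherence_eqI[where O' = "Obj V"]) (simp_all add: nat)
    have "comp_two_fold_functor (?\<tau> W) (two_fold_functor_of_braided b f) = comp_two_fold_functor (two_fold_functor_of_braided c f) (?\<tau> V)"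
      using 1 2 VW unfolding comp_two_fold_functor_def
      by (simp add: comparison_functor_def)
    then show "?\<tau> W \<cdot>\<^bsub>TwoMonCat\<^esub> FArr (F_braid b) f = FArr (F_braid c) f \<cdot>\<^bsub>TwoMonCat\<^esub> ?\<tau> V"
      using f F \<tau>[OF D(1)] \<tau>[OF D(2)] VW by (simp add: sel)
  qed
  then show ?thesis unfolding naturally_equivalent_def by blast
qed

section \<open>The elementary crossings and the given braid as instances\<close>

abbreviation crossing_class :: "bool \<Rightarrow> braid" where "crossing_class e \<equiv> braid_class 4 [(2, e)]"

lemma braid_class_carrierI: "w \<in> braid_words n \<Longrightarrow> braid_class n w \<in> carrier (braid_group n) \<and> w \<in> braid_class n w"
  by (auto simp: braid_class_def braid_group_def intro: quotientI braid_rel.refl)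

lemma crossing_class_interchange:
  assumes "braided_category V"
  shows "interchange_category V (crossing_class e) [(2, e)]
    (\<lambda>U V' W X. monoidal.stens V (Ten V) (BUnit V) (monoidal.sid V (Ten V) (BUnit V) U)
      (monoidal.stens V (Ten V) (BUnit V) (braided_category.sbraiding V e V' W) (monoidal.sid V (Ten V) (BUnit V) X)))"
proof -
  interpret braided_category V by fact
  show ?thesis
  proof (rule interchange_category.intro[OF braided_category_axioms], rule interchange_category_axioms.intro)
    show "crossing_class e \<in> carrier (braid_group 4)" "[(2, e)] \<in> crossing_class e"
      using braid_class_carrierI[of "[(2, e)]" 4] by auto
    show "word_perm [(2, e)] = transpose 2 3" by (simp add: eval_nat_numeral)
    show "strict_interchange (Obj V) sarr sdom scod sid sseq stens sbraiding
       (\<lambda>U V' W X. sid U \<parallel> sbraiding e V' W \<parallel> sid X)"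
      by (rule strict.strict_interchange_crossing)
    fix A B C D assume "A \<in> Obj V" "B \<in> Obj V" "C \<in> Obj V" "D \<in> Obj V"
    then show "sid [A] \<parallel> sbraiding e [B] [C] \<parallel> sid [D] = strict.act [(2, e)] [[A], [B], [C], [D]]"
      using strict.act_middle[of "[A]" "[B]" "[C]" "[D]" e] by simp
  qed
qed

lemma acts_by_interchange_crossing: "acts_by_interchange TYPE(('o, 'a) braided) (crossing_class e)"
  unfolding acts_by_interchange_def using crossing_class_interchange by blast

lemma braid_action_strict:
  assumes "braided_category V" "interchanging_unital_braid b" "w \<in> b"
  shows "braid_action (Obj V) (monoidal.sarr V (Ten V) (BUnit V)) sdom scod (monoidal.sid V (Ten V) (BUnit V))
    (monoidal.sseq V) (monoidal.stens V (Ten V) (BUnit V)) (braided_category.sbraiding V) b w"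
proof -
  interpret braided_category V by fact
  show ?thesis by unfold_locales (use assms in auto)
qed

lemma interchange_category_braid:
  assumes "braided_category V" "interchanging_unital_braid b" "w \<in> b"
  shows "interchange_category V b w (\<lambda>U V' W X. strict_braided.act
    (monoidal.sid V (Ten V) (BUnit V)) (monoidal.sseq V) (monoidal.stens V (Ten V) (BUnit V))
    (braided_category.sbraiding V) w [U, V', W, X])"
proof -
  interpret braided_category V by fact
  interpret a: braid_action "Obj V" sarr sdom scod sid sseq stens sbraiding b w
    by (rule braid_action_strict[OF assms])
  show ?thesis
    by (rule interchange_category.intro[OF braided_category_axioms], rule interchange_category_axioms.intro)
      (use assms interchanging_braid_rels[OF assms(2,3)] a.strict_interchange_axioms in
        \<open>auto simp: interchanging_unital_braid_def\<close>)
qed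

lemma acts_by_interchange_braid:
  assumes "interchanging_unital_braid b"
  shows "acts_by_interchange TYPE(('o, 'a) braided) b"
proof -
  obtain w where "w \<in> b"
    using braid_class_nonempty[of b 4] assms by (auto simp: interchanging_unital_braid_def)
  then show ?thesis unfolding acts_by_interchange_def using interchange_category_braid assms by blast
qed

lemma naturally_equivalent_crossing:
  assumes b: "interchanging_unital_braid b" and w: "w \<in> b"
    and e: "comparison_exponent w = 1 \<or> comparison_exponent w = - 1"
  shows "naturally_equivalent (BraidedCat :: (('o, 'a) braided, ('o, 'a) braided_functor) cat) TwoMonCat
    (F_braid b) (F_braid (crossing_class (comparison_exponent w = 1)))"
proof (rule naturally_equivalent_F_braid[OF acts_by_interchange_braid[OF b] acts_by_interchange_crossing])
  fix V :: "('o, 'a) braided" assume V: "braided_category V"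
  interpret braided_category V by fact
  interpret a: braid_action "Obj V" sarr sdom scod sid sseq stens sbraiding b w
    by (rule braid_action_strict[OF V b w])
  interpret i: interchange_category V b w "\<lambda>U V' W X. strict.act w [U, V', W, X]"
    by (rule interchange_category_braid[OF V b w])
  show "comparison_compatible b (crossing_class (comparison_exponent w = 1)) V i.outer_eta"
    by (rule i.comparison_compatible_crossing[OF crossing_class_interchange[OF V]])
      (rule a.interchange_comparison[OF e])
qed

section \<open>The braided category of a dihedral quandle\<close>

text \<open>The composite of the point reflections \<open>t \<mapsto> 2 y - t\<close> for the
  entries of the list, an element of the infinite dihedral group acting on the integers.\<close>

definition reflect_all :: "int list \<Rightarrow> int \<Rightarrow> int" where
  "reflect_all ys t = foldl (\<lambda>t y. 2 * y - t) t ys"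

lemma reflect_all_simps [simp]:
  "reflect_all [] t = t" "reflect_all (y # ys) t = reflect_all ys (2 * y - t)"
  "reflect_all (xs @ ys) t = reflect_all ys (reflect_all xs t)"
  by (simp_all add: reflect_all_def)

text \<open>Self-distributivity of the quandle: the action of a list respects the quandle
  operation.\<close>

lemma reflect_all_reflection: "reflect_all zs (2 * y - t) = 2 * reflect_all zs y - reflect_all zs t"
proof (induction zs arbitrary: y t)
  case (Cons a zs)
  show ?case using Cons[of "2 * a - y" "2 * a - t"] by (simp add: algebra_simps)
qed simp

text \<open>A map that respects reflections conjugates the action of a list into that of its image.
  With self-distributivity this shows that a crossing preserves the total action of a list.\<close>

lemma reflect_all_map:
  assumes "\<And>y t. g (2 * y - t) = 2 * g y - g t"
  shows "reflect_all (map g ys) (g t) = g (reflect_all ys t)"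
  by (induction ys arbitrary: t) (simp_all flip: assms)

lemma reflect_all_rev [simp]:
  "reflect_all ys (reflect_all (rev ys) t) = t" "reflect_all (rev ys) (reflect_all ys t) = t"
  by (induction ys arbitrary: t) simp_all

text \<open>Tailored to naturality of the crossing: the right block acts on the left one only
  through \<open>reflect_all\<close>, which such a map preserves, and the left block is moved by
  reflections, with which it commutes. The value \<open>[]\<close> at other lengths makes equality
  of maps agree with equality on lists of length \<open>n\<close>.\<close>

definition quandle_map :: "nat \<Rightarrow> (int list \<Rightarrow> int list) \<Rightarrow> bool" where
  "quandle_map n f \<longleftrightarrow> (\<forall>x. length x \<noteq> n \<longrightarrow> f x = []) \<and>
     (\<forall>x. length x = n \<longrightarrow> length (f x) = n \<and> (\<forall>t. reflect_all (f x) t = reflect_all x t) \<and>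
       (\<forall>z. f (map (\<lambda>t. 2 * z - t) x) = map (\<lambda>t. 2 * z - t) (f x)))"

lemma quandle_map_equivariant:
  assumes "quandle_map n f" "length x = n"
  shows "f (map (reflect_all ys) x) = map (reflect_all ys) (f x)"
  using assms
proof (induction ys arbitrary: x)
  case (Cons y ys)
  let ?r = "\<lambda>t. 2 * y - t"
  have r: "map (reflect_all (y # ys)) x = map (reflect_all ys) (map ?r x)" for x by simp
  have "f (map ?r x) = map ?r (f x)" using Cons.prems unfolding quandle_map_def by blast
  then show ?case unfolding r using Cons.IH[of "map ?r x"] Cons.prems by simp
next
  case Nil
  have "reflect_all [] = (\<lambda>t. t)" by (rule ext) simp
  then show ?case by simp
qed

lemma quandle_mapD:
  assumes "quandle_map n f"
  shows "length x = n \<Longrightarrow> length (f x) = n" "length x \<noteq> n \<Longrightarrow> f x = []"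
    "length x = n \<Longrightarrow> reflect_all (f x) = reflect_all x"
  using assms by (auto simp: quandle_map_def)

type_synonym quandle_arrow = "nat \<times> (int list \<Rightarrow> int list)"

definition quandle_arrows :: "quandle_arrow set" where
  "quandle_arrows = {(n, f). quandle_map n f}"

definition block :: "nat \<Rightarrow> (int list \<Rightarrow> int list) \<Rightarrow> int list \<Rightarrow> int list" where
  "block n f x = (if length x = n then f x else [])"

lemma quandle_arrowsD:
  assumes "f \<in> quandle_arrows"
  shows "quandle_map (fst f) (snd f)" "length x = fst f \<Longrightarrow> length (snd f x) = fst f"
    "length x = fst f \<Longrightarrow> reflect_all (snd f x) = reflect_all x"
    "length x = fst f \<Longrightarrow> snd f (map (reflect_all ys) x) = map (reflect_all ys) (snd f x)"
  using assms quandle_mapD quandle_map_equivariant by (auto simp: quandle_arrows_def)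

lemma quandle_arrow_eqI:
  assumes "f \<in> quandle_arrows" "g \<in> quandle_arrows" "fst f = fst g"
    "\<And>x. length x = fst f \<Longrightarrow> snd f x = snd g x"
  shows "f = g"
proof (rule prod_eqI)
  show "snd f = snd g"
  proof
    fix x show "snd f x = snd g x"
      using assms quandle_mapD(2)[OF quandle_arrowsD(1)[OF assms(1)], of x]
        quandle_mapD(2)[OF quandle_arrowsD(1)[OF assms(2)], of x] by (cases "length x = fst f") auto
  qed
qed fact

lemma block_arrow:
  assumes "\<And>x. length x = n \<Longrightarrow> length (f x) = n"
    "\<And>x t. length x = n \<Longrightarrow> reflect_all (f x) t = reflect_all x t"
    "\<And>x z. length x = n \<Longrightarrow> f (map (\<lambda>t. 2 * z - t) x) = map (\<lambda>t. 2 * z - t) (f x)"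
  shows "(n, block n f) \<in> quandle_arrows"
  using assms by (auto simp: quandle_arrows_def quandle_map_def block_def)

definition quandle_id :: "nat \<Rightarrow> quandle_arrow" where
  "quandle_id n = (n, block n (\<lambda>x. x))"

definition quandle_comp :: "quandle_arrow \<Rightarrow> quandle_arrow \<Rightarrow> quandle_arrow" where
  "quandle_comp g f = (if f \<in> quandle_arrows \<and> g \<in> quandle_arrows \<and> fst f = fst g
     then (fst f, block (fst f) (\<lambda>x. snd g (snd f x))) else undefined)"

definition quandle_juxtapose :: "quandle_arrow \<Rightarrow> quandle_arrow \<Rightarrow> quandle_arrow" where
  "quandle_juxtapose f g = (if f \<in> quandle_arrows \<and> g \<in> quandle_arrows
     then (fst f + fst g, block (fst f + fst g) (\<lambda>x. snd f (take (fst f) x) @ snd g (drop (fst f) x))) else undefined)"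

text \<open>The crossing moves the left block across the right one by the quandle action
  \<open>t \<triangleleft> y = 2 y - t\<close>; this is the braiding of crossed sets over the infinite dihedral group.\<close>

definition quandle_crossing :: "nat \<Rightarrow> nat \<Rightarrow> quandle_arrow" where
  "quandle_crossing m n = (m + n, block (m + n) (\<lambda>x. drop m x @ map (reflect_all (drop m x)) (take m x)))"

text \<open>Reflections are involutions, so the action of a list is undone by the reversed
  list.\<close>

definition quandle_crossing_inv :: "nat \<Rightarrow> nat \<Rightarrow> quandle_arrow" where
  "quandle_crossing_inv m n = (m + n, block (m + n) (\<lambda>x. map (reflect_all (rev (take n x))) (drop n x) @ take n x))"

definition quandle_tensor :: "(nat, quandle_arrow) tensor" where
  "quandle_tensor = \<lparr>TObj = (+), TArr = quandle_juxtapose, Assoc = (\<lambda>a b c. quandle_id (a + b + c))\<rparr>"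

definition quandle_category :: "(nat, quandle_arrow) braided" where
  "quandle_category = \<lparr>Obj = UNIV, Arr = quandle_arrows, Dom = restrict fst quandle_arrows,
     Cod = restrict fst quandle_arrows, Ident = quandle_id, Comp = quandle_comp,
     Ten = quandle_tensor, BUnit = 0, Braiding = quandle_crossing\<rparr>"

lemma quandle_id [simp]:
  "quandle_id n \<in> quandle_arrows" "fst (quandle_id n) = n" "length x = n \<Longrightarrow> snd (quandle_id n) x = x"
  unfolding quandle_id_def by (rule block_arrow) (auto simp: block_def)

lemma quandle_comp [simp]:
  assumes "f \<in> quandle_arrows" "g \<in> quandle_arrows" "fst f = fst g"
  shows "quandle_comp g f \<in> quandle_arrows" "fst (quandle_comp g f) = fst g"
    "length x = fst g \<Longrightarrow> snd (quandle_comp g f) x = snd g (snd f x)"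
  using assms quandle_arrowsD(1)[OF assms(1)] quandle_arrowsD(1)[OF assms(2)]
  by (auto intro!: block_arrow simp: quandle_comp_def quandle_map_def) (simp add: block_def)

lemma quandle_juxtapose [simp]:
  assumes "f \<in> quandle_arrows" "g \<in> quandle_arrows"
  shows "quandle_juxtapose f g \<in> quandle_arrows" "fst (quandle_juxtapose f g) = fst f + fst g"
    "length x = fst f + fst g \<Longrightarrow> snd (quandle_juxtapose f g) x = snd f (take (fst f) x) @ snd g (drop (fst f) x)"
proof -
  have "(fst f + fst g, block (fst f + fst g) (\<lambda>x. snd f (take (fst f) x) @ snd g (drop (fst f) x))) \<in> quandle_arrows"
  proof (rule block_arrow)
    fix x :: "int list" and t :: int assume "length x = fst f + fst g"
    then have "reflect_all (snd f (take (fst f) x) @ snd g (drop (fst f) x)) t = reflect_all (take (fst f) x @ drop (fst f) x) t"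
      unfolding reflect_all_simps using assms by (simp add: quandle_arrowsD)
    then show "reflect_all (snd f (take (fst f) x) @ snd g (drop (fst f) x)) t = reflect_all x t" by simp
  qed (use quandle_arrowsD(1)[OF assms(1)] quandle_arrowsD(1)[OF assms(2)] in
      \<open>auto simp: quandle_map_def take_map drop_map\<close>)
  then show "quandle_juxtapose f g \<in> quandle_arrows" "fst (quandle_juxtapose f g) = fst f + fst g"
    "length x = fst f + fst g \<Longrightarrow> snd (quandle_juxtapose f g) x = snd f (take (fst f) x) @ snd g (drop (fst f) x)"
    using assms by (auto simp: quandle_juxtapose_def block_def)
qed

lemma quandle_crossing [simp]:
  "quandle_crossing m n \<in> quandle_arrows" "fst (quandle_crossing m n) = m + n"
  "length x = m + n \<Longrightarrow> snd (quandle_crossing m n) x = drop m x @ map (reflect_all (drop m x)) (take m x)"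
proof -
  show "quandle_crossing m n \<in> quandle_arrows" unfolding quandle_crossing_def
  proof (rule block_arrow)
    fix x :: "int list" and t z :: int assume x: "length x = m + n"
    have "reflect_all (drop m x @ map (reflect_all (drop m x)) (take m x)) t = reflect_all (take m x @ drop m x) t"
      unfolding reflect_all_simps by (rule reflect_all_map) (rule reflect_all_reflection)
    then show "reflect_all (drop m x @ map (reflect_all (drop m x)) (take m x)) t = reflect_all x t"
      by simp
    have "reflect_all (map (\<lambda>t. 2 * z - t) ys) (2 * z - t) = 2 * z - reflect_all ys t" for ys t
      by (rule reflect_all_map) simp
    then show "drop m (map (\<lambda>t. 2 * z - t) x) @ map (reflect_all (drop m (map (\<lambda>t. 2 * z - t) x))) (take m (map (\<lambda>t. 2 * z - t) x)) =
       map (\<lambda>t. 2 * z - t) (drop m x @ map (reflect_all (drop m x)) (take m x))"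
      by (simp add: take_map drop_map comp_def)
  qed auto
qed (simp_all add: quandle_crossing_def block_def)

lemma quandle_crossing_inv [simp]:
  "quandle_crossing_inv m n \<in> quandle_arrows" "fst (quandle_crossing_inv m n) = m + n"
  "length x = m + n \<Longrightarrow> snd (quandle_crossing_inv m n) x = map (reflect_all (rev (take n x))) (drop n x) @ take n x"
proof -
  show "quandle_crossing_inv m n \<in> quandle_arrows" unfolding quandle_crossing_inv_def
  proof (rule block_arrow)
    fix x :: "int list" and t z :: int assume x: "length x = m + n"
    let ?y = "take n x" and ?g = "reflect_all (rev (take n x))"
    have "reflect_all (map ?g (drop n x)) t = reflect_all (map ?g (drop n x)) (?g (reflect_all ?y t))" by simp
    also have "\<dots> = ?g (reflect_all (drop n x) (reflect_all ?y t))"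
      by (rule reflect_all_map) (rule reflect_all_reflection)
    finally have "reflect_all (map ?g (drop n x) @ ?y) t = reflect_all (drop n x) (reflect_all ?y t)" by simp
    also have "\<dots> = reflect_all (?y @ drop n x) t" by (simp only: reflect_all_simps(3))
    also have "\<dots> = reflect_all x t" by (simp only: append_take_drop_id)
    finally show "reflect_all (map ?g (drop n x) @ ?y) t = reflect_all x t" .
    have "reflect_all (map (\<lambda>t. 2 * z - t) ys) (2 * z - t) = 2 * z - reflect_all ys t" for ys t
      by (rule reflect_all_map) simp
    then show "map (reflect_all (rev (take n (map (\<lambda>t. 2 * z - t) x)))) (drop n (map (\<lambda>t. 2 * z - t) x)) @ take n (map (\<lambda>t. 2 * z - t) x) =
       map (\<lambda>t. 2 * z - t) (map ?g (drop n x) @ ?y)"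
      by (simp add: take_map drop_map comp_def rev_map)
  qed auto
qed (simp_all add: quandle_crossing_inv_def block_def)

lemma quandle_sel [simp]:
  "Obj quandle_category = UNIV" "Arr quandle_category = quandle_arrows"
  "f \<in> quandle_arrows \<Longrightarrow> Dom quandle_category f = fst f"
  "f \<in> quandle_arrows \<Longrightarrow> Cod quandle_category f = fst f"
  "Ident quandle_category = quandle_id" "Comp quandle_category = quandle_comp"
  "Ten quandle_category = quandle_tensor" "BUnit quandle_category = 0"
  "TObj quandle_tensor = (+)" "Assoc quandle_tensor a b' c = quandle_id (a + b' + c)"
  "TArr quandle_tensor = quandle_juxtapose" "Braiding quandle_category = quandle_crossing"
  by (simp_all add: quandle_category_def quandle_tensor_def)

lemma quandle_homset [simp]: "homset quandle_category m n = {f \<in> quandle_arrows. fst f = m \<and> m = n}"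
  by (auto simp: homset_def)

lemma category_quandle: "category quandle_category"
proof
  fix f g :: quandle_arrow
  assume "\<not> (f \<in> Arr quandle_category \<and> g \<in> Arr quandle_category \<and> Cod quandle_category f = Dom quandle_category g)"
  then show "g \<cdot>\<^bsub>quandle_category\<^esub> f = undefined" by (auto simp: quandle_comp_def)
next
  fix f A B assume "f \<in> homset quandle_category A B"
  then show "f \<cdot>\<^bsub>quandle_category\<^esub> Ident quandle_category A = f" "Ident quandle_category B \<cdot>\<^bsub>quandle_category\<^esub> f = f"
    by (auto intro!: quandle_arrow_eqI simp: quandle_arrowsD)
next
  fix f A B g D h E
  assume "f \<in> homset quandle_category A B" "g \<in> homset quandle_category B D" "h \<in> homset quandle_category D E"
  then show "(h \<cdot>\<^bsub>quandle_category\<^esub> g) \<cdot>\<^bsub>quandle_category\<^esub> f = h \<cdot>\<^bsub>quandle_category\<^esub> g \<cdot>\<^bsub>quandle_category\<^esub> f"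
    by (auto intro!: quandle_arrow_eqI simp: quandle_arrowsD)
next
  show "Dom quandle_category \<in> Arr quandle_category \<rightarrow>\<^sub>E Obj quandle_category"
    "Cod quandle_category \<in> Arr quandle_category \<rightarrow>\<^sub>E Obj quandle_category"
    by (auto simp: quandle_category_def)
qed auto

lemma monoidal_quandle: "monoidal quandle_category quandle_tensor 0"
proof (rule monoidal.intro[OF category_quandle], rule monoidal_axioms.intro)
  show "case_prod (TArr quandle_tensor) \<in> extensional (Arr quandle_category \<times> Arr quandle_category)"
    by (auto simp: extensional_def quandle_juxtapose_def)
next
  fix f A A' f' A'' g B B' g' B''
  assume "f \<in> homset quandle_category A A'" "f' \<in> homset quandle_category A' A''"
    "g \<in> homset quandle_category B B'" "g' \<in> homset quandle_category B' B''"
  then show "(f' \<cdot>\<^bsub>quandle_category\<^esub> f) \<star>\<^bsub>quandle_tensor\<^esub> (g' \<cdot>\<^bsub>quandle_category\<^esub> g) =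
     (f' \<star>\<^bsub>quandle_tensor\<^esub> g') \<cdot>\<^bsub>quandle_category\<^esub> (f \<star>\<^bsub>quandle_tensor\<^esub> g)"
    by (auto intro!: quandle_arrow_eqI simp: quandle_arrowsD)
next
  fix A B D
  show "iso_arrow quandle_category (Assoc quandle_tensor A B D)"
    unfolding iso_arrow_def inverse_arrows_def
    by (rule exI[of _ "Assoc quandle_tensor A B D"]) (auto intro!: quandle_arrow_eqI)
next
  fix f A A' g B B' h D D'
  assume "f \<in> homset quandle_category A A'" "g \<in> homset quandle_category B B'" "h \<in> homset quandle_category D D'"
  then show "Assoc quandle_tensor A' B' D' \<cdot>\<^bsub>quandle_category\<^esub> (f \<star>\<^bsub>quandle_tensor\<^esub> g) \<star>\<^bsub>quandle_tensor\<^esub> h =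
     (f \<star>\<^bsub>quandle_tensor\<^esub> g \<star>\<^bsub>quandle_tensor\<^esub> h) \<cdot>\<^bsub>quandle_category\<^esub> Assoc quandle_tensor A B D"
    by (auto intro!: quandle_arrow_eqI simp: quandle_arrowsD take_drop add.commute)
next
  fix f assume "f \<in> Arr quandle_category"
  then show "f \<star>\<^bsub>quandle_tensor\<^esub> Ident quandle_category 0 = f" "Ident quandle_category 0 \<star>\<^bsub>quandle_tensor\<^esub> f = f"
    by (auto intro!: quandle_arrow_eqI simp: quandle_arrowsD)
qed (auto intro!: quandle_arrow_eqI simp: extensional_def add.assoc)

text \<open>Naturality is built into \<open>quandle_map\<close>. One hexagon says that a
  concatenation acts block after block, the other that it is acted on block by block.\<close>

lemma braided_category_quandle: "braided_category quandle_category"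
proof -
  interpret monoidal quandle_category quandle_tensor 0 by (rule monoidal_quandle)
  have inv: "arrow_inv quandle_category (quandle_id n) = quandle_id n" for n
    using arrow_inv_Ident[of n] by simp
  show ?thesis
  proof (rule braided_category.intro, simp add: monoidal_quandle, rule braided_category_axioms.intro)
    fix A B
    show "iso_arrow quandle_category (Braiding quandle_category A B)"
      unfolding iso_arrow_def inverse_arrows_def
      by (rule exI[of _ "quandle_crossing_inv A B"])
        (auto intro!: quandle_arrow_eqI simp: comp_def)
  next
    fix f A A' g B B'
    assume "f \<in> homset quandle_category A A'" "g \<in> homset quandle_category B B'"
    then show "Braiding quandle_category A' B' \<cdot>\<^bsub>quandle_category\<^esub> (f \<star>\<^bsub>Ten quandle_category\<^esub> g) =
      (g \<star>\<^bsub>Ten quandle_category\<^esub> f) \<cdot>\<^bsub>quandle_category\<^esub> Braiding quandle_category A B"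
      by (auto intro!: quandle_arrow_eqI simp: quandle_arrowsD add.commute)
  next
    fix A B D
    have "take B (drop A x) @ drop (A + B) x = drop A x" for x :: "int list"
      using append_take_drop_id[of B "drop A x"] by (simp add: add.commute)
    then have 1: "reflect_all (drop (A + B) x) (reflect_all (take B (drop A x)) t) = reflect_all (drop A x) t" for x t
      by (metis reflect_all_simps(3))
    have 2: "drop A (take (A + B) x) @ drop (A + B) x = drop A x" for x :: "int list"
      using append_take_drop_id[of B "drop A x"] by (simp add: add.commute take_drop)
    show "Assoc (Ten quandle_category) B D A \<cdot>\<^bsub>quandle_category\<^esub> Braiding quandle_category A (B \<odot>\<^bsub>Ten quandle_category\<^esub> D)
       \<cdot>\<^bsub>quandle_category\<^esub> Assoc (Ten quandle_category) A B D =
      (Ident quandle_category B \<star>\<^bsub>Ten quandle_category\<^esub> Braiding quandle_category A D) \<cdot>\<^bsub>quandle_category\<^esub>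
       Assoc (Ten quandle_category) B A D \<cdot>\<^bsub>quandle_category\<^esub> (Braiding quandle_category A B \<star>\<^bsub>Ten quandle_category\<^esub> Ident quandle_category D)"
      using 1 2 by (auto intro!: quandle_arrow_eqI simp: comp_def add_ac take_drop)
    have "take A x @ drop A (take (A + B) x) = take (A + B) x" for x :: "int list"
      using append_take_drop_id[of A "take (A + B) x"] by (simp add: min_def)
    then have 3: "map f (take A x) @ map f (drop A (take (A + B) x)) = map f (take (A + B) x)" for f :: "int \<Rightarrow> int" and x
      by (metis map_append)
    show "arrow_inv quandle_category (Assoc (Ten quandle_category) D A B) \<cdot>\<^bsub>quandle_category\<^esub>
       Braiding quandle_category (A \<odot>\<^bsub>Ten quandle_category\<^esub> B) D \<cdot>\<^bsub>quandle_category\<^esub> arrow_inv quandle_category (Assoc (Ten quandle_category) A B D) =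
      (Braiding quandle_category A D \<star>\<^bsub>Ten quandle_category\<^esub> Ident quandle_category B) \<cdot>\<^bsub>quandle_category\<^esub>
       arrow_inv quandle_category (Assoc (Ten quandle_category) A D B) \<cdot>\<^bsub>quandle_category\<^esub>
       (Ident quandle_category A \<star>\<^bsub>Ten quandle_category\<^esub> Braiding quandle_category B D)"
      using 3 by (auto intro!: quandle_arrow_eqI simp: inv comp_def add_ac take_drop)
  qed (auto simp: add.commute)
qed


section \<open>Evaluating two-strand braids on lists of integers\<close>

interpretation quandle: braided_category quandle_category
  by (rule braided_category_quandle)

lemma quandle_tensor_sel [simp]:
  "TObj (Ten quandle_category) = (+)" "Assoc (Ten quandle_category) a b c = quandle_id (a + b + c)"
  "TArr (Ten quandle_category) = quandle_juxtapose"
  "n + BUnit quandle_category = n" "BUnit quandle_category + n = n"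
  "n = BUnit quandle_category \<longleftrightarrow> n = 0"
  by simp_all

text \<open>The facts of the interpretation mention these two selectors, so they are kept folded.\<close>

declare quandle_sel(7,8) [simp del]

abbreviation run :: "(nat, quandle_arrow) strict_arrow \<Rightarrow> int list \<Rightarrow> int list" where
  "run f \<equiv> snd (sval f)"

lemma quandle_tensor_list_append [simp]:
  "quandle.tensor_list (xs @ ys) = quandle.tensor_list xs + quandle.tensor_list ys"
  by (induction xs) auto

lemma quandle_merge: "quandle.merge xs ys = quandle_id (quandle.tensor_list (xs @ ys))"
  by (induction xs) (auto intro!: quandle_arrow_eqI simp: add.assoc)

lemma quandle_inv_id [simp]: "arrow_inv quandle_category (quandle_id n) = quandle_id n"
  using quandle.arrow_inv_Ident[of n] by simp

lemma quandle_inv_crossing: "arrow_inv quandle_category (quandle_crossing m n) = quandle_crossing_inv m n"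
  by (rule quandle.arrow_inv_eq) (auto simp: inverse_arrows_def comp_def intro!: quandle_arrow_eqI)

lemma quandle_sarrD:
  assumes "quandle.sarr f"
  shows "sval f \<in> quandle_arrows" "fst (sval f) = quandle.tensor_list (sdom f)"
    "quandle.tensor_list (scod f) = quandle.tensor_list (sdom f)"
  using assms unfolding quandle.sarr_def by auto

lemma run_seq:
  assumes "quandle.sarr f" "quandle.sarr g" "scod f = sdom g" "length x = quandle.tensor_list (sdom f)"
  shows "run (quandle.sseq f g) x = run g (run f x)"
  using quandle_sarrD[OF assms(1)] quandle_sarrD[OF assms(2)] assms(3,4)
  by (simp add: quandle.sseq_def)

lemma run_stens:
  assumes "quandle.sarr f" "quandle.sarr g" "length x = quandle.tensor_list (sdom f)"
    "length y = quandle.tensor_list (sdom g)"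
  shows "run (quandle.stens f g) (x @ y) = run f x @ run g y"
  using quandle_sarrD[OF assms(1)] quandle_sarrD[OF assms(2)] assms(3,4)
  by (simp add: quandle.stens_def quandle_merge quandle_arrowsD)

lemma run_braiding:
  assumes "length x = quandle.tensor_list xs" "length y = quandle.tensor_list ys"
  shows "run (quandle.sbraiding True xs ys) (x @ y) = y @ map (reflect_all y) x"
    "run (quandle.sbraiding False xs ys) (x @ y) = map (reflect_all (rev x)) y @ x"
  using assms by (simp_all add: quandle_merge quandle_inv_crossing add.commute)

lemma act_two_Cons:
  "quandle.strict.act ((Suc 0, e) # v) [xs, ys] = quandle.sseq (quandle.sbraiding e xs ys) (quandle.strict.act v [ys, xs])"
proof -
  have "quandle.strict.cross (Suc 0, e) [xs, ys] = quandle.sbraiding e xs ys"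
    using quandle.strict.cross_split[of "Suc 0" "[]" e xs ys "[]"] by simp
  moreover have "swap_at (Suc 0) [xs, ys] = [ys, xs]"
    using swap_at_split[of "Suc 0" "[]" xs ys "[]"] by simp
  ultimately show ?thesis by (simp del: quandle.sbraiding.simps)
qed

lemma act_two_sarr:
  "v \<in> braid_words 2 \<Longrightarrow> quandle.sarr (quandle.strict.act v [xs, ys])"
  "v \<in> braid_words 2 \<Longrightarrow> sdom (quandle.strict.act v [xs, ys]) = xs @ ys"
  "v \<in> braid_words 2 \<Longrightarrow> scod (quandle.strict.act v [xs, ys]) = (if even (exponent_sum v) then xs @ ys else ys @ xs)"
  using quandle.strict.act_typed[of v "[xs, ys]"] permute_two[of v xs ys] by (auto simp: numeral_2_eq_2)

text \<open>A crossing preserves the difference \<open>y - x\<close> of two entries and translates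
  both by it, forwards or backwards according to its sign.\<close>

lemma run_power_one_one:
  assumes "v \<in> braid_words 2"
  shows "run (quandle.strict.act v [[1], [1]]) [x, y] =
    [x + exponent_sum v * (y - x), y + exponent_sum v * (y - x)]"
  using assms
proof (induction v arbitrary: x y)
  case Nil
  then show ?case by simp
next
  case (Cons a v)
  obtain e where a: "a = (Suc 0, e)" using Cons.prems by (cases a) auto
  have "run (quandle.strict.act (a # v) [[1], [1]]) [x, y] =
      run (quandle.strict.act v [[1], [1]]) (run (quandle.sbraiding e [1] [1]) ([x] @ [y]))"
    unfolding a act_two_Cons using Cons.prems
    by (subst run_seq) (simp_all add: act_two_sarr del: quandle.sbraiding.simps)
  also have "run (quandle.sbraiding e [1] [1]) ([x] @ [y]) = (if e then [y, 2 * y - x] else [2 * x - y, x])"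
    using run_braiding[of "[x]" "[1]" "[y]" "[1]"] by (cases e) (simp_all del: quandle.sbraiding.simps)
  finally show ?case using Cons a by (auto simp: algebra_simps)
qed

text \<open>The entry \<open>x\<close> meets two equal entries at each crossing; when they act on
  it, their reflections cancel, and when it acts on them, they remain equal. So \<open>x\<close>
  survives unchanged and only the parity of the exponent decides where it ends.\<close>

lemma run_power_one_two:
  assumes "v \<in> braid_words 2"
  shows "(\<exists>u. run (quandle.strict.act v [[1], [1, 1]]) [x, y, y] = (if even (exponent_sum v) then [x, u, u] else [u, u, x])) \<and>
    (\<exists>u. run (quandle.strict.act v [[1, 1], [1]]) [y, y, x] = (if even (exponent_sum v) then [u, u, x] else [x, u, u]))"
  using assms
proof (induction v arbitrary: y)
  case Nil
  then show ?case by simp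
next
  case (Cons a v)
  obtain e where a: "a = (Suc 0, e)" using Cons.prems by (cases a) auto
  have v: "v \<in> braid_words 2" using Cons.prems by simp
  obtain y1 where y1: "run (quandle.sbraiding e [1] [1, 1]) ([x] @ [y, y]) = [y1, y1, x]"
    using run_braiding[of "[x]" "[1]" "[y, y]" "[1, 1]"] by (cases e) (simp_all del: quandle.sbraiding.simps)
  obtain y2 where y2: "run (quandle.sbraiding e [1, 1] [1]) ([y, y] @ [x]) = [x, y2, y2]"
    using run_braiding[of "[y, y]" "[1, 1]" "[x]" "[1]"] by (cases e) (simp_all del: quandle.sbraiding.simps)
  have e1: "run (quandle.strict.act (a # v) [[1], [1, 1]]) [x, y, y] =
      run (quandle.strict.act v [[1, 1], [1]]) (run (quandle.sbraiding e [1] [1, 1]) ([x] @ [y, y]))"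
    unfolding a act_two_Cons using v
    by (subst run_seq) (simp_all add: act_two_sarr del: quandle.sbraiding.simps)
  have e2: "run (quandle.strict.act (a # v) [[1, 1], [1]]) [y, y, x] =
      run (quandle.strict.act v [[1], [1, 1]]) (run (quandle.sbraiding e [1, 1] [1]) ([y, y] @ [x]))"
    unfolding a act_two_Cons using v
    by (subst run_seq) (simp_all add: act_two_sarr del: quandle.sbraiding.simps)
  have par: "even (exponent_sum (a # v)) \<longleftrightarrow> \<not> even (exponent_sum v)" by simp
  note IH = Cons.IH[OF v, of y1, THEN conjunct2] Cons.IH[OF v, of y2, THEN conjunct1]
  show ?case unfolding e1 e2 y1 y2 par
    by (cases "even (exponent_sum v)") (use IH in \<open>simp_all only: simp_thms if_True if_False\<close>)
qed

text \<open>By the hexagon, doubling the second strand of \<open>\<sigma>\<^sup>p\<close> in the comparison braiding gives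
  \<open>\<sigma>\<^sub>1\<^sup>p \<sigma>\<^sub>2\<^sup>p\<close>. On \<open>[1, 0, 0]\<close> the last entry is \<open>1\<close> for the former and \<open>p\<^sup>2\<close> for the latter.\<close>

lemma comparison_exponent_cases:
  assumes "interchanging_unital_braid b" "w \<in> b"
  shows "comparison_exponent w = 1 \<or> comparison_exponent w = - 1"
proof -
  interpret a: braid_action "Obj quandle_category" quandle.sarr sdom scod quandle.sid quandle.sseq quandle.stens quandle.sbraiding b w
    by (rule braid_action_strict[OF braided_category_quandle assms])
  let ?p = "comparison_exponent w"
  let ?v = "power_word ?p"
  let ?\<beta> = "\<lambda>X Y. quandle.strict.act ?v [X, Y]"
  \<comment> \<open>The objects \<open>1\<close> and \<open>2\<close> serve as two distinct
    labels.\<close>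
  have odd: "odd ?p" using a.comparison_odd[of 1 2] by simp
  note t = act_two_sarr[OF power_word_words]
  have "run (?\<beta> [1] ([1] @ [1])) [1, 0, 0] =
      run (quandle.sseq (quandle.stens (?\<beta> [1] [1]) (quandle.sid [1])) (quandle.stens (quandle.sid [1]) (?\<beta> [1] [1]))) ([1, 0] @ [0])"
    using a.comparison_hexagon_power[OF odd, of "[1]" "[1]" "[1]"] by simp
  also have "\<dots> = run (quandle.stens (quandle.sid [1]) (?\<beta> [1] [1]))
      (run (quandle.stens (?\<beta> [1] [1]) (quandle.sid [1])) ([1, 0] @ [0]))"
    by (rule run_seq) (simp_all add: t)
  also have "run (quandle.stens (?\<beta> [1] [1]) (quandle.sid [1])) ([1, 0] @ [0]) = [1 - ?p] @ [- ?p, 0]"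
    by (subst run_stens) (simp_all add: t run_power_one_one del: One_nat_def)
  also have "run (quandle.stens (quandle.sid [1]) (?\<beta> [1] [1])) ([1 - ?p] @ [- ?p, 0]) = [1 - ?p, - ?p + ?p * ?p, ?p * ?p]"
    by (subst run_stens) (simp_all add: t run_power_one_one del: One_nat_def)
  finally have "run (?\<beta> [1] [1, 1]) [1, 0, 0] = [1 - ?p, - ?p + ?p * ?p, ?p * ?p]" by simp
  \<comment> \<open>The odd exponent carries the single strand, with its entry \<open>1\<close>, to
    the right of the doubled one.\<close>
  moreover obtain u where "run (?\<beta> [1] [1, 1]) [1, 0, 0] = [u, u, 1]"
    using run_power_one_two[of ?v 1 0] odd by auto
  ultimately have "?p * ?p = 1" by simp
  then show ?thesis using zmult_eq_1_iff by blast
qed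

section \<open>The two crossings are not equivalent\<close>

lemma braid_class_eqI: "(u, v) \<in> braid_rel n \<Longrightarrow> braid_class n u = braid_class n v"
  unfolding braid_class_def by (rule equiv_class_eq[OF equiv_braid_rel])

lemma braid_class_eqD:
  assumes "braid_class n u = braid_class n v" "v \<in> braid_words n"
  shows "(u, v) \<in> braid_rel n"
  using assms unfolding braid_class_def by (auto intro: braid_rel.refl)

lemma braid_group_mult:
  assumes "u \<in> braid_words n" "v \<in> braid_words n"
  shows "braid_class n u \<otimes>\<^bsub>braid_group n\<^esub> braid_class n v = braid_class n (u @ v)"
proof -
  have "(u @ v, p @ q) \<in> braid_rel n" if "(u, p) \<in> braid_rel n" "(v, q) \<in> braid_rel n" for p q
  proof -
    have "(u @ v, p @ v) \<in> braid_rel n"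
      using braid_rel_append[OF that(1), of "[]" v] assms by simp
    moreover have "(p @ v, p @ q) \<in> braid_rel n"
      using braid_rel_append[OF that(2), of p "[]"] braid_rel_words[OF that(1)] by simp
    ultimately show ?thesis by (rule braid_rel.trans)
  qed
  then show ?thesis using assms
    by (auto simp: braid_group_def braid_class_def intro: braid_rel.trans braid_rel.refl)
qed

text \<open>The inverse is a definite description, so uniqueness is checked on words by cancelling
  \<open>\<sigma>_2\<close> on the left.\<close>

lemma inv_sigma: "inv\<^bsub>braid_group 4\<^esub> (sigma 4 2) = crossing_class False"
  unfolding m_inv_def
proof (rule the_equality)
  have w: "[(2, e)] \<in> braid_words 4" for e by simp
  have c: "([(2, e), (2, \<not> e)] @ v, v) \<in> braid_rel 4" if "v \<in> braid_words 4" for e v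
    using braid_rel.cancel[of "[]" 2 e v 4] that by simp
  show "crossing_class False \<in> carrier (braid_group 4) \<and> sigma 4 2 \<otimes>\<^bsub>braid_group 4\<^esub> crossing_class False = \<one>\<^bsub>braid_group 4\<^esub> \<and>
    crossing_class False \<otimes>\<^bsub>braid_group 4\<^esub> sigma 4 2 = \<one>\<^bsub>braid_group 4\<^esub>"
    using braid_group_mult[OF w w] braid_class_eqI[OF c[of "[]" True]] braid_class_eqI[OF c[of "[]" False]]
      braid_class_carrierI[OF w]
    by (simp add: sigma_def) (simp add: braid_group_def)
  fix y assume y: "y \<in> carrier (braid_group 4) \<and> sigma 4 2 \<otimes>\<^bsub>braid_group 4\<^esub> y = \<one>\<^bsub>braid_group 4\<^esub> \<and>
    y \<otimes>\<^bsub>braid_group 4\<^esub> sigma 4 2 = \<one>\<^bsub>braid_group 4\<^esub>"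
  then obtain v where v: "v \<in> y" using braid_class_nonempty by blast
  then have v4: "v \<in> braid_words 4" and yv: "y = braid_class 4 v" using braid_class_carrier y by auto
  have "braid_class 4 ([(2, True)] @ v) = braid_class 4 []"
    using y braid_group_mult[OF w v4, of True] by (simp add: sigma_def yv) (simp add: braid_group_def)
  then have "([(2, True)] @ v, []) \<in> braid_rel 4" by (rule braid_class_eqD) simp
  from braid_rel_append[OF this, of "[(2, False)]" "[]"]
  have "([(2, False), (2, True)] @ v, [(2, False)]) \<in> braid_rel 4" by simp
  with c[OF v4, of False] have "(v, [(2, False)]) \<in> braid_rel 4"
    by (auto intro: braid_rel.trans braid_rel.sym)
  then show "y = crossing_class False" unfolding yv by (rule braid_class_eqI)
qed

text \<open>The arrow is the component of \<open>\<sigma>\<close> after the inverse component of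
  \<open>\<tau>\<close>, which eliminates the common functor \<open>F\<close>. Naturality is
  recorded for a single endomorphism \<open>f\<close>, to be instantiated with
  \<open>collapse\<close>.\<close>

lemma natural_isomorphism_conjugate:
  assumes \<tau>: "natural_isomorphism C D F G \<tau>" and \<sigma>: "natural_isomorphism C D F H \<sigma>"
    and f: "f \<in> homset C A A"
  shows "\<exists>g. g \<in> homset D (FObj G A) (FObj H A) \<and> iso_arrow D g \<and> g \<cdot>\<^bsub>D\<^esub> FArr G f = FArr H f \<cdot>\<^bsub>D\<^esub> g"
proof -
  have F: "is_functor C D F" "is_functor C D G" "is_functor C D H"
    using \<tau> \<sigma> by (auto simp: natural_isomorphism_def)
  interpret C: category C by (rule is_functorD(1)[OF F(1)])
  interpret D: category D by (rule is_functorD(2)[OF F(1)])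
  have f': "f \<in> Arr C" "Dom C f = A" "Cod C f = A" using f by (auto simp: homset_def)
  then have A: "A \<in> Obj C" by auto
  have t: "\<tau> A \<in> Arr D" "Dom D (\<tau> A) = FObj F A" "Cod D (\<tau> A) = FObj G A" "iso_arrow D (\<tau> A)"
    "\<tau> A \<cdot>\<^bsub>D\<^esub> FArr F f = FArr G f \<cdot>\<^bsub>D\<^esub> \<tau> A"
    using \<tau> A f by (auto simp: natural_isomorphism_def homset_def)
  have s: "\<sigma> A \<in> Arr D" "Dom D (\<sigma> A) = FObj F A" "Cod D (\<sigma> A) = FObj H A" "iso_arrow D (\<sigma> A)"
    "\<sigma> A \<cdot>\<^bsub>D\<^esub> FArr F f = FArr H f \<cdot>\<^bsub>D\<^esub> \<sigma> A"
    using \<sigma> A f by (auto simp: natural_isomorphism_def homset_def)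
  note [simp] = f' t(1-3) s(1-3) D.iso_arrowD[OF t(4)]
    is_functorD(4-6)[OF F(1) f'(1)] is_functorD(4-6)[OF F(2) f'(1)] is_functorD(4-6)[OF F(3) f'(1)]
  let ?i = "arrow_inv D (\<tau> A)"
  have "(\<sigma> A \<cdot>\<^bsub>D\<^esub> ?i) \<cdot>\<^bsub>D\<^esub> FArr G f = \<sigma> A \<cdot>\<^bsub>D\<^esub> ?i \<cdot>\<^bsub>D\<^esub> (FArr G f \<cdot>\<^bsub>D\<^esub> \<tau> A) \<cdot>\<^bsub>D\<^esub> ?i"
    by simp
  also have "\<dots> = \<sigma> A \<cdot>\<^bsub>D\<^esub> (?i \<cdot>\<^bsub>D\<^esub> \<tau> A \<cdot>\<^bsub>D\<^esub> FArr F f) \<cdot>\<^bsub>D\<^esub> ?i"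
    by (simp flip: t(5))
  also have "\<dots> = (\<sigma> A \<cdot>\<^bsub>D\<^esub> FArr F f) \<cdot>\<^bsub>D\<^esub> ?i"
    by (subst D.inv_Comp_tail(1)[OF t(4)]) simp_all
  also have "\<dots> = FArr H f \<cdot>\<^bsub>D\<^esub> \<sigma> A \<cdot>\<^bsub>D\<^esub> ?i"
    unfolding s(5) by simp
  finally have "(\<sigma> A \<cdot>\<^bsub>D\<^esub> ?i) \<cdot>\<^bsub>D\<^esub> FArr G f = FArr H f \<cdot>\<^bsub>D\<^esub> \<sigma> A \<cdot>\<^bsub>D\<^esub> ?i" .
  moreover have "iso_arrow D (\<sigma> A \<cdot>\<^bsub>D\<^esub> ?i)" by (rule D.iso_Comp) (simp_all add: s(4))
  ultimately show ?thesis
    by (intro exI[of _ "\<sigma> A \<cdot>\<^bsub>D\<^esub> ?i"]) (simp add: homset_def)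
qed

text \<open>These two restrictions tell the crossings apart: the outer one is trivial for both
  signs, and the inner one is the braiding or its inverse.\<close>

lemma crossing_interchange_values:
  assumes V: "braided_category V" and A: "A \<in> Obj V" and B: "B \<in> Obj V"
  shows "braid_interchange (crossing_class e) V A (BUnit V) (BUnit V) B = Ident V (A \<odot>\<^bsub>Ten V\<^esub> B)"
    "braid_interchange (crossing_class e) V (BUnit V) A B (BUnit V) =
      (if e then Braiding V A B else arrow_inv V (Braiding V B A))"
proof -
  interpret braided_category V by fact
  interpret c: interchange_category V "crossing_class e" "[(2, e)]" "\<lambda>U V' W X. sid U \<parallel> sbraiding e V' W \<parallel> sid X"
    by (rule crossing_class_interchange[OF V])
  have "sbraiding e [] [] = sid []" using strict.br_Nil(1)[of "[]" e] by simp
  then have "realizes (Node (Leaf A) (Leaf B)) (sid (leaves (Node (Leaf A) (Leaf B)))) (Node (Leaf A) (Leaf B)) (c.outer_eta A B)"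
    using c.outer_eta_realizes[of "Leaf A" "Leaf B"] A B by (simp del: sbraiding.simps)
  from c.realizes_trivial[OF this HOL.refl] show "c.outer_eta A B = Ident V (A \<odot>\<^bsub>Ten V\<^esub> B)" by simp
  have t: "theta (Node (Node Empty (Leaf X)) (Node (Leaf Y) Empty)) = theta (Node (Leaf X) (Leaf Y))"
    "theta (Node (Node Empty (Leaf Y)) (Node (Leaf X) Empty)) = theta (Node (Leaf Y) (Leaf X))"
    if "X \<in> Obj V" "Y \<in> Obj V" for X Y
    by (rule c.theta_Node_cong; use that in \<open>simp del: theta.simps\<close>)+
  have "realizes (Node (Leaf A) (Leaf B)) (sbraiding e [A] [B]) (Node (Leaf B) (Leaf A)) (c.\<eta> (BUnit V) A B (BUnit V))"
    using c.eta_realizes[of Empty "Leaf A" "Leaf B" Empty] t[OF A B] A B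
    unfolding realizes_def by (simp del: theta.simps sbraiding.simps)
  then have "c.\<eta> (BUnit V) A B (BUnit V) = signed_braiding e A B"
    using realizes_unique realizes_braiding[OF A B] by blast
  then show "c.\<eta> (BUnit V) A B (BUnit V) = (if e then Braiding V A B else arrow_inv V (Braiding V B A))"
    by (cases e) simp_all
qed

text \<open>Reordering sums with \<open>add_ac\<close> can leave a remainder two or three summands
  deep; these rules remove it there.\<close>

lemma nested_mod:
  fixes a b c d n :: nat
  shows "(a + (b + c mod n)) mod n = (a + (b + c)) mod n"
    "(a + (b + (c + d mod n))) mod n = (a + (b + (c + d))) mod n"
proof -
  have 1: "(a + (b + c mod n)) mod n = (a + (b + c)) mod n" for a b c :: nat
    using mod_add_right_eq[of "a + b" c n] by (simp only: add.assoc)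
  show "(a + (b + c mod n)) mod n = (a + (b + c)) mod n" by (rule 1)
  show "(a + (b + (c + d mod n))) mod n = (a + (b + (c + d))) mod n"
    using 1[of "a + b" c d] by (simp only: add.assoc)
qed

text \<open>Only the infinity of the two types is available, so objects and arrows are coded by
  numbers and triples of numbers along injections.\<close>

locale cyclic_universe =
  fixes io :: "nat \<Rightarrow> 'o" and ia :: "nat \<times> nat \<times> nat \<Rightarrow> 'a"
  assumes inj_io: "inj io" and inj_ia: "inj ia"
begin

abbreviation "oi \<equiv> the_inv io"
abbreviation "ai \<equiv> the_inv ia"

lemma decode [simp]: "oi (io n) = n" "ai (ia t) = t" "io m = io n \<longleftrightarrow> m = n" "ia t = ia u \<longleftrightarrow> t = u"
  using inj_io inj_ia by (simp_all add: the_inv_f_f inj_eq)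

definition Objs :: "'o set" where "Objs = io ` {..<3}"
definition Arrs :: "'a set" where "Arrs = ia ` ({..<3} \<times> UNIV \<times> {..<3})"

lemma in_Objs [simp]: "io n \<in> Objs \<longleftrightarrow> n < 3" and in_Arrs [simp]: "ia (x, k, z) \<in> Arrs \<longleftrightarrow> x < 3 \<and> z < 3"
  by (auto simp: Objs_def Arrs_def)

text \<open>The arrow \<open>ia (x, k, z)\<close> is an endomorphism of the class \<open>x\<close> modulo 3, with \<open>k\<close> in the additive
  monoid of naturals and \<open>z\<close> modulo 3; the braiding is the bicharacter \<open>(x, y) \<mapsto> x y\<close>.\<close>

definition cyclic_category :: "('o, 'a) braided" where
  "cyclic_category = \<lparr>Obj = Objs, Arr = Arrs, Dom = restrict (\<lambda>f. io (fst (ai f))) Arrs,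
     Cod = restrict (\<lambda>f. io (fst (ai f))) Arrs, Ident = restrict (\<lambda>A. ia (oi A, 0, 0)) Objs,
     Comp = (\<lambda>g f. if f \<in> Arrs \<and> g \<in> Arrs \<and> fst (ai f) = fst (ai g)
       then ia (fst (ai f), fst (snd (ai f)) + fst (snd (ai g)), (snd (snd (ai f)) + snd (snd (ai g))) mod 3) else undefined),
     Ten = \<lparr>TObj = (\<lambda>A B. if A \<in> Objs \<and> B \<in> Objs then io ((oi A + oi B) mod 3) else undefined),
       TArr = (\<lambda>f g. if f \<in> Arrs \<and> g \<in> Arrs
         then ia ((fst (ai f) + fst (ai g)) mod 3, fst (snd (ai f)) + fst (snd (ai g)), (snd (snd (ai f)) + snd (snd (ai g))) mod 3)
         else undefined),
       Assoc = (\<lambda>A B D. if A \<in> Objs \<and> B \<in> Objs \<and> D \<in> Objs then ia ((oi A + oi B + oi D) mod 3, 0, 0) else undefined)\<rparr>,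
     BUnit = io 0,
     Braiding = (\<lambda>A B. if A \<in> Objs \<and> B \<in> Objs then ia ((oi A + oi B) mod 3, 0, (oi A * oi B) mod 3) else undefined)\<rparr>"

abbreviation "\<C> \<equiv> cyclic_category"

lemma cyclic_sel [simp]:
  "Obj \<C> = Objs" "Arr \<C> = Arrs" "BUnit \<C> = io 0"
  "x < 3 \<Longrightarrow> z < 3 \<Longrightarrow> Dom \<C> (ia (x, k, z)) = io x" "x < 3 \<Longrightarrow> z < 3 \<Longrightarrow> Cod \<C> (ia (x, k, z)) = io x"
  "x < 3 \<Longrightarrow> Ident \<C> (io x) = ia (x, 0, 0)"
  "x < 3 \<Longrightarrow> z < 3 \<Longrightarrow> z' < 3 \<Longrightarrow> ia (x, k', z') \<cdot>\<^bsub>\<C>\<^esub> ia (x, k, z) = ia (x, k + k', (z + z') mod 3)"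
  "x < 3 \<Longrightarrow> y < 3 \<Longrightarrow> io x \<odot>\<^bsub>Ten \<C>\<^esub> io y = io ((x + y) mod 3)"
  "x < 3 \<Longrightarrow> y < 3 \<Longrightarrow> z < 3 \<Longrightarrow> z' < 3 \<Longrightarrow>
    ia (x, k, z) \<star>\<^bsub>Ten \<C>\<^esub> ia (y, k', z') = ia ((x + y) mod 3, k + k', (z + z') mod 3)"
  "x < 3 \<Longrightarrow> y < 3 \<Longrightarrow> z < 3 \<Longrightarrow> Assoc (Ten \<C>) (io x) (io y) (io z) = ia ((x + y + z) mod 3, 0, 0)"
  "x < 3 \<Longrightarrow> y < 3 \<Longrightarrow> Braiding \<C> (io x) (io y) = ia ((x + y) mod 3, 0, (x * y) mod 3)"
  by (simp_all add: cyclic_category_def)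

lemma ObjsE: "A \<in> Objs \<Longrightarrow> (\<And>x. A = io x \<Longrightarrow> x < 3 \<Longrightarrow> P) \<Longrightarrow> P"
  by (auto simp: Objs_def)

lemma ArrsE: "f \<in> Arrs \<Longrightarrow> (\<And>x k z. f = ia (x, k, z) \<Longrightarrow> x < 3 \<Longrightarrow> z < 3 \<Longrightarrow> P) \<Longrightarrow> P"
  by (auto simp: Arrs_def)

lemma homE: "f \<in> homset \<C> A B \<Longrightarrow> (\<And>x k z. f = ia (x, k, z) \<Longrightarrow> x < 3 \<Longrightarrow> z < 3 \<Longrightarrow> A = io x \<Longrightarrow> B = io x \<Longrightarrow> P) \<Longrightarrow> P"
  by (auto simp: homset_def elim!: ArrsE)

lemma homI [simp]: "ia (x, k, z) \<in> homset \<C> A B \<longleftrightarrow> x < 3 \<and> z < 3 \<and> A = io x \<and> B = io x"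
  by (auto simp: homset_def)

lemma category_cyclic: "category \<C>"
proof
  show "Dom \<C> \<in> Arr \<C> \<rightarrow>\<^sub>E Obj \<C>" "Cod \<C> \<in> Arr \<C> \<rightarrow>\<^sub>E Obj \<C>" "Ident \<C> \<in> extensional (Obj \<C>)"
    by (auto simp: cyclic_category_def elim!: ArrsE)
  fix f g :: 'a assume "\<not> (f \<in> Arr \<C> \<and> g \<in> Arr \<C> \<and> Cod \<C> f = Dom \<C> g)"
  then show "g \<cdot>\<^bsub>\<C>\<^esub> f = undefined" by (auto simp: cyclic_category_def)
qed (auto elim!: homE ObjsE simp: mod_simps add_ac)

lemma monoidal_cyclic: "monoidal \<C> (Ten \<C>) (BUnit \<C>)"
proof (rule monoidal.intro[OF category_cyclic], rule monoidal_axioms.intro)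
  show "case_prod (TObj (Ten \<C>)) \<in> extensional (Obj \<C> \<times> Obj \<C>)"
    "case_prod (TArr (Ten \<C>)) \<in> extensional (Arr \<C> \<times> Arr \<C>)"
    "(\<lambda>(A, B, D). Assoc (Ten \<C>) A B D) \<in> extensional (Obj \<C> \<times> Obj \<C> \<times> Obj \<C>)"
    by (auto simp: cyclic_category_def extensional_def)
  fix A B D assume "A \<in> Obj \<C>" "B \<in> Obj \<C>" "D \<in> Obj \<C>"
  then show "iso_arrow \<C> (Assoc (Ten \<C>) A B D)"
    unfolding iso_arrow_def inverse_arrows_def
    by (intro exI[of _ "Assoc (Ten \<C>) A B D"]) (auto elim!: ObjsE)
qed (auto elim!: homE ObjsE ArrsE simp: mod_simps nested_mod add_ac)

lemma braided_category_cyclic: "braided_category \<C>"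
proof -
  interpret monoidal \<C> "Ten \<C>" "BUnit \<C>" by (rule monoidal_cyclic)
  have inv: "arrow_inv \<C> (ia (x, 0, 0)) = ia (x, 0, 0)" if "x < 3" for x
    using arrow_inv_Ident[of "io x"] that by simp
  show ?thesis
  proof (rule braided_category.intro[OF monoidal_cyclic], rule braided_category_axioms.intro)
    show "case_prod (Braiding \<C>) \<in> extensional (Obj \<C> \<times> Obj \<C>)"
      by (auto simp: cyclic_category_def extensional_def)
  next
    fix A B assume "A \<in> Obj \<C>" "B \<in> Obj \<C>"
    then obtain x y where xy: "A = io x" "B = io y" "x < 3" "y < 3" by (auto elim!: ObjsE)
    have h: "(m mod 3 + (3 - m mod 3) mod 3) mod 3 = 0" "((3 - m mod 3) mod 3 + m mod 3) mod 3 = 0" for m :: nat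
    proof -
      have "m mod 3 = 0 \<or> m mod 3 = 1 \<or> m mod 3 = 2" by linarith
      then show "(m mod 3 + (3 - m mod 3) mod 3) mod 3 = 0" "((3 - m mod 3) mod 3 + m mod 3) mod 3 = 0"
        by auto
    qed
    show "iso_arrow \<C> (Braiding \<C> A B)"
      unfolding iso_arrow_def inverse_arrows_def
      \<comment> \<open>The witness carries the negative of \<open>x y\<close> modulo 3; its outer
        remainder turns \<open>3 - 0\<close> into \<open>0\<close>.\<close>
      by (intro exI[of _ "ia ((x + y) mod 3, 0, (3 - (x * y) mod 3) mod 3)"]) (auto simp: xy h)
  qed (auto elim!: homE ObjsE simp: mod_simps inv algebra_simps)
qed

lemma arrow_inv_cyclic:
  assumes "x < 3" "z < 3"
  shows "arrow_inv \<C> (ia (x, 0, z)) = ia (x, 0, (3 - z) mod 3)"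
proof -
  interpret category \<C> by (rule category_cyclic)
  show ?thesis
    by (rule arrow_inv_eq) (use assms in \<open>auto simp: inverse_arrows_def mod_simps\<close>)
qed

text \<open>This endofunctor collapses the grading and turns the free generator of the scalars
  into the value of the bicharacter at \<open>(1, 1)\<close>, so that naturality controls the latter.\<close>

definition collapse :: "('o, 'a) braided_functor" where
  "collapse = \<lparr>BSource = \<C>, BTarget = \<C>,
     BFun = \<lparr>FObj = restrict (\<lambda>_. io 0) Objs, FArr = restrict (\<lambda>f. ia (0, 0, fst (snd (ai f)) mod 3)) Arrs\<rparr>,
     Phi = (\<lambda>A B. if A \<in> Objs \<and> B \<in> Objs then ia (0, 0, 0) else undefined)\<rparr>"

lemma collapse_sel [simp]:
  "BSource collapse = \<C>" "BTarget collapse = \<C>"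
  "x < 3 \<Longrightarrow> FObj (BFun collapse) (io x) = io 0"
  "x < 3 \<Longrightarrow> z < 3 \<Longrightarrow> FArr (BFun collapse) (ia (x, k, z)) = ia (0, 0, k mod 3)"
  "x < 3 \<Longrightarrow> y < 3 \<Longrightarrow> Phi collapse (io x) (io y) = ia (0, 0, 0)"
  by (simp_all add: collapse_def)

lemma is_braided_functor_collapse: "is_braided_functor collapse"
proof -
  have "is_functor \<C> \<C> (BFun collapse)"
  proof (rule is_functorI[OF category_cyclic category_cyclic])
    show "FObj (BFun collapse) \<in> extensional (Obj \<C>)" "FArr (BFun collapse) \<in> extensional (Arr \<C>)"
      by (simp_all add: collapse_def)
  qed (auto elim!: ObjsE ArrsE simp: mod_simps)
  then have "lax_monoidal_functor \<C> (Ten \<C>) (BUnit \<C>) \<C> (Ten \<C>) (BUnit \<C>) (BFun collapse) (Phi collapse)"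
  proof (rule laxI)
    show "case_prod (Phi collapse) \<in> extensional (Obj \<C> \<times> Obj \<C>)"
      by (auto simp: collapse_def extensional_def)
  qed (auto elim!: ObjsE ArrsE simp: mod_simps)
  then show ?thesis unfolding is_braided_functor_def Let_def
    by (auto simp: braided_category_cyclic elim!: ObjsE)
qed

lemma no_equivalence:
  assumes g: "g \<in> homset TwoMonCat (two_fold_of_braided (crossing_class True) \<C>) (two_fold_of_braided (crossing_class False) \<C>)"
    and iso: "iso_arrow TwoMonCat g"
    and nat: "g \<cdot>\<^bsub>TwoMonCat\<^esub> two_fold_functor_of_braided (crossing_class True) collapse =
      two_fold_functor_of_braided (crossing_class False) collapse \<cdot>\<^bsub>TwoMonCat\<^esub> g"
  shows False
proof -
  interpret braided_category \<C> by (rule braided_category_cyclic)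
  have gf: "is_two_fold_functor g" and src: "TSource g = two_fold_of_braided (crossing_class True) \<C>"
    "TTarget g = two_fold_of_braided (crossing_class False) \<C>"
    using g by (auto simp: homset_def)
  let ?F = "TFun g" and ?l1 = "Lambda1 g" and ?l2 = "Lambda2 g"
  note D = is_two_fold_functorD[OF gf, unfolded src two_fold_of_braided_sel lax_two_fold_of_braided]
  note Fn = is_functorD(3-8)[OF laxD(1)[OF D(3)], simplified] and l1 = laxD(2-9)[OF D(3), simplified]
    and l2 = laxD(2-9)[OF D(4), simplified]
  have e: "\<exists>k' z'. FArr ?F (ia (0, k, z)) = ia (0, k', z') \<and> z' < 3" if "z < 3" for k z
    using Fn(2-4)[of "ia (0, k, z)"] l1(1) that by (auto elim!: ArrsE)
  \<comment> \<open>An endomorphism of the unit is a pair of a natural number and a residue modulo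
    3; \<open>\<kappa>\<close> is the natural number in the image of such a pair.\<close>
  define \<kappa> where "\<kappa> k z = fst (snd (ai (FArr ?F (ia (0, k, z)))))" for k z
  have \<kappa>: "FArr ?F (ia (0, k, z)) = ia (0, \<kappa> k z, snd (snd (ai (FArr ?F (ia (0, k, z)))))) \<and>
      snd (snd (ai (FArr ?F (ia (0, k, z))))) < 3" if "z < 3" for k z
    using e[OF that, of k] by (auto simp: \<kappa>_def)
  have \<kappa>_add: "\<kappa> (k + k') ((z + z') mod 3) = \<kappa> k z + \<kappa> k' z'" if "z < 3" "z' < 3" for k k' z z'
  proof -
    have "FArr ?F (ia (0, k', z') \<cdot>\<^bsub>\<C>\<^esub> ia (0, k, z)) = FArr ?F (ia (0, k', z')) \<cdot>\<^bsub>\<C>\<^esub> FArr ?F (ia (0, k, z))"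
      by (rule Fn(6)) (use that in auto)
    then show ?thesis using e[OF that(1), of k] e[OF that(2), of k'] that by (auto simp: \<kappa>_def)
  qed
  \<comment> \<open>A residue has finite order, but the naturals contain no nonzero element with a
    negative: the images of \<open>z\<close> and \<open>2 z\<close> have natural parts that add up
    to 0.\<close>
  have \<kappa>_0: "\<kappa> 0 z = 0" if "z < 3" for z
  proof -
    have "\<kappa> 0 0 = 0" using \<kappa>_add[of 0 0 0 0] by simp
    moreover have "\<kappa> 0 0 = \<kappa> 0 z + \<kappa> 0 ((z + z) mod 3)"
    proof -
      have "(z + (z + z) mod 3) mod 3 = 0" using that by presburger
      then show ?thesis using \<kappa>_add[OF that, of "(z + z) mod 3" 0 0] by simp
    qed
    ultimately show ?thesis by simp
  qed
  have \<kappa>_mult: "\<kappa> k 0 = k * \<kappa> 1 0" for k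
  proof (induction k)
    case 0
    then show ?case using \<kappa>_0[of 0] by simp
  next
    case (Suc k)
    then show ?case using \<kappa>_add[of 0 0 1 k] by simp
  qed
  obtain g' where g': "inverse_arrows TwoMonCat g g'" using iso by (auto simp: iso_arrow_def)
  \<comment> \<open>The inverse functor provides a preimage of the free generator, hence a natural
    number \<open>a\<close> with \<open>a * \<kappa> 1 0 = 1\<close>.\<close>
  have one: "\<kappa> 1 0 = 1"
  proof -
    have gf': "is_two_fold_functor g'" "TSource g' = two_fold_of_braided (crossing_class False) \<C>"
      "TTarget g' = two_fold_of_braided (crossing_class True) \<C>"
      and "g \<cdot>\<^bsub>TwoMonCat\<^esub> g' = Ident TwoMonCat (two_fold_of_braided (crossing_class False) \<C>)"
      using g' gf src by (auto simp: inverse_arrows_def homset_def)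
    then have "comp_two_fold_functor g g' = id_two_fold_functor (two_fold_of_braided (crossing_class False) \<C>)"
      using gf src D(2) by simp
    then have "comp_functor \<C> ?F (TFun g') = id_functor \<C>"
      using gf' by (simp add: comp_two_fold_functor_def id_two_fold_functor_def)
    then have *: "FArr ?F (FArr (TFun g') a) = a" if "a \<in> Arrs" for a
      using comp_functor_sel(2)[of a \<C> ?F "TFun g'"] id_functor_sel(2)[of a \<C>] that by simp
    note D' = is_two_fold_functorD(3)[OF gf'(1), unfolded gf'(2,3) two_fold_of_braided_sel lax_two_fold_of_braided]
    note Fn' = is_functorD(3-8)[OF laxD(1)[OF D'], simplified]
    obtain a b where ab: "FArr (TFun g') (ia (0, 1, 0)) = ia (0, a, b)" "b < 3"
      using Fn'(2-4)[of "ia (0, 1, 0)"] laxD(2)[OF D'] by (auto elim!: ArrsE)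
    then have "FArr ?F (ia (0, a, b)) = ia (0, 1, 0)" using *[of "ia (0, 1, 0)"] by simp
    then have "\<kappa> a b = 1" by (simp add: \<kappa>_def)
    moreover have "\<kappa> a b = \<kappa> a 0" using \<kappa>_add[of 0 b a 0] \<kappa>_0[OF ab(2)] ab(2) by simp
    ultimately show ?thesis using \<kappa>_mult[of a] by simp
  qed
  \<comment> \<open>\<open>collapse\<close> sends the free generator to the scalar \<open>1\<close>.
    The functor preserves the natural part of the generator and commutes with
    \<open>collapse\<close>, so it fixes that scalar.\<close>
  have gen: "FArr ?F (ia (0, 0, 1)) = ia (0, 0, 1)"
  proof -
    note c = is_two_fold_functor_of_braided[OF acts_by_interchange_crossing is_braided_functor_collapse]
    have "comp_two_fold_functor g (two_fold_functor_of_braided (crossing_class True) collapse) =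
      comp_two_fold_functor (two_fold_functor_of_braided (crossing_class False) collapse) g"
      using nat gf src c[of True] c[of False] by simp
    then have "comp_functor \<C> ?F (BFun collapse) = comp_functor \<C> (BFun collapse) ?F"
      using src by (simp add: comp_two_fold_functor_def)
    then have "FArr ?F (FArr (BFun collapse) (ia (0, 1, 0))) = FArr (BFun collapse) (FArr ?F (ia (0, 1, 0)))"
      using comp_functor_sel(2)[of "ia (0, 1, 0)" \<C> ?F "BFun collapse"]
        comp_functor_sel(2)[of "ia (0, 1, 0)" \<C> "BFun collapse" ?F] by simp
    then show ?thesis using e[of 0 1] one by (auto simp: \<kappa>_def)
  qed
  obtain y where y: "FObj ?F (io 1) = io y" "y < 3" using Fn(1)[of "io 1"] by (auto elim!: ObjsE)
  obtain t where t: "FObj ?F (io 2) = io t" "t < 3" using Fn(1)[of "io 2"] by (auto elim!: ObjsE)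
  obtain x k z where l: "?l1 (io 1) (io 1) = ia (x, k, z)" "x < 3" "z < 3"
    using l1(2)[of "io 1" "io 1"] by (auto elim!: ArrsE)
  \<comment> \<open>The coherence map at \<open>1, 1\<close> is an endomorphism in this category, so
    the image of the class \<open>2\<close> equals twice the image \<open>y\<close> of the class
    \<open>1\<close>.\<close>
  have xt: "x = t" "x = (y + y) mod 3" using l1(3,4)[of "io 1" "io 1"] l y t by (auto simp: numeral_2_eq_2)
  \<comment> \<open>This arrow is the tensor of the scalar \<open>1\<close> with the identity of the
    class \<open>2\<close>, and the coherence map with a unit argument is an identity.\<close>
  have F2: "FArr ?F (ia (2, 0, 1)) = ia (t, 0, 1)"
    using l1(5)[of "ia (0, 0, 1)" "ia (2, 0, 0)"] l1(8)[of "io 2"] gen Fn(5)[of "io 2"] t Fn(2-4)[of "ia (2, 0, 1)"]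
    by (auto elim!: ArrsE simp: numeral_2_eq_2)
  note v = crossing_interchange_values[OF braided_category_cyclic]
  obtain k' z' where l': "?l2 (io 1) (io 1) = ia (x, k', z')" "z' < 3"
    using l2(2,3)[of "io 1" "io 1"] y xt by (auto elim!: ArrsE)
  \<comment> \<open>At the classes \<open>1, 0, 0, 1\<close> both interchanges are identities, so
    the interchange condition identifies the two coherence maps.\<close>
  have l12: "?l2 (io 1) (io 1) = ?l1 (io 1) (io 1)"
    using D(5)[of "io 1" "io 0" "io 0" "io 1"] v(1)[of "io 1" "io 1"] v(1)[of "io y" "io y"] l1(1,7,8) l2(1,7,8)
      y t l l' xt Fn(5)[of "io 2"]
    by (auto simp: numeral_2_eq_2)
  \<comment> \<open>At the classes \<open>0, 1, 1, 0\<close> the condition sets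
    \<open>- y^2\<close>, from the inverse braiding of the target, against the image
    \<open>1\<close> of the bicharacter at \<open>(1, 1)\<close>. The residue \<open>z\<close> of
    the common coherence map occurs on both sides, so \<open>y^2 = - 1\<close> modulo 3.\<close>
  have "((3 - (y * y) mod 3) mod 3 + z) mod 3 = (z + 1) mod 3"
    using D(5)[of "io 0" "io 1" "io 1" "io 0"] v(2)[of "io 1" "io 1" True] v(2)[of "io y" "io y" False]
      l1(1,7,8) l2(1,7,8) y F2 l l12[unfolded l] xt t
    by (simp add: numeral_2_eq_2 arrow_inv_cyclic)
  moreover have "y = 0 \<or> y = 1 \<or> y = 2" "z = 0 \<or> z = 1 \<or> z = 2" using y(2) l(3) by auto
  ultimately show False by auto
qed

end

theorem theorem4p2:
  fixes b :: braid
    and \<B> :: "(('o, 'a) braided, ('o, 'a) braided_functor) cat"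
    and \<M> :: "(('o, 'a) two_fold, ('o, 'a) two_fold_functor) cat"
  defines "\<B> \<equiv> BraidedCat"
    and "\<M> \<equiv> TwoMonCat"
  assumes "infinite (UNIV :: 'o set)" and "infinite (UNIV :: 'a set)"
    and "interchanging_unital_braid b"
  shows "(naturally_equivalent \<B> \<M> (F_braid b) (F_braid (sigma 4 2)) \<or>
          naturally_equivalent \<B> \<M> (F_braid b) (F_braid (inv\<^bsub>braid_group 4\<^esub> (sigma 4 2)))) \<and>
         \<not> (naturally_equivalent \<B> \<M> (F_braid b) (F_braid (sigma 4 2)) \<and>
            naturally_equivalent \<B> \<M> (F_braid b) (F_braid (inv\<^bsub>braid_group 4\<^esub> (sigma 4 2))))"
proof
  have s: "sigma 4 2 = crossing_class True" by (simp add: sigma_def)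
  obtain w where w: "w \<in> b"
    using braid_class_nonempty[of b 4] assms(5) by (auto simp: interchanging_unital_braid_def)
  have c: "comparison_exponent w = 1 \<or> comparison_exponent w = - 1"
    by (rule comparison_exponent_cases[OF assms(5) w])
  have "naturally_equivalent \<B> \<M> (F_braid b) (F_braid (crossing_class (comparison_exponent w = 1)))"
    unfolding \<B>_def \<M>_def by (rule naturally_equivalent_crossing[OF assms(5) w c])
  then show "naturally_equivalent \<B> \<M> (F_braid b) (F_braid (sigma 4 2)) \<or>
      naturally_equivalent \<B> \<M> (F_braid b) (F_braid (inv\<^bsub>braid_group 4\<^esub> (sigma 4 2)))"
    unfolding inv_sigma unfolding s using c by (cases "comparison_exponent w = 1") auto
  show "\<not> (naturally_equivalent \<B> \<M> (F_braid b) (F_braid (sigma 4 2)) \<and>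
      naturally_equivalent \<B> \<M> (F_braid b) (F_braid (inv\<^bsub>braid_group 4\<^esub> (sigma 4 2))))"
  proof
    assume "naturally_equivalent \<B> \<M> (F_braid b) (F_braid (sigma 4 2)) \<and>
      naturally_equivalent \<B> \<M> (F_braid b) (F_braid (inv\<^bsub>braid_group 4\<^esub> (sigma 4 2)))"
    then obtain \<tau> \<tau>' where \<tau>: "natural_isomorphism \<B> \<M> (F_braid b) (F_braid (crossing_class True)) \<tau>"
      "natural_isomorphism \<B> \<M> (F_braid b) (F_braid (crossing_class False)) \<tau>'"
      unfolding inv_sigma unfolding s naturally_equivalent_def by blast
    obtain io :: "nat \<Rightarrow> 'o" where io: "inj io"
      using assms(3) infinite_countable_subset by blast
    obtain j :: "nat \<Rightarrow> 'a" where j: "inj j"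
      using assms(4) infinite_countable_subset by blast
    \<comment> \<open>A triple is coded as nested pairs: \<open>apsnd prod_encode\<close> packs the
      last two components, \<open>prod_encode\<close> adds the first, and \<open>j\<close> places
      the number in the arrow type.\<close>
    interpret cyclic_universe io "j \<circ> prod_encode \<circ> apsnd prod_encode"
    proof
      show "inj (j \<circ> prod_encode \<circ> apsnd prod_encode)"
        by (auto simp: inj_on_def inj_eq[OF j])
    qed (rule io)
    have f: "collapse \<in> homset \<B> cyclic_category cyclic_category"
      unfolding \<B>_def by (simp add: homset_def is_braided_functor_collapse)
    show False
      using natural_isomorphism_conjugate[OF \<tau> f] no_equivalence
      unfolding \<B>_def \<M>_def by (auto simp: braided_category_cyclic is_braided_functor_collapse)
  qed
qed

end
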